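(* Let $\overline{\alpha}=(\alpha_1,\alpha_2)\in(0,1)^2$, $\overline{p}=(p_1,p_2)\in[1,\infty]^2$ and $\overline{q}=(q_1,q_2)\in[1,\infty]^2$. Then $\|\cdot\|^{(1)}_{\overline{\alpha},\overline{p},\overline{q}}$, $\|\cdot\|^{(2)}_{\overline{\alpha},\overline{p},\overline{q}}$ and $\|\cdot\|_{\overline{\alpha},\overline{p},\overline{q}}$ are equivalent norms on the space $B^{\overline{\alpha}}_{\overline{p},\overline{q}}(\mathbb{R}\times\mathbb{T})$; that is, there is a constant $C>0$ such that for all $f\in\mathcal{S}'_{\pi_2}(\mathbb{R}^2)\cap L^{\overline{p}}(\mathbb{R}\times\mathbb{T})$ $$\|f\|_{\overline{\alpha},\overline{p},\overline{q}}\le C\|f\|^{(2)}_{\overline{\alpha},\overline{p},\overline{q}},\qquad \|f\|^{(2)}_{\overline{\alpha},\overline{p},\overline{q}}\le C\|f\|^{(1)}_{\overline{\alpha},\overline{p},\overline{q}},\qquad \|f\|^{(1)}_{\overline{\alpha},\overline{p},\overline{q}}\le C\|f\|_{\overline{\alpha},\overline{p},\overline{q}}.$$ Furthermore, the same holds if all the integration domains for $h_1$ and $h_2$ in the definitions of $\|\cdot\|^{(1)}_{\overline{\alpha},\overline{p},\overline{q}}$ and $\|\cdot\|^{(2)}_{\overline{\alpha},\overline{p},\overline{q}}$ are replaced by $h_1,h_2\in[-1,1]$.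
   Context: $\mathbb{T}$ is the one-dimensional torus, identified with $[-\pi,\pi]$. Functions $f:\mathbb{R}\times\mathbb{T}\to\mathbb{C}$ are viewed as functions on $\mathbb{R}^2$ that are $2\pi$-periodic in the second variable. For $\overline{p}=(p_1,p_2)\in[1,\infty]^2$, $L^{\overline{p}}(\mathbb{R}\times\mathbb{T})$ is the space of measurable $f$ with finite norm $\|f\|_{\overline p}=\big(\int_{\mathbb{R}}(\int_{\mathbb{T}}|f(x,y)|^{p_2}\,dy)^{p_1/p_2}\,dx\big)^{1/p_1}$ (usual modification for $\infty$). $\mathcal{S}'_{\pi_2}(\mathbb{R}^2)$ is the set of tempered distributions $f\in\mathcal{S}'(\mathbb{R}^2)$ with $f(x_1,x_2+2k\pi)=f(x_1,x_2)$ for all $k\in\mathbb{Z}$ in the distributional sense; $L^{\overline p}(\mathbb{R}\times\mathbb{T})$ is identified with a subspace of it via periodic extension. Dyadic partition of unity: fix smooth functions $\chi,\rho$ on $\mathbb{R}$ with $\operatorname{supp}\chi\subseteq\{|x|\le 4/3\}$, $\operatorname{supp}\rho\subseteq\{3/4\le|x|\le 8/3\}$ and $\chi(z)+\sum_{j\ge0}\rho(2^{-j}z)=1$ for all $z$. Put $\rho_{-1}=\chi$, $\rho_j=\rho(2^{-j}\cdot)$ for $j\ge0$. With $\mathcal{F}$ the Fourier transform on $\mathbb{R}^2$, the anisotropic Littlewood--Paley blocks are $\Delta_{j,k}f=\mathcal{F}^{-1}[\rho_j(\xi_1)\rho_k(\xi_2)\mathcal{F}f(\xi)]$, $j,k\ge-1$.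 These are smooth functions, $2\pi$-periodic in $x_2$ if $f\in\mathcal{S}'_{\pi_2}(\mathbb{R}^2)$. The Besov space with dominating mixed smoothness $B^{\overline\alpha}_{\overline p,\overline q}(\mathbb{R}\times\mathbb{T})$ consists of all $f\in\mathcal{S}'_{\pi_2}(\mathbb{R}^2)$ with $$\|f\|_{\overline\alpha,\overline p,\overline q}:=\Big\|\Big(2^{\alpha_1 j}\big\|(2^{\alpha_2 k}\|\Delta_{j,k}f\|_{\overline p})_{k\ge-1}\big\|_{\ell^{q_2}}\Big)_{j\ge-1}\Big\|_{\ell^{q_1}}<\infty .$$ Increments: $\delta^1_{h_1}f(x)=f(x_1+h_1,x_2)-f(x_1,x_2)$, $\delta^2_{h_2}f(x)=f(x_1,x_2+h_2)-f(x_1,x_2)$, and $\square_{h_1,h_2}f(x)=f(x_1+h_1,x_2+h_2)-f(x_1,x_2+h_2)-f(x_1+h_1,x_2)+f(x_1,x_2)$. Difference norms: $$\|f\|^{(1)}_{\overline\alpha,\overline p,\overline q}:=\|f\|_{\overline p}+\Big(\int_{\mathbb{R}}|h_1|^{-\alpha_1q_1}\sup_{|r_1|\le|h_1|}\|\delta^1_{r_1}f\|_{\overline p}^{q_1}\frac{dh_1}{|h_1|}\Big)^{1/q_1}+\Big(\int_{\mathbb{T}}|h_2|^{-\alpha_2q_2}\sup_{|r_2|\le|h_2|}\|\delta^2_{r_2}f\|_{\overline p}^{q_2}\frac{dh_2}{|h_2|}\Big)^{1/q_2}$$ $$\qquad+\Big(\int_{\mathbb{R}}|h_1|^{-\alpha_1q_1}\Big(\int_{\mathbb{T}}|h_2|^{-\alpha_2q_2}\sup_{|r_1|\le|h_1|,|r_2|\le|h_2|}\|\square_{r_1,r_2}f\|_{\overline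 p}^{q_2}\frac{dh_2}{|h_2|}\Big)^{q_1/q_2}\frac{dh_1}{|h_1|}\Big)^{1/q_1},$$ $$\|f\|^{(2)}_{\overline\alpha,\overline p,\overline q}:=\|f\|_{\overline p}+\Big(\int_{\mathbb{R}}|h_1|^{-\alpha_1q_1}\|\delta^1_{h_1}f\|_{\overline p}^{q_1}\frac{dh_1}{|h_1|}\Big)^{1/q_1}+\Big(\int_{\mathbb{T}}|h_2|^{-\alpha_2q_2}\|\delta^2_{h_2}f\|_{\overline p}^{q_2}\frac{dh_2}{|h_2|}\Big)^{1/q_2}$$ $$\qquad+\Big(\int_{\mathbb{R}}|h_1|^{-\alpha_1q_1}\Big(\int_{\mathbb{T}}|h_2|^{-\alpha_2q_2}\|\square_{h_1,h_2}f\|_{\overline p}^{q_2}\frac{dh_2}{|h_2|}\Big)^{q_1/q_2}\frac{dh_1}{|h_1|}\Big)^{1/q_1},$$ with the usual modifications if some exponent is $\infty$. All these quantities may take the value $+\infty$. The constant $C$ may depend on $\overline\alpha,\overline p,\overline q$ and the dyadic partition, but not on $f$. *)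

theory Defs
  imports "HOL-Probability.Essential_Supremum"
begin

definition dir_deriv ::
    "'a::real_normed_vector \<Rightarrow> ('a \<Rightarrow> 'b::real_normed_vector) \<Rightarrow> 'a \<Rightarrow> 'b" where
  "dir_deriv v f = (\<lambda>x. frechet_derivative f (at x) v)"

text \<open>Iterated partial derivatives are indexed by lists of basis vectors.\<close>

definition iter_deriv ::
    "'a::real_normed_vector list \<Rightarrow> ('a \<Rightarrow> 'b::real_normed_vector) \<Rightarrow> 'a \<Rightarrow> 'b" where
  "iter_deriv vs f = foldr dir_deriv vs f"

definition smooth_fun :: "('a::euclidean_space \<Rightarrow> 'b::real_normed_vector) \<Rightarrow> bool" where
  "smooth_fun f \<longleftrightarrow> (\<forall>vs\<in>lists Basis. iter_deriv vs f differentiable_on UNIV)"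

definition schwartz :: "('a::euclidean_space \<Rightarrow> complex) set" where
  "schwartz = {\<phi>. smooth_fun \<phi> \<and>
     (\<forall>(N::nat). \<forall>vs\<in>lists Basis.
        bdd_above (range (\<lambda>x. (1 + norm x) ^ N * cmod (iter_deriv vs \<phi> x))))}"

definition schwartz_norm :: "nat \<Rightarrow> ('a::euclidean_space \<Rightarrow> complex) \<Rightarrow> real" where
  "schwartz_norm N \<phi> = (\<Sum>vs | set vs \<subseteq> Basis \<and> length vs \<le> N.
     (SUP x. (1 + norm x) ^ N * cmod (iter_deriv vs \<phi> x)))"

text \<open>A distribution is a function on all test functions of the type, but only its values
  on \<^const>\<open>schwartz\<close> are relevant. The increasing norms \<^const>\<open>schwartz_norm\<close> generate
  the topology of the Schwartz space, so the bound below is continuity.\<close>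

type_synonym distr = "(real \<times> real \<Rightarrow> complex) \<Rightarrow> complex"

definition tempered :: "distr set" where
  "tempered = {u.
     (\<forall>\<phi>\<in>schwartz. \<forall>\<psi>\<in>schwartz. u (\<lambda>x. \<phi> x + \<psi> x) = u \<phi> + u \<psi>) \<and>
     (\<forall>c. \<forall>\<phi>\<in>schwartz. u (\<lambda>x. c * \<phi> x) = c * u \<phi>) \<and>
     (\<exists>N C. \<forall>\<phi>\<in>schwartz. cmod (u \<phi>) \<le> C * schwartz_norm N \<phi>)}"

definition tempered_periodic :: "distr set" where
  "tempered_periodic = {u \<in> tempered.
     \<forall>\<phi>\<in>schwartz. \<forall>k::int. u (\<lambda>(x, y). \<phi> (x, y - 2 * of_int k * pi)) = u \<phi>}"

definition distr_of :: "(real \<times> real \<Rightarrow> complex) \<Rightarrow> distr" where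
  "distr_of f = (\<lambda>\<phi>. LINT x|lborel. f x * \<phi> x)"

definition represents :: "(real \<times> real \<Rightarrow> complex) \<Rightarrow> distr \<Rightarrow> bool" where
  "represents g u \<longleftrightarrow>
     (\<forall>\<phi>\<in>schwartz. integrable lborel (\<lambda>x. g x * \<phi> x) \<and> u \<phi> = distr_of g \<phi>)"

definition fourier :: "(real \<times> real \<Rightarrow> complex) \<Rightarrow> real \<times> real \<Rightarrow> complex" where
  "fourier \<phi> \<xi> = (LINT x|lborel. cis (- (x \<bullet> \<xi>)) * \<phi> x)"

definition inv_fourier :: "(real \<times> real \<Rightarrow> complex) \<Rightarrow> real \<times> real \<Rightarrow> complex" where
  "inv_fourier \<phi> x = (LINT \<xi>|lborel. cis (x \<bullet> \<xi>) * \<phi> \<xi>) / of_real ((2 * pi)\<^sup>2)"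

definition distr_fourier :: "distr \<Rightarrow> distr" where
  "distr_fourier u = (\<lambda>\<phi>. u (fourier \<phi>))"

definition distr_inv_fourier :: "distr \<Rightarrow> distr" where
  "distr_inv_fourier u = (\<lambda>\<phi>. u (inv_fourier \<phi>))"

definition distr_mult :: "(real \<times> real \<Rightarrow> complex) \<Rightarrow> distr \<Rightarrow> distr" where
  "distr_mult m u = (\<lambda>\<phi>. u (\<lambda>\<xi>. m \<xi> * \<phi> \<xi>))"

definition dyadic_partition :: "(real \<Rightarrow> real) \<Rightarrow> (real \<Rightarrow> real) \<Rightarrow> bool" where
  "dyadic_partition chi rho \<longleftrightarrow>
     smooth_fun chi \<and> smooth_fun rho \<and>
     closure {x. chi x \<noteq> 0} \<subseteq> {x. \<bar>x\<bar> \<le> 4/3} \<and>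
     closure {x. rho x \<noteq> 0} \<subseteq> {x. 3/4 \<le> \<bar>x\<bar> \<and> \<bar>x\<bar> \<le> 8/3} \<and>
     (\<forall>z. chi z + (\<Sum>j. rho (z / 2 ^ j)) = 1)"

definition dyadic_cutoff :: "(real \<Rightarrow> real) \<Rightarrow> (real \<Rightarrow> real) \<Rightarrow> int \<Rightarrow> real \<Rightarrow> real" where
  "dyadic_cutoff chi rho j z = (if j = -1 then chi z else rho (2 powi (- j) * z))"

definition lp_block_distr ::
    "(real \<Rightarrow> real) \<Rightarrow> (real \<Rightarrow> real) \<Rightarrow> int \<Rightarrow> int \<Rightarrow> distr \<Rightarrow> distr" where
  "lp_block_distr chi rho j k u = distr_inv_fourier (distr_mult
     (\<lambda>(\<xi>1, \<xi>2). of_real (dyadic_cutoff chi rho j \<xi>1 * dyadic_cutoff chi rho k \<xi>2)) (distr_fourier u))"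

text \<open>The block of a tempered distribution is given by a smooth function; it is singled out
  as the only continuous representative.\<close>

definition lp_block ::
    "(real \<Rightarrow> real) \<Rightarrow> (real \<Rightarrow> real) \<Rightarrow> int \<Rightarrow> int \<Rightarrow> distr \<Rightarrow> real \<times> real \<Rightarrow> complex" where
  "lp_block chi rho j k u =
     (THE g. continuous_on UNIV g \<and> represents g (lp_block_distr chi rho j k u))"

text \<open>All norms take values in \<^typ>\<open>ennreal\<close>; the exponents are elements of \<^typ>\<open>ennreal\<close>
  as well. The real power below is only used for positive exponents.\<close>

definition ennreal_rpow :: "ennreal \<Rightarrow> real \<Rightarrow> ennreal" where
  "ennreal_rpow x r = (if x = \<infinity> then \<infinity> else ennreal (enn2real x powr r))"

definition Lnorm :: "ennreal \<Rightarrow> 'a measure \<Rightarrow> ('a \<Rightarrow> ennreal) \<Rightarrow> ennreal" where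
  "Lnorm p M g = (if p = \<infinity> then esssup M g
     else ennreal_rpow (\<integral>\<^sup>+x. ennreal_rpow (g x) (enn2real p) \<partial>M) (1 / enn2real p))"

definition mixed_norm :: "ennreal \<times> ennreal \<Rightarrow> (real \<times> real \<Rightarrow> complex) \<Rightarrow> ennreal" where
  "mixed_norm p f = Lnorm (fst p) lborel (\<lambda>x.
     Lnorm (snd p) (restrict_space lborel {-pi..pi}) (\<lambda>y. ennreal (cmod (f (x, y)))))"

text \<open>Functions are used instead of classes modulo null sets; every class has a
  representative that is Borel measurable and periodic everywhere.\<close>

definition mixed_Lp :: "ennreal \<times> ennreal \<Rightarrow> (real \<times> real \<Rightarrow> complex) set" where
  "mixed_Lp p = {f \<in> borel_measurable borel.
     (\<forall>x y. f (x, y + 2 * pi) = f (x, y)) \<and> mixed_norm p f < \<infinity>}"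

definition besov_norm ::
    "(real \<Rightarrow> real) \<Rightarrow> (real \<Rightarrow> real) \<Rightarrow> real \<times> real \<Rightarrow> ennreal \<times> ennreal \<Rightarrow> ennreal \<times> ennreal
      \<Rightarrow> distr \<Rightarrow> ennreal" where
  "besov_norm chi rho \<alpha> p q u =
     Lnorm (fst q) (count_space {-1..}) (\<lambda>j::int. ennreal (2 powr (fst \<alpha> * of_int j)) *
       Lnorm (snd q) (count_space {-1..}) (\<lambda>k::int. ennreal (2 powr (snd \<alpha> * of_int k)) *
         mixed_norm p (lp_block chi rho j k u)))"

definition increment1 ::
    "real \<Rightarrow> (real \<times> real \<Rightarrow> complex) \<Rightarrow> real \<times> real \<Rightarrow> complex" where
  "increment1 h f = (\<lambda>(x, y). f (x + h, y) - f (x, y))"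

definition increment2 ::
    "real \<Rightarrow> (real \<times> real \<Rightarrow> complex) \<Rightarrow> real \<times> real \<Rightarrow> complex" where
  "increment2 h f = (\<lambda>(x, y). f (x, y + h) - f (x, y))"

definition box_increment ::
    "real \<Rightarrow> real \<Rightarrow> (real \<times> real \<Rightarrow> complex) \<Rightarrow> real \<times> real \<Rightarrow> complex" where
  "box_increment h1 h2 f =
     (\<lambda>(x, y). f (x + h1, y + h2) - f (x, y + h2) - f (x + h1, y) + f (x, y))"

definition scale_measure_on :: "real set \<Rightarrow> real measure" where
  "scale_measure_on D = density (restrict_space lborel D) (\<lambda>h. ennreal (1 / \<bar>h\<bar>))"

text \<open>The weighted integrals with respect to \<open>dh/|h|\<close> over the domain \<open>D\<close> are written as
  \<open>L\<^sup>q\<close> norms for \<open>scale_measure_on D\<close>, which covers the case of infinite \<open>q\<close>.\<close>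

definition diff_norm1 ::
    "real set \<Rightarrow> real set \<Rightarrow> real \<times> real \<Rightarrow> ennreal \<times> ennreal \<Rightarrow> ennreal \<times> ennreal
      \<Rightarrow> (real \<times> real \<Rightarrow> complex) \<Rightarrow> ennreal" where
  "diff_norm1 D1 D2 \<alpha> p q f =
     mixed_norm p f
     + Lnorm (fst q) (scale_measure_on D1) (\<lambda>h1. ennreal (\<bar>h1\<bar> powr (- fst \<alpha>)) *
         (SUP r1\<in>{r. \<bar>r\<bar> \<le> \<bar>h1\<bar>}. mixed_norm p (increment1 r1 f)))
     + Lnorm (snd q) (scale_measure_on D2) (\<lambda>h2. ennreal (\<bar>h2\<bar> powr (- snd \<alpha>)) *
         (SUP r2\<in>{r. \<bar>r\<bar> \<le> \<bar>h2\<bar>}. mixed_norm p (increment2 r2 f)))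
     + Lnorm (fst q) (scale_measure_on D1) (\<lambda>h1. ennreal (\<bar>h1\<bar> powr (- fst \<alpha>)) *
         Lnorm (snd q) (scale_measure_on D2) (\<lambda>h2. ennreal (\<bar>h2\<bar> powr (- snd \<alpha>)) *
           (SUP (r1, r2)\<in>{r. \<bar>r\<bar> \<le> \<bar>h1\<bar>} \<times> {r. \<bar>r\<bar> \<le> \<bar>h2\<bar>}.
              mixed_norm p (box_increment r1 r2 f))))"

definition diff_norm2 ::
    "real set \<Rightarrow> real set \<Rightarrow> real \<times> real \<Rightarrow> ennreal \<times> ennreal \<Rightarrow> ennreal \<times> ennreal
      \<Rightarrow> (real \<times> real \<Rightarrow> complex) \<Rightarrow> ennreal" where
  "diff_norm2 D1 D2 \<alpha> p q f =
     mixed_norm p f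
     + Lnorm (fst q) (scale_measure_on D1) (\<lambda>h1. ennreal (\<bar>h1\<bar> powr (- fst \<alpha>)) *
         mixed_norm p (increment1 h1 f))
     + Lnorm (snd q) (scale_measure_on D2) (\<lambda>h2. ennreal (\<bar>h2\<bar> powr (- snd \<alpha>)) *
         mixed_norm p (increment2 h2 f))
     + Lnorm (fst q) (scale_measure_on D1) (\<lambda>h1. ennreal (\<bar>h1\<bar> powr (- fst \<alpha>)) *
         Lnorm (snd q) (scale_measure_on D2) (\<lambda>h2. ennreal (\<bar>h2\<bar> powr (- snd \<alpha>)) *
           mixed_norm p (box_increment h1 h2 f)))"

end

theory Submission
  imports Defs "HOL-Probability.Probability"
begin

text \<open>
  For a function in the mixed Lebesgue space every block is a convolution with a tensor product of
  two one-dimensional kernels, \<open>\<Delta>\<^sub>j\<^sub>k f = (K\<^sub>j \<otimes> K\<^sub>k) * f\<close>, where \<open>K\<^sub>j\<close> has mean zero for \<open>j \<ge> 0\<close> and decays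
  like \<open>2\<^sup>j / (1 + (2\<^sup>j x)\<^sup>2)\<close>.

  Since the kernels have mean zero, \<open>f\<close> may be replaced under the convolution integral by an
  increment in each variable with index \<open>\<ge> 0\<close>. Increments longer than \<open>1\<close> are estimated trivially;
  as \<open>h\<close> runs over \<open>[-1, 1]\<close>, Minkowski's inequality leaves the kernel \<open>2\<^bsup>\<alpha>j\<^esup> \<bar>h\<bar>\<^bsup>1 + \<alpha>\<^esup> \<bar>K\<^sub>j h\<bar>\<close> between the
  measure \<open>dh / \<bar>h\<bar>\<close> and the dyadic scales \<open>j\<close>, and Schur's test applies because this kernel is
  dominated by a function of \<open>2\<^sup>j \<bar>h\<bar>\<close> that decays like a power at \<open>0\<close> and at \<open>\<infinity>\<close>.

  Conversely \<open>f\<close> is almost everywhere bounded by the sum of its blocks, and so are its increments.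
  Each block reproduces itself under a slightly wider kernel, so an increment by \<open>h\<close> of the block
  of index \<open>j\<close> gains the factor \<open>min 1 (2\<^sup>j \<bar>h\<bar>)\<close>, and the weight \<open>\<bar>h\<bar>\<^bsup>-\<alpha>\<^esup> 2\<^bsup>-\<alpha>j\<^esup> min 1 (2\<^sup>j \<bar>h\<bar>)\<close>
  satisfies the same kind of bound. The supremum over shorter increments costs nothing, because this
  factor is monotone in \<open>\<bar>h\<bar>\<close>.
\<close>

subsection \<open>Lebesgue norms of extended nonnegative functions\<close>

text \<open>The functions are periodic in one variable and the exponents may be infinite, so
  \<open>f\<close> is in general neither integrable over the plane nor the limit of its
  mollifications in the mixed norm. What every admissible \<open>f\<close> has is an L1 bound
  against the weight \<open>cw\<close>, uniform under translations. It makes the convolutions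
  converge, and pointwise reconstruction follows from convergence in the weighted L1 space along a
  subsequence.

  The estimates run in \<open>ennreal\<close>, so nothing has to be known finite before it is
  bounded. The four terms of a difference norm are instances of one estimate: two flags choose the
  increments, and a one-point measure replaces \<open>dh / |h|\<close> in a variable without
  increment.

  The range of \<alpha> enters through the exponents of the dominating powers: \<alpha> < 1 is what
  a first-order increment gains and what the quadratic decay of the kernels can pay for, \<alpha> >
  0 makes the sums over fine scales converge. Blocks are bounded by increments over [-1, 1] alone,
  while increments over any Borel domain are bounded by blocks; hence one chain of inequalities
  covers both choices of domains.\<close>

lemma rpow_ennreal: "0 \<le> x \<Longrightarrow> ennreal_rpow (ennreal x) r = ennreal (x powr r)"
  by (simp add: ennreal_rpow_def)

lemma rpow_top [simp]: "ennreal_rpow top r = top" "ennreal_rpow \<infinity> r = \<infinity>"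
  by (simp_all add: ennreal_rpow_def)

lemma rpow_1 [simp]: "ennreal_rpow 1 r = 1"
  by (simp add: ennreal_rpow_def)

lemma rpow_mono:
  assumes "x \<le> y" "0 \<le> r"
  shows "ennreal_rpow x r \<le> ennreal_rpow y r"
proof (cases "y = top")
  case True
  then show ?thesis by simp
next
  case False
  then have "x \<noteq> top" using assms by (auto simp: top_unique)
  with False assms show ?thesis
    by (auto simp: ennreal_rpow_def less_top intro!: ennreal_leI powr_mono2 enn2real_mono)
qed

lemma rpow_mult: "0 < r \<Longrightarrow> ennreal_rpow (x * y) r = ennreal_rpow x r * ennreal_rpow y r"
proof -
  assume r: "0 < r"
  have *: "ennreal_rpow (top * y) r = top * ennreal_rpow y r" for y
    using r by (cases y) (auto simp: rpow_ennreal ennreal_top_mult ennreal_rpow_def)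
  show ?thesis
  proof (cases x)
    case x: (real a)
    show ?thesis
    proof (cases y)
      case (real b)
      then show ?thesis using x
        by (simp add: rpow_ennreal powr_mult flip: ennreal_mult)
    next
      case top
      then show ?thesis using *[of x] by (metis mult.commute rpow_top(1))
    qed
  qed (use * in simp)
qed

lemma rpow_rpow: "ennreal_rpow (ennreal_rpow x r) s = ennreal_rpow x (r * s)"
  by (cases x) (auto simp: rpow_ennreal powr_powr)

lemma rpow_one [simp]: "ennreal_rpow x 1 = x"
  by (cases x) (auto simp: rpow_ennreal)

lemma measurable_rpow [measurable (raw)]:
  assumes [measurable]: "f \<in> borel_measurable M"
  shows "(\<lambda>x. ennreal_rpow (f x) r) \<in> borel_measurable M"
  unfolding ennreal_rpow_def by measurable

text \<open>Convexity of \<open>u powr q\<close>: its graph lies above the tangent at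
  \<open>L\<close>. The constant term stands on the right because subtraction in
  \<open>ennreal\<close> is truncated.\<close>

lemma rpow_tangent:
  fixes u :: ennreal
  assumes q: "1 \<le> q" and L: "0 \<le> L"
  shows "ennreal (q * L powr (q - 1)) * u \<le> ennreal_rpow u q + ennreal ((q - 1) * L powr q)"
proof (cases u)
  case u: (real x)
  have "q * L powr (q - 1) * x \<le> x powr q + (q - 1) * L powr q"
  proof (cases "x = 0 \<or> L = 0")
    case False
    with u L have "x > 0" "L > 0" by auto
    \<comment> \<open>Young's inequality with weights 1/q and 1 - 1/q bounds x * L^(q-1) by a convex
      combination of x^q and L^q.\<close>
    with q Youngs_inequality_0 [of "1/q" "1 - 1/q" "x powr q" "L powr q"]
    have "x powr (q * (1/q)) * L powr (q * (1 - 1/q)) \<le> 1/q * x powr q + (1 - 1/q) * L powr q"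
      by (simp add: powr_powr)
    also have "q * (1 - 1/q) = q - 1" using q by (simp add: field_simps)
    finally have "q * (x * L powr (q - 1)) \<le> q * (1/q * x powr q + (1 - 1/q) * L powr q)"
      using q \<open>x > 0\<close> by (intro mult_left_mono) auto
    also have "\<dots> = x powr q + (q - 1) * L powr q"
      using q by (simp add: field_simps)
    finally show ?thesis by (simp add: mult_ac)
  qed (use q in auto)
  then show ?thesis using u q L
    by (simp add: rpow_ennreal flip: ennreal_mult ennreal_plus)
qed (use assms in auto)

text \<open>Serves to see that a finite q-th moment against a finite weight forces a finite first
  moment.\<close>

lemma le_1_plus_rpow: "1 \<le> q \<Longrightarrow> u \<le> 1 + ennreal_rpow u q"
proof (cases u)
  case (real x)
  assume q: "1 \<le> q"
  have "x \<le> 1 + x powr q"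
  proof (cases "x \<le> 1")
    case False
    then show ?thesis using powr_mono[of 1 q x] q by auto
  qed (simp add: add_increasing2)
  then show ?thesis using real
    by (simp add: rpow_ennreal flip: ennreal_1 ennreal_plus)
qed auto

text \<open>The weight \<open>k\<close> has mass at most \<open>A\<close> instead of one, hence the
  factor \<open>A powr (q - 1)\<close>. The tangent inequality is integrated against
  \<open>k\<close>; an infinite right-hand side is trivial since \<open>A\<close> is
  positive.\<close>

lemma nn_integral_Jensen:
  assumes [measurable]: "k \<in> borel_measurable M" "g \<in> borel_measurable M"
    and A: "0 < A" and q: "1 \<le> q" and k: "(\<integral>\<^sup>+x. k x \<partial>M) \<le> ennreal A"
  shows "ennreal_rpow (\<integral>\<^sup>+x. k x * g x \<partial>M) q
    \<le> ennreal (A powr (q - 1)) * (\<integral>\<^sup>+x. k x * ennreal_rpow (g x) q \<partial>M)"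
proof (cases "(\<integral>\<^sup>+x. k x * ennreal_rpow (g x) q \<partial>M)")
  case (real i)
  have "(\<integral>\<^sup>+x. k x * g x \<partial>M) \<le> (\<integral>\<^sup>+x. k x * (1 + ennreal_rpow (g x) q) \<partial>M)"
    by (intro nn_integral_mono mult_left_mono le_1_plus_rpow q) auto
  also have "\<dots> = (\<integral>\<^sup>+x. k x \<partial>M) + ennreal i"
    using real by (simp add: distrib_left nn_integral_add)
  also have "\<dots> < top"
    using k by (simp add: less_top[symmetric]) (metis ennreal_neq_top top_unique)
  finally obtain S where S: "(\<integral>\<^sup>+x. k x * g x \<partial>M) = ennreal S" "S \<ge> 0"
    by (cases "(\<integral>\<^sup>+x. k x * g x \<partial>M)") auto
  \<comment> \<open>With the tangent taken at S / A, the left side of the integrated inequality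
    becomes q * L^q * A, so that exactly L^q * A \<le> i remains after cancellation.\<close>
  define L where "L = S / A"
  have L: "0 \<le> L" "S = L * A" using S A by (auto simp: L_def)
  have "ennreal (q * L powr (q - 1)) * (\<integral>\<^sup>+x. k x * g x \<partial>M)
      = (\<integral>\<^sup>+x. k x * (ennreal (q * L powr (q - 1)) * g x) \<partial>M)"
    by (subst nn_integral_cmult[symmetric]) (auto simp: mult_ac)
  also have "\<dots> \<le> (\<integral>\<^sup>+x. k x * (ennreal_rpow (g x) q + ennreal ((q - 1) * L powr q)) \<partial>M)"
    by (intro nn_integral_mono mult_left_mono rpow_tangent q L) auto
  also have "\<dots> = ennreal i + ennreal ((q - 1) * L powr q) * (\<integral>\<^sup>+x. k x \<partial>M)"
    using real by (simp add: distrib_left nn_integral_add nn_integral_multc mult.commute)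
  also have "\<dots> \<le> ennreal i + ennreal ((q - 1) * L powr q) * ennreal A"
    by (intro add_left_mono mult_left_mono k) auto
  finally have "q * L powr (q - 1) * S \<le> i + (q - 1) * L powr q * A"
    using S(2) real q L A by (simp add: S(1) flip: ennreal_mult ennreal_plus)
  moreover have "L powr (q - 1) * L = L powr q"
    using L(1) by (cases "L = 0") (auto simp: powr_diff)
  then have "q * L powr (q - 1) * S = q * L powr q * A"
    by (simp add: L(2))
  moreover have "(q - 1) * L powr q * A = q * L powr q * A - L powr q * A"
    by (simp add: algebra_simps)
  ultimately have "L powr q * A \<le> i" by linarith
  then have "A powr (q - 1) * (L powr q * A) \<le> A powr (q - 1) * i"
    by (intro mult_left_mono) auto
  moreover have "A powr (q - 1) * (L powr q * A) = S powr q"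
    using A L by (simp add: powr_mult powr_diff)
  ultimately show ?thesis
    using S real by (simp add: rpow_ennreal flip: ennreal_mult)
next
  case top
  then show ?thesis using A by (simp add: ennreal_mult_top)
qed

lemma enn2real_ge_1: "1 \<le> p \<Longrightarrow> p \<noteq> \<infinity> \<Longrightarrow> 1 \<le> enn2real p"
  by (cases p) (auto simp flip: ennreal_1)

section \<open>Monotonicity, homogeneity, Schur's test and Minkowski's inequality for Lebesgue
  norms\<close>

lemma rpow_Lnorm:
  assumes "1 \<le> p" "p \<noteq> \<infinity>"
  shows "ennreal_rpow (Lnorm p M g) (enn2real p) = (\<integral>\<^sup>+x. ennreal_rpow (g x) (enn2real p) \<partial>M)"
  using enn2real_ge_1[OF assms] assms by (simp add: Lnorm_def rpow_rpow)

lemma Lnorm_leI: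
  assumes "1 \<le> p" "p \<noteq> \<infinity>"
    and "(\<integral>\<^sup>+x. ennreal_rpow (g x) (enn2real p) \<partial>M) \<le> ennreal_rpow c (enn2real p)"
  shows "Lnorm p M g \<le> c"
proof -
  have "Lnorm p M g \<le> ennreal_rpow (ennreal_rpow c (enn2real p)) (1 / enn2real p)"
    using assms by (auto simp: Lnorm_def intro!: rpow_mono)
  also have "\<dots> = c" using enn2real_ge_1[OF assms(1,2)] by (simp add: rpow_rpow)
  finally show ?thesis .
qed

lemma Lnorm_mono_AE:
  assumes "f \<in> borel_measurable M" "AE x in M. f x \<le> g x"
  shows "Lnorm p M f \<le> Lnorm p M g"
  using assms
  by (auto simp: Lnorm_def intro!: rpow_mono nn_integral_mono_AE esssup_AE_mono elim!: eventually_mono)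

lemma Lnorm_mono:
  "f \<in> borel_measurable M \<Longrightarrow> (\<And>x. x \<in> space M \<Longrightarrow> f x \<le> g x) \<Longrightarrow> Lnorm p M f \<le> Lnorm p M g"
  by (auto intro: Lnorm_mono_AE)

lemma Lnorm_cmult_le:
  assumes q: "1 \<le> q" and [measurable]: "g \<in> borel_measurable M"
  shows "Lnorm q M (\<lambda>x. c * g x) \<le> c * Lnorm q M g"
proof (cases "q = \<infinity>")
  case True
  then show ?thesis
    using esssup_AE[of g M]
    by (auto simp: Lnorm_def intro!: esssup_I mult_left_mono elim!: eventually_mono)
next
  case False
  then have "1 \<le> enn2real q" using q by (intro enn2real_ge_1) auto
  then show ?thesis
    by (intro Lnorm_leI[OF q False])
      (simp add: rpow_mult rpow_Lnorm[OF q False] nn_integral_cmult)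
qed

text \<open>For infinite \<open>q\<close> the integrals in y give the factor directly. For finite
  \<open>q\<close> Jensen's inequality in y costs \<open>A powr (q - 1)\<close>, and after Tonelli
  the integrals in x supply the remaining factor \<open>A\<close>. No duality is involved.\<close>

lemma Lnorm_Schur:
  fixes k :: "'a \<Rightarrow> 'b \<Rightarrow> ennreal"
  assumes "sigma_finite_measure M" "sigma_finite_measure N"
    and k[measurable]: "case_prod k \<in> borel_measurable (M \<Otimes>\<^sub>M N)" and g[measurable]: "g \<in> borel_measurable N"
    and A: "0 < A" and q: "1 \<le> q"
    and kN: "\<And>x. x \<in> space M \<Longrightarrow> (\<integral>\<^sup>+y. k x y \<partial>N) \<le> ennreal A"
    and kM: "\<And>y. y \<in> space N \<Longrightarrow> (\<integral>\<^sup>+x. k x y \<partial>M) \<le> ennreal A"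
  shows "Lnorm q M (\<lambda>x. \<integral>\<^sup>+y. k x y * g y \<partial>N) \<le> ennreal A * Lnorm q N g"
proof -
  interpret pair_sigma_finite M N by (intro pair_sigma_finite.intro assms)
  show ?thesis
  proof (cases "q = \<infinity>")
    case True
    have "(\<integral>\<^sup>+y. k x y * g y \<partial>N) \<le> ennreal A * esssup N g" if [measurable]: "x \<in> space M" for x
    proof -
      have "(\<integral>\<^sup>+y. k x y * g y \<partial>N) \<le> (\<integral>\<^sup>+y. k x y * esssup N g \<partial>N)"
        using esssup_AE[of g N]
        by (intro nn_integral_mono_AE) (auto elim!: eventually_mono intro!: mult_left_mono)
      also have "\<dots> = (\<integral>\<^sup>+y. k x y \<partial>N) * esssup N g"
        by (rule nn_integral_multc) measurable
      also have "\<dots> \<le> ennreal A * esssup N g" by (intro mult_right_mono kN that) auto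
      finally show ?thesis .
    qed
    then show ?thesis using True by (auto simp: Lnorm_def intro!: esssup_I)
  next
    case False
    define r where "r = enn2real q"
    have r: "1 \<le> r" unfolding r_def by (rule enn2real_ge_1[OF q False])
    have "(\<integral>\<^sup>+x. ennreal_rpow (\<integral>\<^sup>+y. k x y * g y \<partial>N) r \<partial>M)
        \<le> (\<integral>\<^sup>+x. ennreal (A powr (r - 1)) * (\<integral>\<^sup>+y. k x y * ennreal_rpow (g y) r \<partial>N) \<partial>M)"
      by (intro nn_integral_mono nn_integral_Jensen A r kN) (measurable; simp)+
    also have "\<dots> = ennreal (A powr (r - 1)) * (\<integral>\<^sup>+x. \<integral>\<^sup>+y. k x y * ennreal_rpow (g y) r \<partial>N \<partial>M)"
      by (rule nn_integral_cmult) measurable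
    also have "(\<integral>\<^sup>+x. \<integral>\<^sup>+y. k x y * ennreal_rpow (g y) r \<partial>N \<partial>M)
        = (\<integral>\<^sup>+y. \<integral>\<^sup>+x. k x y * ennreal_rpow (g y) r \<partial>M \<partial>N)"
      by (rule Fubini'[symmetric]) measurable
    also have "\<dots> = (\<integral>\<^sup>+y. (\<integral>\<^sup>+x. k x y \<partial>M) * ennreal_rpow (g y) r \<partial>N)"
      by (intro nn_integral_cong nn_integral_multc) measurable
    also have "\<dots> \<le> (\<integral>\<^sup>+y. ennreal A * ennreal_rpow (g y) r \<partial>N)"
      by (intro nn_integral_mono mult_right_mono kM) auto
    also have "\<dots> = ennreal A * (\<integral>\<^sup>+y. ennreal_rpow (g y) r \<partial>N)"
      by (rule nn_integral_cmult) measurable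
    also have "ennreal (A powr (r - 1)) * (ennreal A * (\<integral>\<^sup>+y. ennreal_rpow (g y) r \<partial>N))
       = ennreal_rpow (ennreal A * Lnorm q N g) r"
      using A r rpow_Lnorm[OF q False, of N g]
      by (simp add: rpow_mult rpow_ennreal r_def[symmetric] powr_diff mult.assoc[symmetric] flip: ennreal_mult)
    finally have *: "(\<integral>\<^sup>+x. ennreal_rpow (\<integral>\<^sup>+y. k x y * g y \<partial>N) r \<partial>M)
        \<le> ennreal_rpow (ennreal A * Lnorm q N g) r"
      by (simp add: mult_left_mono)
    show ?thesis
      by (rule Lnorm_leI[OF q False]) (use * in \<open>simp add: r_def\<close>)
  qed
qed

text \<open>An essential supremum exceeds \<open>c\<close> precisely when the section of the set
  where \<open>c < F\<close> has positive measure, and the measure of sections is measurable in the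
  parameter by sigma-finiteness.\<close>

lemma measurable_Lnorm:
  assumes "sigma_finite_measure M"
    and [measurable]: "case_prod F \<in> borel_measurable (N \<Otimes>\<^sub>M M)"
  shows "(\<lambda>t. Lnorm p M (F t)) \<in> borel_measurable N"
proof (cases "p = \<infinity>")
  case True
  interpret sigma_finite_measure M by fact
  have "(\<lambda>t. esssup M (F t)) \<in> borel_measurable N"
  proof (rule borel_measurableI_greater)
    fix c :: ennreal
    have "c < esssup M (F t) \<longleftrightarrow> 0 < emeasure M {x\<in>space M. c < F t x}" if [measurable]: "t \<in> space N" for t
    proof
      have "F t \<in> borel_measurable M" by measurable
      then show "0 < emeasure M {x\<in>space M. c < F t x}" if "c < esssup M (F t)"
        using esssup_pos_measure that by blast
      show "c < esssup M (F t)" if *: "0 < emeasure M {x\<in>space M. c < F t x}"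
      proof (rule ccontr)
        assume "\<not> c < esssup M (F t)"
        with esssup_AE[of "F t" M] have "AE x in M. \<not> c < F t x"
          by (auto elim!: eventually_mono)
        then have "emeasure M {x\<in>space M. c < F t x} = 0"
          by (subst (asm) AE_iff_measurable[OF _ refl]) auto
        with * show False by simp
      qed
    qed
    then have "{t\<in>space N. c < esssup M (F t)}
        = {t\<in>space N. 0 < emeasure M {x\<in>space M. c < F t x}}" by auto
    also have "\<dots> = {t\<in>space N. 0 < emeasure M (Pair t -` {z\<in>space (N \<Otimes>\<^sub>M M). c < case_prod F z})}"
      by (intro Collect_cong conj_cong refl arg_cong[where f="\<lambda>A. 0 < emeasure M A"])
        (auto simp: space_pair_measure)
    also have "\<dots> \<in> sets N"
    proof -
      have "(\<lambda>t. emeasure M (Pair t -` {z\<in>space (N \<Otimes>\<^sub>M M). c < case_prod F z})) \<in> borel_measurable N"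
        by (rule measurable_emeasure_Pair) measurable
      then show ?thesis by simp
    qed
    finally show "{t\<in>space N. c < esssup M (F t)} \<in> sets N" .
  qed
  then show ?thesis using True by (simp add: Lnorm_def)
next
  case False
  interpret sigma_finite_measure M by fact
  show ?thesis using False unfolding Lnorm_def by simp
qed

text \<open>For finite \<open>q\<close> this is Jensen's inequality with the norms of the slices as
  weight, applied to the slices divided by their norms: each normalised slice has norm at most one,
  so the total is at most \<open>A powr (r - 1) * A\<close>. For infinite \<open>q\<close> the two
  almost-everywhere quantifiers are exchanged.\<close>

lemma Lnorm_Minkowski:
  fixes F :: "'a \<Rightarrow> 'b \<Rightarrow> ennreal"
  assumes M: "sigma_finite_measure M" and N: "sigma_finite_measure N"
    and F[measurable]: "case_prod F \<in> borel_measurable (M \<Otimes>\<^sub>M N)"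
    and q: "1 \<le> q"
  shows "Lnorm q M (\<lambda>x. \<integral>\<^sup>+t. F x t \<partial>N) \<le> (\<integral>\<^sup>+t. Lnorm q M (\<lambda>x. F x t) \<partial>N)"
proof -
  interpret pair_sigma_finite M N by (intro pair_sigma_finite.intro assms)
  define c where "c = (\<lambda>t. Lnorm q M (\<lambda>x. F x t))"
  have Fs: "(\<lambda>(t, x). F x t) \<in> borel_measurable (N \<Otimes>\<^sub>M M)" by measurable
  have c[measurable]: "c \<in> borel_measurable N"
    unfolding c_def using measurable_Lnorm[OF M Fs] by simp
  have "Lnorm q M (\<lambda>x. \<integral>\<^sup>+t. F x t \<partial>N) \<le> (\<integral>\<^sup>+t. c t \<partial>N)"
  proof (cases "q = \<infinity>")
    case True
    have "AE t in N. AE x in M. F x t \<le> c t"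
      by (rule AE_I2) (simp add: c_def Lnorm_def True esssup_AE)
    then have "AE x in M. AE t in N. F x t \<le> c t"
      by (subst AE_commute) measurable
    then have "AE x in M. (\<integral>\<^sup>+t. F x t \<partial>N) \<le> (\<integral>\<^sup>+t. c t \<partial>N)"
      by (auto elim!: eventually_mono intro!: nn_integral_mono_AE)
    then show ?thesis using True by (auto simp: Lnorm_def intro!: esssup_I)
  next
    case False
    define r where "r = enn2real q"
    have r: "1 \<le> r" unfolding r_def by (rule enn2real_ge_1[OF q False])
    show ?thesis
    proof (rule ennreal_le_epsilon)
      fix \<epsilon> :: real
      assume eps: "0 < \<epsilon>" and "(\<integral>\<^sup>+t. c t \<partial>N) < top"
      then obtain C where C: "(\<integral>\<^sup>+t. c t \<partial>N) = ennreal C" "0 \<le> C"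
        by (cases "(\<integral>\<^sup>+t. c t \<partial>N)") auto
      obtain e where e[measurable]: "e \<in> borel_measurable N" "(\<integral>\<^sup>+t. e t \<partial>N) \<noteq> \<infinity>"
        and epos: "\<And>t. t \<in> space N \<Longrightarrow> 0 < e t"
        using M2.Ex_finite_integrable_function by blast
      obtain E where E: "(\<integral>\<^sup>+t. e t \<partial>N) = ennreal E" "0 \<le> E"
        using e(2) by (cases "(\<integral>\<^sup>+t. e t \<partial>N)") auto
      \<comment> \<open>A small multiple of a strictly positive integrable function is added, so
        that slices of norm zero can be divided by as well; this costs at most \<epsilon> in the
        total weight.\<close>
      define c' where "c' = (\<lambda>t. c t + ennreal (\<epsilon> / (E + 1)) * e t)"
      have c'[measurable]: "c' \<in> borel_measurable N" unfolding c'_def by measurable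
      have c'pos: "0 < c' t" if "t \<in> space N" for t
        unfolding c'_def using epos[OF that] eps E by (simp add: ennreal_zero_less_mult_iff add_pos_pos add_nonneg_pos)
      have cc': "c t \<le> c' t" for t by (simp add: c'_def)
      define A where "A = C + \<epsilon>"
      have A: "0 < A" using C eps by (simp add: A_def)
      have "(\<integral>\<^sup>+t. c' t \<partial>N) = ennreal C + ennreal (\<epsilon> / (E + 1)) * ennreal E"
        unfolding c'_def using C E by (simp add: nn_integral_add nn_integral_cmult)
      also have "\<dots> = ennreal (C + \<epsilon> / (E + 1) * E)"
        using C E eps by (simp flip: ennreal_mult ennreal_plus)
      also have "\<dots> \<le> ennreal A"
        using E eps unfolding A_def by (intro ennreal_leI add_left_mono) (simp add: field_simps)
      finally have c'A: "(\<integral>\<^sup>+t. c' t \<partial>N) \<le> ennreal A" .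
      then have c'fin: "AE t in N. c' t \<noteq> \<infinity>"
        by (intro nn_integral_noteq_infinite) (auto simp: top_unique)
      \<comment> \<open>Dividing and multiplying by \<open>c'\<close> is exact only where
        \<open>c'\<close> is finite, which holds almost everywhere because its integral is
        finite.\<close>
      have *: "(\<integral>\<^sup>+t. F x t \<partial>N) = (\<integral>\<^sup>+t. c' t * (F x t * inverse (c' t)) \<partial>N)" for x
        using c'fin AE_space[of N]
      proof (intro nn_integral_cong_AE, eventually_elim)
        case (elim t)
        then have "c' t * inverse (c' t) = 1"
          using c'pos[of t] by (metis ennreal_divide_self divide_ennreal_def infinity_ennreal_def less_top not_gr_zero)
        then show ?case by (metis mult.commute mult.left_commute mult.right_neutral)
      qed
      have F'[measurable]: "(\<lambda>(x,t). F x t * inverse (c' t)) \<in> borel_measurable (M \<Otimes>\<^sub>M N)" by measurable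
      have **: "(\<integral>\<^sup>+x. ennreal_rpow (F x t * inverse (c' t)) r \<partial>M) \<le> 1" if [measurable]: "t \<in> space N" for t
      proof -
        have "(\<integral>\<^sup>+x. ennreal_rpow (F x t * inverse (c' t)) r \<partial>M)
           = ennreal_rpow (c t) r * ennreal_rpow (inverse (c' t)) r"
          using r rpow_Lnorm[OF q False, of M "\<lambda>x. F x t"]
          by (simp add: rpow_mult nn_integral_multc r_def[symmetric] c_def)
        also have "\<dots> = ennreal_rpow (c t * inverse (c' t)) r" using r by (simp add: rpow_mult)
        also have "\<dots> \<le> ennreal_rpow 1 r"
        proof (intro rpow_mono)
          have "c t * inverse (c' t) \<le> c' t * inverse (c' t)" by (intro mult_right_mono cc') auto
          also have "\<dots> \<le> 1"
            using c'pos[OF that]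
            by (cases "c' t") (auto simp: inverse_ennreal ennreal_mult[symmetric] zero_less_iff_neq_zero)
          finally show "c t * inverse (c' t) \<le> 1" .
        qed (use r in auto)
        finally show ?thesis by simp
      qed
      have "(\<integral>\<^sup>+x. ennreal_rpow (\<integral>\<^sup>+t. F x t \<partial>N) r \<partial>M)
        \<le> (\<integral>\<^sup>+x. ennreal (A powr (r - 1)) * (\<integral>\<^sup>+t. c' t * ennreal_rpow (F x t * inverse (c' t)) r \<partial>N) \<partial>M)"
        unfolding * by (intro nn_integral_mono nn_integral_Jensen A r c'A) (measurable; simp)+
      also have "\<dots> = ennreal (A powr (r - 1)) * (\<integral>\<^sup>+x. \<integral>\<^sup>+t. c' t * ennreal_rpow (F x t * inverse (c' t)) r \<partial>N \<partial>M)"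
        by (rule nn_integral_cmult) measurable
      also have "(\<integral>\<^sup>+x. \<integral>\<^sup>+t. c' t * ennreal_rpow (F x t * inverse (c' t)) r \<partial>N \<partial>M)
          = (\<integral>\<^sup>+t. \<integral>\<^sup>+x. c' t * ennreal_rpow (F x t * inverse (c' t)) r \<partial>M \<partial>N)"
        by (rule Fubini'[symmetric]) measurable
      also have "\<dots> = (\<integral>\<^sup>+t. c' t * (\<integral>\<^sup>+x. ennreal_rpow (F x t * inverse (c' t)) r \<partial>M) \<partial>N)"
        by (intro nn_integral_cong nn_integral_cmult) measurable
      also have "\<dots> \<le> (\<integral>\<^sup>+t. c' t * 1 \<partial>N)"
        by (intro nn_integral_mono mult_left_mono **) auto
      also have "\<dots> \<le> ennreal A" using c'A by simp
      also have "ennreal (A powr (r - 1)) * ennreal A = ennreal_rpow (ennreal A) r"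
        using A by (simp add: rpow_ennreal powr_diff flip: ennreal_mult)
      finally have ***: "(\<integral>\<^sup>+x. ennreal_rpow (\<integral>\<^sup>+t. F x t \<partial>N) r \<partial>M) \<le> ennreal_rpow (ennreal A) r"
        by (simp add: mult_left_mono)
      show "Lnorm q M (\<lambda>x. \<integral>\<^sup>+t. F x t \<partial>N) \<le> (\<integral>\<^sup>+t. c t \<partial>N) + ennreal \<epsilon>"
        using Lnorm_leI[OF q False, of M _ "ennreal A"] *** C eps
        by (simp add: r_def A_def)
    qed
  qed
  then show ?thesis by (simp add: c_def)
qed

text \<open>Minkowski's inequality carries the inner norm under the integral in s, Schur's test for
  \<open>k2\<close> acts for each fixed s, and Schur's test for \<open>k1\<close> finishes with the
  constant \<open>A2\<close> absorbed into the kernel.\<close>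

lemma Lnorm_tensor_Schur:
  fixes W :: "'b \<Rightarrow> 'd \<Rightarrow> ennreal"
  assumes sf: "sigma_finite_measure M1" "sigma_finite_measure N1"
      "sigma_finite_measure M2" "sigma_finite_measure N2"
    and k1[measurable]: "case_prod k1 \<in> borel_measurable (M1 \<Otimes>\<^sub>M N1)"
    and k2[measurable]: "case_prod k2 \<in> borel_measurable (M2 \<Otimes>\<^sub>M N2)"
    and W[measurable]: "case_prod W \<in> borel_measurable (N1 \<Otimes>\<^sub>M N2)"
    and q: "1 \<le> q1" "1 \<le> q2" and A: "0 < A1" "0 < A2"
    and kN1: "\<And>x. x \<in> space M1 \<Longrightarrow> (\<integral>\<^sup>+s. k1 x s \<partial>N1) \<le> ennreal A1"
    and kM1: "\<And>s. s \<in> space N1 \<Longrightarrow> (\<integral>\<^sup>+x. k1 x s \<partial>M1) \<le> ennreal A1"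
    and kN2: "\<And>y. y \<in> space M2 \<Longrightarrow> (\<integral>\<^sup>+t. k2 y t \<partial>N2) \<le> ennreal A2"
    and kM2: "\<And>t. t \<in> space N2 \<Longrightarrow> (\<integral>\<^sup>+y. k2 y t \<partial>M2) \<le> ennreal A2"
  shows "Lnorm q1 M1 (\<lambda>x. Lnorm q2 M2 (\<lambda>y. \<integral>\<^sup>+s. k1 x s * (\<integral>\<^sup>+t. k2 y t * W s t \<partial>N2) \<partial>N1))
    \<le> ennreal (A1 * A2) * Lnorm q1 N1 (\<lambda>s. Lnorm q2 N2 (W s))"
proof -
  interpret M1: sigma_finite_measure M1 by fact
  interpret N1: sigma_finite_measure N1 by fact
  interpret M2: sigma_finite_measure M2 by fact
  interpret N2: sigma_finite_measure N2 by fact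
  have LW[measurable]: "(\<lambda>s. Lnorm q2 N2 (W s)) \<in> borel_measurable N1"
    by (rule measurable_Lnorm[OF sf(4) W])
  have inner: "Lnorm q2 M2 (\<lambda>y. \<integral>\<^sup>+s. k1 x s * (\<integral>\<^sup>+t. k2 y t * W s t \<partial>N2) \<partial>N1)
      \<le> (\<integral>\<^sup>+s. k1 x s * (ennreal A2 * Lnorm q2 N2 (W s)) \<partial>N1)" if [measurable]: "x \<in> space M1" for x
  proof -
    have "Lnorm q2 M2 (\<lambda>y. \<integral>\<^sup>+s. k1 x s * (\<integral>\<^sup>+t. k2 y t * W s t \<partial>N2) \<partial>N1)
      \<le> (\<integral>\<^sup>+s. Lnorm q2 M2 (\<lambda>y. k1 x s * (\<integral>\<^sup>+t. k2 y t * W s t \<partial>N2)) \<partial>N1)"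
      by (rule Lnorm_Minkowski[OF sf(3,2) _ q(2)]) measurable
    also have "\<dots> \<le> (\<integral>\<^sup>+s. k1 x s * (ennreal A2 * Lnorm q2 N2 (W s)) \<partial>N1)"
    proof (rule nn_integral_mono)
      fix s assume [measurable]: "s \<in> space N1"
      have [measurable]: "(\<lambda>y. \<integral>\<^sup>+t. k2 y t * W s t \<partial>N2) \<in> borel_measurable M2" by measurable
      have "Lnorm q2 M2 (\<lambda>y. k1 x s * (\<integral>\<^sup>+t. k2 y t * W s t \<partial>N2))
         \<le> k1 x s * Lnorm q2 M2 (\<lambda>y. \<integral>\<^sup>+t. k2 y t * W s t \<partial>N2)"
        by (intro Lnorm_cmult_le q) measurable
      also have "\<dots> \<le> k1 x s * (ennreal A2 * Lnorm q2 N2 (W s))"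
        by (intro mult_left_mono Lnorm_Schur[OF sf(3,4) _ _ A(2) q(2) kN2 kM2]) (measurable; simp)+
      finally show "Lnorm q2 M2 (\<lambda>y. k1 x s * (\<integral>\<^sup>+t. k2 y t * W s t \<partial>N2))
        \<le> k1 x s * (ennreal A2 * Lnorm q2 N2 (W s))" .
    qed
    finally show ?thesis .
  qed
  have "Lnorm q1 M1 (\<lambda>x. Lnorm q2 M2 (\<lambda>y. \<integral>\<^sup>+s. k1 x s * (\<integral>\<^sup>+t. k2 y t * W s t \<partial>N2) \<partial>N1))
     \<le> Lnorm q1 M1 (\<lambda>x. (\<integral>\<^sup>+s. k1 x s * (ennreal A2 * Lnorm q2 N2 (W s)) \<partial>N1))"
    by (intro Lnorm_mono inner measurable_Lnorm sf) measurable
  also have "\<dots> = Lnorm q1 M1 (\<lambda>x. (\<integral>\<^sup>+s. (ennreal A2 * k1 x s) * Lnorm q2 N2 (W s) \<partial>N1))"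
    by (simp add: mult_ac)
  also have "\<dots> \<le> ennreal (A2 * A1) * Lnorm q1 N1 (\<lambda>s. Lnorm q2 N2 (W s))"
  proof (rule Lnorm_Schur[OF sf(1,2)])
    show "(\<integral>\<^sup>+y. ennreal A2 * k1 x y \<partial>N1) \<le> ennreal (A2 * A1)" if [measurable]: "x \<in> space M1" for x
      using kN1[OF that] A by (subst nn_integral_cmult) (auto simp: ennreal_mult intro!: mult_left_mono)
    show "(\<integral>\<^sup>+x. ennreal A2 * k1 x y \<partial>M1) \<le> ennreal (A2 * A1)" if [measurable]: "y \<in> space N1" for y
      using kM1[OF that] A by (subst nn_integral_cmult) (auto simp: ennreal_mult intro!: mult_left_mono)
  qed (use A q in \<open>auto\<close>)
  finally show ?thesis by (simp add: mult.commute)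
qed

text \<open>The one-point measure is the neutral choice in the tensor estimates: a variable without
  an increment, or a plain number, becomes a norm over \<open>unit\<close>.\<close>

lemma Lnorm_unit [simp]: "1 \<le> q \<Longrightarrow> Lnorm q (count_space (UNIV :: unit set)) g = g ()"
proof -
  assume q: "1 \<le> q"
  show ?thesis
  proof (cases "q = \<infinity>")
    case True
    have "g = (\<lambda>_. g ())" by (auto intro: arg_cong[where f=g])
    then have "esssup (count_space UNIV) g = esssup (count_space (UNIV :: unit set)) (\<lambda>_. g ())"
      by simp
    also have "\<dots> = g ()"
      by (rule esssup_const) simp
    finally show ?thesis using True by (simp add: Lnorm_def)
  next
    case False
    then show ?thesis using enn2real_ge_1[OF q False]
      by (simp add: Lnorm_def nn_integral_count_space_finite rpow_rpow UNIV_unit)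
  qed
qed

section \<open>Counting measures, pairings and the triangle inequality\<close>

lemma sigma_finite_count_space: "sigma_finite_measure (count_space (A :: 'a :: countable set))"
  by (rule sigma_finite_measure_count_space_countable) simp

lemma measurable_nn_integral_count_space [measurable (raw)]:
  fixes f :: "'a \<Rightarrow> 'b :: countable \<Rightarrow> ennreal"
  assumes "\<And>k. k \<in> A \<Longrightarrow> (\<lambda>x. f x k) \<in> borel_measurable M"
  shows "(\<lambda>x. \<integral>\<^sup>+k. f x k \<partial>count_space A) \<in> borel_measurable M"
proof -
  interpret sigma_finite_measure "count_space A" by (rule sigma_finite_count_space)
  have "(\<lambda>(k, x). f x k) \<in> borel_measurable (count_space A \<Otimes>\<^sub>M M)"
    by (rule measurable_pair_measure_countable1) (use assms in auto)
  then have "(\<lambda>(x, k). f x k) \<in> borel_measurable (M \<Otimes>\<^sub>M count_space A)"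
    by (subst measurable_pair_swap_iff) simp
  then show ?thesis by (rule borel_measurable_nn_integral)
qed

text \<open>Hoelder's inequality for a weight that is both integrable and bounded, read off from
  Schur's test with a one-point target: the row integral is the mass of \<open>k\<close>, the column
  integrals are its values.\<close>

lemma Lnorm_pairing:
  assumes "sigma_finite_measure N" and [measurable]: "k \<in> borel_measurable N" "g \<in> borel_measurable N"
    and A: "0 < A" and q: "1 \<le> q"
    and "(\<integral>\<^sup>+y. k y \<partial>N) \<le> ennreal A" "\<And>y. y \<in> space N \<Longrightarrow> k y \<le> ennreal A"
  shows "(\<integral>\<^sup>+y. k y * g y \<partial>N) \<le> ennreal A * Lnorm q N g"
proof -
  have "Lnorm q (count_space (UNIV :: unit set)) (\<lambda>_. \<integral>\<^sup>+y. k y * g y \<partial>N) \<le> ennreal A * Lnorm q N g"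
    by (rule Lnorm_Schur[OF sigma_finite_count_space assms(1)])
      (use assms in \<open>auto simp: nn_integral_count_space_finite UNIV_unit\<close>)
  then show ?thesis using q by simp
qed

text \<open>Minkowski's inequality for the counting measure on \<open>bool\<close>.\<close>

lemma Lnorm_add_le:
  assumes M: "sigma_finite_measure M" and [measurable]: "f \<in> borel_measurable M" "g \<in> borel_measurable M"
    and q: "1 \<le> q"
  shows "Lnorm q M (\<lambda>x. f x + g x) \<le> Lnorm q M f + Lnorm q M g"
proof -
  let ?F = "\<lambda>x b. if b then f x else g x"
  have "case_prod ?F \<in> borel_measurable (M \<Otimes>\<^sub>M count_space UNIV)" by measurable
  from Lnorm_Minkowski[OF M sigma_finite_count_space this q]
  show ?thesis by (simp add: nn_integral_count_space_finite UNIV_bool add.commute)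
qed

lemma Lnorm_distr:
  assumes [measurable]: "T \<in> measurable M N" "g \<in> borel_measurable N"
  shows "Lnorm p (distr M N T) g = Lnorm p M (\<lambda>x. g (T x))"
proof (cases "p = \<infinity>")
  case True
  have "esssup (distr M N T) g = esssup M (\<lambda>x. g (T x))"
  proof (subst (1 2) esssup_eq)
    have "emeasure (distr M N T) {x \<in> space (distr M N T). z < g x} = emeasure M {x \<in> space M. z < g (T x)}" for z
    proof (subst emeasure_distr)
      have "T -` {x \<in> space (distr M N T). z < g x} \<inter> space M = {x \<in> space M. z < g (T x)}"
        using measurable_space[OF assms(1)] by auto
      then show "emeasure M (T -` {x \<in> space (distr M N T). z < g x} \<inter> space M)
        = emeasure M {x \<in> space M. z < g (T x)}" by simp
    qed auto
    then show "Inf {z. emeasure (distr M N T) {x \<in> space (distr M N T). z < g x} = 0}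
       = Inf {z. emeasure M {x \<in> space M. z < g (T x)} = 0}" by simp
  qed (use assms in auto)
  then show ?thesis using True by (simp add: Lnorm_def)
qed (simp add: Lnorm_def nn_integral_distr)

subsection \<open>Integrals of periodic functions\<close>

abbreviation torus :: "real measure" where
  "torus \<equiv> restrict_space lborel {-pi..pi}"

lemma sigma_finite_torus: "sigma_finite_measure torus"
  by (rule sigma_finite_measure_restrict_space) (auto intro: lborel.sigma_finite_measure_axioms)

lemmas [measurable (raw)] =
  measurable_Lnorm[OF sigma_finite_torus] measurable_Lnorm[OF lborel.sigma_finite_measure_axioms]

lemma measurable_torusI [measurable (raw)]: "g \<in> borel_measurable borel \<Longrightarrow> g \<in> borel_measurable torus"
  by (auto intro!: measurable_restrict_space1)

lemma measurable_snd_torus [measurable]: "snd \<in> N \<Otimes>\<^sub>M torus \<rightarrow>\<^sub>M borel"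
  by (rule measurable_compose[OF measurable_snd, of "\<lambda>y. y", unfolded id_def]) simp

lemma measurable_fst_borel [measurable]: "fst \<in> (borel :: (real \<times> real) measure) \<rightarrow>\<^sub>M borel"
  and measurable_snd_borel [measurable]: "snd \<in> (borel :: (real \<times> real) measure) \<rightarrow>\<^sub>M borel"
  by (auto intro!: borel_measurable_continuous_onI continuous_intros)

text \<open>The half-open period is the one whose translates tile the line; the endpoint is a null
  set.\<close>

lemma nn_integral_torus:
  assumes [measurable]: "g \<in> borel_measurable borel"
  shows "(\<integral>\<^sup>+y. g y \<partial>torus) = (\<integral>\<^sup>+y. g y * indicator {-pi..<pi} y \<partial>lborel)"
proof -
  have "(\<integral>\<^sup>+y. g y \<partial>torus) = (\<integral>\<^sup>+y. g y * indicator {-pi..pi} y \<partial>lborel)"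
    by (subst nn_integral_restrict_space) auto
  also have "\<dots> = (\<integral>\<^sup>+y. g y * indicator {-pi..<pi} y \<partial>lborel)"
    using AE_lborel_singleton[of pi]
    by (intro nn_integral_cong_AE) (auto elim!: eventually_mono split: split_indicator)
  finally show ?thesis .
qed

lemma nn_integral_lborel_shift:
  fixes g :: "'a :: euclidean_space \<Rightarrow> ennreal"
  assumes [measurable]: "g \<in> borel_measurable borel"
  shows "(\<integral>\<^sup>+x. g (x + c) \<partial>lborel) = (\<integral>\<^sup>+x. g x \<partial>lborel)"
proof -
  have "(\<integral>\<^sup>+x. g x \<partial>lborel) = (\<integral>\<^sup>+x. g x \<partial>distr lborel borel ((+) c))"
    by (simp add: lborel_distr_plus)
  then show ?thesis by (simp add: nn_integral_distr add.commute)
qed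

lemma periodic_int:
  fixes g :: "real \<Rightarrow> 'a"
  assumes "\<And>y. g (y + 2 * pi) = g y"
  shows "g (y + 2 * pi * of_int k) = g y"
proof -
  have 1: "g (y + 2 * pi * of_nat n) = g y" for n y
  proof (induction n arbitrary: y)
    case (Suc n)
    have "g (y + 2 * pi * of_nat (Suc n)) = g ((y + 2 * pi * of_nat n) + 2 * pi)"
      by (simp add: algebra_simps)
    then show ?case using assms Suc by simp
  qed simp
  show ?thesis
  proof (cases k)
    case (nonneg n)
    then show ?thesis using 1[of y n] by simp
  next
    case (neg n)
    then have k: "real_of_int k = - 1 - real n" by simp
    have e: "y + 2 * pi * of_int k + 2 * pi * of_nat (Suc n) = y" unfolding k by (simp add: algebra_simps)
    show ?thesis using 1[of "y + 2 * pi * of_int k" "Suc n", unfolded e] by simp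
  qed
qed

text \<open>The floor in \<open>k0\<close> names the one translate of the half-open period that
  contains \<open>y\<close>. Unfolding an integral uses the minus sign, folding a shifted period the
  plus sign.\<close>

lemma sum_indicator_period:
  "(\<integral>\<^sup>+k. indicator {-pi..<pi} (y + 2 * pi * of_int k) \<partial>count_space (UNIV :: int set)) = (1 :: ennreal)"
  "(\<integral>\<^sup>+k. indicator {-pi..<pi} (y - 2 * pi * of_int k) \<partial>count_space (UNIV :: int set)) = (1 :: ennreal)"
proof -
  define k0 where "k0 = - \<lfloor>(y + pi) / (2 * pi)\<rfloor>"
  have "y + 2 * pi * of_int k \<in> {-pi..<pi} \<longleftrightarrow> k = k0" for k
  proof -
    have "y + 2 * pi * of_int k \<in> {-pi..<pi} \<longleftrightarrow> of_int (- k) \<le> (y + pi) / (2 * pi) \<and> (y + pi) / (2 * pi) < of_int (- k) + 1"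
      by (simp add: field_simps) argo
    also have "\<dots> \<longleftrightarrow> \<lfloor>(y + pi) / (2 * pi)\<rfloor> = - k"
      by (auto simp: floor_eq_iff)
    finally show ?thesis by (auto simp: k0_def)
  qed
  note * = this
  have "y - 2 * pi * of_int k \<in> {-pi..<pi} \<longleftrightarrow> k = - k0" for k
    using *[of "- k"] by auto
  with * have "indicator {-pi..<pi} (y + 2 * pi * of_int k) = (indicator {k0} k :: ennreal)"
    "indicator {-pi..<pi} (y - 2 * pi * of_int k) = (indicator {- k0} k :: ennreal)" for k
    by (simp_all add: indicator_def)
  then show "(\<integral>\<^sup>+k. indicator {-pi..<pi} (y + 2 * pi * of_int k) \<partial>count_space (UNIV :: int set)) = (1 :: ennreal)"
    "(\<integral>\<^sup>+k. indicator {-pi..<pi} (y - 2 * pi * of_int k) \<partial>count_space (UNIV :: int set)) = (1 :: ennreal)"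
    by simp_all
qed

text \<open>Periodisation of the weight: the line is cut into periods by a sum of indicators equal
  to one, and every piece is shifted back to the standard period, which leaves \<open>g\<close>
  unchanged.\<close>

lemma nn_integral_periodic_unfold:
  fixes g w :: "real \<Rightarrow> ennreal"
  assumes [measurable]: "g \<in> borel_measurable borel" "w \<in> borel_measurable borel"
    and per: "\<And>y. g (y + 2 * pi) = g y"
  shows "(\<integral>\<^sup>+y. g y * w y \<partial>lborel)
    = (\<integral>\<^sup>+y. g y * (\<integral>\<^sup>+k. w (y + 2 * pi * of_int k) \<partial>count_space (UNIV :: int set)) \<partial>torus)"
proof -
  interpret pair_sigma_finite "count_space (UNIV :: int set)" "lborel :: real measure"
    by (intro pair_sigma_finite.intro sigma_finite_count_space lborel.sigma_finite_measure_axioms)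
  have "(\<integral>\<^sup>+y. g y * w y \<partial>lborel) = (\<integral>\<^sup>+y. \<integral>\<^sup>+k. g y * w y * indicator {-pi..<pi} (y - 2 * pi * of_int k) \<partial>count_space (UNIV :: int set) \<partial>lborel)"
    by (subst nn_integral_cmult) (simp_all only: sum_indicator_period mult_1_right, simp)
  also have "\<dots> = (\<integral>\<^sup>+k. \<integral>\<^sup>+y. g y * w y * indicator {-pi..<pi} (y - 2 * pi * of_int k) \<partial>lborel \<partial>count_space (UNIV :: int set))"
    by (rule Fubini') (rule measurable_pair_measure_countable1; simp)
  also have "\<dots> = (\<integral>\<^sup>+k. \<integral>\<^sup>+y. g y * w (y + 2 * pi * of_int k) * indicator {-pi..<pi} y \<partial>lborel \<partial>count_space (UNIV :: int set))"
  proof (rule nn_integral_cong)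
    fix k :: int
    have "(\<integral>\<^sup>+y. g y * w y * indicator {-pi..<pi} (y - 2 * pi * of_int k) \<partial>lborel)
      = (\<integral>\<^sup>+y. g (y + 2 * pi * of_int k) * w (y + 2 * pi * of_int k) * indicator {-pi..<pi} (y + 2 * pi * of_int k - 2 * pi * of_int k) \<partial>lborel)"
      by (rule nn_integral_lborel_shift[symmetric]) measurable
    then show "(\<integral>\<^sup>+y. g y * w y * indicator {-pi..<pi} (y - 2 * pi * of_int k) \<partial>lborel)
      = (\<integral>\<^sup>+y. g y * w (y + 2 * pi * of_int k) * indicator {-pi..<pi} y \<partial>lborel)"
      by (simp add: periodic_int[of g, OF per])
  qed
  also have "\<dots> = (\<integral>\<^sup>+y. \<integral>\<^sup>+k. g y * w (y + 2 * pi * of_int k) * indicator {-pi..<pi} y \<partial>count_space (UNIV :: int set) \<partial>lborel)"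
    by (rule Fubini'[symmetric]) (rule measurable_pair_measure_countable1; simp)
  also have "\<dots> = (\<integral>\<^sup>+y. g y * (\<integral>\<^sup>+k. w (y + 2 * pi * of_int k) \<partial>count_space (UNIV :: int set)) * indicator {-pi..<pi} y \<partial>lborel)"
    by (simp add: nn_integral_cmult nn_integral_multc)
  also have "\<dots> = (\<integral>\<^sup>+y. g y * (\<integral>\<^sup>+k. w (y + 2 * pi * of_int k) \<partial>count_space (UNIV :: int set)) \<partial>torus)"
    by (rule nn_integral_torus[symmetric]) measurable
  finally show ?thesis .
qed

text \<open>After a translation of the line the shift sits in the indicator of the period; the
  periodisation of a shifted period is again the constant one.\<close>

lemma nn_integral_torus_shift:
  fixes g :: "real \<Rightarrow> ennreal"
  assumes [measurable]: "g \<in> borel_measurable borel" and per: "\<And>y. g (y + 2 * pi) = g y"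
  shows "(\<integral>\<^sup>+y. g (y + b) \<partial>torus) = (\<integral>\<^sup>+y. g y \<partial>torus)"
proof -
  have "(\<integral>\<^sup>+y. g (y + b) \<partial>torus) = (\<integral>\<^sup>+y. g (y + b) * indicator {-pi..<pi} (y + b + - b) \<partial>lborel)"
    by (subst nn_integral_torus) auto
  also have "\<dots> = (\<integral>\<^sup>+y. g y * indicator {-pi..<pi} (y + - b) \<partial>lborel)"
    by (rule nn_integral_lborel_shift) measurable
  also have "\<dots> = (\<integral>\<^sup>+y. g y * (\<integral>\<^sup>+k. indicator {-pi..<pi} (y + 2 * pi * of_int k + - b) \<partial>count_space (UNIV :: int set)) \<partial>torus)"
    by (rule nn_integral_periodic_unfold) (use per in auto)
  also have "\<dots> = (\<integral>\<^sup>+y. g y * (\<integral>\<^sup>+k. indicator {-pi..<pi} (y + - b + 2 * pi * of_int k) \<partial>count_space (UNIV :: int set)) \<partial>torus)"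
    by (simp add: algebra_simps)
  finally show ?thesis by (simp only: sum_indicator_period) simp
qed

lemma Lnorm_torus_shift:
  fixes g :: "real \<Rightarrow> ennreal"
  assumes [measurable]: "g \<in> borel_measurable borel" and per: "\<And>y. g (y + 2 * pi) = g y"
  shows "Lnorm p torus (\<lambda>y. g (y + b)) = Lnorm p torus g"
proof (cases "p = \<infinity>")
  case True
  \<comment> \<open>Essential suprema are determined by the measures of superlevel sets. These are
    integrals of periodic indicators, to which the shift invariance of integrals applies.\<close>
  have *: "emeasure torus {y \<in> space torus. z < g (y + c)}
     = (\<integral>\<^sup>+y. indicator {x. z < g x} (y + c) \<partial>torus)" for z c
  proof -
    have "(\<integral>\<^sup>+y. indicator {x. z < g x} (y + c) \<partial>torus)
      = (\<integral>\<^sup>+y. indicator {y \<in> space torus. z < g (y + c)} y \<partial>torus)"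
      by (intro nn_integral_cong) (auto split: split_indicator)
    also have "\<dots> = emeasure torus {y \<in> space torus. z < g (y + c)}"
      by (rule nn_integral_indicator) measurable
    finally show ?thesis ..
  qed
  have "emeasure torus {y \<in> space torus. z < g (y + b)} = emeasure torus {y \<in> space torus. z < g (y + 0)}" for z
    unfolding * by (subst (1 2) nn_integral_torus_shift) (auto simp: per indicator_def)
  then have "esssup torus (\<lambda>y. g (y + b)) = esssup torus g"
    by (subst (1 2) esssup_eq) auto
  then show ?thesis using True by (simp add: Lnorm_def)
next
  case False
  have "(\<integral>\<^sup>+y. ennreal_rpow (g (y + b)) r \<partial>torus) = (\<integral>\<^sup>+y. ennreal_rpow (g y) r \<partial>torus)" for r
    by (rule nn_integral_torus_shift) (auto simp: per)
  then show ?thesis using False by (simp add: Lnorm_def)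
qed

subsection \<open>Mixed norms\<close>

text \<open>The mixed norm of extended nonnegative functions: series and integrals of absolute
  values can be inserted before they are known to be finite.\<close>

definition mnorm :: "ennreal \<times> ennreal \<Rightarrow> (real \<times> real \<Rightarrow> ennreal) \<Rightarrow> ennreal" where
  "mnorm p g = Lnorm (fst p) lborel (\<lambda>x. Lnorm (snd p) torus (\<lambda>y. g (x, y)))"

lemma mixed_norm_eq: "mixed_norm p f = mnorm p (\<lambda>z. ennreal (cmod (f z)))"
  by (simp add: mixed_norm_def mnorm_def)

lemma measurable_mnorm_inner:
  fixes G :: "'t \<Rightarrow> real \<times> real \<Rightarrow> ennreal"
  assumes [measurable]: "case_prod G \<in> borel_measurable (N \<Otimes>\<^sub>M borel)"
  shows "(\<lambda>(t, x). Lnorm r torus (\<lambda>y. G t (x, y))) \<in> borel_measurable (N \<Otimes>\<^sub>M lborel)"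
  unfolding case_prod_beta by (rule measurable_Lnorm[OF sigma_finite_torus]) measurable

lemma measurable_mnorm [measurable (raw)]:
  assumes [measurable]: "case_prod G \<in> borel_measurable (N \<Otimes>\<^sub>M borel)"
  shows "(\<lambda>t. mnorm p (G t)) \<in> borel_measurable N"
  unfolding mnorm_def
  by (rule measurable_Lnorm[OF lborel.sigma_finite_measure_axioms]) (rule measurable_mnorm_inner, fact)

lemma measurable_Lnorm_torus [measurable]:
  fixes g :: "real \<times> real \<Rightarrow> ennreal"
  assumes [measurable]: "g \<in> borel_measurable borel"
  shows "(\<lambda>x. Lnorm r torus (\<lambda>y. g (x, y))) \<in> borel_measurable borel"
proof -
  have "(\<lambda>x. Lnorm r torus (\<lambda>y. g (x, y))) \<in> borel_measurable lborel"
    by (rule measurable_Lnorm[OF sigma_finite_torus]) measurable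
  then show ?thesis by simp
qed

lemma mnorm_mono_AE:
  assumes [measurable]: "g \<in> borel_measurable borel" "h \<in> borel_measurable borel"
    and "AE z in lborel. g z \<le> h z"
  shows "mnorm p g \<le> mnorm p h"
proof -
  have "AE z in lborel \<Otimes>\<^sub>M lborel. g z \<le> h z" unfolding lborel_prod by (rule assms(3))
  then have "AE x in lborel. AE y in lborel. g (x, y) \<le> h (x, y)"
    using lborel_pair.AE_pair by blast
  then have "AE x in lborel. Lnorm (snd p) torus (\<lambda>y. g (x, y)) \<le> Lnorm (snd p) torus (\<lambda>y. h (x, y))"
  proof (eventually_elim)
    case (elim x)
    then have "AE y in torus. g (x, y) \<le> h (x, y)"
      by (subst AE_restrict_space_iff) (auto elim: eventually_mono)
    then show ?case by (intro Lnorm_mono_AE) measurable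
  qed
  then show ?thesis unfolding mnorm_def by (intro Lnorm_mono_AE) auto
qed

lemma mnorm_mono:
  assumes "g \<in> borel_measurable borel" "h \<in> borel_measurable borel" "\<And>z. g z \<le> h z"
  shows "mnorm p g \<le> mnorm p h"
  by (rule mnorm_mono_AE) (use assms in auto)

text \<open>One application of Minkowski's inequality on the torus and one on the line.\<close>

lemma mnorm_Minkowski:
  fixes F :: "real \<times> real \<Rightarrow> 't \<Rightarrow> ennreal"
  assumes N: "sigma_finite_measure N" and [measurable]: "case_prod F \<in> borel_measurable (borel \<Otimes>\<^sub>M N)"
    and p: "1 \<le> fst p" "1 \<le> snd p"
  shows "mnorm p (\<lambda>z. \<integral>\<^sup>+t. F z t \<partial>N) \<le> (\<integral>\<^sup>+t. mnorm p (\<lambda>z. F z t) \<partial>N)"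
proof -
  interpret sigma_finite_measure N by fact
  have m: "(\<lambda>(t, z). F z t) \<in> borel_measurable (N \<Otimes>\<^sub>M borel)" by measurable
  have [measurable]: "(\<lambda>(x, t). Lnorm (snd p) torus (\<lambda>y. F (x, y) t)) \<in> borel_measurable (lborel \<Otimes>\<^sub>M N)"
    using measurable_mnorm_inner[OF m] by (simp add: measurable_split_conv measurable_pair_swap_iff[of _ lborel])
  have "mnorm p (\<lambda>z. \<integral>\<^sup>+t. F z t \<partial>N)
      \<le> Lnorm (fst p) lborel (\<lambda>x. \<integral>\<^sup>+t. Lnorm (snd p) torus (\<lambda>y. F (x, y) t) \<partial>N)"
    unfolding mnorm_def
  proof (rule Lnorm_mono)
    show "(\<lambda>x. Lnorm (snd p) torus (\<lambda>y. \<integral>\<^sup>+t. F (x, y) t \<partial>N)) \<in> borel_measurable lborel"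
      using measurable_Lnorm_torus[of "\<lambda>z. \<integral>\<^sup>+t. F z t \<partial>N"] by simp
    fix x
    have "(\<lambda>u. case_prod F ((x, fst u), snd u)) \<in> borel_measurable (torus \<Otimes>\<^sub>M N)"
      by (rule measurable_compose[of "\<lambda>u. ((x, fst u), snd u)" _ "borel \<Otimes>\<^sub>M N" "case_prod F", OF _ assms(2)])
        (intro measurable_Pair borel_measurable_Pair measurable_const measurable_compose[OF measurable_fst];
          measurable)
    then have "(\<lambda>(y, t). F (x, y) t) \<in> borel_measurable (torus \<Otimes>\<^sub>M N)"
      by (simp add: case_prod_beta)
    from Lnorm_Minkowski[OF sigma_finite_torus N this p(2)]
    show "Lnorm (snd p) torus (\<lambda>y. \<integral>\<^sup>+t. F (x, y) t \<partial>N) \<le> (\<integral>\<^sup>+t. Lnorm (snd p) torus (\<lambda>y. F (x, y) t) \<partial>N)" .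
  qed
  also have "\<dots> \<le> (\<integral>\<^sup>+t. mnorm p (\<lambda>z. F z t) \<partial>N)"
    unfolding mnorm_def
    by (intro Lnorm_Minkowski N p lborel.sigma_finite_measure_axioms) measurable
  finally show ?thesis .
qed

lemma mnorm_add_le:
  assumes p: "1 \<le> fst p" "1 \<le> snd p" and [measurable]: "f \<in> borel_measurable borel" "g \<in> borel_measurable borel"
  shows "mnorm p (\<lambda>z. f z + g z) \<le> mnorm p f + mnorm p g"
proof -
  let ?F = "\<lambda>z b. if b then f z else g z"
  have "case_prod ?F \<in> borel_measurable (borel \<Otimes>\<^sub>M count_space UNIV)" by measurable
  from mnorm_Minkowski[OF sigma_finite_count_space this p]
  show ?thesis by (simp add: nn_integral_count_space_finite UNIV_bool add.commute)
qed

lemma mnorm_cmult_le: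
  assumes p: "1 \<le> fst p" "1 \<le> snd p" and [measurable]: "g \<in> borel_measurable borel"
  shows "mnorm p (\<lambda>z. c * g z) \<le> c * mnorm p g"
proof -
  have "mnorm p (\<lambda>z. c * g z) \<le> Lnorm (fst p) lborel (\<lambda>x. c * Lnorm (snd p) torus (\<lambda>y. g (x, y)))"
    unfolding mnorm_def by (intro Lnorm_mono Lnorm_cmult_le p) measurable
  also have "\<dots> \<le> c * mnorm p g"
    unfolding mnorm_def by (rule Lnorm_cmult_le[OF p(1)]) (use measurable_Lnorm_torus[of g] in simp)
  finally show ?thesis .
qed

lemma mnorm_shift:
  assumes [measurable]: "g \<in> borel_measurable borel" and per: "\<And>x y. g (x, y + 2 * pi) = g (x, y)"
  shows "mnorm p (\<lambda>z. g (z + c)) = mnorm p g"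
proof -
  have "mnorm p (\<lambda>z. g (z + c)) = Lnorm (fst p) lborel (\<lambda>x. Lnorm (snd p) torus (\<lambda>y. g (x + fst c, y + snd c)))"
    by (simp add: mnorm_def plus_prod_def)
  also have "\<dots> = Lnorm (fst p) lborel (\<lambda>x. Lnorm (snd p) torus (\<lambda>y. g (fst c + x, y)))"
    by (subst Lnorm_torus_shift) (auto simp: per add.commute)
  also have "\<dots> = Lnorm (fst p) (distr lborel borel ((+) (fst c))) (\<lambda>x. Lnorm (snd p) torus (\<lambda>y. g (x, y)))"
    by (rule Lnorm_distr[symmetric]) (use measurable_Lnorm_torus[of g] in simp_all)
  also have "\<dots> = mnorm p g" by (simp add: lborel_distr_plus mnorm_def)
  finally show ?thesis .
qed

subsection \<open>The weight\<close>

text \<open>The Cauchy weight. It is the decay that two integrations by parts give to the kernels,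
  it has integral \<open>pi\<close>, and a bounded translation changes it only by a bounded
  factor.\<close>

definition cw :: "real \<Rightarrow> real" where
  "cw x = 1 / (1 + x\<^sup>2)"

lemma cw_pos: "0 < cw x"
  by (simp add: cw_def add_pos_nonneg)

lemma cw_le_1: "cw x \<le> 1"
  by (simp add: cw_def add_pos_nonneg)

lemma cw_nonneg [simp]: "0 \<le> cw x"
  using cw_pos[of x] by simp

lemma cw_measurable [measurable]: "cw \<in> borel_measurable borel"
  unfolding cw_def by measurable

lemma nn_integral_cw: "(\<integral>\<^sup>+x. ennreal (cw x) \<partial>lborel) = ennreal pi"
proof -
  have cw: "cw = (\<lambda>x. inverse (1 + x\<^sup>2))" by (auto simp: cw_def field_simps)
  have "set_integrable lborel UNIV cw" "(LINT x:UNIV|lborel. cw x) = pi"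
    using integrable_inverse_1_plus_square LBINT_inverse_1_plus_square
    by (simp_all add: cw interval_lebesgue_integral_def)
  then have "integrable lborel cw" "(LINT x|lborel. cw x) = pi"
    by (simp_all add: set_integrable_def set_lebesgue_integral_def)
  then show ?thesis by (subst nn_integral_eq_integral) auto
qed

text \<open>Peetre's inequality for this weight; it rests on (x + h)^2 \<le> 2 x^2 + 2 h^2.\<close>

lemma cw_shift: "cw x \<le> 2 * (1 + h\<^sup>2) * cw (x + h)"
proof -
  have "1 + (x + h)\<^sup>2 \<le> 2 * (1 + h\<^sup>2) * (1 + x\<^sup>2)"
  proof -
    have "0 \<le> (x - h)\<^sup>2" by simp
    then have "(x + h)\<^sup>2 \<le> 2 * x\<^sup>2 + 2 * h\<^sup>2"
      by (simp add: power2_sum power2_diff)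
    moreover have "2 * (1 + h\<^sup>2) * (1 + x\<^sup>2) = 2 + 2 * x\<^sup>2 + 2 * h\<^sup>2 + 2 * (h * x)\<^sup>2"
      by (simp add: algebra_simps power_mult_distrib)
    moreover have "0 \<le> (h * x)\<^sup>2" by simp
    ultimately show ?thesis by linarith
  qed
  moreover have "0 < 1 + (x + h)\<^sup>2" "0 < 1 + x\<^sup>2" by (auto intro: add_pos_nonneg)
  ultimately show ?thesis by (simp add: cw_def field_simps)
qed

lemma cw_shift_le:
  assumes "\<bar>h\<bar> \<le> M"
  shows "cw (s - h) \<le> 2 * (1 + M\<^sup>2) * cw s"
proof -
  have "h\<^sup>2 \<le> M\<^sup>2" using assms power2_le_iff_abs_le[of M h] by simp
  have "cw (s - h) \<le> 2 * (1 + h\<^sup>2) * cw (s - h + h)" by (rule cw_shift)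
  also have "\<dots> \<le> 2 * (1 + M\<^sup>2) * cw (s - h + h)"
    by (intro mult_right_mono) (use \<open>h\<^sup>2 \<le> M\<^sup>2\<close> in auto)
  finally show ?thesis by simp
qed

text \<open>By Peetre's inequality any two values of the periodised weight on one period are
  comparable with the constant \<open>c\<close>. Averaging over the period, where its integral is
  that of \<open>cw\<close> over the line, bounds each value by \<open>c / 2\<close>.\<close>

lemma sum_cw_period:
  obtains C where "0 < C"
    "\<And>y. y \<in> {-pi..pi} \<Longrightarrow> (\<integral>\<^sup>+k. ennreal (cw (y + 2 * pi * of_int k)) \<partial>count_space (UNIV :: int set)) \<le> ennreal C"
proof -
  define c where "c = 2 * (1 + (2 * pi)\<^sup>2)"
  define S where "S = (\<lambda>y. \<integral>\<^sup>+k. ennreal (cw (y + 2 * pi * of_int k)) \<partial>count_space (UNIV :: int set))"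
  have c: "0 < c" by (simp add: c_def add_pos_nonneg)
  have S[measurable]: "S \<in> borel_measurable borel" unfolding S_def by measurable
  have le: "S y \<le> ennreal c * S z" if "y \<in> {-pi..pi}" "z \<in> {-pi..pi}" for y z
  proof -
    have "S y \<le> (\<integral>\<^sup>+k. ennreal c * ennreal (cw (z + 2 * pi * of_int k)) \<partial>count_space (UNIV :: int set))"
      unfolding S_def
    proof (rule nn_integral_mono)
      fix k :: int
      have "\<bar>z - y\<bar> \<le> 2 * pi" using that by auto
      then have "(z - y)\<^sup>2 \<le> (2 * pi)\<^sup>2" by (rule power2_le_iff_abs_le[THEN iffD2, rotated]) simp
      then have "2 * (1 + (z - y)\<^sup>2) \<le> c" by (simp add: c_def)
      have "cw (y + 2 * pi * of_int k) \<le> 2 * (1 + (z - y)\<^sup>2) * cw (y + 2 * pi * of_int k + (z - y))"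
        by (rule cw_shift)
      also have "\<dots> \<le> c * cw (y + 2 * pi * of_int k + (z - y))"
        by (rule mult_right_mono) (use \<open>2 * (1 + (z - y)\<^sup>2) \<le> c\<close> in auto)
      also have "y + 2 * pi * of_int k + (z - y) = z + 2 * pi * of_int k" by simp
      finally show "ennreal (cw (y + 2 * pi * of_int k)) \<le> ennreal c * ennreal (cw (z + 2 * pi * of_int k))"
        using c by (simp flip: ennreal_mult add: ennreal_leI)
    qed
    also have "\<dots> = ennreal c * S z"
      unfolding S_def by (rule nn_integral_cmult) simp
    finally show ?thesis .
  qed
  have int: "(\<integral>\<^sup>+z. S z \<partial>torus) = ennreal pi"
    using nn_integral_periodic_unfold[of "\<lambda>_. 1" "\<lambda>x. ennreal (cw x)"] nn_integral_cw
    by (simp add: S_def)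
  have "S y \<le> ennreal (c / 2)" if y: "y \<in> {-pi..pi}" for y
  proof -
    have "ennreal (2 * pi) * S y = (\<integral>\<^sup>+z. S y \<partial>torus)"
      by (simp add: space_restrict_space emeasure_restrict_space mult.commute)
    also have "\<dots> \<le> (\<integral>\<^sup>+z. ennreal c * S z \<partial>torus)"
      by (intro nn_integral_mono le y) (simp add: space_restrict_space)
    also have "\<dots> = ennreal c * ennreal pi"
      by (subst nn_integral_cmult) (use int in \<open>auto simp: measurable_restrict_space1\<close>)
    finally have *: "ennreal (2 * pi) * S y \<le> ennreal (c * pi)" using c by (simp add: ennreal_mult)
    then have "S y \<noteq> top" by (auto simp: ennreal_mult_top top_unique)
    then obtain s where s: "S y = ennreal s" "0 \<le> s" by (cases "S y") auto
    with * have "2 * pi * s \<le> c * pi" using c by (simp flip: ennreal_mult)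
    then have "s \<le> c / 2" by (simp add: field_simps)
    then show ?thesis using s by (simp add: ennreal_leI)
  qed
  then show thesis using that[of "c / 2"] c by (auto simp: S_def)
qed

text \<open>The bound is uniform in the translation, because the mixed norm is invariant under translations.\<close>

lemma mnorm_weight_bound:
  assumes p: "1 \<le> fst p" "1 \<le> snd p"
  obtains C where "0 < C"
    "\<And>g c. g \<in> borel_measurable borel \<Longrightarrow> (\<And>x y. g (x, y + 2 * pi) = g (x, y)) \<Longrightarrow>
      (\<integral>\<^sup>+z. ennreal (cw (fst z) * cw (snd z)) * g (z + c) \<partial>lborel) \<le> ennreal C * mnorm p g"
proof -
  obtain C1 where C1: "0 < C1"
    "\<And>y. y \<in> {-pi..pi} \<Longrightarrow> (\<integral>\<^sup>+k. ennreal (cw (y + 2 * pi * of_int k)) \<partial>count_space (UNIV :: int set)) \<le> ennreal C1"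
    by (rule sum_cw_period) blast
  \<comment> \<open>One constant has to dominate both the supremum \<open>C1\<close> and the mass
    \<open>2 * pi * C1\<close> of the periodised weight on the torus.\<close>
  define C2 where "C2 = C1 * (1 + 2 * pi)"
  have C2: "0 < C2" using C1 by (simp add: C2_def add_pos_pos)
  define S where "S = (\<lambda>y. \<integral>\<^sup>+k. ennreal (cw (y + 2 * pi * of_int k)) \<partial>count_space (UNIV :: int set))"
  have S[measurable]: "S \<in> borel_measurable borel" unfolding S_def by measurable
  \<comment> \<open>The factor 4 dominates both the integral \<open>pi\<close> and the supremum 1 of
    \<open>cw\<close> on the line.\<close>
  have *: "(\<integral>\<^sup>+z. ennreal (cw (fst z) * cw (snd z)) * g z \<partial>lborel) \<le> ennreal (C2 * 4) * mnorm p g"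
    if [measurable]: "g \<in> borel_measurable borel" and per: "\<And>x y. g (x, y + 2 * pi) = g (x, y)" for g
  proof -
    have "(\<integral>\<^sup>+z. ennreal (cw (fst z) * cw (snd z)) * g z \<partial>lborel)
       = (\<integral>\<^sup>+z. ennreal (cw (fst z) * cw (snd z)) * g z \<partial>(lborel \<Otimes>\<^sub>M lborel))"
      by (simp add: lborel_prod)
    also have "\<dots> = (\<integral>\<^sup>+x. \<integral>\<^sup>+y. ennreal (cw x) * (g (x, y) * ennreal (cw y)) \<partial>lborel \<partial>lborel)"
    proof (subst lborel.nn_integral_fst[symmetric])
      show "(\<lambda>z. ennreal (cw (fst z) * cw (snd z)) * g z) \<in> borel_measurable (lborel \<Otimes>\<^sub>M lborel)"
        unfolding lborel_prod by simp
    qed (simp add: ennreal_mult mult_ac)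
    also have "\<dots> = (\<integral>\<^sup>+x. ennreal (cw x) * (\<integral>\<^sup>+y. g (x, y) * ennreal (cw y) \<partial>lborel) \<partial>lborel)"
      by (intro nn_integral_cong nn_integral_cmult) measurable
    also have "\<dots> = (\<integral>\<^sup>+x. ennreal (cw x) * (\<integral>\<^sup>+y. S y * g (x, y) \<partial>torus) \<partial>lborel)"
    proof -
      have "(\<integral>\<^sup>+y. g (x, y) * ennreal (cw y) \<partial>lborel) = (\<integral>\<^sup>+y. S y * g (x, y) \<partial>torus)" for x
        using nn_integral_periodic_unfold[of "\<lambda>y. g (x, y)" "\<lambda>y. ennreal (cw y)", OF _ _ per]
        unfolding S_def by (simp add: mult.commute)
      then show ?thesis by simp
    qed
    also have "\<dots> \<le> (\<integral>\<^sup>+x. ennreal (cw x) * (ennreal C2 * Lnorm (snd p) torus (\<lambda>y. g (x, y))) \<partial>lborel)"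
    proof (intro nn_integral_mono mult_left_mono Lnorm_pairing[OF sigma_finite_torus _ _ C2 p(2)])
      have "(\<integral>\<^sup>+y. S y \<partial>torus) \<le> (\<integral>\<^sup>+y. ennreal C1 \<partial>torus)"
        by (intro nn_integral_mono) (use C1 in \<open>auto simp: S_def\<close>)
      also have "\<dots> = ennreal (C1 * (2 * pi))"
        using C1(1) by (simp add: space_restrict_space emeasure_restrict_space ennreal_mult)
      also have "\<dots> \<le> ennreal C2"
        using C1(1) by (intro ennreal_leI) (simp add: C2_def algebra_simps)
      finally show "(\<integral>\<^sup>+y. S y \<partial>torus) \<le> ennreal C2" .
      have "C1 \<le> C2" using C1(1) by (simp add: C2_def algebra_simps)
      then show "S y \<le> ennreal C2" if "y \<in> space torus" for y
        using C1(2)[of y] that order_trans[OF _ ennreal_leI] by (auto simp: S_def)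
    qed (measurable; simp)+
    also have "\<dots> = (\<integral>\<^sup>+x. ennreal C2 * ennreal (cw x) * Lnorm (snd p) torus (\<lambda>y. g (x, y)) \<partial>lborel)"
      by (simp add: mult_ac)
    also have "\<dots> \<le> ennreal (C2 * 4) * Lnorm (fst p) lborel (\<lambda>x. Lnorm (snd p) torus (\<lambda>y. g (x, y)))"
    proof (rule Lnorm_pairing[OF lborel.sigma_finite_measure_axioms _ _ _ p(1)])
      have "(\<integral>\<^sup>+y. ennreal C2 * ennreal (cw y) \<partial>lborel) = ennreal C2 * ennreal pi"
        by (subst nn_integral_cmult) (auto simp: nn_integral_cw)
      also have "\<dots> \<le> ennreal C2 * ennreal 4"
        using pi_less_4 by (intro mult_left_mono ennreal_leI) auto
      finally show "(\<integral>\<^sup>+y. ennreal C2 * ennreal (cw y) \<partial>lborel) \<le> ennreal (C2 * 4)"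
        using C2 by (simp add: ennreal_mult)
      show "ennreal C2 * ennreal (cw y) \<le> ennreal (C2 * 4)" for y
        using cw_le_1[of y] C2 by (simp flip: ennreal_mult add: ennreal_leI)
    qed (use C2 in auto)
    finally show ?thesis by (simp add: mnorm_def)
  qed
  show thesis
  proof (rule that[of "C2 * 4"])
    fix g :: "real \<times> real \<Rightarrow> ennreal" and c
    assume [measurable]: "g \<in> borel_measurable borel" and per: "\<And>x y. g (x, y + 2 * pi) = g (x, y)"
    have "(\<integral>\<^sup>+z. ennreal (cw (fst z) * cw (snd z)) * g (z + c) \<partial>lborel)
       \<le> ennreal (C2 * 4) * mnorm p (\<lambda>z. g (z + c))"
    proof (rule *)
      show "g ((x, y + 2 * pi) + c) = g ((x, y) + c)" for x y
        using per[of "x + fst c" "y + snd c"] by (simp add: plus_prod_def add_ac)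
    qed measurable
    then show "(\<integral>\<^sup>+z. ennreal (cw (fst z) * cw (snd z)) * g (z + c) \<partial>lborel) \<le> ennreal (C2 * 4) * mnorm p g"
      using mnorm_shift[of g p c] per by simp
  qed (use C2 in auto)
qed

subsection \<open>Smooth functions of one variable with compact support\<close>

text \<open>Existence of n successive derivatives, with the derivative quantified away: the product
  and affine rules become plain inductions without a notation for higher derivatives.\<close>

primrec times_diff :: "nat \<Rightarrow> (real \<Rightarrow> complex) \<Rightarrow> bool" where
  "times_diff 0 f \<longleftrightarrow> True"
| "times_diff (Suc n) f \<longleftrightarrow> (\<exists>f'. (\<forall>x. (f has_vector_derivative f' x) (at x)) \<and> times_diff n f')"

definition test_fun :: "(real \<Rightarrow> complex) \<Rightarrow> bool" where
  "test_fun f \<longleftrightarrow> (\<forall>n. times_diff n f) \<and> (\<exists>R>0. \<forall>x. R < \<bar>x\<bar> \<longrightarrow> f x = 0)"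

lemma times_diff_SucI:
  "(\<And>x. (f has_vector_derivative f' x) (at x)) \<Longrightarrow> times_diff n f' \<Longrightarrow> times_diff (Suc n) f"
  by auto

lemma times_diff_SucE:
  assumes "times_diff (Suc n) f"
  obtains f' where "\<And>x. (f has_vector_derivative f' x) (at x)" "times_diff n f'"
  using assms by auto

lemma times_diff_Suc: "times_diff (Suc n) f \<Longrightarrow> times_diff n f"
  by (induction n arbitrary: f) auto

lemma times_diff_add: "times_diff n f \<Longrightarrow> times_diff n g \<Longrightarrow> times_diff n (\<lambda>x. f x + g x)"
proof (induction n arbitrary: f g)
  case (Suc n)
  obtain f' where f': "\<And>x. (f has_vector_derivative f' x) (at x)" "times_diff n f'"
    using Suc.prems(1) by (rule times_diff_SucE) blast
  obtain g' where g': "\<And>x. (g has_vector_derivative g' x) (at x)" "times_diff n g'"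
    using Suc.prems(2) by (rule times_diff_SucE) blast
  show ?case
    by (intro times_diff_SucI[of _ "\<lambda>x. f' x + g' x"] has_vector_derivative_add Suc.IH f' g')
qed simp

lemma times_diff_mult: "times_diff n f \<Longrightarrow> times_diff n g \<Longrightarrow> times_diff n (\<lambda>x. f x * g x)"
proof (induction n arbitrary: f g)
  case (Suc n)
  obtain f' where d: "\<And>x. (f has_vector_derivative f' x) (at x)" "times_diff n f'"
    using Suc.prems(1) by (rule times_diff_SucE) blast
  obtain g' where d': "\<And>x. (g has_vector_derivative g' x) (at x)" "times_diff n g'"
    using Suc.prems(2) by (rule times_diff_SucE) blast
  have "times_diff n (\<lambda>x. f x * g' x + f' x * g x)"
    by (intro times_diff_add Suc.IH d(2) d'(2) times_diff_Suc[OF Suc.prems(1)] times_diff_Suc[OF Suc.prems(2)])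
  moreover have "((\<lambda>x. f x * g x) has_vector_derivative f x * g' x + f' x * g x) (at x)" for x
    by (rule has_vector_derivative_mult[OF d(1) d'(1)])
  ultimately show ?case by (intro times_diff_SucI)
qed simp

lemma times_diff_affine: "times_diff n f \<Longrightarrow> times_diff n (\<lambda>x. f (c * x + d))"
proof (induction n arbitrary: f)
  case (Suc n)
  obtain f' where d: "\<And>x. (f has_vector_derivative f' x) (at x)" "times_diff n f'"
    using Suc.prems by (rule times_diff_SucE) blast
  have "times_diff m (\<lambda>x. a)" for m and a :: complex
    by (induction m arbitrary: a) (simp, rule times_diff_SucI[of _ "\<lambda>_. 0"], auto)
  then have "times_diff n (\<lambda>x. of_real c * f' (c * x + d))"
    by (rule times_diff_mult) (rule Suc.IH[OF d(2)])
  moreover have "((\<lambda>x. f (c * x + d)) has_vector_derivative of_real c * f' (c * x + d)) (at x)" for x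
  proof -
    have "((\<lambda>x. c * x + d) has_vector_derivative c) (at x)"
      by (auto intro!: derivative_eq_intros simp flip: has_real_derivative_iff_has_vector_derivative)
    from vector_diff_chain_at[OF this d(1)]
    show ?thesis by (simp add: o_def scaleR_conv_of_real)
  qed
  ultimately show ?case by (intro times_diff_SucI)
qed simp

text \<open>The recursion may choose a different derivative for every n; uniqueness of derivatives
  merges these choices into one function.\<close>

lemma times_diff_deriv:
  assumes "\<And>n. times_diff n f"
  obtains f' where "\<And>x. (f has_vector_derivative f' x) (at x)" "\<And>n. times_diff n f'"
proof -
  obtain f' where f': "\<And>x. (f has_vector_derivative f' x) (at x)" using assms[of "Suc 0"] by (rule times_diff_SucE) blast
  have "times_diff n f'" for n
  proof -
    obtain g where g: "\<And>x. (f has_vector_derivative g x) (at x)" "times_diff n g"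
      using assms[of "Suc n"] by (rule times_diff_SucE) blast
    have "g = f'" by (rule ext) (rule vector_derivative_unique_at[OF g(1) f'])
    with g show ?thesis by simp
  qed
  show thesis by (rule that) (fact f', fact)
qed

lemma test_fun_deriv:
  assumes "test_fun f"
  obtains f' where "\<And>x. (f has_vector_derivative f' x) (at x)" "test_fun f'"
proof -
  obtain f' where f': "\<And>x. (f has_vector_derivative f' x) (at x)" "\<And>n. times_diff n f'"
    using times_diff_deriv[of f] assms unfolding test_fun_def by metis
  obtain R where R: "0 < R" "\<And>x. R < \<bar>x\<bar> \<Longrightarrow> f x = 0" using assms by (auto simp: test_fun_def)
  have "f' x = 0" if x: "R < \<bar>x\<bar>" for x
  proof -
    have "open {y. R < \<bar>y :: real\<bar>}" by (intro open_Collect_less continuous_intros)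
    moreover have "x \<in> {y. R < \<bar>y\<bar>}" using x by simp
    moreover have "0 = f y" if "y \<in> {y. R < \<bar>y\<bar>}" for y using R(2)[of y] that by simp
    ultimately have "(f has_vector_derivative 0) (at x)"
      by (rule has_vector_derivative_transform_within_open[of "\<lambda>_. 0", OF has_vector_derivative_const])
    with f'(1)[of x] show ?thesis by (rule vector_derivative_unique_at)
  qed
  with f'(2) R(1) have "test_fun f'" unfolding test_fun_def by blast
  then show thesis using that f'(1) by blast
qed

lemma test_fun_continuous: "test_fun f \<Longrightarrow> continuous_on UNIV f"
proof -
  assume "test_fun f"
  then obtain f' where "\<And>x. (f has_vector_derivative f' x) (at x)" by (rule test_fun_deriv) blast
  then show ?thesis
    by (auto intro!: continuous_at_imp_continuous_on has_vector_derivative_continuous)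
qed

lemma test_fun_measurable [measurable_dest]: "test_fun f \<Longrightarrow> f \<in> borel_measurable borel"
  by (intro borel_measurable_continuous_onI test_fun_continuous)

lemma test_fun_support:
  assumes "test_fun f"
  obtains R where "0 < R" "\<And>x. R < \<bar>x\<bar> \<Longrightarrow> f x = 0"
  using assms by (auto simp: test_fun_def)

lemma test_fun_bounded:
  assumes "test_fun f"
  obtains B where "0 < B" "\<And>x. cmod (f x) \<le> B"
proof -
  obtain R where R: "0 < R" "\<And>x. R < \<bar>x\<bar> \<Longrightarrow> f x = 0" using assms by (rule test_fun_support) blast
  have "compact (f ` {-R..R})"
    by (intro compact_continuous_image continuous_on_subset[OF test_fun_continuous[OF assms]]) auto
  then obtain B where B: "0 < B" "\<And>y. y \<in> f ` {-R..R} \<Longrightarrow> cmod y \<le> B"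
    using compact_imp_bounded[of "f ` {-R..R}"] bounded_pos[of "f ` {-R..R}"] by metis
  have "cmod (f x) \<le> B" for x
  proof (cases "R < \<bar>x\<bar>")
    case False
    then show ?thesis by (intro B imageI) auto
  qed (use R B in auto)
  with B that show thesis by blast
qed

lemma integrable_compact_support:
  fixes f :: "real \<Rightarrow> complex"
  assumes "continuous_on UNIV f" "\<And>x. R < \<bar>x\<bar> \<Longrightarrow> f x = 0"
  shows "integrable lborel f"
proof -
  have "set_integrable lborel {-R..R} f"
    by (intro borel_integrable_atLeastAtMost' continuous_on_subset[OF assms(1)]) auto
  moreover have "indicator {-R..R} x *\<^sub>R f x = f x" for x
    using assms(2)[of x] by (auto split: split_indicator)
  ultimately show ?thesis by (simp add: set_integrable_def)
qed

lemma test_fun_integrable: "test_fun f \<Longrightarrow> integrable lborel f"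
  by (metis integrable_compact_support test_fun_continuous test_fun_support)

lemma test_fun_mult: "test_fun f \<Longrightarrow> test_fun g \<Longrightarrow> test_fun (\<lambda>x. f x * g x)"
  unfolding test_fun_def by (auto intro: times_diff_mult)

lemma test_fun_affine:
  assumes "test_fun f" "c \<noteq> 0"
  shows "test_fun (\<lambda>x. f (c * x + d))"
proof -
  obtain R where R: "0 < R" "\<And>x. R < \<bar>x\<bar> \<Longrightarrow> f x = 0" using assms(1) by (rule test_fun_support) blast
  have "f (c * x + d) = 0" if "(R + \<bar>d\<bar>) / \<bar>c\<bar> < \<bar>x\<bar>" for x
  proof (rule R(2))
    have "R + \<bar>d\<bar> < \<bar>c * x\<bar>" using that assms(2) by (simp add: field_simps abs_mult)
    then show "R < \<bar>c * x + d\<bar>" by linarith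
  qed
  moreover have "0 < (R + \<bar>d\<bar>) / \<bar>c\<bar>" using R assms(2) by (simp add: add_pos_nonneg)
  ultimately show ?thesis
    using assms(1) unfolding test_fun_def by (auto intro!: times_diff_affine)
qed

lemma test_fun_scale: "test_fun f \<Longrightarrow> c \<noteq> 0 \<Longrightarrow> test_fun (\<lambda>x. f (c * x))"
  using test_fun_affine[of f c 0] by simp

text \<open>On the line the only basis vector is 1, so iterated directional derivatives along lists
  of basis vectors are the ordinary higher derivatives.\<close>

lemma smooth_fun_test_fun:
  fixes f :: "real \<Rightarrow> real"
  assumes "smooth_fun f" and R: "0 < R" "\<And>x. R < \<bar>x\<bar> \<Longrightarrow> f x = 0"
  shows "test_fun (\<lambda>x. of_real (f x))"
proof -
  define g where "g = (\<lambda>k. iter_deriv (replicate k (1 :: real)) f)"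
  have d: "(g k has_vector_derivative g (Suc k) x) (at x)" for k x
  proof -
    have "replicate k (1 :: real) \<in> lists Basis" by (auto simp: in_lists_conv_set)
    then have "g k differentiable (at x)"
      using assms(1) unfolding smooth_fun_def g_def differentiable_on_def by blast
    then have "(g k has_derivative frechet_derivative (g k) (at x)) (at x)"
      by (simp flip: frechet_derivative_works)
    moreover have "frechet_derivative (g k) (at x) = (\<lambda>h. h *\<^sub>R frechet_derivative (g k) (at x) 1)"
    proof
      fix h
      show "frechet_derivative (g k) (at x) h = h *\<^sub>R frechet_derivative (g k) (at x) 1"
        using linear_scale[OF has_derivative_linear[OF calculation], of h 1] by simp
    qed
    moreover have "frechet_derivative (g k) (at x) 1 = g (Suc k) x"
      by (simp add: g_def iter_deriv_def dir_deriv_def)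
    ultimately show ?thesis by (simp add: has_vector_derivative_def)
  qed
  have "times_diff n (\<lambda>x. of_real (g k x))" for n k
  proof (induction n arbitrary: k)
    case (Suc n)
    have "((\<lambda>x. complex_of_real (g k x)) has_vector_derivative of_real (g (Suc k) x)) (at x)" for x
      by (rule bounded_linear.has_vector_derivative[OF bounded_linear_of_real d])
    then show ?case by (rule times_diff_SucI) (rule Suc)
  qed simp
  from this[of _ 0] R show ?thesis by (auto simp: test_fun_def g_def iter_deriv_def)
qed

subsection \<open>Inverse Fourier transforms of test functions\<close>

text \<open>The inverse Fourier transform of \<open>m\<close>, reflected at the origin. The sign
  fits \<open>conv2\<close>, which integrates the kernel at \<open>w\<close> against
  \<open>f (z + w)\<close>, so that no reflection appears in the formula for the blocks.\<close>

definition kern :: "(real \<Rightarrow> complex) \<Rightarrow> real \<Rightarrow> complex" where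
  "kern m x = (LINT \<xi>|lborel. cis (- (x * \<xi>)) * m \<xi>) / of_real (2 * pi)"

lemma cis_measurable [measurable]: "cis \<in> borel_measurable borel"
  by (intro borel_measurable_continuous_onI continuous_intros)

lemma integrable_cis_mult:
  "integrable M m \<Longrightarrow> g \<in> borel_measurable M \<Longrightarrow> integrable M (\<lambda>\<xi>. cis (g \<xi>) * m \<xi>)"
  by (rule Bochner_Integration.integrable_bound[of M m]) (auto simp: norm_mult)

lemma has_vector_derivative_cis [derivative_intros]:
  "((\<lambda>x. cis (a * x)) has_vector_derivative (\<i> * of_real a * cis (a * x))) (at x)"
proof -
  have "((\<lambda>z. exp (\<i> * of_real a * z)) has_field_derivative \<i> * of_real a * exp (\<i> * of_real a * of_real x)) (at (of_real x))"
    by (auto intro!: derivative_eq_intros)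
  from has_vector_derivative_real_field[OF this] show ?thesis
    by (simp add: cis_conv_exp mult_ac)
qed

lemma integral_deriv_zero:
  fixes g :: "real \<Rightarrow> complex"
  assumes d: "\<And>x. (g has_vector_derivative g' x) (at x)" and "continuous_on UNIV g'"
    and R: "0 < R" "\<And>x. R < \<bar>x\<bar> \<Longrightarrow> g x = 0" "\<And>x. R < \<bar>x\<bar> \<Longrightarrow> g' x = 0"
  shows "(LINT x|lborel. g' x) = 0"
proof -
  have "(LINT x|lborel. g' x) = (LINT x|lborel. indicator {-(R+1)..R+1} x *\<^sub>R g' x)"
  proof (intro Bochner_Integration.integral_cong refl)
    fix x show "g' x = indicator {-(R+1)..R+1} x *\<^sub>R g' x"
      using R(3)[of x] by (auto split: split_indicator)
  qed
  also have "\<dots> = g (R + 1) - g (-(R+1))"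
    by (rule integral_FTC_atLeastAtMost)
      (use R in \<open>auto intro!: has_vector_derivative_at_within[OF d] continuous_on_subset[OF assms(2)]\<close>)
  also have "\<dots> = 0" using R(1) by (simp add: R(2))
  finally show ?thesis .
qed

text \<open>The derivative of the compactly supported function
  \<open>cis (- (x * \<xi>)) * m \<xi>\<close> has integral zero.\<close>

lemma kern_by_parts:
  assumes "\<And>x. (m has_vector_derivative m1 x) (at x)"
    and "continuous_on UNIV m1" and R: "0 < R" "\<And>x. R < \<bar>x\<bar> \<Longrightarrow> m x = 0" "\<And>x. R < \<bar>x\<bar> \<Longrightarrow> m1 x = 0"
  shows "(LINT \<xi>|lborel. cis (- (x * \<xi>)) * m1 \<xi>) = \<i> * of_real x * (LINT \<xi>|lborel. cis (- (x * \<xi>)) * m \<xi>)"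
proof -
  have cm: "continuous_on UNIV m"
    using assms(1) by (auto intro!: continuous_at_imp_continuous_on has_vector_derivative_continuous)
  have i: "integrable lborel m" "integrable lborel m1"
    using integrable_compact_support cm assms(2) R by blast+
  note i' = integrable_cis_mult[OF i(1), of "\<lambda>\<xi>. - (x * \<xi>)"] integrable_cis_mult[OF i(2), of "\<lambda>\<xi>. - (x * \<xi>)"]
  have "(LINT \<xi>|lborel. cis (- (x * \<xi>)) * m1 \<xi> + (- \<i> * of_real x) * (cis (- (x * \<xi>)) * m \<xi>)) = 0"
  proof (rule integral_deriv_zero[of "\<lambda>\<xi>. cis (- (x * \<xi>)) * m \<xi>"])
    fix \<xi>
    show "((\<lambda>\<xi>. cis (- (x * \<xi>)) * m \<xi>) has_vector_derivative
        cis (- (x * \<xi>)) * m1 \<xi> + (- \<i> * of_real x) * (cis (- (x * \<xi>)) * m \<xi>)) (at \<xi>)"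
      using has_vector_derivative_mult[OF has_vector_derivative_cis[of "-x" \<xi>] assms(1)[of \<xi>]]
      by (simp add: mult_ac)
  qed (use R cm assms(2) in \<open>auto intro!: continuous_intros\<close>)
  then have "(LINT \<xi>|lborel. cis (- (x * \<xi>)) * m1 \<xi>) + (- \<i> * of_real x) * (LINT \<xi>|lborel. cis (- (x * \<xi>)) * m \<xi>) = 0"
    using i' by (simp add: mult.assoc)
  then show ?thesis by (simp add: mult.assoc add_eq_0_iff2)
qed

text \<open>Two integrations by parts produce the factor -x^2, so 1 + x^2 times the integral is the
  integral of m - m2 against a character; this is at most 2 B on an interval of length 2 R. The
  constant is explicit because it is needed for a family of symbols depending on a step
  \<open>h\<close>.\<close>

lemma kern_decay_bound:
  assumes d: "\<And>x. (m has_vector_derivative m1 x) (at x)" "\<And>x. (m1 has_vector_derivative m2 x) (at x)"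
    and c: "continuous_on UNIV m2" and R: "0 < R"
    "\<And>x. R < \<bar>x\<bar> \<Longrightarrow> m x = 0" "\<And>x. R < \<bar>x\<bar> \<Longrightarrow> m1 x = 0" "\<And>x. R < \<bar>x\<bar> \<Longrightarrow> m2 x = 0"
    and B: "\<And>x. cmod (m x) \<le> B" "\<And>x. cmod (m2 x) \<le> B"
  shows "cmod (kern m x) \<le> 4 * R * B * cw x"
proof -
  have c1: "continuous_on UNIV m1" "continuous_on UNIV m"
    using d by (auto intro!: continuous_at_imp_continuous_on has_vector_derivative_continuous)
  have i: "integrable lborel m" "integrable lborel m2"
    using integrable_compact_support c1 c R by blast+
  note i' = integrable_cis_mult[OF i(1), of "\<lambda>\<xi>. - (x * \<xi>)"] integrable_cis_mult[OF i(2), of "\<lambda>\<xi>. - (x * \<xi>)"]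
  define I where "I = (LINT \<xi>|lborel. cis (- (x * \<xi>)) * m \<xi>)"
  have "(LINT \<xi>|lborel. cis (- (x * \<xi>)) * m2 \<xi>) = \<i> * of_real x * (\<i> * of_real x * I)"
    unfolding I_def
    by (subst kern_by_parts[OF d(2) c R(1,3,4)], assumption+, subst kern_by_parts[OF d(1) c1(1) R(1,2,3)], assumption+, rule refl)
  then have "(1 + of_real (x\<^sup>2)) * I = (LINT \<xi>|lborel. cis (- (x * \<xi>)) * m \<xi> - cis (- (x * \<xi>)) * m2 \<xi>)"
    using i' by (simp add: I_def algebra_simps power2_eq_square)
  also have "cmod \<dots> \<le> (LINT \<xi>|lborel. indicator {-R..R} \<xi> * (2 * B))"
  proof (rule order_trans[OF integral_norm_bound Bochner_Integration.integral_mono])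
    fix \<xi> :: real
    show "cmod (cis (- (x * \<xi>)) * m \<xi> - cis (- (x * \<xi>)) * m2 \<xi>) \<le> indicator {-R..R} \<xi> * (2 * B)"
    proof (cases "R < \<bar>\<xi>\<bar>")
      case True
      then show ?thesis using R B(1)[of \<xi>] by (auto split: split_indicator)
    next
      case False
      have "cmod (cis (- (x * \<xi>)) * m \<xi> - cis (- (x * \<xi>)) * m2 \<xi>) \<le> cmod (m \<xi>) + cmod (m2 \<xi>)"
        by (rule order_trans[OF norm_triangle_ineq4]) (simp add: norm_mult)
      also have "\<dots> \<le> 2 * B" using B[of \<xi>] by simp
      finally show ?thesis using False by (auto split: split_indicator)
    qed
  qed (use i' in \<open>auto simp: emeasure_lborel_Icc_eq intro!: Bochner_Integration.integrable_diff integrable_real_indicator\<close>)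
  also have "\<dots> = 4 * R * B" using R by simp
  finally have "cmod ((1 + of_real (x\<^sup>2)) * I) \<le> 4 * R * B" .
  moreover have "cmod (1 + of_real (x\<^sup>2)) = 1 + x\<^sup>2"
    by (metis (no_types) abs_of_nonneg add_nonneg_nonneg norm_of_real of_real_1 of_real_add zero_le_one zero_le_power2)
  moreover have "0 < 1 + x\<^sup>2" by (simp add: add_pos_nonneg)
  ultimately have "(1 + x\<^sup>2) * cmod I \<le> 4 * R * B" "0 < 1 + x\<^sup>2"
    by (simp_all only: norm_mult)
  then have "cmod I \<le> 4 * R * B * cw x"
    by (simp add: cw_def field_simps)
  moreover have "cmod (kern m x) \<le> cmod I"
  proof -
    have "kern m x = I / of_real (2 * pi)" by (simp only: kern_def I_def)
    then have "cmod (kern m x) = cmod I / (2 * pi)" by (simp add: norm_divide norm_mult)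
    also have "\<dots> \<le> cmod I"
      using pi_gt3 mult_left_mono[of 1 "2 * pi" "cmod I"] by (simp add: field_simps)
    finally show ?thesis .
  qed
  ultimately show ?thesis by simp
qed

lemma kern_decay:
  assumes m: "test_fun m"
  obtains K where "0 < K" "\<And>x. cmod (kern m x) \<le> K * cw x"
proof -
  obtain m1 where m1: "\<And>x. (m has_vector_derivative m1 x) (at x)" "test_fun m1" using m by (rule test_fun_deriv) blast
  obtain m2 where m2: "\<And>x. (m1 has_vector_derivative m2 x) (at x)" "test_fun m2" using m1(2) by (rule test_fun_deriv) blast
  obtain R0 where R0: "0 < R0" "\<And>x. R0 < \<bar>x\<bar> \<Longrightarrow> m x = 0" using m by (rule test_fun_support) blast
  obtain R1 where R1: "0 < R1" "\<And>x. R1 < \<bar>x\<bar> \<Longrightarrow> m1 x = 0" using m1(2) by (rule test_fun_support) blast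
  obtain R2 where R2: "0 < R2" "\<And>x. R2 < \<bar>x\<bar> \<Longrightarrow> m2 x = 0" using m2(2) by (rule test_fun_support) blast
  obtain B0 where B0: "0 < B0" "\<And>x. cmod (m x) \<le> B0" using m by (rule test_fun_bounded) blast
  obtain B2 where B2: "0 < B2" "\<And>x. cmod (m2 x) \<le> B2" using m2(2) by (rule test_fun_bounded) blast
  have "cmod (kern m x) \<le> 4 * (R0 + R1 + R2) * (B0 + B2) * cw x" for x
    by (rule kern_decay_bound[OF m1(1) m2(1) test_fun_continuous[OF m2(2)]])
      (use R0 R1 R2 B0 B2 in \<open>auto simp: add_increasing2 add_increasing\<close>)
  then show thesis using R0 R1 R2 B0 B2 that[of "4 * (R0 + R1 + R2) * (B0 + B2)"] by simp
qed

lemma kern_continuous: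
  assumes "integrable lborel m"
  shows "continuous_on UNIV (kern m)"
proof -
  have "isCont (\<lambda>x. LINT \<xi>|lborel. cis (- (x * \<xi>)) * m \<xi>) x" for x
    unfolding continuous_at_sequentially o_def
  proof (intro allI impI)
    fix u :: "nat \<Rightarrow> real" assume u: "u \<longlonglongrightarrow> x"
    show "(\<lambda>n. LINT \<xi>|lborel. cis (- (u n * \<xi>)) * m \<xi>) \<longlonglongrightarrow> (LINT \<xi>|lborel. cis (- (x * \<xi>)) * m \<xi>)"
    proof (rule integral_dominated_convergence[where w="\<lambda>\<xi>. cmod (m \<xi>)"])
      show "AE \<xi> in lborel. (\<lambda>n. cis (- (u n * \<xi>)) * m \<xi>) \<longlonglongrightarrow> cis (- (x * \<xi>)) * m \<xi>"
        by (intro AE_I2 tendsto_intros tendsto_cis u)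
    qed (use assms in \<open>auto simp: norm_mult\<close>)
  qed
  then show ?thesis
    unfolding kern_def by (intro continuous_at_imp_continuous_on ballI continuous_intros) auto
qed

lemma kern_measurable [measurable]: "test_fun m \<Longrightarrow> kern m \<in> borel_measurable borel"
  by (intro borel_measurable_continuous_onI kern_continuous test_fun_integrable)

lemma integrable_cw: "integrable lborel cw"
  by (rule integrableI_bounded) (auto simp: nn_integral_cw)

lemma kern_integrable:
  assumes "test_fun m"
  shows "integrable lborel (kern m)"
proof -
  obtain K where K: "0 < K" "\<And>x. cmod (kern m x) \<le> K * cw x" using assms by (rule kern_decay) blast
  show ?thesis
    by (rule Bochner_Integration.integrable_bound[of _ "\<lambda>x. K * cw x"])
      (use K integrable_cw assms in \<open>auto simp: abs_mult\<close>)
qed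

lemma kern_scale:
  assumes "c > 0"
  shows "kern (\<lambda>\<xi>. m (\<xi> / c)) x = of_real c * kern m (c * x)"
proof -
  have "(LINT \<xi>|lborel. cis (- (x * \<xi>)) * m (\<xi> / c)) = \<bar>c\<bar> *\<^sub>R (LINT \<xi>|lborel. cis (- (x * (0 + c * \<xi>))) * m ((0 + c * \<xi>) / c))"
    using assms by (intro lborel_integral_real_affine) auto
  then show ?thesis using assms by (simp add: kern_def scaleR_conv_of_real mult_ac)
qed

lemma norm_cis_minus_1: "cmod (cis a - 1) \<le> \<bar>a\<bar>"
  using iexp_approx1[of a 0] by (simp add: cis_conv_exp)

text \<open>A translation of the kernel multiplies its symbol by a character, so the decay estimate
  applied to the symbol \<open>(cis (h \<xi>) - 1) * m \<xi>\<close> bounds the modulus of continuity.\<close>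

lemma kern_shift_decay:
  assumes m: "test_fun m"
  obtains K where "0 < K" "\<And>h x. \<bar>h\<bar> \<le> 1 \<Longrightarrow> cmod (kern m (x - h) - kern m x) \<le> K * \<bar>h\<bar> * cw x"
proof -
  obtain m1 where m1: "\<And>x. (m has_vector_derivative m1 x) (at x)" "test_fun m1" using m by (rule test_fun_deriv) blast
  obtain m2 where m2: "\<And>x. (m1 has_vector_derivative m2 x) (at x)" "test_fun m2" using m1(2) by (rule test_fun_deriv) blast
  obtain R0 where R0: "0 < R0" "\<And>x. R0 < \<bar>x\<bar> \<Longrightarrow> m x = 0" using m by (rule test_fun_support) blast
  obtain R1 where R1: "0 < R1" "\<And>x. R1 < \<bar>x\<bar> \<Longrightarrow> m1 x = 0" using m1(2) by (rule test_fun_support) blast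
  obtain R2 where R2: "0 < R2" "\<And>x. R2 < \<bar>x\<bar> \<Longrightarrow> m2 x = 0" using m2(2) by (rule test_fun_support) blast
  obtain B0 where B0: "0 < B0" "\<And>x. cmod (m x) \<le> B0" using m by (rule test_fun_bounded) blast
  obtain B1 where B1: "0 < B1" "\<And>x. cmod (m1 x) \<le> B1" using m1(2) by (rule test_fun_bounded) blast
  obtain B2 where B2: "0 < B2" "\<And>x. cmod (m2 x) \<le> B2" using m2(2) by (rule test_fun_bounded) blast
  define R where "R = R0 + R1 + R2"
  define B where "B = B0 + B1 + B2"
  have R: "0 < R" "\<And>x. R < \<bar>x\<bar> \<Longrightarrow> m x = 0" "\<And>x. R < \<bar>x\<bar> \<Longrightarrow> m1 x = 0" "\<And>x. R < \<bar>x\<bar> \<Longrightarrow> m2 x = 0"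
    using R0 R1 R2 by (auto simp: R_def)
  have B: "0 < B" "\<And>x. cmod (m x) \<le> B" "\<And>x. cmod (m1 x) \<le> B" "\<And>x. cmod (m2 x) \<le> B"
    using B0 B1 B2 by (auto simp: B_def add_increasing add_increasing2)
  have "cmod (kern m (x - h) - kern m x) \<le> 4 * R * ((3 + R) * B) * \<bar>h\<bar> * cw x" if h: "\<bar>h\<bar> \<le> 1" for h x
  proof -
    define c where "c = (\<lambda>\<xi>. cis (h * \<xi>) - 1)"
    have dc: "(c has_vector_derivative \<i> * of_real h * cis (h * \<xi>)) (at \<xi>)" for \<xi>
      unfolding c_def by (auto intro!: derivative_eq_intros)
    have dc2: "((\<lambda>\<xi>. \<i> * of_real h * cis (h * \<xi>)) has_vector_derivative - of_real (h\<^sup>2) * cis (h * \<xi>)) (at \<xi>)" for \<xi>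
      by (rule has_vector_derivative_eq_rhs[OF has_vector_derivative_mult_right[OF has_vector_derivative_cis]])
        (simp add: power2_eq_square mult_ac)
    have cb: "cmod (c \<xi>) \<le> \<bar>h\<bar> * R" if "\<not> R < \<bar>\<xi>\<bar>" for \<xi>
    proof -
      have "cmod (c \<xi>) \<le> \<bar>h\<bar> * \<bar>\<xi>\<bar>" using norm_cis_minus_1[of "h * \<xi>"] by (simp add: c_def abs_mult)
      also have "\<dots> \<le> \<bar>h\<bar> * R" using that by (intro mult_left_mono) auto
      finally show ?thesis .
    qed
    have "kern m (x - h) - kern m x = kern (\<lambda>\<xi>. c \<xi> * m \<xi>) x"
    proof -
      note i = integrable_cis_mult[OF test_fun_integrable[OF m]]
      have "(LINT \<xi>|lborel. cis (- ((x - h) * \<xi>)) * m \<xi>) - (LINT \<xi>|lborel. cis (- (x * \<xi>)) * m \<xi>)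
         = (LINT \<xi>|lborel. cis (- ((x - h) * \<xi>)) * m \<xi> - cis (- (x * \<xi>)) * m \<xi>)"
        by (rule Bochner_Integration.integral_diff[symmetric]; rule i) measurable
      also have "\<dots> = (LINT \<xi>|lborel. cis (- (x * \<xi>)) * (c \<xi> * m \<xi>))"
      proof (intro Bochner_Integration.integral_cong refl)
        fix \<xi>
        have "cis (- ((x - h) * \<xi>)) = cis (- (x * \<xi>)) * cis (h * \<xi>)"
          by (simp add: cis_mult algebra_simps)
        then show "cis (- ((x - h) * \<xi>)) * m \<xi> - cis (- (x * \<xi>)) * m \<xi> = cis (- (x * \<xi>)) * (c \<xi> * m \<xi>)"
          by (simp add: c_def algebra_simps)
      qed
      finally show ?thesis by (simp add: kern_def flip: diff_divide_distrib)
    qed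
    \<comment> \<open>In (3 + R) B |h|, the bound for the second derivative of \<open>c * m\<close>,
      the R comes from \<open>c * m2\<close> and one unit each from the two mixed terms and from the
      term with h^2.\<close>
    also have "cmod \<dots> \<le> 4 * R * ((3 + R) * B * \<bar>h\<bar>) * cw x"
    proof (rule kern_decay_bound)
      let ?n1 = "\<lambda>\<xi>. c \<xi> * m1 \<xi> + \<i> * of_real h * cis (h * \<xi>) * m \<xi>"
      let ?n2 = "\<lambda>\<xi>. (c \<xi> * m2 \<xi> + \<i> * of_real h * cis (h * \<xi>) * m1 \<xi>)
        + (\<i> * of_real h * cis (h * \<xi>) * m1 \<xi> + - of_real (h\<^sup>2) * cis (h * \<xi>) * m \<xi>)"
      show "((\<lambda>\<xi>. c \<xi> * m \<xi>) has_vector_derivative ?n1 \<xi>) (at \<xi>)" for \<xi>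
        by (rule has_vector_derivative_mult[OF dc m1(1)])
      show "(?n1 has_vector_derivative ?n2 \<xi>) (at \<xi>)" for \<xi>
        by (intro has_vector_derivative_add has_vector_derivative_mult dc dc2 m1 m2)
      show "continuous_on UNIV ?n2"
        using test_fun_continuous m m1(2) m2(2) unfolding c_def by (auto intro!: continuous_intros)
      \<comment> \<open>The restriction |h| \<le> 1 enters here: it makes the quadratic term linear
        in \<open>h\<close>.\<close>
      have h2: "\<bar>h\<bar>\<^sup>2 \<le> \<bar>h\<bar>" unfolding power2_eq_square by (rule mult_left_le[OF h]) simp
      have le: "\<bar>h\<bar> * R * B + \<bar>h\<bar> * B + \<bar>h\<bar> * B + \<bar>h\<bar> * B = (3 + R) * B * \<bar>h\<bar>"
        by (simp add: algebra_simps)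
      show "cmod (c \<xi> * m \<xi>) \<le> (3 + R) * B * \<bar>h\<bar>" for \<xi>
      proof (cases "R < \<bar>\<xi>\<bar>")
        case True
        then show ?thesis using R B by simp
      next
        case False
        have "cmod (c \<xi> * m \<xi>) \<le> \<bar>h\<bar> * R * B"
          unfolding norm_mult by (intro mult_mono cb[OF False] B) (use R in auto)
        also have "\<dots> \<le> (3 + R) * B * \<bar>h\<bar>" unfolding le[symmetric] using B by simp
        finally show ?thesis .
      qed
      show "cmod (?n2 \<xi>) \<le> (3 + R) * B * \<bar>h\<bar>" for \<xi>
      proof (cases "R < \<bar>\<xi>\<bar>")
        case True
        then show ?thesis using R B by simp
      next
        case False
        have 1: "cmod (c \<xi> * m2 \<xi>) \<le> \<bar>h\<bar> * R * B"
          unfolding norm_mult by (intro mult_mono cb[OF False] B) (use R in auto)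
        have 2: "cmod (\<i> * of_real h * cis (h * \<xi>) * m1 \<xi>) \<le> \<bar>h\<bar> * B"
          using B(3) by (simp add: norm_mult mult_left_mono)
        have "cmod (- of_real (h\<^sup>2) * cis (h * \<xi>) * m \<xi>) = \<bar>h\<bar>\<^sup>2 * cmod (m \<xi>)"
          by (simp add: norm_mult norm_power)
        also have "\<dots> \<le> \<bar>h\<bar> * B" by (intro mult_mono h2 B) auto
        finally have 3: "cmod (- of_real (h\<^sup>2) * cis (h * \<xi>) * m \<xi>) \<le> \<bar>h\<bar> * B" .
        have "cmod (?n2 \<xi>) \<le> (\<bar>h\<bar> * R * B + \<bar>h\<bar> * B) + (\<bar>h\<bar> * B + \<bar>h\<bar> * B)"
          by (intro norm_triangle_mono 1 2 3)
        then show ?thesis using le by simp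
      qed
    qed (use R in auto)
    finally show ?thesis by (simp add: mult_ac)
  qed
  then show thesis using R B that[of "4 * R * ((3 + R) * B)"] by simp
qed

subsection \<open>Fourier inversion\<close>

lemma Fubini_swap:
  fixes f :: "'a \<Rightarrow> 'b \<Rightarrow> complex"
  assumes "sigma_finite_measure M" "sigma_finite_measure N"
    and [measurable]: "case_prod f \<in> borel_measurable (M \<Otimes>\<^sub>M N)"
    and fin: "(\<integral>\<^sup>+x. \<integral>\<^sup>+y. ennreal (cmod (f x y)) \<partial>N \<partial>M) < \<infinity>"
  shows "(LINT x|M. LINT y|N. f x y) = (LINT y|N. LINT x|M. f x y)"
proof -
  interpret pair_sigma_finite M N by (intro pair_sigma_finite.intro assms)
  have "(\<integral>\<^sup>+z. ennreal (cmod (case_prod f z)) \<partial>(M \<Otimes>\<^sub>M N)) = (\<integral>\<^sup>+x. \<integral>\<^sup>+y. ennreal (cmod (f x y)) \<partial>N \<partial>M)"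
    by (subst M2.nn_integral_fst[symmetric]) auto
  then have "integrable (M \<Otimes>\<^sub>M N) (case_prod f)" using fin by (intro integrableI_bounded) auto
  then show ?thesis by (rule Fubini_integral[symmetric])
qed

text \<open>The characteristic function of the standard normal distribution, dilated by
  \<open>N\<close>: a wide Gaussian on one side becomes a narrow one on the other.\<close>

lemma integral_gaussian:
  assumes N: "0 < N"
  shows "(LINT s|lborel. cis (s * \<tau>) * of_real (std_normal_density (s / N)))
     = of_real (N * exp (- (N * \<tau>)\<^sup>2 / 2))"
proof -
  have "char std_normal_distribution t = (LINT x|lborel. cis (x * t) * of_real (std_normal_density x))" for t
    unfolding char_def
    by (subst integral_density) (auto simp: scaleR_conv_of_real cis_conv_exp mult_ac)
  then have *: "(LINT x|lborel. cis (x * t) * of_real (std_normal_density x)) = of_real (exp (- t\<^sup>2 / 2))" for t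
    by (simp add: char_std_normal_distribution)
  have "(LINT s|lborel. cis (s * \<tau>) * of_real (std_normal_density (s / N)))
      = \<bar>N\<bar> *\<^sub>R (LINT x|lborel. cis ((0 + N * x) * \<tau>) * of_real (std_normal_density ((0 + N * x) / N)))"
    using N by (intro lborel_integral_real_affine) auto
  also have "\<dots> = \<bar>N\<bar> *\<^sub>R (LINT x|lborel. cis (x * (N * \<tau>)) * of_real (std_normal_density x))"
    using N by (simp add: mult_ac)
  also have "\<dots> = of_real (N * exp (- (N * \<tau>)\<^sup>2 / 2))"
    using N by (simp add: * scaleR_conv_of_real)
  finally show ?thesis .
qed

text \<open>Fourier inversion by Gaussian regularisation. As \<open>G n\<close> widens, the
  regularised integral tends to \<open>a\<close> times the inversion integral. By Fubini it is also
  \<open>a\<close> times a Gaussian average of \<open>m\<close> around \<open>\<eta>\<close> at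
  scale \<open>1 / Suc n\<close>, which tends to \<open>m \<eta>\<close> by continuity.\<close>

lemma kern_inversion:
  assumes m: "test_fun m"
  shows "(LINT s|lborel. cis (s * \<eta>) * kern m s) = m \<eta>"
proof -
  define G where "G = (\<lambda>n s. of_real (std_normal_density (s / real (Suc n))) :: complex)"
  define I where "I = (\<lambda>n. LINT s|lborel. cis (s * \<eta>) * kern m s * G n s)"
  note km = kern_integrable[OF m] and im = test_fun_integrable[OF m]
  have [measurable]: "m \<in> borel_measurable borel" "kern m \<in> borel_measurable borel"
    using m by measurable
  have [measurable]: "G n \<in> borel_measurable borel" for n unfolding G_def by measurable
  obtain B where B: "0 < B" "\<And>x. cmod (m x) \<le> B" using m by (rule test_fun_bounded) blast
  \<comment> \<open>The value of the normal density at 0. Its square is the factor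
    \<open>1 / (2 * pi)\<close> in \<open>kern\<close>, so the normalisations match.\<close>
  define a where "a = 1 / sqrt (2 * pi)"
  have a: "0 < a" by (simp add: a_def)
  have aa: "a * a = 1 / (2 * pi)" by (simp add: a_def)
  have G_le: "cmod (G n s) \<le> a" for n s
  proof -
    have "\<bar>std_normal_density (s / real (Suc n))\<bar> \<le> a"
      unfolding std_normal_density_def a_def by (simp add: abs_mult divide_right_mono)
    then show ?thesis by (simp only: G_def norm_of_real)
  qed
  have "I \<longlonglongrightarrow> (LINT s|lborel. cis (s * \<eta>) * kern m s * of_real a)"
    unfolding I_def
  proof (rule integral_dominated_convergence[where w="\<lambda>s. cmod (kern m s) * a"])
    have "(\<lambda>n. s / real (Suc n)) \<longlonglongrightarrow> 0" for s :: real
      using tendsto_mult[OF tendsto_const[of s] LIMSEQ_inverse_real_of_nat] by (simp add: field_simps)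
    then have "(\<lambda>n. G n s) \<longlonglongrightarrow> of_real (std_normal_density 0)" for s
      unfolding G_def std_normal_density_def by (intro tendsto_intros) auto
    then show "AE s in lborel. (\<lambda>n. cis (s * \<eta>) * kern m s * G n s) \<longlonglongrightarrow> cis (s * \<eta>) * kern m s * of_real a"
      by (intro AE_I2 tendsto_intros) (simp add: std_normal_density_def a_def)
    show "AE s in lborel. cmod (cis (s * \<eta>) * kern m s * G n s) \<le> cmod (kern m s) * a" for n
      by (intro AE_I2) (simp add: norm_mult G_le mult_left_mono)
  qed (use km in auto)
  then have lim1: "I \<longlonglongrightarrow> (LINT s|lborel. cis (s * \<eta>) * kern m s) * of_real a" by simp
  have I: "I n = of_real a * (LINT u|lborel. of_real (std_normal_density u) * m (\<eta> + u / real (Suc n)))" for n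
  proof -
    define N where "N = real (Suc n)"
    have N: "0 < N" by (simp add: N_def)
    have "I n = (LINT s|lborel. LINT \<xi>|lborel. cis (s * (\<eta> - \<xi>)) * m \<xi> * G n s) / of_real (2 * pi)"
    proof -
      have "cis (s * \<eta>) * kern m s * G n s = (LINT \<xi>|lborel. cis (s * (\<eta> - \<xi>)) * m \<xi> * G n s) / of_real (2 * pi)" for s
      proof -
        have "(LINT \<xi>|lborel. cis (s * (\<eta> - \<xi>)) * m \<xi> * G n s)
          = (LINT \<xi>|lborel. (cis (s * \<eta>) * G n s) * (cis (- (s * \<xi>)) * m \<xi>))"
        proof (intro Bochner_Integration.integral_cong refl)
          fix \<xi>
          have "cis (s * (\<eta> - \<xi>)) = cis (s * \<eta>) * cis (- (s * \<xi>))" by (simp add: cis_mult algebra_simps)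
          then show "cis (s * (\<eta> - \<xi>)) * m \<xi> * G n s = (cis (s * \<eta>) * G n s) * (cis (- (s * \<xi>)) * m \<xi>)"
            by simp
        qed
        also have "\<dots> = cis (s * \<eta>) * G n s * (LINT \<xi>|lborel. cis (- (s * \<xi>)) * m \<xi>)"
          by (rule integral_mult_right_zero)
        finally show ?thesis by (simp only: kern_def times_divide_eq_right times_divide_eq_left mult.assoc mult.commute[of _ "G n s"])
      qed
      then show ?thesis by (simp add: I_def)
    qed
    also have "(LINT s|lborel. LINT \<xi>|lborel. cis (s * (\<eta> - \<xi>)) * m \<xi> * G n s)
       = (LINT \<xi>|lborel. LINT s|lborel. cis (s * (\<eta> - \<xi>)) * m \<xi> * G n s)"
    proof (rule Fubini_swap[OF lborel.sigma_finite_measure_axioms lborel.sigma_finite_measure_axioms])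
      have iG: "integrable lborel (G n)"
        using lborel_integrable_real_affine[OF integrable_normal_density[of 1 0], of "1 / N" 0] N
        by (simp add: G_def N_def del: of_nat_Suc)
      have "(\<integral>\<^sup>+x. \<integral>\<^sup>+y. ennreal (cmod (cis (x * (\<eta> - y)) * m y * G n x)) \<partial>lborel \<partial>lborel)
         = (\<integral>\<^sup>+x. ennreal (cmod (G n x)) * (\<integral>\<^sup>+y. ennreal (cmod (m y)) \<partial>lborel) \<partial>lborel)"
        by (simp add: norm_mult ennreal_mult nn_integral_cmult[symmetric] mult.commute)
      also have "\<dots> = (\<integral>\<^sup>+x. ennreal (cmod (G n x)) \<partial>lborel) * (\<integral>\<^sup>+y. ennreal (cmod (m y)) \<partial>lborel)"
        by (rule nn_integral_multc) measurable
      also have "\<dots> < \<infinity>"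
        using iG im by (simp add: integrable_iff_bounded ennreal_mult_less_top)
      finally show "(\<integral>\<^sup>+x. \<integral>\<^sup>+y. ennreal (cmod (cis (x * (\<eta> - y)) * m y * G n x)) \<partial>lborel \<partial>lborel) < \<infinity>" .
    qed measurable
    also have "\<dots> = (LINT \<xi>|lborel. m \<xi> * of_real (N * exp (- (N * (\<eta> - \<xi>))\<^sup>2 / 2)))"
    proof (intro Bochner_Integration.integral_cong refl)
      fix \<xi>
      have "(LINT s|lborel. cis (s * (\<eta> - \<xi>)) * m \<xi> * G n s) = (LINT s|lborel. m \<xi> * (cis (s * (\<eta> - \<xi>)) * G n s))"
        by (simp add: mult_ac)
      also have "\<dots> = m \<xi> * of_real (N * exp (- (N * (\<eta> - \<xi>))\<^sup>2 / 2))"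
        using integral_gaussian[OF N, of "\<eta> - \<xi>"] by (simp add: G_def N_def del: of_nat_Suc)
      finally show "(LINT s|lborel. cis (s * (\<eta> - \<xi>)) * m \<xi> * G n s) = m \<xi> * of_real (N * exp (- (N * (\<eta> - \<xi>))\<^sup>2 / 2))" .
    qed
    \<comment> \<open>The substitution \<xi> = \<eta> + u / N absorbs the factor N and makes the
      Gaussian independent of N.\<close>
    also have "\<dots> = \<bar>1 / N\<bar> *\<^sub>R (LINT u|lborel. m (\<eta> + 1 / N * u) * of_real (N * exp (- (N * (\<eta> - (\<eta> + 1 / N * u)))\<^sup>2 / 2)))"
      using N by (intro lborel_integral_real_affine) auto
    also have "\<dots> = (LINT u|lborel. m (\<eta> + u / N) * of_real (exp (- u\<^sup>2 / 2)))"
      using N by (simp add: scaleR_conv_of_real flip: Bochner_Integration.integral_mult_right_zero)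
    also have "\<dots> / of_real (2 * pi) = (LINT u|lborel. m (\<eta> + u / N) * of_real (exp (- u\<^sup>2 / 2)) * of_real (a * a))"
      by (simp add: aa del: of_real_mult)
    also have "\<dots> = (LINT u|lborel. of_real a * (of_real (std_normal_density u) * m (\<eta> + u / N)))"
    proof (intro Bochner_Integration.integral_cong refl)
      fix u
      have "std_normal_density u = a * exp (- u\<^sup>2 / 2)"
        by (simp add: std_normal_density_def a_def)
      then show "m (\<eta> + u / N) * of_real (exp (- u\<^sup>2 / 2)) * of_real (a * a)
          = of_real a * (of_real (std_normal_density u) * m (\<eta> + u / N))"
        by (simp add: mult_ac)
    qed
    finally show ?thesis by (simp add: N_def)
  qed
  have "(\<lambda>n. LINT u|lborel. of_real (std_normal_density u) * m (\<eta> + u / real (Suc n)))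
     \<longlonglongrightarrow> (LINT u|lborel. of_real (std_normal_density u) * m \<eta>)"
  proof (rule integral_dominated_convergence[where w="\<lambda>u. std_normal_density u * B"])
    have "(\<lambda>n. \<eta> + u / real (Suc n)) \<longlonglongrightarrow> \<eta> + 0" for u :: real
      using tendsto_mult[OF tendsto_const[of u] LIMSEQ_inverse_real_of_nat]
      by (intro tendsto_add tendsto_const) (simp add: field_simps)
    then have "(\<lambda>n. m (\<eta> + u / real (Suc n))) \<longlonglongrightarrow> m \<eta>" for u :: real
      using continuous_on_tendsto_compose[OF test_fun_continuous[OF m], of "\<lambda>n. \<eta> + u / real (Suc n)" \<eta>] by simp
    then show "AE u in lborel. (\<lambda>n. of_real (std_normal_density u) * m (\<eta> + u / real (Suc n)))
      \<longlonglongrightarrow> of_real (std_normal_density u) * m \<eta>"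
      by (intro AE_I2 tendsto_intros)
    show "AE u in lborel. cmod (of_real (std_normal_density u) * m (\<eta> + u / real (Suc n))) \<le> std_normal_density u * B" for n
      using B by (intro AE_I2) (simp add: norm_mult mult_left_mono)
  qed auto
  then have "I \<longlonglongrightarrow> of_real a * (LINT u|lborel. of_real (std_normal_density u) * m \<eta>)"
    unfolding I by (intro tendsto_intros)
  with lim1 have "(LINT s|lborel. cis (s * \<eta>) * kern m s) * of_real a
     = of_real a * (LINT u|lborel. of_real (std_normal_density u) * m \<eta>)"
    by (rule LIMSEQ_unique)
  also have "(LINT u|lborel. of_real (std_normal_density u) * m \<eta>) = m \<eta>"
    using integral_normal_density[of 1 0] by (simp flip: of_real_def)
  finally show ?thesis using a by simp
qed

text \<open>Convolution multiplies symbols: after Fubini the integral in s is the inversion formula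
  for \<open>kern m\<close>.\<close>

lemma kern_reproducing:
  assumes m: "test_fun m" and n: "test_fun n"
  shows "(LINT s|lborel. kern m s * kern n (u - s)) = kern (\<lambda>\<xi>. m \<xi> * n \<xi>) u"
proof -
  have [measurable]: "m \<in> borel_measurable borel" "kern m \<in> borel_measurable borel"
     "n \<in> borel_measurable borel" "kern n \<in> borel_measurable borel"
    using m n by measurable
  note km = kern_integrable[OF m] and im = test_fun_integrable[OF n]
  have "(LINT s|lborel. kern m s * kern n (u - s))
     = (LINT s|lborel. LINT \<xi>|lborel. kern m s * (cis (- ((u - s) * \<xi>)) * n \<xi>)) / of_real (2 * pi)"
    by (simp add: kern_def[of n])
  also have "(LINT s|lborel. LINT \<xi>|lborel. kern m s * (cis (- ((u - s) * \<xi>)) * n \<xi>))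
    = (LINT \<xi>|lborel. LINT s|lborel. kern m s * (cis (- ((u - s) * \<xi>)) * n \<xi>))"
  proof (rule Fubini_swap[OF lborel.sigma_finite_measure_axioms lborel.sigma_finite_measure_axioms])
    have "(\<integral>\<^sup>+s. \<integral>\<^sup>+\<xi>. ennreal (cmod (kern m s * (cis (- ((u - s) * \<xi>)) * n \<xi>))) \<partial>lborel \<partial>lborel)
       = (\<integral>\<^sup>+s. ennreal (cmod (kern m s)) * (\<integral>\<^sup>+\<xi>. ennreal (cmod (n \<xi>)) \<partial>lborel) \<partial>lborel)"
      by (simp add: norm_mult ennreal_mult nn_integral_cmult)
    also have "\<dots> = (\<integral>\<^sup>+s. ennreal (cmod (kern m s)) \<partial>lborel) * (\<integral>\<^sup>+\<xi>. ennreal (cmod (n \<xi>)) \<partial>lborel)"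
      by (rule nn_integral_multc) measurable
    also have "\<dots> < \<infinity>"
      using km im by (simp add: integrable_iff_bounded ennreal_mult_less_top)
    finally show "(\<integral>\<^sup>+s. \<integral>\<^sup>+\<xi>. ennreal (cmod (kern m s * (cis (- ((u - s) * \<xi>)) * n \<xi>))) \<partial>lborel \<partial>lborel) < \<infinity>" .
  qed measurable
  also have "\<dots> = (LINT \<xi>|lborel. cis (- (u * \<xi>)) * (m \<xi> * n \<xi>))"
  proof (intro Bochner_Integration.integral_cong refl)
    fix \<xi>
    have "(LINT s|lborel. kern m s * (cis (- ((u - s) * \<xi>)) * n \<xi>))
       = (LINT s|lborel. (cis (- (u * \<xi>)) * n \<xi>) * (cis (s * \<xi>) * kern m s))"
    proof (intro Bochner_Integration.integral_cong refl)
      fix s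
      have "cis (- ((u - s) * \<xi>)) = cis (- (u * \<xi>)) * cis (s * \<xi>)" by (simp add: cis_mult algebra_simps)
      then show "kern m s * (cis (- ((u - s) * \<xi>)) * n \<xi>) = (cis (- (u * \<xi>)) * n \<xi>) * (cis (s * \<xi>) * kern m s)"
        by simp
    qed
    then show "(LINT s|lborel. kern m s * (cis (- ((u - s) * \<xi>)) * n \<xi>)) = cis (- (u * \<xi>)) * (m \<xi> * n \<xi>)"
      by (simp add: kern_inversion[OF m])
  qed
  finally show ?thesis by (simp add: kern_def)
qed

subsection \<open>Tensor product convolution operators\<close>

definition decaying :: "(real \<Rightarrow> complex) \<Rightarrow> bool" where
  "decaying a \<longleftrightarrow> continuous_on UNIV a \<and> (\<exists>K>0. \<forall>s. cmod (a s) \<le> K * cw s)"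

lemma decaying_measurable [measurable_dest]: "decaying a \<Longrightarrow> a \<in> borel_measurable borel"
  by (auto simp: decaying_def intro: borel_measurable_continuous_onI)

lemma decaying_bound:
  assumes "decaying a"
  obtains K where "0 < K" "\<And>s. cmod (a s) \<le> K * cw s"
  using assms by (auto simp: decaying_def)

lemma decaying_kern: "test_fun m \<Longrightarrow> decaying (kern m)"
  unfolding decaying_def using kern_decay[of m] kern_continuous[OF test_fun_integrable, of m] by metis

lemma decaying_integrable:
  assumes "decaying a"
  shows "integrable lborel a"
proof -
  obtain K where K: "0 < K" "\<And>x. cmod (a x) \<le> K * cw x" using assms by (rule decaying_bound) blast
  show ?thesis
    by (rule Bochner_Integration.integrable_bound[of _ "\<lambda>x. K * cw x"])
      (use K integrable_cw assms in \<open>auto simp: abs_mult\<close>)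
qed

lemma decaying_shift:
  assumes "decaying a"
  shows "decaying (\<lambda>s. a (s - h))"
proof -
  obtain K where K: "0 < K" "\<And>x. cmod (a x) \<le> K * cw x" using assms by (rule decaying_bound) blast
  have "cmod (a (s - h)) \<le> K * (2 * (1 + h\<^sup>2)) * cw s" for s
  proof -
    have "cmod (a (s - h)) \<le> K * cw (s - h)" by (rule K)
    also have "\<dots> \<le> K * (2 * (1 + h\<^sup>2) * cw (s - h + h))"
      by (intro mult_left_mono cw_shift) (use K in auto)
    finally show ?thesis by (simp add: mult.assoc)
  qed
  moreover have "0 < K * (2 * (1 + h\<^sup>2))" using K by (simp add: add_pos_nonneg)
  moreover have "continuous_on UNIV (\<lambda>s. a (s - h))"
    using assms by (auto simp: decaying_def intro!: continuous_intros continuous_on_compose2[of UNIV a])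
  ultimately show ?thesis unfolding decaying_def by blast
qed

lemma decaying_diff:
  assumes "decaying a" "decaying b"
  shows "decaying (\<lambda>s. a s - c * b s)"
proof -
  obtain K where K: "0 < K" "\<And>x. cmod (a x) \<le> K * cw x" using assms(1) by (rule decaying_bound) blast
  obtain L where L: "0 < L" "\<And>x. cmod (b x) \<le> L * cw x" using assms(2) by (rule decaying_bound) blast
  have "cmod (a s - c * b s) \<le> (K + cmod c * L) * cw s" for s
  proof -
    have "cmod (a s - c * b s) \<le> cmod (a s) + cmod c * cmod (b s)"
      by (metis norm_mult norm_triangle_ineq4)
    also have "\<dots> \<le> K * cw s + cmod c * (L * cw s)" by (intro add_mono mult_left_mono K L) auto
    finally show ?thesis by (simp add: algebra_simps)
  qed
  moreover have "0 < K + cmod c * L" using K L by (simp add: add_pos_nonneg)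
  moreover have "continuous_on UNIV (\<lambda>s. a s - c * b s)"
    using assms by (auto simp: decaying_def intro!: continuous_intros)
  ultimately show ?thesis unfolding decaying_def by blast
qed

text \<open>A substitute for integrability over the plane, which fails for nonzero periodic
  functions. Uniformity in the translation \<open>c\<close> makes convolutions with decaying kernels
  bounded at every point, not merely finite almost everywhere.\<close>

definition weighted_L1 :: "(real \<times> real \<Rightarrow> complex) \<Rightarrow> bool" where
  "weighted_L1 f \<longleftrightarrow> f \<in> borel_measurable borel \<and>
     (\<exists>B\<ge>0. \<forall>c. (\<integral>\<^sup>+z. ennreal (cw (fst z) * cw (snd z)) * ennreal (cmod (f (z + c))) \<partial>lborel) \<le> ennreal B)"

lemma weighted_L1_measurable [measurable_dest]: "weighted_L1 f \<Longrightarrow> f \<in> borel_measurable borel"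
  by (simp add: weighted_L1_def)

lemma weighted_L1_bound:
  assumes "weighted_L1 f"
  obtains B where "0 \<le> B"
    "\<And>c. (\<integral>\<^sup>+z. ennreal (cw (fst z) * cw (snd z)) * ennreal (cmod (f (z + c))) \<partial>lborel) \<le> ennreal B"
  using assms by (auto simp: weighted_L1_def)

lemma mixed_Lp_weighted_L1:
  assumes "1 \<le> fst p" "1 \<le> snd p" "f \<in> mixed_Lp p"
  shows "weighted_L1 f"
proof -
  obtain C where C: "0 < C" "\<And>g c. g \<in> borel_measurable borel \<Longrightarrow> (\<And>x y. g (x, y + 2 * pi) = g (x, y)) \<Longrightarrow>
      (\<integral>\<^sup>+z. ennreal (cw (fst z) * cw (snd z)) * g (z + c) \<partial>lborel) \<le> ennreal C * mnorm p g"
    using mnorm_weight_bound[OF assms(1,2)] by blast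
  have f[measurable]: "f \<in> borel_measurable borel" "\<And>x y. f (x, y + 2 * pi) = f (x, y)"
    and fin: "mnorm p (\<lambda>z. ennreal (cmod (f z))) < top"
    using assms(3) by (auto simp: mixed_Lp_def mixed_norm_eq)
  obtain N where N: "mnorm p (\<lambda>z. ennreal (cmod (f z))) = ennreal N" "0 \<le> N"
    using fin by (cases "mnorm p (\<lambda>z. ennreal (cmod (f z)))") auto
  have "(\<integral>\<^sup>+z. ennreal (cw (fst z) * cw (snd z)) * ennreal (cmod (f (z + c))) \<partial>lborel) \<le> ennreal (C * N)" for c
    using C(2)[of "\<lambda>z. ennreal (cmod (f z))" c] C(1) N f(2) by (simp add: ennreal_mult)
  with C N show ?thesis unfolding weighted_L1_def by (auto intro!: exI[of _ "C * N"])
qed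

text \<open>A correlation with argument \<open>z + w\<close>: the integration variable is itself the
  step of the increment that appears once means are subtracted.\<close>

definition conv2 ::
    "(real \<Rightarrow> complex) \<Rightarrow> (real \<Rightarrow> complex) \<Rightarrow> (real \<times> real \<Rightarrow> complex) \<Rightarrow> real \<times> real \<Rightarrow> complex" where
  "conv2 a b f z = (LINT w|lborel. a (fst w) * b (snd w) * f (z + w))"

section \<open>Iterated integrals and translations in the plane\<close>

lemma nn_integral_lborel_prod:
  assumes [measurable]: "f \<in> borel_measurable (borel :: (real \<times> real) measure)"
  shows "(\<integral>\<^sup>+z. f z \<partial>lborel) = (\<integral>\<^sup>+x. \<integral>\<^sup>+y. f (x, y) \<partial>lborel \<partial>lborel)"
proof -
  have "(\<integral>\<^sup>+z. f z \<partial>lborel) = (\<integral>\<^sup>+z. f z \<partial>(lborel \<Otimes>\<^sub>M lborel))"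
    unfolding lborel_prod ..
  also have "\<dots> = (\<integral>\<^sup>+x. \<integral>\<^sup>+y. f (x, y) \<partial>lborel \<partial>lborel)"
    by (rule lborel.nn_integral_fst[symmetric]) (unfold lborel_prod, simp)
  finally show ?thesis .
qed

lemma nn_integral_tensor:
  assumes [measurable]: "g \<in> borel_measurable borel" "h \<in> borel_measurable borel"
  shows "(\<integral>\<^sup>+w. g (fst w) * h (snd w) \<partial>(lborel :: (real \<times> real) measure))
    = (\<integral>\<^sup>+s. g s \<partial>lborel) * (\<integral>\<^sup>+t. h t \<partial>lborel)"
proof -
  have "(\<integral>\<^sup>+w. g (fst w) * h (snd w) \<partial>(lborel :: (real \<times> real) measure))
      = (\<integral>\<^sup>+x. \<integral>\<^sup>+y. g x * h y \<partial>lborel \<partial>lborel)"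
    by (subst nn_integral_lborel_prod) auto
  also have "\<dots> = (\<integral>\<^sup>+s. g s \<partial>lborel) * (\<integral>\<^sup>+t. h t \<partial>lborel)"
    by (simp add: nn_integral_cmult nn_integral_multc)
  finally show ?thesis .
qed

lemma integral_tensor:
  fixes g h :: "real \<Rightarrow> complex"
  assumes "integrable lborel (\<lambda>w :: real \<times> real. g (fst w) * h (snd w))"
  shows "(LINT w|(lborel :: (real \<times> real) measure). g (fst w) * h (snd w)) = (LINT s|lborel. g s) * (LINT t|lborel. h t)"
proof -
  have i: "integrable (lborel \<Otimes>\<^sub>M lborel) (\<lambda>(x, y). g x * h y)"
    unfolding lborel_prod using assms by (simp add: case_prod_beta')
  have "(LINT w|(lborel :: (real \<times> real) measure). g (fst w) * h (snd w)) = (LINT w|(lborel \<Otimes>\<^sub>M lborel). (\<lambda>(x, y). g x * h y) w)"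
    unfolding lborel_prod by (simp add: case_prod_beta')
  also have "\<dots> = (LINT x|lborel. LINT y|lborel. g x * h y)"
    by (rule lborel_pair.integral_fst[OF i, symmetric])
  finally show ?thesis by simp
qed

lemma integral_lborel_shift:
  fixes f :: "'a :: euclidean_space \<Rightarrow> complex"
  assumes "f \<in> borel_measurable borel"
  shows "(LINT x|lborel. f (x + c)) = (LINT x|lborel. f x)"
proof -
  have "(LINT x|lborel. f x) = (LINT x|distr lborel borel ((+) c). f x)"
    by (simp add: lborel_distr_plus)
  also have "\<dots> = (LINT x|lborel. f (c + x))"
    by (rule integral_distr) (use assms in auto)
  finally show ?thesis by (simp add: add.commute)
qed

lemma conv2_abs_bound:
  assumes "decaying a" "decaying b" "weighted_L1 f"
  obtains B where "0 \<le> B"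
    "\<And>z. (\<integral>\<^sup>+w. ennreal (cmod (a (fst w) * b (snd w) * f (z + w))) \<partial>lborel) \<le> ennreal B"
proof -
  obtain K where K: "0 < K" "\<And>x. cmod (a x) \<le> K * cw x" using assms(1) by (rule decaying_bound) blast
  obtain L where L: "0 < L" "\<And>x. cmod (b x) \<le> L * cw x" using assms(2) by (rule decaying_bound) blast
  obtain B where B: "0 \<le> B" "\<And>c. (\<integral>\<^sup>+z. ennreal (cw (fst z) * cw (snd z)) * ennreal (cmod (f (z + c))) \<partial>lborel) \<le> ennreal B"
    using assms(3) by (rule weighted_L1_bound) blast
  have [measurable]: "f \<in> borel_measurable borel" using assms by measurable
  have "(\<integral>\<^sup>+w. ennreal (cmod (a (fst w) * b (snd w) * f (z + w))) \<partial>lborel) \<le> ennreal (K * L * B)" for z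
  proof -
    have "(\<integral>\<^sup>+w. ennreal (cmod (a (fst w) * b (snd w) * f (z + w))) \<partial>lborel)
      \<le> (\<integral>\<^sup>+w. ennreal (K * L) * (ennreal (cw (fst w) * cw (snd w)) * ennreal (cmod (f (w + z)))) \<partial>lborel)"
    proof (rule nn_integral_mono)
      fix w :: "real \<times> real"
      have "cmod (a (fst w)) * cmod (b (snd w)) * cmod (f (z + w))
        \<le> ((K * cw (fst w)) * (L * cw (snd w))) * cmod (f (z + w))"
        by (intro mult_right_mono mult_mono K L) (use K L in auto)
      then have "cmod (a (fst w) * b (snd w) * f (z + w)) \<le> (K * L) * (cw (fst w) * cw (snd w) * cmod (f (w + z)))"
        by (simp add: norm_mult mult_ac add.commute)
      then show "ennreal (cmod (a (fst w) * b (snd w) * f (z + w)))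
        \<le> ennreal (K * L) * (ennreal (cw (fst w) * cw (snd w)) * ennreal (cmod (f (w + z))))"
        using K L by (simp add: ennreal_leI flip: ennreal_mult)
    qed
    also have "\<dots> = ennreal (K * L) * (\<integral>\<^sup>+w. ennreal (cw (fst w) * cw (snd w)) * ennreal (cmod (f (w + z))) \<partial>lborel)"
      by (rule nn_integral_cmult) measurable
    also have "\<dots> \<le> ennreal (K * L) * ennreal B" by (intro mult_left_mono B) auto
    finally show ?thesis using K L B by (simp add: ennreal_mult)
  qed
  then show thesis using that[of "K * L * B"] K L B by simp
qed

lemma conv2_integrable:
  assumes "decaying a" "decaying b" "weighted_L1 f"
  shows "integrable lborel (\<lambda>w. a (fst w) * b (snd w) * f (z + w))"
proof -
  have [measurable]: "a \<in> borel_measurable borel" "b \<in> borel_measurable borel" "f \<in> borel_measurable borel"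
    using assms by measurable
  obtain B where B: "\<And>z. (\<integral>\<^sup>+w. ennreal (cmod (a (fst w) * b (snd w) * f (z + w))) \<partial>lborel) \<le> ennreal B"
    using assms by (rule conv2_abs_bound) blast
  show ?thesis
    by (rule integrableI_bounded) (use B[of z] in \<open>auto simp: less_top[symmetric] top_unique\<close>)
qed

text \<open>Lets the kernels, which are regular, carry a translation instead of
  \<open>f\<close>.\<close>

lemma conv2_shift:
  assumes "decaying a" "decaying b" "weighted_L1 f"
  shows "conv2 a b f (z + h) = conv2 (\<lambda>s. a (s - fst h)) (\<lambda>t. b (t - snd h)) f z"
proof -
  have [measurable]: "a \<in> borel_measurable borel" "b \<in> borel_measurable borel" "f \<in> borel_measurable borel"
    using assms by measurable
  have "conv2 a b f (z + h) = (LINT w|lborel. a (fst (w + h) - fst h) * b (snd (w + h) - snd h) * f (z + (w + h)))"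
    by (simp add: conv2_def add_ac)
  also have "\<dots> = (LINT w|lborel. a (fst w - fst h) * b (snd w - snd h) * f (z + w))"
    by (rule integral_lborel_shift) measurable
  finally show ?thesis by (simp add: conv2_def)
qed

text \<open>With the translation moved to the kernels dominated convergence applies: along a bounded
  sequence the translated weights stay below a fixed multiple of the original one.\<close>

lemma conv2_continuous:
  assumes a: "decaying a" and b: "decaying b" and f: "weighted_L1 f"
  shows "continuous_on UNIV (conv2 a b f)"
proof -
  have [measurable]: "a \<in> borel_measurable borel" "b \<in> borel_measurable borel" "f \<in> borel_measurable borel"
    using assms by measurable
  obtain K where K: "0 < K" "\<And>x. cmod (a x) \<le> K * cw x" using a by (rule decaying_bound) blast
  obtain L where L: "0 < L" "\<And>x. cmod (b x) \<le> L * cw x" using b by (rule decaying_bound) blast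
  obtain B where B: "0 \<le> B" "\<And>c. (\<integral>\<^sup>+z. ennreal (cw (fst z) * cw (snd z)) * ennreal (cmod (f (z + c))) \<partial>lborel) \<le> ennreal B"
    using f by (rule weighted_L1_bound) blast
  have i: "integrable lborel (\<lambda>w. cw (fst w) * cw (snd w) * cmod (f w))"
    by (rule integrableI_bounded) (use B(2)[of 0] in \<open>auto simp: ennreal_mult less_top[symmetric] top_unique\<close>)
  have eq: "conv2 a b f z = (LINT w|lborel. a (fst w - fst z) * b (snd w - snd z) * f w)" for z
    using conv2_shift[OF assms, of 0 z] by (simp add: conv2_def)
  have "isCont (conv2 a b f) z" for z
    unfolding continuous_at_sequentially o_def
  proof (intro allI impI)
    fix u :: "nat \<Rightarrow> real \<times> real" assume u: "u \<longlonglongrightarrow> z"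
    then have "Bseq u" by (intro convergent_imp_Bseq convergentI)
    then obtain M where M: "0 < M" "\<And>n. norm (u n) \<le> M" by (auto simp: Bseq_def)
    note bd = cw_shift_le
    \<comment> \<open>Peetre's inequality gives the factor \<open>2 * (1 + M\<^sup>2)\<close> once
      in each variable; \<open>K * L\<close> are the decay constants.\<close>
    define W where "W = (2 * (1 + M\<^sup>2))\<^sup>2 * (K * L)"
    show "(\<lambda>n. conv2 a b f (u n)) \<longlonglongrightarrow> conv2 a b f z"
      unfolding eq
    proof (rule integral_dominated_convergence[where w="\<lambda>w. W * (cw (fst w) * cw (snd w) * cmod (f w))"])
      have "(\<lambda>n. a (s - fst (u n))) \<longlonglongrightarrow> a (s - fst z)" "(\<lambda>n. b (s - snd (u n))) \<longlonglongrightarrow> b (s - snd z)" for s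
        using a b by (auto simp: decaying_def intro!: continuous_on_tendsto_compose[of UNIV a]
            continuous_on_tendsto_compose[of UNIV b] tendsto_intros u)
      then show "AE w in lborel. (\<lambda>n. a (fst w - fst (u n)) * b (snd w - snd (u n)) * f w)
        \<longlonglongrightarrow> a (fst w - fst z) * b (snd w - snd z) * f w"
        by (intro AE_I2 tendsto_intros)
      show "AE w in lborel. cmod (a (fst w - fst (u n)) * b (snd w - snd (u n)) * f w)
        \<le> W * (cw (fst w) * cw (snd w) * cmod (f w))" for n
      proof (rule AE_I2)
        fix w :: "real \<times> real"
        have un: "\<bar>fst (u n)\<bar> \<le> M" "\<bar>snd (u n)\<bar> \<le> M"
          using norm_fst_le[of "fst (u n)" "snd (u n)"] norm_snd_le[of "snd (u n)" "fst (u n)"] M(2)[of n] by auto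
        have "cmod (a (fst w - fst (u n))) \<le> K * (2 * (1 + M\<^sup>2) * cw (fst w))"
          by (rule order_trans[OF K(2)]) (intro mult_left_mono bd un, use K in auto)
        moreover have "cmod (b (snd w - snd (u n))) \<le> L * (2 * (1 + M\<^sup>2) * cw (snd w))"
          by (rule order_trans[OF L(2)]) (intro mult_left_mono bd un, use L in auto)
        ultimately have "cmod (a (fst w - fst (u n))) * cmod (b (snd w - snd (u n))) * cmod (f w)
          \<le> (K * (2 * (1 + M\<^sup>2) * cw (fst w))) * (L * (2 * (1 + M\<^sup>2) * cw (snd w))) * cmod (f w)"
          by (intro mult_right_mono mult_mono) (use K in auto)
        then show "cmod (a (fst w - fst (u n)) * b (snd w - snd (u n)) * f w)
          \<le> W * (cw (fst w) * cw (snd w) * cmod (f w))"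
          by (simp add: norm_mult W_def power2_eq_square mult_ac)
      qed
    qed (use i in auto)
  qed
  then show ?thesis by (simp add: continuous_at_imp_continuous_on)
qed

lemma conv2_measurable: "decaying a \<Longrightarrow> decaying b \<Longrightarrow> weighted_L1 f \<Longrightarrow> conv2 a b f \<in> borel_measurable borel"
  by (intro borel_measurable_continuous_onI conv2_continuous)

section \<open>Mixed norms of convolutions\<close>

lemma norm_integral_le_nn_integral:
  fixes f :: "'a \<Rightarrow> complex"
  shows "ennreal (cmod (LINT x|M. f x)) \<le> (\<integral>\<^sup>+x. ennreal (cmod (f x)) \<partial>M)"
  by (cases "integrable M f") (auto simp: integral_norm_bound_ennreal not_integrable_integral_eq)

text \<open>The representation of \<open>g\<close> is demanded only almost everywhere, because the
  formula that replaces \<open>f\<close> by increments holds outside a null set.\<close>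

lemma mixed_norm_integral_le:
  fixes F :: "real \<times> real \<Rightarrow> real \<times> real \<Rightarrow> complex"
  assumes p: "1 \<le> fst p" "1 \<le> snd p"
    and [measurable]: "case_prod F \<in> borel_measurable (borel \<Otimes>\<^sub>M borel)" "k \<in> borel_measurable borel"
      "g \<in> borel_measurable borel"
    and AE: "AE z in lborel. g z = (LINT w|lborel. k w * F z w)"
  shows "mixed_norm p g \<le> (\<integral>\<^sup>+w. ennreal (cmod (k w)) * mixed_norm p (\<lambda>z. F z w) \<partial>lborel)"
proof -
  have "mixed_norm p g \<le> mnorm p (\<lambda>z. \<integral>\<^sup>+w. ennreal (cmod (k w)) * ennreal (cmod (F z w)) \<partial>lborel)"
    unfolding mixed_norm_eq
  proof (rule mnorm_mono_AE)
    show "AE z in lborel. ennreal (cmod (g z)) \<le> (\<integral>\<^sup>+w. ennreal (cmod (k w)) * ennreal (cmod (F z w)) \<partial>lborel)"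
      using AE
    proof eventually_elim
      case (elim z)
      then show ?case
        using norm_integral_le_nn_integral[of lborel "\<lambda>w. k w * F z w"] by (simp add: norm_mult ennreal_mult)
    qed
  qed measurable
  also have "\<dots> \<le> (\<integral>\<^sup>+w. mnorm p (\<lambda>z. ennreal (cmod (k w)) * ennreal (cmod (F z w))) \<partial>lborel)"
    by (rule mnorm_Minkowski[OF lborel.sigma_finite_measure_axioms _ p]) measurable
  also have "\<dots> \<le> (\<integral>\<^sup>+w. ennreal (cmod (k w)) * mixed_norm p (\<lambda>z. F z w) \<partial>lborel)"
    unfolding mixed_norm_eq by (intro nn_integral_mono mnorm_cmult_le p) measurable
  finally show ?thesis .
qed

lemma mixed_norm_shift:
  assumes "f \<in> mixed_Lp p"
  shows "mixed_norm p (\<lambda>z. f (z + c)) = mixed_norm p f"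
  using assms mnorm_shift[of "\<lambda>z. ennreal (cmod (f z))" p c]
  by (auto simp: mixed_Lp_def mixed_norm_eq)

text \<open>Young's inequality with integrable kernels: Minkowski's inequality together with the
  translation invariance of the mixed norm.\<close>

lemma mixed_norm_conv2_le:
  assumes p: "1 \<le> fst p" "1 \<le> snd p" and a: "decaying a" and b: "decaying b" and f: "f \<in> mixed_Lp p"
  shows "mixed_norm p (conv2 a b f)
    \<le> (\<integral>\<^sup>+s. ennreal (cmod (a s)) \<partial>lborel) * (\<integral>\<^sup>+t. ennreal (cmod (b t)) \<partial>lborel) * mixed_norm p f"
proof -
  have w: "weighted_L1 f" by (rule mixed_Lp_weighted_L1[OF p f])
  have [measurable]: "a \<in> borel_measurable borel" "b \<in> borel_measurable borel" "f \<in> borel_measurable borel"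
    using a b w by measurable
  have [measurable]: "conv2 a b f \<in> borel_measurable borel" by (rule conv2_measurable[OF a b w])
  have "mixed_norm p (conv2 a b f)
    \<le> (\<integral>\<^sup>+w. ennreal (cmod (a (fst w) * b (snd w))) * mixed_norm p (\<lambda>z. f (z + w)) \<partial>lborel)"
    by (rule mixed_norm_integral_le[OF p]) (measurable; simp add: conv2_def)+
  also have "\<dots> = (\<integral>\<^sup>+w. ennreal (cmod (a (fst w))) * ennreal (cmod (b (snd w))) \<partial>lborel) * mixed_norm p f"
    unfolding mixed_norm_shift[OF f] norm_mult ennreal_mult[OF norm_ge_zero norm_ge_zero]
    by (rule nn_integral_multc) measurable
  finally show ?thesis by (simp add: nn_integral_tensor[of "\<lambda>s. ennreal (cmod (a s))" "\<lambda>t. ennreal (cmod (b t))"])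
qed

lemma conv2_mixed_Lp:
  assumes p: "1 \<le> fst p" "1 \<le> snd p" and a: "decaying a" and b: "decaying b" and f: "f \<in> mixed_Lp p"
  shows "conv2 a b f \<in> mixed_Lp p"
proof -
  have "conv2 a b f (x, y + 2 * pi) = conv2 a b f (x, y)" for x y
  proof -
    have "f ((x, y + 2 * pi) + w) = f ((x, y) + w)" for w
    proof -
      have "(x, y + 2 * pi) + w = (x + fst w, (y + snd w) + 2 * pi)" "(x, y) + w = (x + fst w, y + snd w)"
        by (simp_all add: prod_eq_iff)
      moreover have "f (x + fst w, (y + snd w) + 2 * pi) = f (x + fst w, y + snd w)"
        using f by (simp only: mixed_Lp_def mem_Collect_eq)
      ultimately show ?thesis by (simp only:)
    qed
    then show ?thesis by (simp add: conv2_def)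
  qed
  moreover have "mixed_norm p (conv2 a b f) < \<infinity>"
  proof -
    have "mixed_norm p (conv2 a b f)
      \<le> (\<integral>\<^sup>+s. ennreal (cmod (a s)) \<partial>lborel) * (\<integral>\<^sup>+t. ennreal (cmod (b t)) \<partial>lborel) * mixed_norm p f"
      by (rule mixed_norm_conv2_le[OF assms])
    also have "\<dots> < \<infinity>"
      using decaying_integrable[OF a] decaying_integrable[OF b] f
      by (simp add: integrable_iff_bounded ennreal_mult_less_top mixed_Lp_def)
    finally show ?thesis .
  qed
  ultimately show ?thesis
    using conv2_measurable[OF a b mixed_Lp_weighted_L1[OF p f]] by (simp add: mixed_Lp_def)
qed

text \<open>The inner variable is shifted by \<open>w\<close> and the order of integration
  exchanged; the integral over \<open>w\<close> of the four kernel factors then splits into two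
  one-dimensional convolutions.\<close>

lemma conv2_conv2:
  assumes a: "decaying a" "decaying b" and a': "decaying a'" "decaying b'" and f: "weighted_L1 f"
  shows "conv2 a b (conv2 a' b' f) = conv2 (\<lambda>u. LINT s|lborel. a s * a' (u - s)) (\<lambda>u. LINT s|lborel. b s * b' (u - s)) f"
proof
  fix z
  have m[measurable]: "a \<in> borel_measurable borel" "b \<in> borel_measurable borel" "f \<in> borel_measurable borel"
    "a' \<in> borel_measurable borel" "b' \<in> borel_measurable borel"
    using assms by measurable
  define P where "P = (\<lambda>w. a (fst w) * b (snd w))"
  define Q where "Q = (\<lambda>w. a' (fst w) * b' (snd w))"
  have [measurable]: "P \<in> borel_measurable borel" "Q \<in> borel_measurable borel"
    unfolding P_def Q_def by measurable
  obtain B where B: "\<And>z. (\<integral>\<^sup>+w. ennreal (cmod (Q w * f (z + w))) \<partial>lborel) \<le> ennreal B"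
    using a' f unfolding Q_def by (rule conv2_abs_bound) blast
  have "conv2 a b (conv2 a' b' f) z = (LINT w|lborel. P w * (LINT v|lborel. Q (v + w - w) * f (z + (v + w))))"
    by (simp add: conv2_def P_def Q_def add_ac)
  also have "\<dots> = (LINT w|lborel. P w * (LINT u|lborel. Q (u - w) * f (z + u)))"
    by (subst integral_lborel_shift) auto
  also have "\<dots> = (LINT w|lborel. LINT u|lborel. P w * (Q (u - w) * f (z + u)))"
    by simp
  also have "\<dots> = (LINT u|lborel. LINT w|lborel. P w * (Q (u - w) * f (z + u)))"
  proof (rule Fubini_swap[OF lborel.sigma_finite_measure_axioms lborel.sigma_finite_measure_axioms])
    have "(\<integral>\<^sup>+w. \<integral>\<^sup>+u. ennreal (cmod (P w * (Q (u - w) * f (z + u)))) \<partial>lborel \<partial>lborel)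
       = (\<integral>\<^sup>+w. ennreal (cmod (P w)) * (\<integral>\<^sup>+u. ennreal (cmod (Q (u - w) * f (z + u))) \<partial>lborel) \<partial>lborel)"
      by (simp add: norm_mult[of "P _"] ennreal_mult nn_integral_cmult)
    also have "\<dots> = (\<integral>\<^sup>+w. ennreal (cmod (P w)) * (\<integral>\<^sup>+u. ennreal (cmod (Q u * f (z + w + u))) \<partial>lborel) \<partial>lborel)"
    proof -
      have "(\<integral>\<^sup>+u. ennreal (cmod (Q u * f (z + w + u))) \<partial>lborel)
        = (\<integral>\<^sup>+u. ennreal (cmod (Q (u + w - w) * f (z + (u + w)))) \<partial>lborel)" for w
        by (simp add: add_ac)
      also have "\<dots> w = (\<integral>\<^sup>+u. ennreal (cmod (Q (u - w) * f (z + u))) \<partial>lborel)" for w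
        by (rule nn_integral_lborel_shift) measurable
      finally show ?thesis by simp
    qed
    also have "\<dots> \<le> (\<integral>\<^sup>+w. ennreal (cmod (P w)) * ennreal B \<partial>lborel)"
      by (intro nn_integral_mono mult_left_mono B) auto
    also have "\<dots> = (\<integral>\<^sup>+w. ennreal (cmod (a (fst w))) * ennreal (cmod (b (snd w))) \<partial>lborel) * ennreal B"
      unfolding P_def norm_mult ennreal_mult[OF norm_ge_zero norm_ge_zero]
      by (rule nn_integral_multc) measurable
    also have "\<dots> < \<infinity>"
      using decaying_integrable[OF a(1)] decaying_integrable[OF a(2)]
      by (simp add: nn_integral_tensor[of "\<lambda>s. ennreal (cmod (a s))" "\<lambda>t. ennreal (cmod (b t))"] integrable_iff_bounded ennreal_mult_less_top)
    finally show "(\<integral>\<^sup>+w. \<integral>\<^sup>+u. ennreal (cmod (P w * (Q (u - w) * f (z + u)))) \<partial>lborel \<partial>lborel) < \<infinity>" .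
  qed measurable
  also have "\<dots> = (LINT u|lborel. (LINT s|lborel. a s * a' (fst u - s)) * (LINT s|lborel. b s * b' (snd u - s)) * f (z + u))"
  proof (intro Bochner_Integration.integral_cong refl)
    fix u :: "real \<times> real"
    \<comment> \<open>In each variable one factor is integrable and the other is bounded by its
      decay constant.\<close>
    have i: "integrable lborel (\<lambda>w. (a (fst w) * a' (fst u - fst w)) * (b (snd w) * b' (snd u - snd w)))"
    proof (rule integrableI_bounded)
      obtain K where K: "0 < K" "\<And>x. cmod (a' x) \<le> K * cw x" using a'(1) by (rule decaying_bound) blast
      obtain L where L: "0 < L" "\<And>x. cmod (b' x) \<le> L * cw x" using a'(2) by (rule decaying_bound) blast
      have K': "cmod (a' x) \<le> K" for x
        using order_trans[OF K(2)[of x] mult_left_mono[OF cw_le_1[of x], of K]] K(1) by simp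
      have L': "cmod (b' x) \<le> L" for x
        using order_trans[OF L(2)[of x] mult_left_mono[OF cw_le_1[of x], of L]] L(1) by simp
      have "(\<integral>\<^sup>+w. ennreal (cmod ((a (fst w) * a' (fst u - fst w)) * (b (snd w) * b' (snd u - snd w)))) \<partial>lborel)
        \<le> (\<integral>\<^sup>+w. ennreal (cmod (a (fst w)) * K) * ennreal (cmod (b (snd w)) * L) \<partial>lborel)"
        using K L by (intro nn_integral_mono)
          (simp add: norm_mult flip: ennreal_mult, intro ennreal_leI mult_mono mult_left_mono K' L', auto)
      also have "\<dots> = (\<integral>\<^sup>+s. ennreal (cmod (a s) * K) \<partial>lborel) * (\<integral>\<^sup>+t. ennreal (cmod (b t) * L) \<partial>lborel)"
        by (rule nn_integral_tensor) measurable
      also have "\<dots> < \<infinity>"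
        using decaying_integrable[OF a(1)] decaying_integrable[OF a(2)] K L
        by (simp add: ennreal_mult nn_integral_multc integrable_iff_bounded ennreal_mult_less_top)
      finally show "(\<integral>\<^sup>+w. ennreal (cmod ((a (fst w) * a' (fst u - fst w)) * (b (snd w) * b' (snd u - snd w)))) \<partial>lborel) < \<infinity>" .
    qed measurable
    have "(LINT w|lborel. P w * (Q (u - w) * f (z + u)))
       = (LINT w|lborel. (a (fst w) * a' (fst u - fst w)) * (b (snd w) * b' (snd u - snd w)) * f (z + u))"
      by (simp add: P_def Q_def mult_ac)
    also have "\<dots> = (LINT s|lborel. a s * a' (fst u - s)) * (LINT s|lborel. b s * b' (snd u - s)) * f (z + u)"
      using integral_tensor[OF i] by simp
    finally show "(LINT w|lborel. P w * (Q (u - w) * f (z + u)))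
       = (LINT s|lborel. a s * a' (fst u - s)) * (LINT s|lborel. b s * b' (snd u - s)) * f (z + u)" .
  qed
  finally show "conv2 a b (conv2 a' b' f) z
    = conv2 (\<lambda>u. LINT s|lborel. a s * a' (u - s)) (\<lambda>u. LINT s|lborel. b s * b' (u - s)) f z"
    by (simp add: conv2_def)
qed

subsection \<open>Increments\<close>

text \<open>The flags select whether the increment is taken in the respective variable, so that
  the function itself, both partial increments and the box increment are treated at once.\<close>

definition gen_incr ::
    "bool \<Rightarrow> bool \<Rightarrow> real \<times> real \<Rightarrow> (real \<times> real \<Rightarrow> complex) \<Rightarrow> real \<times> real \<Rightarrow> complex" where
  "gen_incr e1 e2 h f z = f (z + h) - of_bool e1 * f (z + (0, snd h)) - of_bool e2 * f (z + (fst h, 0))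
     + of_bool e1 * of_bool e2 * f z"

text \<open>A flag that is not set leaves a translation, not the identity; setting the corresponding
  component of the step to 0 removes it.\<close>

lemma gen_incr_eqs:
  "gen_incr False False 0 f = f" "increment1 r f = gen_incr True False (r, 0) f"
  "increment2 r f = gen_incr False True (0, r) f" "box_increment r s f = gen_incr True True (r, s) f"
  by (auto simp: fun_eq_iff gen_incr_def increment1_def increment2_def box_increment_def)

text \<open>The product of the two kernel differences expands into exactly the four signed terms of
  the increment, so the increment acts on each tensor factor separately.\<close>

lemma gen_incr_conv2:
  assumes a: "decaying a" and b: "decaying b" and f: "weighted_L1 f"
  shows "gen_incr e1 e2 h (conv2 a b f)
    = conv2 (\<lambda>s. a (s - fst h) - of_bool e1 * a s) (\<lambda>t. b (t - snd h) - of_bool e2 * b t) f"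
proof
  fix z
  let ?a = "\<lambda>s. a (s - fst h)" and ?b = "\<lambda>t. b (t - snd h)"
  have a': "decaying ?a" and b': "decaying ?b" using a b by (auto intro: decaying_shift)
  note i = conv2_integrable[OF a' b' f, of z] conv2_integrable[OF a b' f, of z]
    conv2_integrable[OF a' b f, of z] conv2_integrable[OF a b f, of z]
  have "gen_incr e1 e2 h (conv2 a b f) z
    = conv2 ?a ?b f z - of_bool e1 * conv2 a ?b f z - of_bool e2 * conv2 ?a b f z + of_bool e1 * of_bool e2 * conv2 a b f z"
    unfolding gen_incr_def by (simp add: conv2_shift[OF a b f])
  also have "\<dots> = (LINT w|lborel. ?a (fst w) * ?b (snd w) * f (z + w) - of_bool e1 * (a (fst w) * ?b (snd w) * f (z + w))
     - of_bool e2 * (?a (fst w) * b (snd w) * f (z + w)) + of_bool e1 * of_bool e2 * (a (fst w) * b (snd w) * f (z + w)))"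
    unfolding conv2_def using i by simp
  also have "\<dots> = conv2 (\<lambda>s. ?a s - of_bool e1 * a s) (\<lambda>t. ?b t - of_bool e2 * b t) f z"
    unfolding conv2_def by (intro Bochner_Integration.integral_cong refl) (simp add: algebra_simps)
  finally show "gen_incr e1 e2 h (conv2 a b f) z
    = conv2 (\<lambda>s. ?a s - of_bool e1 * a s) (\<lambda>t. ?b t - of_bool e2 * b t) f z" .
qed

text \<open>For a displacement other than \<open>w\<close> itself the integrand is not controlled at
  every \<open>z\<close>. Integrating over \<open>z\<close> against the weight and exchanging the
  order gives a finite total, hence integrability for almost every \<open>z\<close>.\<close>

lemma conv2_AE_integrable:
  assumes a: "decaying a" and b: "decaying b" and f: "weighted_L1 f"
    and [measurable]: "T \<in> borel_measurable borel"
  shows "AE z in lborel. integrable lborel (\<lambda>w. a (fst w) * b (snd w) * f (z + T w))"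
proof -
  have [measurable]: "a \<in> borel_measurable borel" "b \<in> borel_measurable borel" "f \<in> borel_measurable borel"
    using assms by measurable
  obtain B where B: "0 \<le> B" "\<And>c. (\<integral>\<^sup>+z. ennreal (cw (fst z) * cw (snd z)) * ennreal (cmod (f (z + c))) \<partial>lborel) \<le> ennreal B"
    using f by (rule weighted_L1_bound) blast
  let ?J = "\<lambda>z. \<integral>\<^sup>+w. ennreal (cmod (a (fst w) * b (snd w) * f (z + T w))) \<partial>lborel"
  have "(\<integral>\<^sup>+z. ennreal (cw (fst z) * cw (snd z)) * ?J z \<partial>lborel)
     = (\<integral>\<^sup>+z. \<integral>\<^sup>+w. ennreal (cmod (a (fst w) * b (snd w))) * (ennreal (cw (fst z) * cw (snd z)) * ennreal (cmod (f (z + T w)))) \<partial>lborel \<partial>lborel)"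
    by (subst nn_integral_cmult[symmetric]) (auto simp: norm_mult ennreal_mult mult_ac)
  also have "\<dots> = (\<integral>\<^sup>+w. \<integral>\<^sup>+z. ennreal (cmod (a (fst w) * b (snd w))) * (ennreal (cw (fst z) * cw (snd z)) * ennreal (cmod (f (z + T w)))) \<partial>lborel \<partial>lborel)"
    by (rule lborel_pair.Fubini'[symmetric]) measurable
  also have "\<dots> = (\<integral>\<^sup>+w. ennreal (cmod (a (fst w) * b (snd w))) * (\<integral>\<^sup>+z. ennreal (cw (fst z) * cw (snd z)) * ennreal (cmod (f (z + T w))) \<partial>lborel) \<partial>lborel)"
    by (intro nn_integral_cong nn_integral_cmult) measurable
  also have "\<dots> \<le> (\<integral>\<^sup>+w. ennreal (cmod (a (fst w) * b (snd w))) * ennreal B \<partial>lborel)"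
    by (intro nn_integral_mono mult_left_mono B) auto
  also have "\<dots> = (\<integral>\<^sup>+w. ennreal (cmod (a (fst w))) * ennreal (cmod (b (snd w))) \<partial>lborel) * ennreal B"
    unfolding norm_mult ennreal_mult[OF norm_ge_zero norm_ge_zero]
    by (rule nn_integral_multc) measurable
  also have "\<dots> < \<infinity>"
    using decaying_integrable[OF a] decaying_integrable[OF b]
    by (simp add: nn_integral_tensor[of "\<lambda>s. ennreal (cmod (a s))" "\<lambda>t. ennreal (cmod (b t))"] integrable_iff_bounded ennreal_mult_less_top)
  finally have "AE z in lborel. ennreal (cw (fst z) * cw (snd z)) * ?J z \<noteq> \<infinity>"
    by (intro nn_integral_noteq_infinite) auto
  then show ?thesis
  proof eventually_elim
    case (elim z)
    have "cw (fst z) \<noteq> 0" "cw (snd z) \<noteq> 0" using cw_pos[of "fst z"] cw_pos[of "snd z"] by simp_all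
    with elim have "?J z \<noteq> top" by (auto simp: ennreal_mult_top)
    then show ?case by (intro integrableI_bounded) (auto simp: less_top)
  qed
qed

text \<open>Each subtracted term is independent of a component of \<open>w\<close> in which the
  kernel has mean zero, so its integral vanishes. These terms sample \<open>f\<close> along lines
  through \<open>z\<close>, where integrability is available only for almost every
  \<open>z\<close>.\<close>

lemma conv2_eq_incr:
  assumes a: "decaying a" and b: "decaying b" and f: "weighted_L1 f"
    and e: "e1 \<Longrightarrow> (LINT s|lborel. a s) = 0" "e2 \<Longrightarrow> (LINT s|lborel. b s) = 0"
  shows "AE z in lborel. conv2 a b f z = (LINT w|lborel. a (fst w) * b (snd w) * gen_incr e1 e2 w f z)"
proof -
  note i1 = conv2_AE_integrable[OF a b f, of "\<lambda>w. (0, snd w)"]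
  note i2 = conv2_AE_integrable[OF a b f, of "\<lambda>w. (fst w, 0)"]
  note i3 = conv2_AE_integrable[OF a b f, of "\<lambda>w. 0"]
  have m: "(\<lambda>w. (0 :: real, snd w)) \<in> borel_measurable (borel :: (real \<times> real) measure)"
    "(\<lambda>w. (fst w, 0 :: real)) \<in> borel_measurable (borel :: (real \<times> real) measure)"
    by measurable
  show ?thesis
    using i1[OF m(1)] i2[OF m(2)] i3[OF borel_measurable_const]
  proof eventually_elim
    case (elim z)
    note i = conv2_integrable[OF a b f, of z]
    have "of_bool e1 * (LINT w|lborel. a (fst w) * b (snd w) * f (z + (0, snd w))) = 0"
      using integral_tensor[of a "\<lambda>t. b t * f (z + (0, t))"] elim(1) e(1) by (simp add: mult.assoc)
    moreover have "of_bool e2 * (LINT w|lborel. a (fst w) * b (snd w) * f (z + (fst w, 0))) = 0"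
      using integral_tensor[of "\<lambda>s. a s * f (z + (s, 0))" b] elim(2) e(2) by (simp add: mult_ac)
    moreover have "of_bool e1 * of_bool e2 * (LINT w|lborel. a (fst w) * b (snd w) * f (z + 0)) = 0"
      using integral_tensor[of a "\<lambda>t. b t * f (z + 0)"] elim(3) e(1) by (simp add: mult.assoc)
    moreover have "(LINT w|lborel. a (fst w) * b (snd w) * gen_incr e1 e2 w f z)
      = (LINT w|lborel. a (fst w) * b (snd w) * f (z + w)
         - of_bool e1 * (a (fst w) * b (snd w) * f (z + (0, snd w)))
         - of_bool e2 * (a (fst w) * b (snd w) * f (z + (fst w, 0)))
         + of_bool e1 * of_bool e2 * (a (fst w) * b (snd w) * f (z + 0)))"
      by (intro Bochner_Integration.integral_cong refl) (simp add: gen_incr_def algebra_simps)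
    ultimately show ?case using i elim by (simp add: conv2_def)
  qed
qed

subsection \<open>Tensor products as Schwartz functions\<close>

lemma tensor_has_derivative:
  fixes a b :: "real \<Rightarrow> complex"
  assumes "(a has_vector_derivative a') (at (fst z))" "(b has_vector_derivative b') (at (snd z))"
  shows "((\<lambda>z. a (fst z) * b (snd z)) has_derivative
    (\<lambda>h. a (fst z) * (snd h *\<^sub>R b') + fst h *\<^sub>R a' * b (snd z))) (at z)"
proof -
  have 1: "((\<lambda>z. a (fst z)) has_derivative (\<lambda>h. fst h *\<^sub>R a')) (at z)"
    using has_derivative_compose[OF bounded_linear_imp_has_derivative[OF bounded_linear_fst] assms(1)[unfolded has_vector_derivative_def]] .
  have 2: "((\<lambda>z. b (snd z)) has_derivative (\<lambda>h. snd h *\<^sub>R b')) (at z)"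
    using has_derivative_compose[OF bounded_linear_imp_has_derivative[OF bounded_linear_snd] assms(2)[unfolded has_vector_derivative_def]] .
  from has_derivative_mult[OF 1 2] show ?thesis .
qed

lemma norm_pair_le: "norm z \<le> \<bar>fst z\<bar> + \<bar>snd z\<bar>" for z :: "real \<times> real"
  using sqrt_sum_squares_le_sum_abs[of "fst z" "snd z"] by (simp add: norm_prod_def)

text \<open>A derivative along a basis vector falls on one factor and thus preserves the tensor
  form.\<close>

lemma iter_deriv_tensor:
  assumes "vs \<in> lists (Basis :: (real \<times> real) set)" "test_fun a" "test_fun b"
  shows "\<exists>a' b'. test_fun a' \<and> test_fun b' \<and> iter_deriv vs (\<lambda>z. a (fst z) * b (snd z)) = (\<lambda>z. a' (fst z) * b' (snd z))"
  using assms(1)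
proof (induction vs)
  case Nil
  then show ?case using assms by (auto simp: iter_deriv_def)
next
  case (Cons v vs)
  then obtain a0 b0 where ab: "test_fun a0" "test_fun b0"
    "iter_deriv vs (\<lambda>z. a (fst z) * b (snd z)) = (\<lambda>z. a0 (fst z) * b0 (snd z))" by auto
  obtain a1 where a1: "\<And>x. (a0 has_vector_derivative a1 x) (at x)" "test_fun a1" using ab(1) by (rule test_fun_deriv) blast
  obtain b1 where b1: "\<And>x. (b0 has_vector_derivative b1 x) (at x)" "test_fun b1" using ab(2) by (rule test_fun_deriv) blast
  have fd: "frechet_derivative (\<lambda>z. a0 (fst z) * b0 (snd z)) (at z)
      = (\<lambda>h. a0 (fst z) * (snd h *\<^sub>R b1 (snd z)) + fst h *\<^sub>R a1 (fst z) * b0 (snd z))" for z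
    by (rule frechet_derivative_at[symmetric, OF tensor_has_derivative[OF a1(1) b1(1)]])
  have it: "iter_deriv (v # vs) (\<lambda>z. a (fst z) * b (snd z))
     = (\<lambda>z. a0 (fst z) * (snd v *\<^sub>R b1 (snd z)) + fst v *\<^sub>R a1 (fst z) * b0 (snd z))"
    using ab(3) by (simp add: iter_deriv_def dir_deriv_def fd)
  from Cons.hyps have "v = (1, 0) \<or> v = (0, 1)" by (auto simp: Basis_prod_def)
  then show ?case
  proof
    assume "v = (1, 0)"
    then show ?thesis unfolding it using a1(2) ab(2) by auto
  next
    assume "v = (0, 1)"
    then show ?thesis unfolding it using b1(2) ab(1) by auto
  qed
qed

text \<open>Supplies the localised test functions that separate two continuous functions
  representing the same distribution.\<close>

lemma tensor_schwartz:
  assumes "test_fun a" "test_fun b"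
  shows "(\<lambda>z. a (fst z) * b (snd z)) \<in> schwartz"
proof -
  have diff: "(\<lambda>z. a (fst z) * b (snd z)) differentiable_on UNIV" if ab: "test_fun a" "test_fun b" for a b
  proof -
    obtain a1 where a1: "\<And>x. (a has_vector_derivative a1 x) (at x)" "test_fun a1" using ab(1) by (rule test_fun_deriv) blast
    obtain b1 where b1: "\<And>x. (b has_vector_derivative b1 x) (at x)" "test_fun b1" using ab(2) by (rule test_fun_deriv) blast
    show ?thesis
      unfolding differentiable_on_def differentiable_def
      using tensor_has_derivative[OF a1(1) b1(1)] by blast
  qed
  have bdd: "bdd_above (range (\<lambda>z. (1 + norm z) ^ N * cmod (a (fst z) * b (snd z))))" if ab: "test_fun a" "test_fun b" for a b and N :: nat
  proof -
    obtain A where A: "0 < A" "\<And>x. cmod (a x) \<le> A" using ab(1) by (rule test_fun_bounded) blast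
    obtain B where B: "0 < B" "\<And>x. cmod (b x) \<le> B" using ab(2) by (rule test_fun_bounded) blast
    obtain R where R: "0 < R" "\<And>x. R < \<bar>x\<bar> \<Longrightarrow> a x = 0" using ab(1) by (rule test_fun_support) blast
    obtain S where S: "0 < S" "\<And>x. S < \<bar>x\<bar> \<Longrightarrow> b x = 0" using ab(2) by (rule test_fun_support) blast
    have "(1 + norm z) ^ N * cmod (a (fst z) * b (snd z)) \<le> (1 + (R + S)) ^ N * (A * B)" for z
    proof (cases "R < \<bar>fst z\<bar> \<or> S < \<bar>snd z\<bar>")
      case True
      then have z: "a (fst z) * b (snd z) = 0" using R(2)[of "fst z"] S(2)[of "snd z"] by auto
      show ?thesis unfolding z using R(1) S(1) A(1) B(1) by simp
    next
      case False
      have "norm z \<le> \<bar>fst z\<bar> + \<bar>snd z\<bar>" by (rule norm_pair_le)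
      with False have "norm z \<le> R + S" by linarith
      then show ?thesis unfolding norm_mult
        using R(1) S(1) by (intro mult_mono power_mono A B) (use A in auto)
    qed
    then show ?thesis by (auto intro!: bdd_aboveI2)
  qed
  have it: "\<exists>a' b'. test_fun a' \<and> test_fun b' \<and> iter_deriv vs (\<lambda>z. a (fst z) * b (snd z)) = (\<lambda>z. a' (fst z) * b' (snd z))"
    if "vs \<in> lists (Basis :: (real \<times> real) set)" for vs
    using iter_deriv_tensor[OF that assms] .
  show ?thesis
    unfolding schwartz_def smooth_fun_def mem_Collect_eq
  proof (intro conjI ballI allI)
    fix vs :: "(real \<times> real) list" assume "vs \<in> lists Basis"
    then obtain a' b' where ab: "test_fun a'" "test_fun b'"
      "iter_deriv vs (\<lambda>z. a (fst z) * b (snd z)) = (\<lambda>z. a' (fst z) * b' (snd z))"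
      using it by blast
    show "iter_deriv vs (\<lambda>z. a (fst z) * b (snd z)) differentiable_on UNIV"
      unfolding ab(3) by (rule diff[OF ab(1,2)])
  next
    fix N :: nat and vs :: "(real \<times> real) list" assume "vs \<in> lists Basis"
    then obtain a' b' where ab: "test_fun a'" "test_fun b'"
      "iter_deriv vs (\<lambda>z. a (fst z) * b (snd z)) = (\<lambda>z. a' (fst z) * b' (snd z))"
      using it by blast
    show "bdd_above (range (\<lambda>z. (1 + norm z) ^ N * cmod (iter_deriv vs (\<lambda>z. a (fst z) * b (snd z)) z)))"
      unfolding ab(3) by (rule bdd[OF ab(1,2)])
  qed
qed

section \<open>Integrability of Schwartz functions\<close>

lemma schwartz_measurable: "\<phi> \<in> schwartz \<Longrightarrow> \<phi> \<in> borel_measurable borel"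
proof -
  assume "\<phi> \<in> schwartz"
  then have "iter_deriv [] \<phi> differentiable_on UNIV" unfolding schwartz_def smooth_fun_def by blast
  then show ?thesis
    by (intro borel_measurable_continuous_onI differentiable_imp_continuous_on) (simp add: iter_deriv_def)
qed

lemma schwartz_integrable:
  fixes \<phi> :: "real \<times> real \<Rightarrow> complex"
  assumes "\<phi> \<in> schwartz"
  shows "integrable lborel \<phi>"
proof -
  have [measurable]: "\<phi> \<in> borel_measurable borel" by (rule schwartz_measurable[OF assms])
  have "\<forall>(N::nat). \<forall>vs\<in>lists Basis. bdd_above (range (\<lambda>x. (1 + norm x) ^ N * cmod (iter_deriv vs \<phi> x)))"
    using assms unfolding schwartz_def by simp
  \<comment> \<open>The power 4 covers two quadratic weights, one per coordinate, each at most
    \<open>(1 + norm z)\<^sup>2\<close>.\<close>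
  from bspec[OF spec[OF this, of 4] lists.Nil]
  have "bdd_above (range (\<lambda>x. (1 + norm x) ^ 4 * cmod (iter_deriv [] \<phi> x)))" .
  moreover have "iter_deriv [] \<phi> = \<phi>" by (simp add: iter_deriv_def)
  ultimately obtain C where C: "\<And>x. (1 + norm x) ^ 4 * cmod (\<phi> x) \<le> C"
    unfolding bdd_above_def by auto
  have "0 \<le> (1 + norm (0 :: real \<times> real)) ^ 4 * cmod (\<phi> 0)" by simp
  from order_trans[OF this C] have C0: "0 \<le> C" .
  have "cmod (\<phi> z) \<le> C * (cw (fst z) * cw (snd z))" for z
  proof -
    have le: "1 + (fst z)\<^sup>2 \<le> (1 + norm z)\<^sup>2" "1 + (snd z)\<^sup>2 \<le> (1 + norm z)\<^sup>2"
    proof -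
      have "(fst z)\<^sup>2 \<le> (norm z)\<^sup>2" "(snd z)\<^sup>2 \<le> (norm z)\<^sup>2"
        by (simp_all add: norm_prod_def)
      moreover have "(1 + norm z)\<^sup>2 = 1 + 2 * norm z + (norm z)\<^sup>2" by (simp add: power2_sum)
      ultimately show "1 + (fst z)\<^sup>2 \<le> (1 + norm z)\<^sup>2" "1 + (snd z)\<^sup>2 \<le> (1 + norm z)\<^sup>2"
        using norm_ge_zero[of z] by linarith+
    qed
    have pos: "0 < 1 + (fst z)\<^sup>2" "0 < 1 + (snd z)\<^sup>2" by (auto intro: add_pos_nonneg)
    have "(1 + (fst z)\<^sup>2) * (1 + (snd z)\<^sup>2) \<le> (1 + norm z)\<^sup>2 * (1 + norm z)\<^sup>2"
      using le pos by (intro mult_mono) auto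
    also have "\<dots> = (1 + norm z) ^ 4" by (simp flip: power_add)
    finally have "(1 + (fst z)\<^sup>2) * (1 + (snd z)\<^sup>2) * cmod (\<phi> z) \<le> C"
      using C[of z] by (meson mult_right_mono norm_ge_zero order_trans)
    then have "cmod (\<phi> z) \<le> C / ((1 + (fst z)\<^sup>2) * (1 + (snd z)\<^sup>2))"
      using mult_pos_pos[OF pos] by (simp only: pos_le_divide_eq mult.commute)
    then show ?thesis by (simp add: cw_def)
  qed
  then have "(\<integral>\<^sup>+z. ennreal (cmod (\<phi> z)) \<partial>lborel) \<le> (\<integral>\<^sup>+z. ennreal C * (ennreal (cw (fst z)) * ennreal (cw (snd z))) \<partial>lborel)"
    using C0 by (intro nn_integral_mono) (simp add: ennreal_leI flip: ennreal_mult)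
  also have "\<dots> = ennreal C * (ennreal pi * ennreal pi)"
    using nn_integral_tensor[of "\<lambda>s. ennreal (cw s)" "\<lambda>s. ennreal (cw s)"] nn_integral_cw
    by (subst nn_integral_cmult) auto
  also have "\<dots> < \<infinity>" by (simp add: ennreal_mult_less_top)
  finally show ?thesis by (intro integrableI_bounded) auto
qed

subsection \<open>The dyadic partition of unity\<close>

locale dyadic =
  fixes chi rho :: "real \<Rightarrow> real"
  assumes dyadic: "dyadic_partition chi rho"
begin

lemma chi_zero: "4 / 3 < \<bar>z\<bar> \<Longrightarrow> chi z = 0"
  and rho_zero: "\<bar>z\<bar> < 3 / 4 \<Longrightarrow> rho z = 0" "8 / 3 < \<bar>z\<bar> \<Longrightarrow> rho z = 0"
proof -
  have 0: "closure {x. chi x \<noteq> 0} \<subseteq> {x. \<bar>x\<bar> \<le> 4/3}"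
    using dyadic unfolding dyadic_partition_def by (elim conjE)
  have 1: "closure {x. rho x \<noteq> 0} \<subseteq> {x. 3/4 \<le> \<bar>x\<bar> \<and> \<bar>x\<bar> \<le> 8/3}"
    using dyadic unfolding dyadic_partition_def by (elim conjE)
  note 1 = subset_trans[OF closure_subset 0] subset_trans[OF closure_subset 1]
  show "4 / 3 < \<bar>z\<bar> \<Longrightarrow> chi z = 0" "\<bar>z\<bar> < 3 / 4 \<Longrightarrow> rho z = 0" "8 / 3 < \<bar>z\<bar> \<Longrightarrow> rho z = 0"
    using subsetD[OF 1(1), of z] subsetD[OF 1(2), of z] by force+
qed

lemma summable_rho: "summable (\<lambda>j. rho (z / 2 ^ j))"
proof -
  obtain N where N: "\<bar>z\<bar> / (3 / 4) < 2 ^ N" using real_arch_pow[of "2 :: real"] by (metis one_less_numeral_iff semiring_norm(76))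
  have "rho (z / 2 ^ j) = 0" if "N \<le> j" for j
  proof (rule rho_zero(1))
    have "(2 :: real) ^ N \<le> 2 ^ j" using that by (intro power_increasing) auto
    with N have "\<bar>z\<bar> / (3 / 4) < 2 ^ j" by linarith
    then show "\<bar>z / 2 ^ j\<bar> < 3 / 4" by (simp add: field_simps abs_mult)
  qed
  then show ?thesis by (intro summable_finite[of "{..<N}"]) auto
qed

lemma chi_one: "\<bar>z\<bar> < 3 / 4 \<Longrightarrow> chi z = 1"
proof -
  assume z: "\<bar>z\<bar> < 3 / 4"
  have "rho (z / 2 ^ j) = 0" for j
  proof (rule rho_zero(1))
    have "\<bar>z / 2 ^ j\<bar> \<le> \<bar>z\<bar>" by (simp add: field_simps mult_le_cancel_left1 abs_mult)
    with z show "\<bar>z / 2 ^ j\<bar> < 3 / 4" by linarith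
  qed
  then have "(\<Sum>j. rho (z / 2 ^ j)) = 0" by simp
  moreover have "chi z + (\<Sum>j. rho (z / 2 ^ j)) = 1"
    using dyadic unfolding dyadic_partition_def by blast
  ultimately show ?thesis by simp
qed

text \<open>The sum in the partition identity at \<open>z / 2\<close> is the sum at \<open>z\<close>
  without its term of index 0.\<close>

lemma chi_half: "chi (z / 2) = chi z + rho z"
proof -
  have p: "chi z + (\<Sum>j. rho (z / 2 ^ j)) = 1" for z
    using dyadic by (simp add: dyadic_partition_def)
  have "(\<Sum>j. rho (z / 2 / 2 ^ j)) = (\<Sum>j. rho (z / 2 ^ Suc j))" by (simp add: mult.commute)
  also have "\<dots> = (\<Sum>j. rho (z / 2 ^ j)) - rho z"
    using suminf_split_head[OF summable_rho[of z]] by simp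
  finally show ?thesis using p[of z] p[of "z / 2"] by simp
qed

text \<open>Partial sums of the partition are dilates of the single profile \<open>chi\<close>;
  therefore partial sums of the block decomposition form an approximate identity.\<close>

lemma chi_telescope: "(\<Sum>j\<in>{-1..<int n}. dyadic_cutoff chi rho j z) = chi (z / 2 ^ n)"
proof (induction n)
  case 0
  have "{-1..<int 0} = {-1 :: int}" by auto
  then show ?case by (simp add: dyadic_cutoff_def)
next
  case (Suc n)
  have "{-1..<int (Suc n)} = insert (int n) {-1..<int n}" by auto
  then have "(\<Sum>j\<in>{-1..<int (Suc n)}. dyadic_cutoff chi rho j z)
     = dyadic_cutoff chi rho (int n) z + chi (z / 2 ^ n)"
    using Suc by simp
  also have "dyadic_cutoff chi rho (int n) z = rho (z / 2 ^ n)"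
    by (simp add: dyadic_cutoff_def power_int_minus field_simps)
  also have "rho (z / 2 ^ n) + chi (z / 2 ^ n) = chi (z / 2 ^ Suc n)"
    using chi_half[of "z / 2 ^ n"] by (simp add: mult.commute)
  finally show ?case .
qed

text \<open>The symbol of all frequencies below scale \<open>j\<close>: for j \<ge> 0 it is, by
  telescoping, the sum of the cutoffs with index less than \<open>j\<close>.\<close>

definition lowC :: "int \<Rightarrow> real \<Rightarrow> complex" where
  "lowC j x = of_real (chi (x / 2 powi j))"

definition cutC :: "int \<Rightarrow> real \<Rightarrow> complex" where
  "cutC j x = of_real (dyadic_cutoff chi rho j x)"

lemma cutC_eq: "cutC (-1) = lowC 0" "j \<noteq> -1 \<Longrightarrow> cutC j = (\<lambda>x. of_real (rho (x / 2 powi j)))"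
  by (auto simp: cutC_def lowC_def dyadic_cutoff_def power_int_minus field_simps fun_eq_iff)

lemma test_fun_chi: "test_fun (\<lambda>x. of_real (chi x))"
  using smooth_fun_test_fun[of chi "4/3"] chi_zero dyadic by (simp add: dyadic_partition_def)

lemma test_fun_rho: "test_fun (\<lambda>x. of_real (rho x))"
  using smooth_fun_test_fun[of rho "8/3"] rho_zero dyadic by (simp add: dyadic_partition_def)

lemma test_fun_lowC: "test_fun (lowC j)"
  using test_fun_scale[OF test_fun_chi, of "inverse (2 powi j)"]
  by (simp add: lowC_def[abs_def] field_simps)

lemma test_fun_cutC: "test_fun (cutC j)"
proof (cases "j = -1")
  case True
  then show ?thesis using test_fun_lowC cutC_eq by simp
next
  case False
  then show ?thesis using test_fun_scale[OF test_fun_rho, of "inverse (2 powi j)"]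
    by (simp add: cutC_eq field_simps)
qed

text \<open>The cutoff of index \<open>j\<close> is supported in frequencies up to
  \<open>8/3 * 2 powi j\<close>, and \<open>lowC (j + 2)\<close> equals one below
  \<open>3 * 2 powi j\<close>. An offset of one would only reach \<open>3/2 * 2 powi j\<close>,
  which is too small.\<close>

lemma low_cut:
  assumes "-1 \<le> j"
  shows "lowC (j + 2) \<xi> * cutC j \<xi> = cutC j \<xi>"
proof (cases "cutC j \<xi> = 0")
  case False
  have "\<bar>\<xi>\<bar> \<le> 8 / 3 * 2 powi j"
  proof (cases "j = -1")
    case True
    with False show ?thesis using chi_zero[of \<xi>] by (force simp: cutC_eq lowC_def)
  next
    case j: False
    with False have "\<bar>\<xi> / 2 powi j\<bar> \<le> 8 / 3" using rho_zero(2)[of "\<xi> / 2 powi j"] by (force simp: cutC_eq)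
    then show ?thesis by (simp add: field_simps abs_mult)
  qed
  moreover have "(2 :: real) powi (j + 2) = 4 * 2 powi j" by (simp add: power_int_add)
  moreover have "(0 :: real) < 2 powi j" by simp
  ultimately have "\<bar>\<xi>\<bar> < 3 / 4 * 2 powi (j + 2)"
    by linarith
  moreover have "(0 :: real) < 2 powi (j + 2)" by simp
  ultimately have "\<bar>\<xi> / 2 powi (j + 2)\<bar> < 3 / 4"
    by (simp add: field_simps)
  then show ?thesis by (simp add: lowC_def chi_one)
qed simp

section \<open>Convolution kernels of the cutoffs\<close>

definition kcut :: "int \<Rightarrow> real \<Rightarrow> complex" where "kcut j = kern (cutC j)"

definition klow :: "int \<Rightarrow> real \<Rightarrow> complex" where "klow j = kern (lowC j)"

lemma decaying_kcut: "decaying (kcut j)" and decaying_klow: "decaying (klow j)"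
  unfolding kcut_def klow_def by (simp_all add: decaying_kern test_fun_cutC test_fun_lowC)

lemma kcut_measurable [measurable]: "kcut j \<in> borel_measurable borel"
  and klow_measurable [measurable]: "klow j \<in> borel_measurable borel"
  using decaying_kcut decaying_klow by (auto intro: decaying_measurable)

lemma klow_scale: "klow j x = of_real (2 powi j) * klow 0 (2 powi j * x)"
  using kern_scale[of "2 powi j" "\<lambda>x. of_real (chi x)" x]
  by (simp add: klow_def lowC_def[abs_def])

lemma kcut_scale: "0 \<le> j \<Longrightarrow> kcut j x = of_real (2 powi j) * kcut 0 (2 powi j * x)"
  using kern_scale[of "2 powi j" "\<lambda>x. of_real (rho x)" x]
  by (simp add: kcut_def cutC_eq)

text \<open>The mean of a kernel is its symbol at frequency 0, where \<open>rho\<close> vanishes.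
  Index -1 is excluded because \<open>chi\<close> equals 1 there.\<close>

lemma integral_kcut: "0 \<le> j \<Longrightarrow> (LINT s|lborel. kcut j s) = 0"
  using kern_inversion[OF test_fun_cutC, of 0 j] rho_zero(1)[of 0]
  by (simp add: kcut_def cutC_eq)

lemma integral_klow: "(LINT s|lborel. klow j s) = 1"
  using kern_inversion[OF test_fun_lowC, of 0 j] chi_one[of 0]
  by (simp add: klow_def lowC_def)

lemma klow_kcut: "-1 \<le> j \<Longrightarrow> (LINT s|lborel. klow (j + 2) s * kcut j (u - s)) = kcut j u"
  using kern_reproducing[OF test_fun_lowC test_fun_cutC, of "j + 2" j u] low_cut[of j]
  by (simp add: klow_def kcut_def)

lemma sum_kcut: "(\<Sum>j\<in>{-1..<int n}. kcut j x) = klow (int n) x"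
proof -
  have i: "integrable lborel (\<lambda>\<xi>. cis (- (x * \<xi>)) * cutC j \<xi>)" for j
    by (intro integrable_cis_mult test_fun_integrable test_fun_cutC) measurable
  have s: "(\<Sum>j\<in>{-1..<int n}. cis (- (x * \<xi>)) * cutC j \<xi>) = cis (- (x * \<xi>)) * lowC (int n) \<xi>" for \<xi>
    using chi_telescope[where n = n and z = \<xi>] by (simp add: cutC_def lowC_def flip: sum_distrib_left of_real_sum)
  have "(\<Sum>j\<in>{-1..<int n}. kcut j x) = (LINT \<xi>|lborel. (\<Sum>j\<in>{-1..<int n}. cis (- (x * \<xi>)) * cutC j \<xi>)) / of_real (2 * pi)"
    using i by (simp add: kcut_def kern_def sum_divide_distrib)
  also have "\<dots> = klow (int n) x" unfolding s klow_def kern_def ..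
  finally show ?thesis .
qed

subsection \<open>Identification of the Littlewood--Paley blocks\<close>

text \<open>Tested against a bump near a point where the two functions differ, their difference
  would have a nonzero integral. This makes the definite description in \<open>lp_block\<close>
  meaningful.\<close>

lemma represents_unique:
  assumes cont: "continuous_on UNIV g" "continuous_on UNIV g'"
    and rep: "represents g u" "represents g' u"
  shows "g = g'"
proof (rule ccontr)
  assume "g \<noteq> g'"
  then obtain z0 where z0: "g z0 \<noteq> g' z0" by (metis ext)
  define d where "d = (\<lambda>z. g z - g' z)"
  \<comment> \<open>Projecting the complex difference onto its value at \<open>z0\<close> gives a
    real function with value \<open>2 * \<epsilon>\<close> there, hence larger than \<epsilon>
    nearby.\<close>
  define \<eta> where "\<eta> = (\<lambda>z. Re (cnj (d z0) * d z))"
  define \<epsilon> where "\<epsilon> = (cmod (d z0))\<^sup>2 / 2"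
  have \<epsilon>: "0 < \<epsilon>" using z0 by (simp add: \<epsilon>_def d_def)
  have contd: "continuous_on UNIV d" unfolding d_def by (intro continuous_intros cont)
  have "continuous_on UNIV \<eta>" unfolding \<eta>_def by (intro continuous_intros contd)
  then have "isCont \<eta> z0" using continuous_on_eq_continuous_at[OF open_UNIV, of \<eta>] by blast
  moreover have "\<eta> z0 = 2 * \<epsilon>" proof -
    have "\<eta> z0 = (Re (d z0))\<^sup>2 + (Im (d z0))\<^sup>2" by (simp add: \<eta>_def power2_eq_square)
    then show ?thesis by (simp add: \<epsilon>_def cmod_power2)
  qed
  ultimately have "\<forall>\<^sub>F z in nhds z0. \<epsilon> < \<eta> z"
    using \<epsilon> by (intro order_tendstoD(1)[of \<eta> "2 * \<epsilon>"]) (auto simp: continuous_at tendsto_nhds_iff)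
  then obtain \<delta> where \<delta>: "0 < \<delta>" "\<And>z. dist z z0 < \<delta> \<Longrightarrow> \<epsilon> < \<eta> z"
    unfolding eventually_nhds_metric by blast
  \<comment> \<open>Scaled by N, \<open>chi\<close> vanishes when a coordinate differs by more than
    4 / (3 N) < 2 / N, and two coordinates together stay within the distance 4 / N =
    \<delta>.\<close>
  define N where "N = 4 / \<delta>"
  have N: "0 < N" "\<delta> = 4 / N" using \<delta> by (auto simp: N_def)
  have small: "\<bar>N * t\<bar> < 3 / 4" if "\<bar>t\<bar> < 1 / (2 * N)" for t
  proof -
    have "N * \<bar>t\<bar> < 1 / 2" using that N(1) by (simp add: field_simps)
    then show ?thesis using N(1) by (simp add: abs_mult)
  qed
  have small': "\<bar>t\<bar> < 2 / N" if "\<bar>N * t\<bar> \<le> 4 / 3" for t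
  proof -
    have "N * \<bar>t\<bar> < 2" using that N(1) by (simp add: abs_mult)
    then show ?thesis using N(1) by (simp add: field_simps)
  qed
  \<comment> \<open>\<open>chi\<close> may change sign, so its square is taken to obtain a
    nonnegative bump.\<close>
  define b where "b = (\<lambda>c x. complex_of_real (chi (N * x + - N * c)) * complex_of_real (chi (N * x + - N * c)))"
  have b: "test_fun (b c)" for c
    unfolding b_def using N by (intro test_fun_mult test_fun_affine[OF test_fun_chi]) auto
  define \<phi> where "\<phi> = (\<lambda>z. b (fst z0) (fst z) * b (snd z0) (snd z))"
  have \<phi>: "\<phi> \<in> schwartz" unfolding \<phi>_def by (intro tensor_schwartz b)
  define \<psi> where "\<psi> = (\<lambda>z. (chi (N * (fst z - fst z0)))\<^sup>2 * (chi (N * (snd z - snd z0)))\<^sup>2)"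
  have \<phi>\<psi>: "\<phi> z = of_real (\<psi> z)" for z
    by (simp add: \<phi>_def \<psi>_def b_def power2_eq_square algebra_simps)
  have i: "integrable lborel (\<lambda>z. d z * \<phi> z)" and I: "(LINT z|lborel. d z * \<phi> z) = 0"
    using rep \<phi> by (simp_all add: represents_def distr_of_def d_def left_diff_distrib)
  have eq: "Re (cnj (d z0) * (d z * \<phi> z)) = \<eta> z * \<psi> z" for z
    by (simp add: \<eta>_def \<phi>\<psi> algebra_simps)
  have i1: "integrable lborel (\<lambda>z. \<eta> z * \<psi> z)"
    unfolding eq[symmetric] using i by (intro integrable_Re integrable_mult_right) auto
  have "(LINT z|lborel. \<eta> z * \<psi> z) = Re (LINT z|lborel. cnj (d z0) * (d z * \<phi> z))"
    unfolding eq[symmetric] using i by (intro integral_Re integrable_mult_right) auto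
  also have "\<dots> = 0" using I by simp
  finally have zero: "(LINT z|lborel. \<eta> z * \<psi> z) = 0" .
  have lower: "\<epsilon> * indicator (ball z0 (1 / (2 * N))) z \<le> \<eta> z * \<psi> z" for z
  proof (cases "\<psi> z = 0")
    case True
    have "z \<notin> ball z0 (1 / (2 * N))"
    proof
      assume "z \<in> ball z0 (1 / (2 * N))"
      then have "\<bar>fst z - fst z0\<bar> < 1 / (2 * N)" "\<bar>snd z - snd z0\<bar> < 1 / (2 * N)"
        using dist_fst_le[of z z0] dist_snd_le[of z z0] by (auto simp: dist_commute dist_real_def)
      then have "\<bar>N * (fst z - fst z0)\<bar> < 3 / 4" "\<bar>N * (snd z - snd z0)\<bar> < 3 / 4"
        by (simp_all only: small)
      then have "\<psi> z = 1" by (simp add: \<psi>_def chi_one)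
      with True show False by simp
    qed
    with True show ?thesis by simp
  next
    case False
    then have "\<bar>N * (fst z - fst z0)\<bar> \<le> 4 / 3" "\<bar>N * (snd z - snd z0)\<bar> \<le> 4 / 3"
      using chi_zero[of "N * (fst z - fst z0)"] chi_zero[of "N * (snd z - snd z0)"]
      by (force simp: \<psi>_def)+
    then have "\<bar>fst z - fst z0\<bar> < 2 / N" "\<bar>snd z - snd z0\<bar> < 2 / N"
      by (simp_all only: small')
    moreover have "dist z z0 \<le> \<bar>fst z - fst z0\<bar> + \<bar>snd z - snd z0\<bar>"
      using norm_pair_le[of "z - z0"] by (simp add: dist_norm)
    ultimately have "dist z z0 < \<delta>" using N by simp
    then have \<eta>: "\<epsilon> < \<eta> z" by (rule \<delta>)
    have \<psi>0: "0 \<le> \<psi> z" by (simp add: \<psi>_def)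
    show ?thesis
    proof (cases "z \<in> ball z0 (1 / (2 * N))")
      case True
      then have "\<bar>fst z - fst z0\<bar> < 1 / (2 * N)" "\<bar>snd z - snd z0\<bar> < 1 / (2 * N)"
        using dist_fst_le[of z z0] dist_snd_le[of z z0] by (auto simp: dist_commute dist_real_def)
      then have "\<bar>N * (fst z - fst z0)\<bar> < 3 / 4" "\<bar>N * (snd z - snd z0)\<bar> < 3 / 4"
        by (simp_all only: small)
      then have "\<psi> z = 1" by (simp add: \<psi>_def chi_one)
      with \<eta> True show ?thesis by simp
    qed (use \<eta> \<epsilon> \<psi>0 in auto)
  qed
  have r: "0 < 1 / (2 * N)" using N by simp
  have ib: "integrable lborel (\<lambda>z. \<epsilon> * indicator (ball z0 (1 / (2 * N))) z :: real)"
    using emeasure_lborel_ball_finite[of z0 "1 / (2 * N)"]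
    by (intro integrable_mult_right integrable_real_indicator) auto
  have "0 < \<epsilon> * measure lborel (ball z0 (1 / (2 * N)))"
    using \<epsilon> content_ball_pos[OF r, of z0] by simp
  also have "\<dots> = (LINT z|lborel. \<epsilon> * indicator (ball z0 (1 / (2 * N))) z)" by simp
  also have "\<dots> \<le> (LINT z|lborel. \<eta> z * \<psi> z)"
    by (rule Bochner_Integration.integral_mono[OF ib i1 lower])
  finally show False using zero by simp
qed

text \<open>The adjoint form of the block operator, as it acts on a test function. Fubini turns it
  into a convolution; the factor \<open>(2 * pi)\<^sup>2\<close> of \<open>inv_fourier\<close>
  splits into the two factors \<open>2 * pi\<close> of \<open>kern\<close>.\<close>

lemma fourier_multiplier:
  fixes \<phi> :: "real \<times> real \<Rightarrow> complex"
  assumes \<phi>: "integrable lborel \<phi>"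
  shows "fourier (\<lambda>\<xi>. cutC j (fst \<xi>) * cutC k (snd \<xi>) * inv_fourier \<phi> \<xi>) x
    = (LINT y|lborel. \<phi> y * (kcut j (fst (x - y)) * kcut k (snd (x - y))))"
proof -
  have [measurable]: "\<phi> \<in> borel_measurable borel" using \<phi> by auto
  have [measurable]: "cutC j \<in> borel_measurable borel" for j using test_fun_cutC by measurable
  define m where "m = (\<lambda>\<xi>. cutC j (fst \<xi>) * cutC k (snd \<xi>))"
  have [measurable]: "m \<in> borel_measurable borel" unfolding m_def by measurable
  have mfin: "(\<integral>\<^sup>+\<xi>. ennreal (cmod (m \<xi>)) \<partial>lborel) < \<infinity>"
  proof -
    have "(\<integral>\<^sup>+\<xi>. ennreal (cmod (m \<xi>)) \<partial>lborel) = (\<integral>\<^sup>+s. ennreal (cmod (cutC j s)) \<partial>lborel) * (\<integral>\<^sup>+s. ennreal (cmod (cutC k s)) \<partial>lborel)"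
      using nn_integral_tensor[of "\<lambda>s. ennreal (cmod (cutC j s))" "\<lambda>s. ennreal (cmod (cutC k s))"]
      by (simp add: m_def norm_mult ennreal_mult)
    also have "\<dots> < \<infinity>"
      using test_fun_integrable[OF test_fun_cutC] by (simp add: integrable_iff_bounded ennreal_mult_less_top)
    finally show ?thesis .
  qed
  have "fourier (\<lambda>\<xi>. m \<xi> * inv_fourier \<phi> \<xi>) x
    = (LINT \<xi>|lborel. (LINT y|lborel. \<phi> y * (cis (- ((x - y) \<bullet> \<xi>)) * m \<xi>))) / of_real ((2 * pi)\<^sup>2)"
  proof -
    have "cis (- (x \<bullet> \<xi>)) * (m \<xi> * inv_fourier \<phi> \<xi>)
      = (LINT y|lborel. \<phi> y * (cis (- ((x - y) \<bullet> \<xi>)) * m \<xi>)) / of_real ((2 * pi)\<^sup>2)" for \<xi>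
    proof -
      have "(LINT y|lborel. \<phi> y * (cis (- ((x - y) \<bullet> \<xi>)) * m \<xi>))
        = (LINT y|lborel. (cis (- (x \<bullet> \<xi>)) * m \<xi>) * (cis (\<xi> \<bullet> y) * \<phi> y))"
      proof (intro Bochner_Integration.integral_cong refl)
        fix y
        have "cis (- ((x - y) \<bullet> \<xi>)) = cis (- (x \<bullet> \<xi>)) * cis (\<xi> \<bullet> y)"
          unfolding cis_mult by (rule arg_cong[where f = cis]) (simp add: inner_diff_left inner_commute[of \<xi> y])
        then show "\<phi> y * (cis (- ((x - y) \<bullet> \<xi>)) * m \<xi>) = (cis (- (x \<bullet> \<xi>)) * m \<xi>) * (cis (\<xi> \<bullet> y) * \<phi> y)"
          by simp
      qed
      also have "\<dots> = (cis (- (x \<bullet> \<xi>)) * m \<xi>) * (LINT y|lborel. cis (\<xi> \<bullet> y) * \<phi> y)"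
        by (rule integral_mult_right_zero)
      finally show ?thesis by (simp only: inv_fourier_def times_divide_eq_right mult.assoc)
    qed
    then show ?thesis by (simp add: fourier_def inner_commute[of _ x])
  qed
  also have "(LINT \<xi>|lborel. (LINT y|lborel. \<phi> y * (cis (- ((x - y) \<bullet> \<xi>)) * m \<xi>)))
    = (LINT y|lborel. (LINT \<xi>|lborel. \<phi> y * (cis (- ((x - y) \<bullet> \<xi>)) * m \<xi>)))"
  proof (rule Fubini_swap[OF lborel.sigma_finite_measure_axioms lborel.sigma_finite_measure_axioms])
    have "(\<integral>\<^sup>+\<xi>. \<integral>\<^sup>+y. ennreal (cmod (\<phi> y * (cis (- ((x - y) \<bullet> \<xi>)) * m \<xi>))) \<partial>lborel \<partial>lborel)
       = (\<integral>\<^sup>+\<xi>. (\<integral>\<^sup>+y. ennreal (cmod (\<phi> y)) \<partial>lborel) * ennreal (cmod (m \<xi>)) \<partial>lborel)"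
      by (simp add: norm_mult ennreal_mult nn_integral_multc)
    also have "\<dots> = (\<integral>\<^sup>+y. ennreal (cmod (\<phi> y)) \<partial>lborel) * (\<integral>\<^sup>+\<xi>. ennreal (cmod (m \<xi>)) \<partial>lborel)"
      by (rule nn_integral_cmult) measurable
    also have "\<dots> < \<infinity>" using mfin \<phi> by (simp add: integrable_iff_bounded ennreal_mult_less_top)
    finally show "(\<integral>\<^sup>+\<xi>. \<integral>\<^sup>+y. ennreal (cmod (\<phi> y * (cis (- ((x - y) \<bullet> \<xi>)) * m \<xi>))) \<partial>lborel \<partial>lborel) < \<infinity>" .
  qed measurable
  also have "\<dots> = (LINT y|lborel. \<phi> y * (kcut j (fst (x - y)) * kcut k (snd (x - y))) * of_real ((2 * pi)\<^sup>2))"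
  proof (intro Bochner_Integration.integral_cong refl)
    fix y
    define v where "v = x - y"
    have "(LINT \<xi>|lborel. cis (- (v \<bullet> \<xi>)) * m \<xi>)
      = (LINT \<xi>|lborel. (cis (- (fst v * fst \<xi>)) * cutC j (fst \<xi>)) * (cis (- (snd v * snd \<xi>)) * cutC k (snd \<xi>)))"
    proof (intro Bochner_Integration.integral_cong refl)
      fix \<xi> :: "real \<times> real"
      have "cis (- (v \<bullet> \<xi>)) = cis (- (fst v * fst \<xi>)) * cis (- (snd v * snd \<xi>))"
        by (simp add: cis_mult inner_prod_def)
      then show "cis (- (v \<bullet> \<xi>)) * m \<xi>
        = (cis (- (fst v * fst \<xi>)) * cutC j (fst \<xi>)) * (cis (- (snd v * snd \<xi>)) * cutC k (snd \<xi>))"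
        by (simp add: m_def)
    qed
    also have "\<dots> = (LINT \<xi>|lborel. cis (- (fst v * \<xi>)) * cutC j \<xi>) * (LINT \<xi>|lborel. cis (- (snd v * \<xi>)) * cutC k \<xi>)"
    proof (rule integral_tensor)
      show "integrable lborel (\<lambda>\<xi>. (cis (- (fst v * fst \<xi>)) * cutC j (fst \<xi>)) * (cis (- (snd v * snd \<xi>)) * cutC k (snd \<xi>)))"
        by (rule integrableI_bounded) (use mfin in \<open>auto simp: m_def norm_mult\<close>)
    qed
    also have "\<dots> = kcut j (fst v) * kcut k (snd v) * of_real ((2 * pi)\<^sup>2)"
      by (simp add: kcut_def kern_def power2_eq_square)
    finally show "(LINT \<xi>|lborel. \<phi> y * (cis (- ((x - y) \<bullet> \<xi>)) * m \<xi>))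
      = \<phi> y * (kcut j (fst (x - y)) * kcut k (snd (x - y))) * of_real ((2 * pi)\<^sup>2)"
      by (simp add: v_def)
  qed
  finally show ?thesis by (simp add: m_def)
qed

text \<open>Fubini moves the kernel from the test function to \<open>f\<close>, where it produces
  \<open>conv2\<close>. This function is continuous and bounded, hence integrable against Schwartz
  functions, and uniqueness of the continuous representative identifies it with the block.\<close>

lemma lp_block_eq:
  assumes f: "weighted_L1 f"
  shows "lp_block chi rho j k (distr_of f) = conv2 (kcut j) (kcut k) f"
proof -
  have [measurable]: "f \<in> borel_measurable borel" using f by measurable
  let ?g = "conv2 (kcut j) (kcut k) f"
  let ?K = "\<lambda>w. kcut j (fst w) * kcut k (snd w)"
  note dk = decaying_kcut[of j] decaying_kcut[of k]
  have cont: "continuous_on UNIV ?g" by (intro conv2_continuous dk f)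
  obtain B where B: "0 \<le> B" "\<And>z. (\<integral>\<^sup>+w. ennreal (cmod (?K w * f (z + w))) \<partial>lborel) \<le> ennreal B"
    using dk f by (rule conv2_abs_bound) blast
  have g_le: "cmod (?g z) \<le> B" for z
    using order_trans[OF norm_integral_le_nn_integral[of lborel "\<lambda>w. ?K w * f (z + w)"] B(2)[of z]] B(1)
    by (simp add: conv2_def)
  have rep: "represents ?g (lp_block_distr chi rho j k (distr_of f))"
    unfolding represents_def
  proof (intro ballI conjI)
    fix \<phi> :: "real \<times> real \<Rightarrow> complex" assume "\<phi> \<in> schwartz"
    then have \<phi>: "integrable lborel \<phi>" and [measurable]: "\<phi> \<in> borel_measurable borel"
      by (simp_all add: schwartz_integrable schwartz_measurable)
    have [measurable]: "?g \<in> borel_measurable borel" by (intro borel_measurable_continuous_onI cont)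
    show "integrable lborel (\<lambda>x. ?g x * \<phi> x)"
      by (rule Bochner_Integration.integrable_bound[of _ "\<lambda>x. B * \<phi> x"])
        (use \<phi> g_le B in \<open>auto simp: norm_mult intro!: mult_right_mono\<close>)
    have "lp_block_distr chi rho j k (distr_of f) \<phi>
      = distr_of f (fourier (\<lambda>\<xi>. cutC j (fst \<xi>) * cutC k (snd \<xi>) * inv_fourier \<phi> \<xi>))"
      by (simp add: lp_block_distr_def distr_inv_fourier_def distr_mult_def distr_fourier_def cutC_def case_prod_beta)
    also have "\<dots> = (LINT x|lborel. LINT y|lborel. f x * (\<phi> y * ?K (x - y)))"
      by (simp add: distr_of_def fourier_multiplier[OF \<phi>])
    also have "\<dots> = (LINT y|lborel. LINT x|lborel. f x * (\<phi> y * ?K (x - y)))"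
    proof (rule Fubini_swap[OF lborel.sigma_finite_measure_axioms lborel.sigma_finite_measure_axioms])
      have "(\<integral>\<^sup>+x. \<integral>\<^sup>+y. ennreal (cmod (f x * (\<phi> y * ?K (x - y)))) \<partial>lborel \<partial>lborel)
        = (\<integral>\<^sup>+y. \<integral>\<^sup>+x. ennreal (cmod (f x * (\<phi> y * ?K (x - y)))) \<partial>lborel \<partial>lborel)"
        by (rule lborel_pair.Fubini'[symmetric]) measurable
      also have "\<dots> = (\<integral>\<^sup>+y. ennreal (cmod (\<phi> y)) * (\<integral>\<^sup>+x. ennreal (cmod (?K (x - y) * f x)) \<partial>lborel) \<partial>lborel)"
        by (subst nn_integral_cmult[symmetric]) (auto simp: norm_mult ennreal_mult mult_ac)
      also have "\<dots> = (\<integral>\<^sup>+y. ennreal (cmod (\<phi> y)) * (\<integral>\<^sup>+w. ennreal (cmod (?K w * f (y + w))) \<partial>lborel) \<partial>lborel)"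
      proof -
        have "(\<integral>\<^sup>+w. ennreal (cmod (?K w * f (y + w))) \<partial>lborel)
           = (\<integral>\<^sup>+w. ennreal (cmod (?K ((w + y) - y) * f (w + y))) \<partial>lborel)" for y
          by (simp add: add.commute)
        also have "\<dots> y = (\<integral>\<^sup>+x. ennreal (cmod (?K (x - y) * f x)) \<partial>lborel)" for y
          by (rule nn_integral_lborel_shift) measurable
        finally show ?thesis by simp
      qed
      also have "\<dots> \<le> (\<integral>\<^sup>+y. ennreal (cmod (\<phi> y)) * ennreal B \<partial>lborel)"
        by (intro nn_integral_mono mult_left_mono B) auto
      also have "\<dots> < \<infinity>"
        using \<phi> by (simp add: nn_integral_multc integrable_iff_bounded ennreal_mult_less_top)
      finally show "(\<integral>\<^sup>+x. \<integral>\<^sup>+y. ennreal (cmod (f x * (\<phi> y * ?K (x - y)))) \<partial>lborel \<partial>lborel) < \<infinity>" .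
    qed measurable
    also have "\<dots> = (LINT y|lborel. ?g y * \<phi> y)"
    proof (intro Bochner_Integration.integral_cong refl)
      fix y
      have "(LINT x|lborel. f x * (\<phi> y * ?K (x - y))) = (LINT x|lborel. (?K (x - y) * f x) * \<phi> y)"
        by (simp add: mult_ac)
      also have "\<dots> = (LINT x|lborel. ?K (x - y) * f x) * \<phi> y"
        by (rule integral_mult_left_zero)
      also have "(LINT x|lborel. ?K (x - y) * f x) = (LINT w|lborel. ?K ((w + y) - y) * f (w + y))"
        by (rule integral_lborel_shift[symmetric]) measurable
      also have "\<dots> = ?g y" by (simp add: conv2_def add.commute)
      finally show "(LINT x|lborel. f x * (\<phi> y * ?K (x - y))) = ?g y * \<phi> y" .
    qed
    finally show "lp_block_distr chi rho j k (distr_of f) \<phi> = distr_of ?g \<phi>"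
      by (simp add: distr_of_def)
  qed
  show ?thesis
    unfolding lp_block_def
    by (rule the_equality) (use cont rep represents_unique in blast)+
qed

end

subsection \<open>Continuity of translations in the mean\<close>

lemma ennreal_tendsto_0_le:
  fixes u v :: "nat \<Rightarrow> ennreal"
  assumes "v \<longlonglongrightarrow> 0" "\<And>n. u n \<le> v n"
  shows "u \<longlonglongrightarrow> 0"
  by (rule tendsto_sandwich[OF always_eventually always_eventually tendsto_const assms(1)]) (simp_all add: assms(2))

lemma nn_integral_translation_triangle:
  fixes f g :: "'a :: euclidean_space \<Rightarrow> complex"
  assumes [measurable]: "f \<in> borel_measurable borel" "g \<in> borel_measurable borel"
  shows "(\<integral>\<^sup>+z. ennreal (cmod (f (z + h) - f z)) \<partial>lborel)
    \<le> (\<integral>\<^sup>+z. ennreal (cmod (g (z + h) - g z)) \<partial>lborel) + 2 * (\<integral>\<^sup>+z. ennreal (cmod (f z - g z)) \<partial>lborel)"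
proof -
  have "(\<integral>\<^sup>+z. ennreal (cmod (f (z + h) - f z)) \<partial>lborel)
    \<le> (\<integral>\<^sup>+z. ennreal (cmod (g (z + h) - g z)) + (ennreal (cmod (f (z + h) - g (z + h))) + ennreal (cmod (f z - g z))) \<partial>lborel)"
  proof (rule nn_integral_mono)
    fix z
    have "cmod (P + (Q - R)) \<le> cmod P + (cmod Q + cmod R)" for P Q R :: complex
      by (rule order_trans[OF norm_triangle_ineq add_left_mono[OF norm_triangle_ineq4]])
    from this[of "g (z + h) - g z" "f (z + h) - g (z + h)" "f z - g z"]
    have "cmod (f (z + h) - f z) \<le> cmod (g (z + h) - g z) + (cmod (f (z + h) - g (z + h)) + cmod (f z - g z))"
      by simp
    then show "ennreal (cmod (f (z + h) - f z))
      \<le> ennreal (cmod (g (z + h) - g z)) + (ennreal (cmod (f (z + h) - g (z + h))) + ennreal (cmod (f z - g z)))"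
      by (simp flip: ennreal_plus)
  qed
  also have "\<dots> = (\<integral>\<^sup>+z. ennreal (cmod (g (z + h) - g z)) \<partial>lborel)
     + ((\<integral>\<^sup>+z. ennreal (cmod (f (z + h) - g (z + h))) \<partial>lborel) + (\<integral>\<^sup>+z. ennreal (cmod (f z - g z)) \<partial>lborel))"
    by (simp add: nn_integral_add)
  also have "(\<integral>\<^sup>+z. ennreal (cmod (f (z + h) - g (z + h))) \<partial>lborel) = (\<integral>\<^sup>+z. ennreal (cmod (f z - g z)) \<partial>lborel)"
    by (rule nn_integral_lborel_shift) measurable
  finally show ?thesis by (simp add: mult_2)
qed

text \<open>The translation error vanishes also for L1 limits: an approximant costs twice its
  distance, so three portions of \<open>e / 4\<close> stay below \<open>e\<close>.\<close>

lemma translation_tendsto_approx: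
  fixes f :: "'a :: euclidean_space \<Rightarrow> complex"
  assumes [measurable]: "f \<in> borel_measurable borel"
    and ap: "\<And>\<epsilon>. 0 < \<epsilon> \<Longrightarrow> \<exists>g\<in>borel_measurable borel. (\<integral>\<^sup>+z. ennreal (cmod (f z - g z)) \<partial>lborel) \<le> ennreal \<epsilon> \<and>
      (\<lambda>n. \<integral>\<^sup>+z. ennreal (cmod (g (z + h n) - g z)) \<partial>lborel) \<longlonglongrightarrow> 0"
  shows "(\<lambda>n :: nat. \<integral>\<^sup>+z. ennreal (cmod (f (z + h n) - f z)) \<partial>lborel) \<longlonglongrightarrow> 0"
proof (rule order_tendstoI)
  fix a :: ennreal assume "0 < a"
  then obtain e where e: "0 < e" "ennreal e < a"
    by (metis dense ennreal_cases ennreal_less_zero_iff order.strict_trans top.not_eq_extremum less_imp_neq)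
  obtain g where g[measurable]: "g \<in> borel_measurable borel" "(\<integral>\<^sup>+z. ennreal (cmod (f z - g z)) \<partial>lborel) \<le> ennreal (e / 4)"
    "(\<lambda>n. \<integral>\<^sup>+z. ennreal (cmod (g (z + h n) - g z)) \<partial>lborel) \<longlonglongrightarrow> 0"
    using ap[of "e / 4"] e by auto
  have "\<forall>\<^sub>F n in sequentially. (\<integral>\<^sup>+z. ennreal (cmod (g (z + h n) - g z)) \<partial>lborel) < ennreal (e / 4)"
    by (rule order_tendstoD(2)[OF g(3)]) (use e in simp)
  then show "\<forall>\<^sub>F n in sequentially. (\<integral>\<^sup>+z. ennreal (cmod (f (z + h n) - f z)) \<partial>lborel) < a"
  proof eventually_elim
    case (elim n)
    have "(\<integral>\<^sup>+z. ennreal (cmod (f (z + h n) - f z)) \<partial>lborel) \<le> ennreal (e / 4) + 2 * ennreal (e / 4)"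
      by (rule order_trans[OF nn_integral_translation_triangle[of f g]])
        (use elim g in \<open>auto intro!: add_mono mult_left_mono\<close>)
    also have "\<dots> = ennreal (e / 4) + ennreal 2 * ennreal (e / 4)" by simp
    also have "\<dots> = ennreal (3 * e / 4)"
      using e by (simp del: ennreal_numeral flip: ennreal_mult ennreal_plus)
    also have "\<dots> \<le> ennreal e" using e by (intro ennreal_leI) simp
    also have "\<dots> < a" by (rule e)
    finally show ?case .
  qed
qed simp

text \<open>For an open set the integral of the signed difference vanishes, so only the
  points that are moved out of the set matter; these disappear in the limit.\<close>

lemma translation_tendsto_open:
  fixes U :: "'a :: euclidean_space set"
  assumes U: "open U" "emeasure lborel U < \<infinity>" and h: "h \<longlonglongrightarrow> 0"
  shows "(\<lambda>n :: nat. \<integral>\<^sup>+z. ennreal (cmod (indicator U (z + h n) *\<^sub>R c - indicator U z *\<^sub>R c)) \<partial>lborel) \<longlonglongrightarrow> 0"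
proof -
  have [measurable]: "U \<in> sets borel" using U by auto
  define out where "out = (\<lambda>n z. indicator U z * indicator (- U) (z + h n) :: ennreal)"
  have [measurable]: "out n \<in> borel_measurable borel" for n unfolding out_def by measurable
  have fin: "(\<integral>\<^sup>+z. out n z \<partial>lborel) \<le> emeasure lborel U" for n
  proof -
    have "(\<integral>\<^sup>+z. out n z \<partial>lborel) \<le> (\<integral>\<^sup>+z. indicator U z \<partial>lborel)"
      unfolding out_def by (intro nn_integral_mono) (auto split: split_indicator)
    then show ?thesis by simp
  qed
  \<comment> \<open>Points entering \<open>U\<close> and points leaving it have equal measure,
    because \<open>U\<close> and its translate do; the common part is finite and cancels.\<close>
  have sym: "(\<integral>\<^sup>+z. indicator U (z + h n) * indicator (- U) z \<partial>lborel) = (\<integral>\<^sup>+z. out n z \<partial>lborel)" for n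
  proof -
    let ?i = "\<integral>\<^sup>+z. indicator U z * indicator U (z + h n) \<partial>lborel"
    have "?i \<le> emeasure lborel U"
    proof -
      have "?i \<le> (\<integral>\<^sup>+z. indicator U z \<partial>lborel)"
        by (intro nn_integral_mono) (auto split: split_indicator)
      then show ?thesis by simp
    qed
    then have i: "?i \<noteq> top" using U(2) by (auto simp: top_unique)
    have "?i + (\<integral>\<^sup>+z. indicator U (z + h n) * indicator (- U) z \<partial>lborel)
       = (\<integral>\<^sup>+z. indicator U z * indicator U (z + h n) + indicator U (z + h n) * indicator (- U) z \<partial>lborel)"
      by (rule nn_integral_add[symmetric]) measurable
    also have "\<dots> = (\<integral>\<^sup>+z. indicator U (z + h n) \<partial>lborel)"
      by (intro nn_integral_cong) (auto split: split_indicator)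
    also have "\<dots> = (\<integral>\<^sup>+z. indicator U z \<partial>lborel)"
      by (rule nn_integral_lborel_shift) measurable
    also have "\<dots> = (\<integral>\<^sup>+z. indicator U z * indicator U (z + h n) + out n z \<partial>lborel)"
      unfolding out_def by (intro nn_integral_cong) (auto split: split_indicator)
    also have "\<dots> = ?i + (\<integral>\<^sup>+z. out n z \<partial>lborel)"
      by (rule nn_integral_add) measurable
    finally show ?thesis using i by (simp add: ennreal_add_left_cancel)
  qed
  have lim: "(\<lambda>n. \<integral>\<^sup>+z. out n z \<partial>lborel) \<longlonglongrightarrow> (\<integral>\<^sup>+z. 0 \<partial>(lborel :: 'a measure))"
  proof (rule nn_integral_dominated_convergence[where w="indicator U :: 'a \<Rightarrow> ennreal"])
    show "AE z in lborel. (\<lambda>n. out n z) \<longlonglongrightarrow> 0"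
    proof (rule AE_I2)
      fix z
      show "(\<lambda>n. out n z) \<longlonglongrightarrow> 0"
      proof (cases "z \<in> U")
        case True
        \<comment> \<open>Openness enters here: a point of \<open>U\<close> is eventually not moved
          out of it.\<close>
        have "(\<lambda>n. z + h n) \<longlonglongrightarrow> z + 0" by (intro tendsto_intros h)
        then have "\<forall>\<^sub>F n in sequentially. z + h n \<in> U"
          using topological_tendstoD[OF _ U(1)] True by simp
        then have "\<forall>\<^sub>F n in sequentially. out n z = 0"
          by eventually_elim (simp add: out_def)
        then show ?thesis by (rule tendsto_eventually)
      qed (simp add: out_def)
    qed
    show "(\<integral>\<^sup>+z. indicator U z \<partial>lborel) < \<infinity>" using U by simp
  qed (auto simp: out_def split: split_indicator)
  have "(\<integral>\<^sup>+z. ennreal (cmod (indicator U (z + h n) *\<^sub>R c - indicator U z *\<^sub>R c)) \<partial>lborel)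
     = ennreal (cmod c) * (2 * (\<integral>\<^sup>+z. out n z \<partial>lborel))" for n
  proof -
    have "(\<integral>\<^sup>+z. ennreal (cmod (indicator U (z + h n) *\<^sub>R c - indicator U z *\<^sub>R c)) \<partial>lborel)
      = (\<integral>\<^sup>+z. ennreal (cmod c) * (out n z + indicator U (z + h n) * indicator (- U) z) \<partial>lborel)"
      unfolding out_def by (intro nn_integral_cong) (auto split: split_indicator)
    also have "\<dots> = ennreal (cmod c) * ((\<integral>\<^sup>+z. out n z \<partial>lborel) + (\<integral>\<^sup>+z. indicator U (z + h n) * indicator (- U) z \<partial>lborel))"
      by (simp add: nn_integral_cmult nn_integral_add)
    finally show ?thesis by (simp add: sym mult_2)
  qed
  moreover have "(\<lambda>n. ennreal (cmod c) * (2 * (\<integral>\<^sup>+z. out n z \<partial>lborel))) \<longlonglongrightarrow> ennreal (cmod c) * (2 * 0)"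
    using lim by (intro tendsto_intros ennreal_tendsto_cmult) auto
  ultimately show ?thesis by simp
qed

text \<open>Induction over integrable functions; an indicator is reduced to that of an open superset
  by outer regularity of Lebesgue measure.\<close>

lemma translation_tendsto:
  fixes f :: "'a :: euclidean_space \<Rightarrow> complex"
  assumes "integrable lborel f" and h: "h \<longlonglongrightarrow> 0"
  shows "(\<lambda>n :: nat. \<integral>\<^sup>+z. ennreal (cmod (f (z + h n) - f z)) \<partial>lborel) \<longlonglongrightarrow> 0"
  using assms(1)
proof (induction rule: integrable_induct)
  case (base A c)
  then have [measurable]: "A \<in> sets borel" by simp
  show ?case
  proof (rule translation_tendsto_approx)
    fix \<epsilon> :: real assume "0 < \<epsilon>"
    \<comment> \<open>The added 1 avoids a division by 0 when \<open>c\<close> is 0, and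
      \<open>cmod c * e\<close> stays below \<epsilon>.\<close>
    define e where "e = \<epsilon> / (cmod c + 1)"
    have e: "0 < e" using \<open>0 < \<epsilon>\<close> by (simp add: e_def add_nonneg_pos)
    obtain U where U: "open U" "A \<subseteq> U" "U - A \<in> lmeasurable" "emeasure lebesgue (U - A) < ennreal e"
      using sets_lebesgue_outer_open[of A e] e by (auto simp: sets_completionI_sets)
    have [measurable]: "U \<in> sets borel" using U by auto
    have UA: "emeasure lborel (U - A) \<le> ennreal e"
      using U(4) by (simp add: emeasure_completion less_imp_le)
    have "emeasure lborel U \<le> emeasure lborel A + emeasure lborel (U - A)"
    proof -
      have "U = A \<union> (U - A)" using U(2) by auto
      then show ?thesis using emeasure_subadditive[of A lborel "U - A"] by simp
    qed
    also have "\<dots> < \<infinity>" using base(2) UA by (auto simp: less_top[symmetric] top_unique)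
    finally have Ufin: "emeasure lborel U < \<infinity>" .
    show "\<exists>g\<in>borel_measurable borel. (\<integral>\<^sup>+z. ennreal (cmod (indicator A z *\<^sub>R c - g z)) \<partial>lborel) \<le> ennreal \<epsilon> \<and>
      (\<lambda>n. \<integral>\<^sup>+z. ennreal (cmod (g (z + h n) - g z)) \<partial>lborel) \<longlonglongrightarrow> 0"
    proof (intro bexI[of _ "\<lambda>z. indicator U z *\<^sub>R c"] conjI)
      have "(\<integral>\<^sup>+z. ennreal (cmod (indicator A z *\<^sub>R c - indicator U z *\<^sub>R c)) \<partial>lborel)
        = (\<integral>\<^sup>+z. ennreal (cmod c) * indicator (U - A) z \<partial>lborel)"
        using U(2) by (intro nn_integral_cong) (auto split: split_indicator)
      also have "\<dots> = ennreal (cmod c) * emeasure lborel (U - A)"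
        by (rule nn_integral_cmult_indicator) measurable
      also have "\<dots> \<le> ennreal (cmod c) * ennreal e" by (intro mult_left_mono UA) auto
      also have "\<dots> \<le> ennreal \<epsilon>"
      proof -
        have p: "0 < cmod c + 1" using norm_ge_zero[of c] by linarith
        have "cmod c * e \<le> \<epsilon>" unfolding e_def using p \<open>0 < \<epsilon>\<close> by (simp add: field_simps)
        then show ?thesis using e by (simp add: ennreal_leI flip: ennreal_mult)
      qed
      finally show "(\<integral>\<^sup>+z. ennreal (cmod (indicator A z *\<^sub>R c - indicator U z *\<^sub>R c)) \<partial>lborel) \<le> ennreal \<epsilon>" .
      show "(\<lambda>n. \<integral>\<^sup>+z. ennreal (cmod (indicator U (z + h n) *\<^sub>R c - indicator U z *\<^sub>R c)) \<partial>lborel) \<longlonglongrightarrow> 0"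
        by (rule translation_tendsto_open[OF U(1) Ufin h])
    qed measurable
  qed measurable
next
  case (add f g)
  then have [measurable]: "f \<in> borel_measurable borel" "g \<in> borel_measurable borel" by auto
  have le: "(\<integral>\<^sup>+z. ennreal (cmod (f (z + h n) + g (z + h n) - (f z + g z))) \<partial>lborel)
    \<le> (\<integral>\<^sup>+z. ennreal (cmod (f (z + h n) - f z)) \<partial>lborel) + (\<integral>\<^sup>+z. ennreal (cmod (g (z + h n) - g z)) \<partial>lborel)" for n
  proof -
    have "(\<integral>\<^sup>+z. ennreal (cmod (f (z + h n) + g (z + h n) - (f z + g z))) \<partial>lborel)
      \<le> (\<integral>\<^sup>+z. ennreal (cmod (f (z + h n) - f z)) + ennreal (cmod (g (z + h n) - g z)) \<partial>lborel)"
      by (intro nn_integral_mono) (simp add: norm_diff_triangle_ineq flip: ennreal_plus)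
    also have "\<dots> = (\<integral>\<^sup>+z. ennreal (cmod (f (z + h n) - f z)) \<partial>lborel) + (\<integral>\<^sup>+z. ennreal (cmod (g (z + h n) - g z)) \<partial>lborel)"
      by (rule nn_integral_add) measurable
    finally show ?thesis .
  qed
  have "(\<lambda>n. (\<integral>\<^sup>+z. ennreal (cmod (f (z + h n) - f z)) \<partial>lborel) + (\<integral>\<^sup>+z. ennreal (cmod (g (z + h n) - g z)) \<partial>lborel)) \<longlonglongrightarrow> 0 + 0"
    by (intro tendsto_add add.IH)
  then show ?case
    using ennreal_tendsto_0_le[OF _ le] by simp
next
  case (lim f s)
  have [measurable]: "f \<in> borel_measurable borel" "\<And>i. s i \<in> borel_measurable borel"
    using lim.hyps(1,4) by auto
  show ?case
  proof (rule translation_tendsto_approx)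
    fix \<epsilon> :: real assume \<epsilon>: "0 < \<epsilon>"
    have "(\<lambda>i. \<integral>\<^sup>+z. ennreal (cmod (f z - s i z)) \<partial>lborel) \<longlonglongrightarrow> (\<integral>\<^sup>+z. 0 \<partial>(lborel :: 'a measure))"
    proof (rule nn_integral_dominated_convergence[where w="\<lambda>z. ennreal (3 * cmod (f z))"])
      show "AE z in lborel. ennreal (cmod (f z - s i z)) \<le> ennreal (3 * cmod (f z))" for i
      proof (intro AE_I2 ennreal_leI)
        fix z
        have "cmod (f z - s i z) \<le> cmod (f z) + cmod (s i z)" by (rule norm_triangle_ineq4)
        then show "cmod (f z - s i z) \<le> 3 * cmod (f z)" using lim.hyps(3)[of z i] by simp
      qed
      show "(\<integral>\<^sup>+z. ennreal (3 * cmod (f z)) \<partial>lborel) < \<infinity>"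
        using lim.hyps(4) by (simp add: ennreal_mult nn_integral_cmult integrable_iff_bounded ennreal_mult_less_top)
      show "AE z in lborel. (\<lambda>i. ennreal (cmod (f z - s i z))) \<longlonglongrightarrow> 0"
      proof (rule AE_I2)
        fix z
        have "(\<lambda>i. cmod (f z - s i z)) \<longlonglongrightarrow> cmod (f z - f z)"
          by (intro tendsto_intros lim.hyps(2)) simp
        then show "(\<lambda>i. ennreal (cmod (f z - s i z))) \<longlonglongrightarrow> 0"
          by (metis diff_self ennreal_0 norm_zero tendsto_ennrealI)
      qed
    qed auto
    then have "\<forall>\<^sub>F i in sequentially. (\<integral>\<^sup>+z. ennreal (cmod (f z - s i z)) \<partial>lborel) < ennreal \<epsilon>"
      by (rule order_tendstoD(2)) (use \<epsilon> in simp)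
    then obtain i where "(\<integral>\<^sup>+z. ennreal (cmod (f z - s i z)) \<partial>lborel) < ennreal \<epsilon>"
      by (auto simp: eventually_sequentially)
    then show "\<exists>g\<in>borel_measurable borel. (\<integral>\<^sup>+z. ennreal (cmod (f z - g z)) \<partial>lborel) \<le> ennreal \<epsilon> \<and>
      (\<lambda>n. \<integral>\<^sup>+z. ennreal (cmod (g (z + h n) - g z)) \<partial>lborel) \<longlonglongrightarrow> 0"
      using lim.IH[of i] by (intro bexI[of _ "s i"]) auto
  qed measurable
qed

text \<open>Only the product \<open>F\<close> of weight and \<open>f\<close> is integrable.
  Translating \<open>F\<close> instead of \<open>f\<close> leaves a commutator, the difference of
  the weight at two points times \<open>f\<close>; a change of variable moves the translation to the
  weight, and dominated convergence applies.\<close>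

lemma weighted_translation_tendsto:
  assumes f: "weighted_L1 f" and h: "h \<longlonglongrightarrow> 0"
  shows "(\<lambda>n :: nat. \<integral>\<^sup>+z. ennreal (cw (fst z) * cw (snd z)) * ennreal (cmod (f (z + h n) - f z)) \<partial>lborel) \<longlonglongrightarrow> 0"
proof -
  have [measurable]: "f \<in> borel_measurable borel" using f by measurable
  define W where "W = (\<lambda>z :: real \<times> real. cw (fst z) * cw (snd z))"
  have [measurable]: "W \<in> borel_measurable borel" unfolding W_def by measurable
  have W0: "0 \<le> W z" for z by (simp add: W_def)
  define F where "F = (\<lambda>z. of_real (W z) * f z)"
  obtain B where B: "0 \<le> B" "\<And>c. (\<integral>\<^sup>+z. ennreal (cw (fst z) * cw (snd z)) * ennreal (cmod (f (z + c))) \<partial>lborel) \<le> ennreal B"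
    using f by (rule weighted_L1_bound) blast
  have Wf: "(\<integral>\<^sup>+z. ennreal (W z) * ennreal (cmod (f z)) \<partial>lborel) < \<infinity>"
    using B(2)[of 0] by (auto simp: W_def less_top[symmetric] top_unique)
  have F: "integrable lborel F"
    unfolding F_def by (rule integrableI_bounded) (use Wf W0 in \<open>auto simp: norm_mult ennreal_mult\<close>)
  have "Bseq h" using h by (intro convergent_imp_Bseq convergentI)
  then obtain M where M: "0 < M" "\<And>n. norm (h n) \<le> M" by (auto simp: Bseq_def)
  define K where "K = (2 * (1 + M\<^sup>2))\<^sup>2"
  have Wshift: "W (z - h n) \<le> K * W z" for z n
  proof -
    have "\<bar>fst (h n)\<bar> \<le> M" "\<bar>snd (h n)\<bar> \<le> M"
      using norm_fst_le[of "fst (h n)" "snd (h n)"] norm_snd_le[of "snd (h n)" "fst (h n)"] M(2)[of n] by auto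
    then have "W (z - h n) \<le> (2 * (1 + M\<^sup>2) * cw (fst z)) * (2 * (1 + M\<^sup>2) * cw (snd z))"
      unfolding W_def fst_diff snd_diff by (intro mult_mono cw_shift_le) simp_all
    then show ?thesis by (simp add: K_def W_def power2_eq_square mult_ac)
  qed
  have K0: "0 \<le> K" by (simp add: K_def)
  have le: "(\<integral>\<^sup>+z. ennreal (W z) * ennreal (cmod (f (z + h n) - f z)) \<partial>lborel)
    \<le> (\<integral>\<^sup>+z. ennreal (cmod (F (z + h n) - F z)) \<partial>lborel)
      + (\<integral>\<^sup>+z. ennreal (\<bar>W (z - h n) - W z\<bar>) * ennreal (cmod (f z)) \<partial>lborel)" for n
  proof -
    have "(\<integral>\<^sup>+z. ennreal (W z) * ennreal (cmod (f (z + h n) - f z)) \<partial>lborel)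
      \<le> (\<integral>\<^sup>+z. ennreal (cmod (F (z + h n) - F z)) + ennreal (\<bar>W z - W (z + h n)\<bar>) * ennreal (cmod (f (z + h n))) \<partial>lborel)"
    proof (rule nn_integral_mono)
      fix z
      have "of_real (W z) * (f (z + h n) - f z) = (F (z + h n) - F z) + of_real (W z - W (z + h n)) * f (z + h n)"
        by (simp add: F_def algebra_simps)
      then have "cmod (of_real (W z) * (f (z + h n) - f z))
        \<le> cmod (F (z + h n) - F z) + cmod (of_real (W z - W (z + h n)) * f (z + h n))"
        by (metis norm_triangle_ineq)
      then have "W z * cmod (f (z + h n) - f z)
        \<le> cmod (F (z + h n) - F z) + \<bar>W z - W (z + h n)\<bar> * cmod (f (z + h n))"
        using W0[of z] by (simp only: norm_mult norm_of_real abs_of_nonneg)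
      then show "ennreal (W z) * ennreal (cmod (f (z + h n) - f z))
        \<le> ennreal (cmod (F (z + h n) - F z)) + ennreal (\<bar>W z - W (z + h n)\<bar>) * ennreal (cmod (f (z + h n)))"
        using W0[of z] by (simp add: ennreal_leI flip: ennreal_mult ennreal_plus)
    qed
    also have "\<dots> = (\<integral>\<^sup>+z. ennreal (cmod (F (z + h n) - F z)) \<partial>lborel)
       + (\<integral>\<^sup>+z. ennreal (\<bar>W ((z + h n) - h n) - W (z + h n)\<bar>) * ennreal (cmod (f (z + h n))) \<partial>lborel)"
      unfolding F_def by (subst nn_integral_add) auto
    also have "(\<integral>\<^sup>+z. ennreal (\<bar>W ((z + h n) - h n) - W (z + h n)\<bar>) * ennreal (cmod (f (z + h n))) \<partial>lborel)
       = (\<integral>\<^sup>+z. ennreal (\<bar>W (z - h n) - W z\<bar>) * ennreal (cmod (f z)) \<partial>lborel)"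
      by (rule nn_integral_lborel_shift) measurable
    finally show ?thesis .
  qed
  have "(\<lambda>n. \<integral>\<^sup>+z. ennreal (\<bar>W (z - h n) - W z\<bar>) * ennreal (cmod (f z)) \<partial>lborel) \<longlonglongrightarrow> (\<integral>\<^sup>+z. 0 \<partial>(lborel :: (real \<times> real) measure))"
  proof (rule nn_integral_dominated_convergence[where w="\<lambda>z. ennreal (K + 1) * (ennreal (W z) * ennreal (cmod (f z)))"])
    show "AE z in lborel. ennreal \<bar>W (z - h n) - W z\<bar> * ennreal (cmod (f z)) \<le> ennreal (K + 1) * (ennreal (W z) * ennreal (cmod (f z)))" for n
    proof (rule AE_I2)
      fix z
      have "\<bar>W (z - h n) - W z\<bar> \<le> (K + 1) * W z"
        using Wshift[of z n] W0[of z] W0[of "z - h n"] K0 by (simp add: algebra_simps abs_if)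
      then have "\<bar>W (z - h n) - W z\<bar> * cmod (f z) \<le> (K + 1) * W z * cmod (f z)"
        by (rule mult_right_mono) simp
      then have "ennreal (\<bar>W (z - h n) - W z\<bar> * cmod (f z)) \<le> ennreal ((K + 1) * W z * cmod (f z))"
        by (rule ennreal_leI)
      then show "ennreal \<bar>W (z - h n) - W z\<bar> * ennreal (cmod (f z)) \<le> ennreal (K + 1) * (ennreal (W z) * ennreal (cmod (f z)))"
        using W0[of z] K0 by (simp add: ennreal_mult mult.assoc)
    qed
    show "(\<integral>\<^sup>+z. ennreal (K + 1) * (ennreal (W z) * ennreal (cmod (f z))) \<partial>lborel) < \<infinity>"
      using Wf by (subst nn_integral_cmult) (auto simp: ennreal_mult_less_top)
    show "AE z in lborel. (\<lambda>n. ennreal \<bar>W (z - h n) - W z\<bar> * ennreal (cmod (f z))) \<longlonglongrightarrow> 0"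
    proof (rule AE_I2)
      fix z
      have "continuous_on UNIV W"
        unfolding W_def cw_def by (intro continuous_intros) (auto simp: add_nonneg_eq_0_iff)
      moreover have "(\<lambda>n. z - h n) \<longlonglongrightarrow> z - 0" by (intro tendsto_intros h)
      ultimately have "(\<lambda>n. W (z - h n)) \<longlonglongrightarrow> W z"
        using continuous_on_tendsto_compose[of UNIV W "\<lambda>n. z - h n" z] by simp
      then have "(\<lambda>n. \<bar>W (z - h n) - W z\<bar> * cmod (f z)) \<longlonglongrightarrow> \<bar>W z - W z\<bar> * cmod (f z)"
        by (intro tendsto_intros)
      then have "(\<lambda>n. ennreal (\<bar>W (z - h n) - W z\<bar> * cmod (f z))) \<longlonglongrightarrow> ennreal (\<bar>W z - W z\<bar> * cmod (f z))"
        by (rule tendsto_ennrealI)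
      then show "(\<lambda>n. ennreal \<bar>W (z - h n) - W z\<bar> * ennreal (cmod (f z))) \<longlonglongrightarrow> 0"
        by (simp add: ennreal_mult)
    qed
  qed measurable
  then have "(\<lambda>n. (\<integral>\<^sup>+z. ennreal (cmod (F (z + h n) - F z)) \<partial>lborel)
      + (\<integral>\<^sup>+z. ennreal (\<bar>W (z - h n) - W z\<bar>) * ennreal (cmod (f z)) \<partial>lborel)) \<longlonglongrightarrow> 0 + 0"
    by (intro tendsto_add translation_tendsto[OF F h]) simp
  then show ?thesis
    using ennreal_tendsto_0_le[OF _ le] by (simp add: W_def)
qed

lemma AE_lborel_shift:
  fixes c :: "'a :: euclidean_space"
  assumes "AE z in lborel. P z"
  shows "AE z in lborel. P (z + c)"
proof -
  have "AE z in distr lborel borel ((+) c). P z" by (subst lborel_distr_plus) (rule assms)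
  then have "AE z in lborel. P (c + z)" by (rule AE_distrD[rotated]) simp
  then show ?thesis by (simp add: add.commute)
qed

subsection \<open>Reconstruction from the blocks\<close>

context dyadic
begin

text \<open>The low-pass kernels have integral one and concentrate by dilation. The error is
  measured in the weighted L1 space because in the mixed norm it need not vanish for infinite
  exponents.\<close>

lemma klow_approx_tendsto:
  assumes f: "weighted_L1 f"
  shows "(\<lambda>n :: nat. \<integral>\<^sup>+z. ennreal (cw (fst z) * cw (snd z))
    * ennreal (cmod (conv2 (klow (int n)) (klow (int n)) f z - f z)) \<partial>lborel) \<longlonglongrightarrow> 0"
proof -
  have [measurable]: "f \<in> borel_measurable borel" using f by measurable
  let ?W = "\<lambda>z :: real \<times> real. ennreal (cw (fst z) * cw (snd z))"
  \<comment> \<open>The weighted L1 modulus of continuity of \<open>f\<close>. It is bounded by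
    \<open>2 * B\<close> and tends to 0 along null sequences, as dominated convergence
    requires.\<close>
  define D where "D = (\<lambda>v. \<integral>\<^sup>+z. ?W z * ennreal (cmod (f (z + v) - f z)) \<partial>lborel)"
  have [measurable]: "D \<in> borel_measurable borel" unfolding D_def by measurable
  obtain B where B: "0 \<le> B" "\<And>c. (\<integral>\<^sup>+z. ?W z * ennreal (cmod (f (z + c))) \<partial>lborel) \<le> ennreal B"
    using f by (rule weighted_L1_bound) blast
  have DB: "D v \<le> ennreal (2 * B)" for v
  proof -
    have "D v \<le> (\<integral>\<^sup>+z. ?W z * ennreal (cmod (f (z + v))) + ?W z * ennreal (cmod (f (z + 0))) \<partial>lborel)"
      unfolding D_def
      by (intro nn_integral_mono)
        (simp add: norm_triangle_ineq4 mult_left_mono flip: distrib_left ennreal_plus)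
    also have "\<dots> = (\<integral>\<^sup>+z. ?W z * ennreal (cmod (f (z + v))) \<partial>lborel) + (\<integral>\<^sup>+z. ?W z * ennreal (cmod (f (z + 0))) \<partial>lborel)"
      by (rule nn_integral_add) measurable
    also have "\<dots> \<le> ennreal B + ennreal B" by (intro add_mono B)
    also have "ennreal B + ennreal B = ennreal (2 * B)" using B(1) by (simp flip: ennreal_plus)
    finally show ?thesis .
  qed
  let ?k = "\<lambda>j v. klow j (fst v) * klow j (snd v)"
  have kfin: "(\<integral>\<^sup>+v. ennreal (cmod (?k j v)) \<partial>lborel) < \<infinity>" for j
    using nn_integral_tensor[of "\<lambda>s. ennreal (cmod (klow j s))" "\<lambda>s. ennreal (cmod (klow j s))"]
      decaying_integrable[OF decaying_klow, of j]
    by (simp add: norm_mult ennreal_mult integrable_iff_bounded ennreal_mult_less_top)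
  have kint: "integrable lborel (?k j)" for j
    by (rule integrableI_bounded) (use kfin in auto)
  have k1: "(LINT v|lborel. ?k j v) = 1" for j
    using integral_tensor[OF kint] by (simp add: integral_klow)
  have le: "(\<integral>\<^sup>+z. ?W z * ennreal (cmod (conv2 (klow (int n)) (klow (int n)) f z - f z)) \<partial>lborel)
     \<le> (\<integral>\<^sup>+v. ennreal (cmod (?k 0 v)) * D ((1 / 2 ^ n) *\<^sub>R v) \<partial>lborel)" for n
  proof -
    have "(\<integral>\<^sup>+z. ?W z * ennreal (cmod (conv2 (klow (int n)) (klow (int n)) f z - f z)) \<partial>lborel)
      \<le> (\<integral>\<^sup>+z. ?W z * (\<integral>\<^sup>+v. ennreal (cmod (?k (int n) v)) * ennreal (cmod (f (z + v) - f z)) \<partial>lborel) \<partial>lborel)"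
    proof (intro nn_integral_mono mult_left_mono)
      fix z
      have "conv2 (klow (int n)) (klow (int n)) f z - f z
        = (LINT v|lborel. ?k (int n) v * f (z + v)) - (LINT v|lborel. ?k (int n) v * f z)"
        using k1[of "int n"] by (simp add: conv2_def)
      also have "\<dots> = (LINT v|lborel. ?k (int n) v * f (z + v) - ?k (int n) v * f z)"
        by (intro Bochner_Integration.integral_diff[symmetric] conv2_integrable decaying_klow f
            integrable_mult_left kint)
      finally show "ennreal (cmod (conv2 (klow (int n)) (klow (int n)) f z - f z))
        \<le> (\<integral>\<^sup>+v. ennreal (cmod (?k (int n) v)) * ennreal (cmod (f (z + v) - f z)) \<partial>lborel)"
        using norm_integral_le_nn_integral[of lborel "\<lambda>v. ?k (int n) v * f (z + v) - ?k (int n) v * f z"]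
        by (simp add: norm_mult ennreal_mult flip: right_diff_distrib)
    qed simp
    also have "\<dots> = (\<integral>\<^sup>+z. \<integral>\<^sup>+v. ennreal (cmod (?k (int n) v)) * (?W z * ennreal (cmod (f (z + v) - f z))) \<partial>lborel \<partial>lborel)"
      by (subst nn_integral_cmult[symmetric]) (auto simp: mult_ac)
    also have "\<dots> = (\<integral>\<^sup>+v. \<integral>\<^sup>+z. ennreal (cmod (?k (int n) v)) * (?W z * ennreal (cmod (f (z + v) - f z))) \<partial>lborel \<partial>lborel)"
      by (rule lborel_pair.Fubini'[symmetric]) measurable
    also have "\<dots> = (\<integral>\<^sup>+v. ennreal (cmod (?k (int n) v)) * D v \<partial>lborel)"
      unfolding D_def by (intro nn_integral_cong nn_integral_cmult) measurable
    also have "\<dots> = (\<integral>\<^sup>+x. \<integral>\<^sup>+y. ennreal (cmod (?k (int n) (x, y))) * D (x, y) \<partial>lborel \<partial>lborel)"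
      by (rule nn_integral_lborel_prod) measurable
    \<comment> \<open>A substitution in each variable removes the scale from the kernels and puts it
      into the argument of \<open>D\<close>.\<close>
    also have "\<dots> = (\<integral>\<^sup>+x. \<integral>\<^sup>+y. ennreal (cmod (?k 0 (x, y))) * D (x / 2 ^ n, y / 2 ^ n) \<partial>lborel \<partial>lborel)"
    proof -
      have ky: "(\<integral>\<^sup>+y. ennreal (cmod (?k (int n) (x, y))) * D (x, y) \<partial>lborel)
        = ennreal (cmod (klow (int n) x)) * (\<integral>\<^sup>+y. ennreal (cmod (klow 0 y)) * D (x, y / 2 ^ n) \<partial>lborel)" for x
      proof -
        have m: "(\<lambda>y. ennreal (cmod (?k (int n) (x, y))) * D (x, y)) \<in> borel_measurable borel" by measurable
        have "(\<integral>\<^sup>+y. ennreal (cmod (?k (int n) (x, y))) * D (x, y) \<partial>lborel)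
          = ennreal \<bar>1 / 2 ^ n\<bar> * (\<integral>\<^sup>+y. ennreal (cmod (?k (int n) (x, 0 + 1 / 2 ^ n * y))) * D (x, 0 + 1 / 2 ^ n * y) \<partial>lborel)"
          by (rule nn_integral_real_affine[OF m]) simp
        also have "\<dots> = (\<integral>\<^sup>+y. ennreal \<bar>1 / 2 ^ n\<bar> * (ennreal (cmod (?k (int n) (x, 0 + 1 / 2 ^ n * y))) * D (x, 0 + 1 / 2 ^ n * y)) \<partial>lborel)"
          by (rule nn_integral_cmult[symmetric]) measurable
        also have "\<dots> = (\<integral>\<^sup>+y. ennreal (cmod (klow (int n) x)) * (ennreal (cmod (klow 0 y)) * D (x, y / 2 ^ n)) \<partial>lborel)"
        proof (rule nn_integral_cong)
          fix y
          have "klow (int n) (0 + 1 / 2 ^ n * y) = of_real (2 ^ n) * klow 0 y"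
            using klow_scale[of "int n" "0 + 1 / 2 ^ n * y"] by simp
          then have "\<bar>1 / 2 ^ n\<bar> * cmod (?k (int n) (x, 0 + 1 / 2 ^ n * y)) = cmod (klow (int n) x) * cmod (klow 0 y)"
            by (simp add: norm_mult norm_power)
          then have "ennreal \<bar>1 / 2 ^ n\<bar> * ennreal (cmod (?k (int n) (x, 0 + 1 / 2 ^ n * y)))
              = ennreal (cmod (klow (int n) x)) * ennreal (cmod (klow 0 y))"
            by (simp only: ennreal_mult[symmetric] abs_ge_zero norm_ge_zero)
          then show "ennreal \<bar>1 / 2 ^ n\<bar> * (ennreal (cmod (?k (int n) (x, 0 + 1 / 2 ^ n * y))) * D (x, 0 + 1 / 2 ^ n * y))
              = ennreal (cmod (klow (int n) x)) * (ennreal (cmod (klow 0 y)) * D (x, y / 2 ^ n))"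
            by (simp only: mult.assoc[symmetric]) simp
        qed
        also have "\<dots> = ennreal (cmod (klow (int n) x)) * (\<integral>\<^sup>+y. ennreal (cmod (klow 0 y)) * D (x, y / 2 ^ n) \<partial>lborel)"
          by (rule nn_integral_cmult) measurable
        finally show ?thesis .
      qed
      define G where "G = (\<lambda>x. \<integral>\<^sup>+y. ennreal (cmod (klow 0 y)) * D (x, y / 2 ^ n) \<partial>lborel)"
      have [measurable]: "G \<in> borel_measurable borel" unfolding G_def by measurable
      have "(\<integral>\<^sup>+x. \<integral>\<^sup>+y. ennreal (cmod (?k (int n) (x, y))) * D (x, y) \<partial>lborel \<partial>lborel)
         = (\<integral>\<^sup>+x. ennreal (cmod (klow (int n) x)) * G x \<partial>lborel)"
        unfolding ky G_def ..
      also have "\<dots> = ennreal \<bar>1 / 2 ^ n\<bar> * (\<integral>\<^sup>+x. ennreal (cmod (klow (int n) (0 + 1 / 2 ^ n * x))) * G (0 + 1 / 2 ^ n * x) \<partial>lborel)"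
        by (rule nn_integral_real_affine) simp_all
      also have "\<dots> = (\<integral>\<^sup>+x. ennreal \<bar>1 / 2 ^ n\<bar> * (ennreal (cmod (klow (int n) (0 + 1 / 2 ^ n * x))) * G (0 + 1 / 2 ^ n * x)) \<partial>lborel)"
        by (rule nn_integral_cmult[symmetric]) measurable
      also have "\<dots> = (\<integral>\<^sup>+x. ennreal (cmod (klow 0 x)) * G (x / 2 ^ n) \<partial>lborel)"
      proof (rule nn_integral_cong)
        fix x
        have "klow (int n) (0 + 1 / 2 ^ n * x) = of_real (2 ^ n) * klow 0 x"
          using klow_scale[of "int n" "0 + 1 / 2 ^ n * x"] by simp
        then have "\<bar>1 / 2 ^ n\<bar> * cmod (klow (int n) (0 + 1 / 2 ^ n * x)) = cmod (klow 0 x)"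
          by (simp add: norm_mult norm_power)
        then have "ennreal \<bar>1 / 2 ^ n\<bar> * ennreal (cmod (klow (int n) (0 + 1 / 2 ^ n * x))) = ennreal (cmod (klow 0 x))"
          by (simp only: ennreal_mult[symmetric] abs_ge_zero norm_ge_zero)
        then show "ennreal \<bar>1 / 2 ^ n\<bar> * (ennreal (cmod (klow (int n) (0 + 1 / 2 ^ n * x))) * G (0 + 1 / 2 ^ n * x))
            = ennreal (cmod (klow 0 x)) * G (x / 2 ^ n)"
          by (simp only: mult.assoc[symmetric]) simp
      qed
      also have "\<dots> = (\<integral>\<^sup>+x. \<integral>\<^sup>+y. ennreal (cmod (?k 0 (x, y))) * D (x / 2 ^ n, y / 2 ^ n) \<partial>lborel \<partial>lborel)"
        unfolding G_def by (subst nn_integral_cmult[symmetric]) (auto simp: norm_mult ennreal_mult mult.assoc)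
      finally show ?thesis .
    qed
    also have "\<dots> = (\<integral>\<^sup>+v. ennreal (cmod (?k 0 v)) * D ((1 / 2 ^ n) *\<^sub>R v) \<partial>lborel)"
      by (subst nn_integral_lborel_prod) (auto simp: scaleR_prod_def)
    finally show ?thesis .
  qed
  have "(\<lambda>n. \<integral>\<^sup>+v. ennreal (cmod (?k 0 v)) * D ((1 / 2 ^ n) *\<^sub>R v) \<partial>lborel) \<longlonglongrightarrow> (\<integral>\<^sup>+v. 0 \<partial>(lborel :: (real \<times> real) measure))"
  proof (rule nn_integral_dominated_convergence[where w="\<lambda>v. ennreal (cmod (?k 0 v)) * ennreal (2 * B)"])
    show "AE v in lborel. ennreal (cmod (?k 0 v)) * D ((1 / 2 ^ n) *\<^sub>R v) \<le> ennreal (cmod (?k 0 v)) * ennreal (2 * B)" for n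
      by (intro AE_I2 mult_left_mono DB) auto
    show "(\<integral>\<^sup>+v. ennreal (cmod (?k 0 v)) * ennreal (2 * B) \<partial>lborel) < \<infinity>"
      using kfin[of 0] by (subst nn_integral_multc) (auto simp: ennreal_mult_less_top)
    show "AE v in lborel. (\<lambda>n. ennreal (cmod (?k 0 v)) * D ((1 / 2 ^ n) *\<^sub>R v)) \<longlonglongrightarrow> 0"
    proof (rule AE_I2)
      fix v :: "real \<times> real"
      have "(\<lambda>n. 1 / (2 :: real) ^ n) \<longlonglongrightarrow> 0"
        using LIMSEQ_realpow_zero[of "1/2"] by (simp add: power_one_over)
      then have "(\<lambda>n. (1 / 2 ^ n) *\<^sub>R v) \<longlonglongrightarrow> 0 *\<^sub>R v" by (intro tendsto_intros)
      then have "(\<lambda>n. D ((1 / 2 ^ n) *\<^sub>R v)) \<longlonglongrightarrow> 0"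
        unfolding D_def by (intro weighted_translation_tendsto f) simp
      then have "(\<lambda>n. ennreal (cmod (?k 0 v)) * D ((1 / 2 ^ n) *\<^sub>R v)) \<longlonglongrightarrow> ennreal (cmod (?k 0 v)) * 0"
        by (intro ennreal_tendsto_cmult) auto
      then show "(\<lambda>n. ennreal (cmod (?k 0 v)) * D ((1 / 2 ^ n) *\<^sub>R v)) \<longlonglongrightarrow> 0" by simp
    qed
  qed measurable
  then show ?thesis
    using ennreal_tendsto_0_le[OF _ le] by simp
qed

text \<open>Convergence of the weighted errors in L1 yields a subsequence converging almost
  everywhere; the weight is positive and can be divided out.\<close>

lemma klow_approx_AE:
  assumes f: "weighted_L1 f"
  obtains r where "strict_mono r"
    "AE z in lborel. (\<lambda>n. conv2 (klow (int (r n))) (klow (int (r n))) f z) \<longlonglongrightarrow> f z"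
proof -
  have [measurable]: "f \<in> borel_measurable borel" using f by measurable
  have [measurable]: "conv2 (klow (int n)) (klow (int n)) f \<in> borel_measurable borel" for n
    by (intro conv2_measurable decaying_klow f)
  define W where "W = (\<lambda>z :: real \<times> real. cw (fst z) * cw (snd z))"
  have [measurable]: "W \<in> borel_measurable borel" unfolding W_def by measurable
  have W0: "0 < W z" for z by (simp add: W_def cw_pos)
  define u where "u = (\<lambda>n z. of_real (W z) * (conv2 (klow (int n)) (klow (int n)) f z - f z))"
  have [measurable]: "u n \<in> borel_measurable borel" for n unfolding u_def by measurable
  have nu: "(\<integral>\<^sup>+z. ennreal (cmod (u n z)) \<partial>lborel)
    = (\<integral>\<^sup>+z. ennreal (W z) * ennreal (cmod (conv2 (klow (int n)) (klow (int n)) f z - f z)) \<partial>lborel)" for n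
    using less_imp_le[OF W0] by (simp add: u_def norm_mult ennreal_mult)
  obtain B where B: "0 \<le> B" "\<And>c. (\<integral>\<^sup>+z. ennreal (cw (fst z) * cw (snd z)) * ennreal (cmod (f (z + c))) \<partial>lborel) \<le> ennreal B"
    using f by (rule weighted_L1_bound) blast
  have Wf: "integrable lborel (\<lambda>z. of_real (W z) * f z)"
    by (rule integrableI_bounded)
      (use B(2)[of 0] less_imp_le[OF W0] in \<open>auto simp: norm_mult ennreal_mult W_def less_top[symmetric] top_unique\<close>)
  have Wfin: "integrable lborel W"
    using integrable_cw nn_integral_tensor[of "\<lambda>s. ennreal (cw s)" "\<lambda>s. ennreal (cw s)"] nn_integral_cw
    by (intro integrableI_bounded) (auto simp: W_def ennreal_mult abs_mult ennreal_mult_less_top)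
  have int: "integrable lborel (u n)" for n
  proof -
    obtain B' where B': "0 \<le> B'" "\<And>z. (\<integral>\<^sup>+w. ennreal (cmod (klow (int n) (fst w) * klow (int n) (snd w) * f (z + w))) \<partial>lborel) \<le> ennreal B'"
      using decaying_klow decaying_klow f by (rule conv2_abs_bound) blast
    have c: "cmod (conv2 (klow (int n)) (klow (int n)) f z) \<le> B'" for z
      using order_trans[OF norm_integral_le_nn_integral B'(2)[of z]] B'(1) by (simp add: conv2_def)
    have "integrable lborel (\<lambda>z. of_real (W z) * conv2 (klow (int n)) (klow (int n)) f z)"
      by (rule Bochner_Integration.integrable_bound[of _ "\<lambda>z. W z * B'"])
        (use Wfin c B' less_imp_le[OF W0] in \<open>auto simp: norm_mult abs_mult intro!: mult_left_mono\<close>)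
    then show ?thesis unfolding u_def right_diff_distrib by (intro Bochner_Integration.integrable_diff Wf)
  qed
  have "(\<lambda>n. ennreal (LINT z|lborel. cmod (u n z))) \<longlonglongrightarrow> ennreal 0"
  proof -
    have "ennreal (LINT z|lborel. cmod (u n z)) = (\<integral>\<^sup>+z. ennreal (cmod (u n z)) \<partial>lborel)" for n
      using int[of n] by (subst nn_integral_eq_integral) auto
    then show ?thesis using klow_approx_tendsto[OF f] by (simp add: nu W_def)
  qed
  then have "(\<lambda>n. LINT z|lborel. cmod (u n z)) \<longlonglongrightarrow> 0"
    by (subst (asm) tendsto_ennreal_iff) (auto intro!: always_eventually)
  from tendsto_L1_AE_subseq[OF int this]
  obtain r where r: "strict_mono r" "AE z in lborel. (\<lambda>n. u (r n) z) \<longlonglongrightarrow> 0" by blast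
  have "AE z in lborel. (\<lambda>n. conv2 (klow (int (r n))) (klow (int (r n))) f z) \<longlonglongrightarrow> f z"
    using r(2)
  proof eventually_elim
    case (elim z)
    have "(\<lambda>n. inverse (of_real (W z)) * u (r n) z + f z) \<longlonglongrightarrow> inverse (of_real (W z)) * 0 + f z"
      by (intro tendsto_intros elim)
    moreover have "inverse (of_real (W z)) * u (r n) z + f z = conv2 (klow (int (r n))) (klow (int (r n))) f z" for n
      using less_imp_neq[OF W0[of z]] by (simp add: u_def flip: mult.assoc)
    ultimately show ?case by simp
  qed
  with r(1) that show thesis by blast
qed

lemma conv2_klow_sum:
  assumes f: "weighted_L1 f"
  shows "conv2 (klow (int n)) (klow (int n)) f z
    = (\<Sum>j\<in>{-1..<int n}. \<Sum>k\<in>{-1..<int n}. conv2 (kcut j) (kcut k) f z)"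
proof -
  have "conv2 (klow (int n)) (klow (int n)) f z
    = (LINT w|lborel. (\<Sum>j\<in>{-1..<int n}. \<Sum>k\<in>{-1..<int n}. kcut j (fst w) * kcut k (snd w) * f (z + w)))"
    unfolding conv2_def sum_kcut[symmetric] sum_product by (simp add: sum_distrib_right)
  also have "\<dots> = (\<Sum>j\<in>{-1..<int n}. \<Sum>k\<in>{-1..<int n}. conv2 (kcut j) (kcut k) f z)"
    using conv2_integrable[OF decaying_kcut decaying_kcut f]
    by (simp add: conv2_def Bochner_Integration.integral_sum)
  finally show ?thesis .
qed

lemma gen_incr_sum: "gen_incr e1 e2 h (\<lambda>z. \<Sum>i\<in>I. g i z) z = (\<Sum>i\<in>I. gen_incr e1 e2 h (g i) z)"
  unfolding gen_incr_def by (simp add: sum.distrib sum_subtractf sum_distrib_left)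

text \<open>Null sets are translation invariant, so for almost every \<open>z\<close> the low-pass
  approximations converge at all four points sampled by the increment. Each approximation is a
  finite square sum of blocks and is dominated by the full double sum, which may be
  infinite.\<close>

lemma gen_incr_le_blocks:
  assumes f: "weighted_L1 f"
  shows "AE z in lborel. ennreal (cmod (gen_incr e1 e2 h f z))
    \<le> (\<integral>\<^sup>+j. \<integral>\<^sup>+k. ennreal (cmod (gen_incr e1 e2 h (conv2 (kcut j) (kcut k) f) z))
        \<partial>count_space {-1..} \<partial>count_space {-1..})"
proof -
  obtain r where r: "strict_mono r"
    "AE z in lborel. (\<lambda>n. conv2 (klow (int (r n))) (klow (int (r n))) f z) \<longlonglongrightarrow> f z"
    using klow_approx_AE[OF f] by blast
  show ?thesis
    using r(2) AE_lborel_shift[OF r(2), of h] AE_lborel_shift[OF r(2), of "(0, snd h)"]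
      AE_lborel_shift[OF r(2), of "(fst h, 0)"]
  proof eventually_elim
    case (elim z)
    let ?S = "\<lambda>n. conv2 (klow (int (r n))) (klow (int (r n))) f"
    let ?g = "\<lambda>j k. conv2 (kcut j) (kcut k) f"
    let ?R = "\<integral>\<^sup>+j. \<integral>\<^sup>+k. ennreal (cmod (gen_incr e1 e2 h (?g j k) z)) \<partial>count_space {-1..} \<partial>count_space {-1..}"
    have "(\<lambda>n. gen_incr e1 e2 h (?S n) z) \<longlonglongrightarrow> gen_incr e1 e2 h f z"
      unfolding gen_incr_def by (intro tendsto_intros elim)
    then have lim: "(\<lambda>n. ennreal (cmod (gen_incr e1 e2 h (?S n) z))) \<longlonglongrightarrow> ennreal (cmod (gen_incr e1 e2 h f z))"
      by (intro tendsto_ennrealI tendsto_norm)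
    have le: "ennreal (cmod (gen_incr e1 e2 h (?S n) z)) \<le> ?R" for n
    proof -
      let ?I = "{-1..<int (r n)}"
      have sub: "(\<Sum>k\<in>?I. F k) \<le> (\<integral>\<^sup>+k. F k \<partial>count_space {-1..})" for F :: "int \<Rightarrow> ennreal"
      proof -
        have "(\<Sum>k\<in>?I. F k) = (\<integral>\<^sup>+k. F k \<partial>count_space ?I)"
          by (rule nn_integral_count_space_finite[symmetric]) simp
        also have "\<dots> = (\<integral>\<^sup>+k. F k * indicator ?I k \<partial>count_space UNIV)"
          by (rule nn_integral_count_space_indicator) simp
        also have "\<dots> \<le> (\<integral>\<^sup>+k. F k * indicator {-1..} k \<partial>count_space UNIV)"
          by (intro nn_integral_mono) (auto split: split_indicator)
        also have "\<dots> = (\<integral>\<^sup>+k. F k \<partial>count_space {-1..})"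
          by (rule nn_integral_count_space_indicator[symmetric]) simp
        finally show ?thesis .
      qed
      have "gen_incr e1 e2 h (?S n) z = (\<Sum>j\<in>?I. \<Sum>k\<in>?I. gen_incr e1 e2 h (?g j k) z)"
        unfolding conv2_klow_sum[OF f, abs_def] gen_incr_sum ..
      then have "cmod (gen_incr e1 e2 h (?S n) z) \<le> (\<Sum>j\<in>?I. \<Sum>k\<in>?I. cmod (gen_incr e1 e2 h (?g j k) z))"
        by (auto intro!: order_trans[OF norm_sum] sum_mono)
      then have "ennreal (cmod (gen_incr e1 e2 h (?S n) z)) \<le> ennreal (\<Sum>j\<in>?I. \<Sum>k\<in>?I. cmod (gen_incr e1 e2 h (?g j k) z))"
        by (rule ennreal_leI)
      also have "\<dots> = (\<Sum>j\<in>?I. \<Sum>k\<in>?I. ennreal (cmod (gen_incr e1 e2 h (?g j k) z)))"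
        by (simp add: sum_nonneg)
      also have "\<dots> \<le> (\<Sum>j\<in>?I. (\<integral>\<^sup>+k. ennreal (cmod (gen_incr e1 e2 h (?g j k) z)) \<partial>count_space {-1..}))"
        by (intro sum_mono sub)
      also have "\<dots> \<le> ?R" by (rule sub)
      finally show ?thesis .
    qed
    show ?case by (rule LIMSEQ_le_const2[OF lim]) (use le in blast)
  qed
qed

lemma conv2_klow_kcut:
  assumes f: "weighted_L1 f" and w: "weighted_L1 (conv2 (kcut j) (kcut k) f)" and jk: "-1 \<le> j" "-1 \<le> k"
  shows "conv2 (klow (j + 2)) (klow (k + 2)) (conv2 (kcut j) (kcut k) f) = conv2 (kcut j) (kcut k) f"
  by (subst conv2_conv2[OF decaying_klow decaying_klow decaying_kcut decaying_kcut f]) (simp add: klow_kcut jk)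

text \<open>Dilation reduces the claim to index 0 and the step \<open>x = 2 powi j * h\<close>. For
  |x| \<le> 1 the modulus of continuity of the kernel is integrated against the weight, otherwise
  the triangle inequality suffices.\<close>

lemma klow_modulus:
  obtains C where "0 < C" "\<And>j e h. (\<integral>\<^sup>+s. ennreal (cmod (klow j (s - h) - of_bool e * klow j s)) \<partial>lborel)
    \<le> ennreal (C * (if e then min 1 (2 powi j * \<bar>h\<bar>) else 1))"
proof -
  obtain K where K: "0 < K" "\<And>h x. \<bar>h\<bar> \<le> 1 \<Longrightarrow> cmod (klow 0 (x - h) - klow 0 x) \<le> K * \<bar>h\<bar> * cw x"
    using kern_shift_decay[OF test_fun_lowC[of 0]] unfolding klow_def by blast
  define A where "A = (LINT s|lborel. cmod (klow 0 s))"
  have A: "(\<integral>\<^sup>+s. ennreal (cmod (klow 0 s)) \<partial>lborel) = ennreal A"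
    unfolding A_def using decaying_integrable[OF decaying_klow, of 0]
    by (intro nn_integral_eq_integral) auto
  have A0: "0 \<le> A" by (simp add: A_def)
  \<comment> \<open>\<open>K * pi\<close> pays for short steps, \<open>2 * A\<close> for long ones
    and for the kernel itself.\<close>
  define C where "C = K * pi + 2 * A + 1"
  have C: "0 < C" using K A0 by (simp add: C_def add_pos_nonneg)
  have scale: "(\<integral>\<^sup>+s. ennreal (cmod (klow j (s - h) - c * klow j s)) \<partial>lborel)
      = (\<integral>\<^sup>+s. ennreal (cmod (klow 0 (s - 2 powi j * h) - c * klow 0 s)) \<partial>lborel)" for j h c
  proof -
    define t where "t = (2 :: real) powi j"
    have t: "0 < t" by (simp add: t_def)
    have "(\<integral>\<^sup>+s. ennreal (cmod (klow j (s - h) - c * klow j s)) \<partial>lborel)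
      = ennreal \<bar>1 / t\<bar> * (\<integral>\<^sup>+s. ennreal (cmod (klow j ((0 + 1 / t * s) - h) - c * klow j (0 + 1 / t * s))) \<partial>lborel)"
      by (rule nn_integral_real_affine) (use t in auto)
    also have "\<dots> = (\<integral>\<^sup>+s. ennreal \<bar>1 / t\<bar> * ennreal (cmod (klow j ((0 + 1 / t * s) - h) - c * klow j (0 + 1 / t * s))) \<partial>lborel)"
      by (rule nn_integral_cmult[symmetric]) measurable
    also have "\<dots> = (\<integral>\<^sup>+s. ennreal (cmod (klow 0 (s - t * h) - c * klow 0 s)) \<partial>lborel)"
    proof (rule nn_integral_cong)
      fix s
      have "t * ((0 + 1 / t * s) - h) = s - t * h" "t * (0 + 1 / t * s) = s"
        using t by (simp_all add: right_diff_distrib)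
      then have "klow j ((0 + 1 / t * s) - h) = of_real t * klow 0 (s - t * h)" "klow j (0 + 1 / t * s) = of_real t * klow 0 s"
        using klow_scale[of j "(0 + 1 / t * s) - h"] klow_scale[of j "0 + 1 / t * s"]
        by (simp_all only: t_def[symmetric])
      then have "klow j ((0 + 1 / t * s) - h) - c * klow j (0 + 1 / t * s) = of_real t * (klow 0 (s - t * h) - c * klow 0 s)"
        by (simp add: algebra_simps)
      then show "ennreal \<bar>1 / t\<bar> * ennreal (cmod (klow j ((0 + 1 / t * s) - h) - c * klow j (0 + 1 / t * s)))
        = ennreal (cmod (klow 0 (s - t * h) - c * klow 0 s))"
        using t by (simp only: norm_mult norm_of_real) (simp flip: ennreal_mult)
    qed
    finally show ?thesis by (simp add: t_def)
  qed
  have tri: "(\<integral>\<^sup>+s. ennreal (cmod (klow 0 (s - h) - of_bool e * klow 0 s)) \<partial>lborel)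
     \<le> ennreal (A + of_bool e * A)" for h e
  proof -
    have sh: "(\<integral>\<^sup>+s. ennreal (cmod (klow 0 (s - h))) \<partial>lborel) = ennreal A"
      using nn_integral_lborel_shift[of "\<lambda>s. ennreal (cmod (klow 0 s))" "- h"] A by simp
    have "(\<integral>\<^sup>+s. ennreal (cmod (klow 0 (s - h) - of_bool e * klow 0 s)) \<partial>lborel)
      \<le> (\<integral>\<^sup>+s. ennreal (cmod (klow 0 (s - h))) + ennreal (of_bool e) * ennreal (cmod (klow 0 s)) \<partial>lborel)"
    proof (rule nn_integral_mono)
      fix s
      show "ennreal (cmod (klow 0 (s - h) - of_bool e * klow 0 s))
        \<le> ennreal (cmod (klow 0 (s - h))) + ennreal (of_bool e) * ennreal (cmod (klow 0 s))"
        by (cases e) (auto simp: norm_triangle_ineq4 simp flip: ennreal_plus)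
    qed
    also have "\<dots> = ennreal A + ennreal (of_bool e) * ennreal A"
      by (simp add: nn_integral_add nn_integral_cmult A sh)
    finally show ?thesis using A0 by (simp add: ennreal_mult)
  qed
  have "(\<integral>\<^sup>+s. ennreal (cmod (klow j (s - h) - of_bool e * klow j s)) \<partial>lborel)
    \<le> ennreal (C * (if e then min 1 (2 powi j * \<bar>h\<bar>) else 1))" for j e h
  proof -
    define x where "x = 2 powi j * h"
    have absx: "\<bar>x\<bar> = 2 powi j * \<bar>h\<bar>" by (simp add: x_def abs_mult)
    have "(\<integral>\<^sup>+s. ennreal (cmod (klow 0 (s - x) - of_bool e * klow 0 s)) \<partial>lborel)
      \<le> ennreal (C * (if e then min 1 \<bar>x\<bar> else 1))"
    proof (cases "e \<and> \<bar>x\<bar> \<le> 1")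
      case True
      then have "(\<integral>\<^sup>+s. ennreal (cmod (klow 0 (s - x) - of_bool e * klow 0 s)) \<partial>lborel)
        \<le> (\<integral>\<^sup>+s. ennreal (K * \<bar>x\<bar>) * ennreal (cw s) \<partial>lborel)"
        using K by (intro nn_integral_mono) (simp add: ennreal_leI flip: ennreal_mult)
      also have "\<dots> = ennreal (K * \<bar>x\<bar> * pi)"
        using K by (subst nn_integral_cmult) (auto simp: nn_integral_cw ennreal_mult)
      also have "\<dots> \<le> ennreal (C * \<bar>x\<bar>)"
        using K A0 by (intro ennreal_leI) (simp add: C_def algebra_simps)
      finally show ?thesis using True by simp
    next
      case False
      then have "(if e then min 1 \<bar>x\<bar> else 1) = (1 :: real)" by auto
      moreover have "A + of_bool e * A \<le> C" using A0 K by (cases e) (auto simp: C_def add_increasing)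
      ultimately show ?thesis using order_trans[OF tri ennreal_leI] by simp
    qed
    then show ?thesis by (subst scale) (simp only: x_def[symmetric] absx[symmetric])
  qed
  with C that show thesis by blast
qed

end

subsection \<open>The scale measure and discretisation of scales\<close>

lemma measurable_scaleI: "g \<in> borel_measurable borel \<Longrightarrow> g \<in> borel_measurable (scale_measure_on D)"
  unfolding scale_measure_on_def by (auto intro!: measurable_restrict_space1)

lemma measurable_scale_id: "(\<lambda>h. h) \<in> scale_measure_on D \<rightarrow>\<^sub>M borel"
  unfolding scale_measure_on_def by (auto intro!: measurable_restrict_space1)

lemma measurable_pair_mono:
  assumes "(\<lambda>x. x) \<in> M \<rightarrow>\<^sub>M M'" "(\<lambda>x. x) \<in> N \<rightarrow>\<^sub>M N'" "g \<in> M' \<Otimes>\<^sub>M N' \<rightarrow>\<^sub>M K"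
  shows "g \<in> M \<Otimes>\<^sub>M N \<rightarrow>\<^sub>M K"
proof -
  have "(\<lambda>z. (fst z, snd z)) \<in> M \<Otimes>\<^sub>M N \<rightarrow>\<^sub>M M' \<Otimes>\<^sub>M N'"
    using measurable_compose[OF measurable_fst assms(1)] measurable_compose[OF measurable_snd assms(2)]
    by (intro measurable_Pair) auto
  from measurable_compose[OF this assms(3)] show ?thesis by simp
qed

text \<open>The density is finite everywhere, at the origin because \<open>1 / 0\<close> is
  0.\<close>

lemma sigma_finite_scale:
  assumes "D \<in> sets borel"
  shows "sigma_finite_measure (scale_measure_on D)"
proof -
  interpret R: sigma_finite_measure "restrict_space lborel D"
    using assms by (intro sigma_finite_measure_restrict_space lborel.sigma_finite_measure_axioms) simp
  show ?thesis
    unfolding scale_measure_on_def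
    by (subst R.sigma_finite_iff_density_finite) (auto intro!: measurable_restrict_space1)
qed

lemma nn_integral_scale:
  assumes "D \<in> sets borel" and [measurable]: "g \<in> borel_measurable borel"
  shows "(\<integral>\<^sup>+h. g h \<partial>scale_measure_on D) = (\<integral>\<^sup>+h. ennreal (1 / \<bar>h\<bar>) * g h * indicator D h \<partial>lborel)"
  unfolding scale_measure_on_def using assms(1)
  by (subst nn_integral_density) (auto intro!: measurable_restrict_space1 simp: nn_integral_restrict_space)

lemma AE_scale_iff:
  assumes "D \<in> sets borel"
  shows "(AE h in scale_measure_on D. P h) \<longleftrightarrow> (AE h in lborel. h \<in> D \<longrightarrow> 0 < ennreal (1 / \<bar>h\<bar>) \<longrightarrow> P h)"
  unfolding scale_measure_on_def using assms
  by (subst AE_density) (auto intro!: measurable_restrict_space1 simp: AE_restrict_space_iff)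

lemma Lnorm_scale_mono:
  assumes D: "D \<in> sets borel" "D' \<in> sets borel" "D \<subseteq> D'" and [measurable]: "g \<in> borel_measurable borel"
  shows "Lnorm q (scale_measure_on D) g \<le> Lnorm q (scale_measure_on D') g"
proof (cases "q = \<infinity>")
  case True
  have "AE h in scale_measure_on D'. g h \<le> esssup (scale_measure_on D') g" by (rule esssup_AE)
  then have "AE h in scale_measure_on D. g h \<le> esssup (scale_measure_on D') g"
    unfolding AE_scale_iff[OF D(1)] AE_scale_iff[OF D(2)] using D(3) by (auto elim!: eventually_mono)
  then show ?thesis using True by (auto simp: Lnorm_def intro!: esssup_I measurable_scaleI)
next
  case False
  then show ?thesis using D
    by (auto simp: Lnorm_def nn_integral_scale intro!: rpow_mono nn_integral_mono mult_left_mono split: split_indicator)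
qed

text \<open>The supremum over all shorter steps is over an uncountable set, so measurability is
  drawn from monotonicity: a nonempty superlevel set is the exterior of a symmetric interval
  together with at most two endpoints.\<close>

lemma borel_measurable_abs_mono:
  fixes F :: "real \<Rightarrow> ennreal"
  assumes mono: "\<And>x y. \<bar>x\<bar> \<le> \<bar>y\<bar> \<Longrightarrow> F x \<le> F y"
  shows "F \<in> borel_measurable borel"
proof (rule borel_measurableI_greater)
  fix c :: ennreal
  define S where "S = {x. c < F x}"
  have up: "y \<in> S" if "x \<in> S" "\<bar>x\<bar> \<le> \<bar>y\<bar>" for x y
    using that mono[of x y] unfolding S_def by (auto intro: less_le_trans)
  have "S \<in> sets borel"
  proof (cases "S = {}")
    case False
    define a where "a = Inf (abs ` S)"
    have bdd: "bdd_below (abs ` S)" by (rule bdd_belowI[of _ 0]) auto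
    have lower: "a \<le> \<bar>x\<bar>" if "x \<in> S" for x
      unfolding a_def using bdd that by (intro cInf_lower) auto
    have upper: "x \<in> S" if ax: "a < \<bar>x\<bar>" for x
    proof -
      obtain y where "y \<in> S" "\<bar>y\<bar> < \<bar>x\<bar>"
        using cInf_lessD[of "abs ` S" "\<bar>x\<bar>"] ax False unfolding a_def by auto
      then show ?thesis using up[of y x] by simp
    qed
    have "S = {x. a < \<bar>x\<bar>} \<union> (S \<inter> {a, -a})"
      using lower upper by (force simp: abs_if)
    moreover have "{x. a < \<bar>x\<bar>} \<in> sets borel" by measurable
    moreover have "S \<inter> {a, -a} \<in> sets borel" by (intro borel_closed finite_imp_closed) auto
    ultimately show ?thesis by (metis sets.Un)
  qed simp
  then show "{x \<in> space borel. c < F x} \<in> sets borel" by (simp add: S_def)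
qed

text \<open>The common majorant of the Schur kernels between scales and steps, as a function of
  \<open>2 powi j * h\<close>. Its power decay at 0 and at infinity makes it integrable for the
  dilation invariant measure \<open>du / |u|\<close>.\<close>

definition phi :: "real \<Rightarrow> real \<Rightarrow> real \<Rightarrow> real" where
  "phi a b u = min (\<bar>u\<bar> powr a) (\<bar>u\<bar> powr (- b))"

lemma phi_nonneg [simp]: "0 \<le> phi a b u"
  by (simp add: phi_def)

lemma phi_measurable [measurable]: "phi a b \<in> borel_measurable borel"
  unfolding phi_def by measurable

lemma phi_integral:
  assumes a: "0 < a" and b: "0 < b"
  obtains A where "0 < A" "(\<integral>\<^sup>+u. ennreal (1 / \<bar>u\<bar>) * ennreal (phi a b u) \<partial>lborel) \<le> ennreal A"
proof -
  \<comment> \<open>A one-sided majorant of phi(u) / u: the power at 0 contributes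
    \<open>1 / a\<close> to its integral, the power at infinity \<open>1 / b\<close>.\<close>
  define g where "g = (\<lambda>u :: real. ennreal (u powr (a - 1)) * indicator {0..1} u + ennreal (u powr (- b - 1)) * indicator {1..} u)"
  have [measurable]: "g \<in> borel_measurable borel" unfolding g_def by measurable
  have 1: "(\<integral>\<^sup>+u. ennreal ((u :: real) powr (a - 1)) * indicator {0..1} u \<partial>lborel) = ennreal (1 / a)"
    using nn_integral_has_integral_lebesgue'[OF _ has_integral_powr_from_0[of "a - 1" 1]] a by simp
  have 2: "(\<integral>\<^sup>+u. ennreal ((u :: real) powr (- b - 1)) * indicator {1..} u \<partial>lborel) = ennreal (1 / b)"
    using nn_integral_has_integral_lebesgue'[OF _ has_integral_powr_to_inf[of "- b - 1" 1]] b by simp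
  have g: "(\<integral>\<^sup>+u. g u \<partial>lborel) = ennreal (1 / a + 1 / b)"
    unfolding g_def using 1 2 a b by (simp add: nn_integral_add)
  have g': "(\<integral>\<^sup>+u. g (- u) \<partial>lborel) = ennreal (1 / a + 1 / b)"
    using nn_integral_real_affine[of g "-1" 0] g by simp
  have "(\<integral>\<^sup>+u. ennreal (1 / \<bar>u\<bar>) * ennreal (phi a b u) \<partial>lborel) \<le> (\<integral>\<^sup>+u. g u + g (- u) \<partial>lborel)"
  proof (rule nn_integral_mono)
    fix u :: real
    have pos: "ennreal (1 / v) * ennreal (phi a b v) \<le> g v" if "0 < v" for v
    proof (cases "v \<le> 1")
      case True
      have "1 / v * phi a b v \<le> 1 / v * v powr a"
        using that by (intro mult_left_mono) (auto simp: phi_def)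
      also have "\<dots> = v powr (a - 1)" using that by (simp add: powr_diff)
      finally have "ennreal (1 / v) * ennreal (phi a b v) \<le> ennreal (v powr (a - 1))"
        using that by (simp add: ennreal_leI flip: ennreal_mult)
      then show ?thesis using True that by (auto simp: g_def intro: order_trans)
    next
      case False
      have "1 / v * phi a b v \<le> 1 / v * v powr (- b)"
        using that by (intro mult_left_mono) (auto simp: phi_def)
      also have "\<dots> = v powr (- b - 1)" using that by (simp add: powr_diff)
      finally have "ennreal (1 / v) * ennreal (phi a b v) \<le> ennreal (v powr (- b - 1))"
        using that by (simp add: ennreal_leI flip: ennreal_mult)
      then show ?thesis using False that by (auto simp: g_def)
    qed
    consider "u = 0" | "0 < u" | "u < 0" by linarith
    then show "ennreal (1 / \<bar>u\<bar>) * ennreal (phi a b u) \<le> g u + g (- u)"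
    proof cases
      case 2
      then show ?thesis using pos[of u] by (auto intro: add_increasing2)
    next
      case 3
      then have "ennreal (1 / \<bar>u\<bar>) * ennreal (phi a b u) \<le> g (- u)"
        using pos[of "- u"] by (simp add: phi_def)
      then show ?thesis by (auto intro: add_increasing)
    qed simp
  qed
  also have "\<dots> = ennreal (2 * (1 / a + 1 / b))"
    using a b by (simp add: nn_integral_add g g' flip: ennreal_plus)
  finally show thesis using that[of "2 * (1 / a + 1 / b)"] a b by (simp add: add_pos_pos)
qed

text \<open>The intervals are disjoint: doubling the left endpoint yields the left endpoint of the
  next one.\<close>

lemma dyadic_interval_sum:
  fixes x w :: real
  assumes x: "0 < x"
  shows "(\<integral>\<^sup>+j. indicator {2 powi j * x..<2 * (2 powi j * x)} w \<partial>count_space (UNIV :: int set)) \<le> (1 :: ennreal)"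
proof -
  define J where "J = {j :: int. w \<in> {2 powi j * x..<2 * (2 powi j * x)}}"
  have uniq: "\<not> i < j" if "i \<in> J" "j \<in> J" for i j
  proof
    assume "i < j"
    then have "(2 :: real) powi (i + 1) \<le> 2 powi j" by (intro power_int_increasing) auto
    then have "2 * (2 powi i * x) \<le> 2 powi j * x" using x by (simp add: power_int_add)
    with that show False by (auto simp: J_def)
  qed
  have "emeasure (count_space (UNIV :: int set)) J \<le> 1"
  proof (cases "J = {}")
    case False
    then obtain j0 where "j0 \<in> J" by auto
    then have "J = {j0}" using uniq[of _ j0] uniq[of j0] by (auto simp: not_less intro: antisym)
    then show ?thesis by simp
  qed simp
  moreover have "(\<integral>\<^sup>+j. indicator {2 powi j * x..<2 * (2 powi j * x)} w \<partial>count_space (UNIV :: int set))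
    = (\<integral>\<^sup>+j. indicator J j \<partial>count_space (UNIV :: int set))"
    by (intro nn_integral_cong) (auto simp: J_def split: split_indicator)
  ultimately show ?thesis by simp
qed

text \<open>The sum over dyadic scales is compared with the integral over all scales.\<close>

lemma phi_bounds:
  assumes a: "0 < a" and b: "0 < b"
  obtains A where "0 < A"
    "\<And>c. 0 < c \<Longrightarrow> (\<integral>\<^sup>+u. ennreal (1 / \<bar>u\<bar>) * ennreal (phi a b (c * u)) \<partial>lborel) \<le> ennreal A"
    "\<And>x. (\<integral>\<^sup>+j. ennreal (phi a b (2 powi j * x)) \<partial>count_space (UNIV :: int set)) \<le> ennreal A"
proof -
  obtain B where B: "0 < B" "(\<integral>\<^sup>+u. ennreal (1 / \<bar>u\<bar>) * ennreal (phi a b u) \<partial>lborel) \<le> ennreal B"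
    using phi_integral[OF a b] by blast
  \<comment> \<open>The measure \<open>du / |u|\<close> is invariant under dilation, so the constant
    does not depend on \<open>c\<close>.\<close>
  have scale: "(\<integral>\<^sup>+u. ennreal (1 / \<bar>u\<bar>) * ennreal (phi a b (c * u)) \<partial>lborel) \<le> ennreal B" if c: "0 < c" for c
  proof -
    have "(\<integral>\<^sup>+u. ennreal (1 / \<bar>u\<bar>) * ennreal (phi a b u) \<partial>lborel)
      = ennreal \<bar>c\<bar> * (\<integral>\<^sup>+u. ennreal (1 / \<bar>0 + c * u\<bar>) * ennreal (phi a b (0 + c * u)) \<partial>lborel)"
      by (rule nn_integral_real_affine) (use c in auto)
    also have "\<dots> = (\<integral>\<^sup>+u. ennreal \<bar>c\<bar> * (ennreal (1 / \<bar>0 + c * u\<bar>) * ennreal (phi a b (0 + c * u))) \<partial>lborel)"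
      by (rule nn_integral_cmult[symmetric]) measurable
    also have "\<dots> = (\<integral>\<^sup>+u. ennreal (1 / \<bar>u\<bar>) * ennreal (phi a b (c * u)) \<partial>lborel)"
    proof (rule nn_integral_cong)
      fix u :: real
      have "\<bar>c\<bar> * (1 / \<bar>0 + c * u\<bar>) = 1 / \<bar>u\<bar>" using c by (simp add: abs_mult)
      then have "ennreal \<bar>c\<bar> * ennreal (1 / \<bar>0 + c * u\<bar>) = ennreal (1 / \<bar>u\<bar>)"
        by (subst ennreal_mult[symmetric]) auto
      then show "ennreal \<bar>c\<bar> * (ennreal (1 / \<bar>0 + c * u\<bar>) * ennreal (phi a b (0 + c * u)))
        = ennreal (1 / \<bar>u\<bar>) * ennreal (phi a b (c * u))"
        by (simp only: mult.assoc[symmetric]) simp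
    qed
    finally show ?thesis using B(2) by simp
  qed
  \<comment> \<open>Between u and 2 u the function \<open>phi\<close> drops at most by the factor
    \<open>2 powr b\<close> and 1 / |w| at most by the factor 2.\<close>
  define c where "c = 2 * 2 powr b"
  have c: "0 < c" by (simp add: c_def)
  have phi_le: "ennreal (phi a b u) \<le> (\<integral>\<^sup>+w. ennreal c * (indicator {u..<2 * u} w * (ennreal (1 / \<bar>w\<bar>) * ennreal (phi a b w))) \<partial>lborel)"
    if u: "0 < u" for u
  proof -
    have "ennreal (phi a b u) = (\<integral>\<^sup>+w. ennreal (phi a b u / u) * indicator {u..<2 * u} w \<partial>lborel)"
      using u by (subst nn_integral_cmult_indicator) (auto simp flip: ennreal_mult)
    also have "\<dots> \<le> (\<integral>\<^sup>+w. ennreal c * (indicator {u..<2 * u} w * (ennreal (1 / \<bar>w\<bar>) * ennreal (phi a b w))) \<partial>lborel)"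
    proof (rule nn_integral_mono)
      fix w :: real
      show "ennreal (phi a b u / u) * indicator {u..<2 * u} w
        \<le> ennreal c * (indicator {u..<2 * u} w * (ennreal (1 / \<bar>w\<bar>) * ennreal (phi a b w)))"
      proof (cases "w \<in> {u..<2 * u}")
        case True
        then have w: "u \<le> w" "w < 2 * u" "0 < w" using u by auto
        have p: "(1 :: real) \<le> 2 powr b" using b by (simp add: ge_one_powr_ge_zero)
        have "u powr a \<le> w powr a" using w u a by (intro powr_mono2) auto
        also have "\<dots> \<le> 2 powr b * w powr a" using p by (simp add: mult_le_cancel_right1)
        finally have 1: "u powr a \<le> 2 powr b * w powr a" .
        have "(2 * u) powr (- b) \<le> w powr (- b)" using w u b by (intro powr_mono2') auto
        then have "2 powr b * ((2 * u) powr (- b)) \<le> 2 powr b * w powr (- b)" by (intro mult_left_mono) auto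
        moreover have "2 powr b * ((2 * u) powr (- b)) = u powr (- b)"
          using u by (simp add: powr_mult flip: powr_add mult.assoc)
        ultimately have 2: "u powr (- b) \<le> 2 powr b * w powr (- b)" by simp
        have "phi a b u \<le> 2 powr b * phi a b w"
          using 1 2 u w by (simp add: phi_def min_mult_distrib_left min_le_iff_disj min.coboundedI1 min.coboundedI2)
        moreover have "1 / u \<le> 2 * (1 / w)" using w u by (simp add: field_simps)
        ultimately have "phi a b u * (1 / u) \<le> (2 powr b * phi a b w) * (2 * (1 / w))"
          using u by (intro mult_mono) auto
        then have "phi a b u / u \<le> c * (1 / \<bar>w\<bar> * phi a b w)" using w by (simp add: c_def mult_ac)
        then have "ennreal (phi a b u / u) \<le> ennreal (c * (1 / \<bar>w\<bar> * phi a b w))" by (rule ennreal_leI)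
        also have "ennreal (c * (1 / \<bar>w\<bar> * phi a b w)) = ennreal c * (ennreal (1 / \<bar>w\<bar>) * ennreal (phi a b w))"
          using c by (subst ennreal_mult, simp, simp, subst ennreal_mult) simp_all
        finally show ?thesis using True by simp
      qed simp
    qed
    finally show ?thesis .
  qed
  have sum: "(\<integral>\<^sup>+j. ennreal (phi a b (2 powi j * x)) \<partial>count_space (UNIV :: int set)) \<le> ennreal (c * B)" if x: "0 < x" for x
  proof -
    interpret pair_sigma_finite "count_space (UNIV :: int set)" "lborel :: real measure"
      by (intro pair_sigma_finite.intro sigma_finite_count_space lborel.sigma_finite_measure_axioms)
    let ?i = "\<lambda>j w. indicator {2 powi j * x..<2 * (2 powi j * x)} w :: ennreal"
    let ?p = "\<lambda>w. ennreal (1 / \<bar>w\<bar>) * ennreal (phi a b w)"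
    have "(\<integral>\<^sup>+j. ennreal (phi a b (2 powi j * x)) \<partial>count_space (UNIV :: int set))
      \<le> (\<integral>\<^sup>+j. \<integral>\<^sup>+w. ennreal c * (?i j w * ?p w) \<partial>lborel \<partial>count_space (UNIV :: int set))"
      by (intro nn_integral_mono phi_le) (use x in auto)
    also have "\<dots> = (\<integral>\<^sup>+w. \<integral>\<^sup>+j. ennreal c * (?i j w * ?p w) \<partial>count_space (UNIV :: int set) \<partial>lborel)"
      by (rule Fubini'[symmetric], rule measurable_pair_measure_countable1) auto
    also have "\<dots> = (\<integral>\<^sup>+w. ennreal c * ((\<integral>\<^sup>+j. ?i j w \<partial>count_space (UNIV :: int set)) * ?p w) \<partial>lborel)"
      by (rule nn_integral_cong, rule trans[OF nn_integral_cmult], simp,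
          rule arg_cong[where f = "\<lambda>t. ennreal c * t"], rule nn_integral_multc, simp)
    also have "\<dots> \<le> (\<integral>\<^sup>+w. ennreal c * (1 * ?p w) \<partial>lborel)"
      by (intro nn_integral_mono mult_left_mono mult_right_mono dyadic_interval_sum x) auto
    also have "\<dots> = ennreal c * (\<integral>\<^sup>+w. ?p w \<partial>lborel)"
      by (simp add: nn_integral_cmult)
    also have "\<dots> \<le> ennreal c * ennreal B" by (intro mult_left_mono B) auto
    finally show ?thesis using c B by (simp add: ennreal_mult)
  qed
  have sum': "(\<integral>\<^sup>+j. ennreal (phi a b (2 powi j * x)) \<partial>count_space (UNIV :: int set)) \<le> ennreal (c * B)" for x
  proof (cases "x = 0")
    case False
    have "phi a b (2 powi j * x) = phi a b (2 powi j * \<bar>x\<bar>)" for j :: int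
      by (simp add: phi_def abs_mult)
    then show ?thesis using sum[of "\<bar>x\<bar>"] False by simp
  qed (simp add: phi_def)
  show thesis
  proof (rule that[of "c * B + B"])
    show "0 < c * B + B" using c B by (simp add: add_pos_pos)
    show "(\<integral>\<^sup>+u. ennreal (1 / \<bar>u\<bar>) * ennreal (phi a b (d * u)) \<partial>lborel) \<le> ennreal (c * B + B)" if "0 < d" for d
      using c B by (intro order_trans[OF scale[OF that] ennreal_leI]) auto
    show "(\<integral>\<^sup>+j. ennreal (phi a b (2 powi j * x)) \<partial>count_space (UNIV :: int set)) \<le> ennreal (c * B + B)" for x
      using c B by (intro order_trans[OF sum' ennreal_leI]) auto
  qed
qed

subsection \<open>Schur kernels\<close>

text \<open>The hypotheses of Schur's test with one constant for both marginals. This symmetry lets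
  the same criterion serve kernels from steps to scales and from scales to steps.\<close>

definition schur :: "'a measure \<Rightarrow> 'b measure \<Rightarrow> ('a \<Rightarrow> 'b \<Rightarrow> ennreal) \<Rightarrow> real \<Rightarrow> bool" where
  "schur M N k A \<longleftrightarrow> sigma_finite_measure M \<and> sigma_finite_measure N \<and>
     case_prod k \<in> borel_measurable (M \<Otimes>\<^sub>M N) \<and> 0 < A \<and>
     (\<forall>x\<in>space M. (\<integral>\<^sup>+y. k x y \<partial>N) \<le> ennreal A) \<and> (\<forall>y\<in>space N. (\<integral>\<^sup>+x. k x y \<partial>M) \<le> ennreal A)"

lemma schur_swap: "schur M N k A \<Longrightarrow> schur N M (\<lambda>y x. k x y) A"
  unfolding schur_def by (auto simp: measurable_pair_swap_iff[of _ M N] case_prod_beta')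

lemma Lnorm_tensor_schur:
  assumes "schur M1 N1 k1 A1" "schur M2 N2 k2 A2" "case_prod W \<in> borel_measurable (N1 \<Otimes>\<^sub>M N2)"
    "1 \<le> q1" "1 \<le> q2"
  shows "Lnorm q1 M1 (\<lambda>x. Lnorm q2 M2 (\<lambda>y. \<integral>\<^sup>+s. k1 x s * (\<integral>\<^sup>+t. k2 y t * W s t \<partial>N2) \<partial>N1))
    \<le> ennreal (A1 * A2) * Lnorm q1 N1 (\<lambda>s. Lnorm q2 N2 (W s))"
  using assms unfolding schur_def by (intro Lnorm_tensor_Schur) auto

text \<open>At a fixed scale the kernel is integrated against \<open>dh / |h|\<close>, at a fixed
  step it is summed over dyadic scales; both are bounds for \<open>phi\<close>.\<close>

lemma schur_scale:
  fixes k :: "int \<Rightarrow> real \<Rightarrow> ennreal"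
  assumes ab: "0 < a" "0 < b" and D: "D \<in> sets borel" and K: "0 < K"
    and k[measurable]: "\<And>j. k j \<in> borel_measurable borel"
    and le: "\<And>j h. -1 \<le> j \<Longrightarrow> k j h \<le> ennreal (K * phi a b (2 powi j * h))"
  obtains A where "schur (count_space {-1..}) (scale_measure_on D) k A"
proof -
  obtain A where A: "0 < A"
    "\<And>c. 0 < c \<Longrightarrow> (\<integral>\<^sup>+u. ennreal (1 / \<bar>u\<bar>) * ennreal (phi a b (c * u)) \<partial>lborel) \<le> ennreal A"
    "\<And>x. (\<integral>\<^sup>+j. ennreal (phi a b (2 powi j * x)) \<partial>count_space (UNIV :: int set)) \<le> ennreal A"
    using phi_bounds[OF ab] by blast
  have "schur (count_space {-1..}) (scale_measure_on D) k (K * A)"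
    unfolding schur_def
  proof (intro conjI ballI)
    show "case_prod k \<in> borel_measurable (count_space {-1..} \<Otimes>\<^sub>M scale_measure_on D)"
      by (rule measurable_pair_measure_countable1) (auto intro: measurable_scaleI)
    show "(\<integral>\<^sup>+h. k j h \<partial>scale_measure_on D) \<le> ennreal (K * A)" if "j \<in> space (count_space {-1..})" for j
    proof -
      have "(\<integral>\<^sup>+h. k j h \<partial>scale_measure_on D) \<le> (\<integral>\<^sup>+h. ennreal K * (ennreal (1 / \<bar>h\<bar>) * ennreal (phi a b (2 powi j * h))) \<partial>lborel)"
        unfolding nn_integral_scale[OF D k]
      proof (rule nn_integral_mono)
        fix h
        have "ennreal (1 / \<bar>h\<bar>) * k j h * indicator D h \<le> ennreal (1 / \<bar>h\<bar>) * k j h"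
          by (auto split: split_indicator)
        also have "\<dots> \<le> ennreal (1 / \<bar>h\<bar>) * ennreal (K * phi a b (2 powi j * h))"
          using that by (intro mult_left_mono le) auto
        finally show "ennreal (1 / \<bar>h\<bar>) * k j h * indicator D h \<le> ennreal K * (ennreal (1 / \<bar>h\<bar>) * ennreal (phi a b (2 powi j * h)))"
          using K by (simp add: ennreal_mult mult_ac)
      qed
      also have "\<dots> = ennreal K * (\<integral>\<^sup>+h. ennreal (1 / \<bar>h\<bar>) * ennreal (phi a b (2 powi j * h)) \<partial>lborel)"
        by (rule nn_integral_cmult) measurable
      also have "\<dots> \<le> ennreal K * ennreal A" by (intro mult_left_mono A) auto
      finally show ?thesis using K A(1) by (simp add: ennreal_mult)
    qed
    show "(\<integral>\<^sup>+j. k j h \<partial>count_space {-1..}) \<le> ennreal (K * A)" for h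
    proof -
      have "(\<integral>\<^sup>+j. k j h \<partial>count_space {-1..}) = (\<integral>\<^sup>+j. k j h * indicator {-1..} j \<partial>count_space UNIV)"
        by (rule nn_integral_count_space_indicator) simp
      also have "\<dots> \<le> (\<integral>\<^sup>+j. ennreal K * ennreal (phi a b (2 powi j * h)) \<partial>count_space UNIV)"
        using K by (intro nn_integral_mono) (auto simp: le ennreal_mult[symmetric] split: split_indicator)
      also have "\<dots> = ennreal K * (\<integral>\<^sup>+j. ennreal (phi a b (2 powi j * h)) \<partial>count_space (UNIV :: int set))"
        by (rule nn_integral_cmult) simp
      also have "\<dots> \<le> ennreal K * ennreal A" by (intro mult_left_mono A) auto
      finally show ?thesis using K A(1) by (simp add: ennreal_mult)
    qed
  qed (use K A D in \<open>auto intro: sigma_finite_count_space sigma_finite_scale\<close>)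
  with that show thesis by blast
qed

text \<open>A geometrically decaying sequence is summable, and as a kernel into a single point it
  needs nothing more. The dyadic sum of \<open>phi b b\<close> at the point 1 takes the place of a
  geometric series.\<close>

lemma schur_unit:
  fixes k :: "int \<Rightarrow> ennreal"
  assumes b: "0 < b" and K: "0 < K"
    and le: "\<And>j. -1 \<le> j \<Longrightarrow> k j \<le> ennreal (K * 2 powr (- b * of_int j))"
  obtains A where "schur (count_space {-1..}) (count_space (UNIV :: unit set)) (\<lambda>j _. k j) A"
proof -
  obtain A where A: "0 < A"
    "\<And>x. (\<integral>\<^sup>+j. ennreal (phi b b (2 powi j * x)) \<partial>count_space (UNIV :: int set)) \<le> ennreal A"
    by (rule phi_bounds[OF b b]) (rule that, assumption+)
  \<comment> \<open>For j \<ge> -1 the worst case is t = 1/2, where \<open>t powr (- b)\<close>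
    exceeds \<open>t powr b\<close> by the factor \<open>4 powr b\<close>.\<close>
  define c where "c = K * 4 powr b"
  have c: "0 < c" using K by (simp add: c_def)
  have kc: "k j \<le> ennreal (c * phi b b (2 powi j * 1))" if j: "-1 \<le> j" for j
  proof -
    define t where "t = (2 :: real) powr of_int j"
    have t: "0 < t" "2 powi j = t" by (simp_all add: t_def powr_real_of_int')
    have t2: "1 / 2 \<le> t"
    proof -
      have "(2 :: real) powr (-1) \<le> 2 powr of_int j" using j by (intro powr_mono) auto
      then show ?thesis by (simp add: t_def powr_minus)
    qed
    have tb: "2 powr (- b * of_int j) = t powr (- b)" by (simp add: t_def powr_powr mult.commute)
    have "(1 / 2) powr b \<le> t powr b" using t2 b by (intro powr_mono2) auto
    then have s: "1 \<le> 2 powr b * t powr b" by (simp add: powr_divide field_simps)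
    have "1 * t powr (- b) \<le> (2 powr b * t powr b) * (2 powr b * t powr b) * t powr (- b)"
      using mult_mono[OF s s] by (intro mult_right_mono) auto
    also have "\<dots> = 4 powr b * t powr b"
      using t by (simp add: powr_minus field_simps flip: powr_mult)
    finally have 1: "t powr (- b) \<le> 4 powr b * t powr b" by simp
    have 2: "t powr (- b) \<le> 4 powr b * t powr (- b)"
      using b by (simp add: mult_le_cancel_right1 ge_one_powr_ge_zero)
    have "t powr (- b) \<le> 4 powr b * phi b b t"
      using 1 2 t by (simp add: phi_def min_def)
    then have "K * t powr (- b) \<le> c * phi b b t"
      using K by (simp add: c_def mult.assoc)
    then show ?thesis using le[OF j] tb t by (auto intro: order_trans ennreal_leI)
  qed
  have sum: "(\<integral>\<^sup>+j. k j \<partial>count_space {-1..}) \<le> ennreal (c * A)"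
  proof -
    have "(\<integral>\<^sup>+j. k j \<partial>count_space {-1..}) = (\<integral>\<^sup>+j. k j * indicator {-1..} j \<partial>count_space UNIV)"
      by (rule nn_integral_count_space_indicator) simp
    also have "\<dots> \<le> (\<integral>\<^sup>+j. ennreal c * ennreal (phi b b (2 powi j * 1)) \<partial>count_space UNIV)"
      using c kc by (intro nn_integral_mono) (auto simp: ennreal_mult[symmetric] split: split_indicator)
    also have "\<dots> = ennreal c * (\<integral>\<^sup>+j. ennreal (phi b b (2 powi j * 1)) \<partial>count_space (UNIV :: int set))"
      by (rule nn_integral_cmult) simp
    also have "\<dots> \<le> ennreal c * ennreal A" by (intro mult_left_mono A) auto
    finally show ?thesis using c A(1) by (simp add: ennreal_mult)
  qed
  have "k j \<le> ennreal (c * A)" if "-1 \<le> j" for j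
  proof -
    \<comment> \<open>A single term is at most the whole sum; this is the marginal bound over the
      one-point space.\<close>
    have "k j = (\<integral>\<^sup>+i. k i * indicator {j} i \<partial>count_space {-1..})"
      using that by (subst nn_integral_indicator_singleton) auto
    also have "\<dots> \<le> (\<integral>\<^sup>+i. k i \<partial>count_space {-1..})"
      by (intro nn_integral_mono) (auto split: split_indicator)
    finally show ?thesis using sum by (rule order_trans)
  qed
  then have "schur (count_space {-1..}) (count_space (UNIV :: unit set)) (\<lambda>j _. k j) (c * A)"
    unfolding schur_def using c A(1) sum
    by (auto intro!: sigma_finite_count_space measurable_pair_measure_countable1
        simp: nn_integral_count_space_finite UNIV_unit)
  with that show thesis by blast
qed

text \<open>The homogeneity estimate for the factor 1 / c, multiplied back by \<open>c\<close>; the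
  factor is real, so the division is exact.\<close>

lemma Lnorm_cmult_ge:
  assumes q: "1 \<le> q" and c: "0 \<le> c" and [measurable]: "g \<in> borel_measurable M"
  shows "ennreal c * Lnorm q M g \<le> Lnorm q M (\<lambda>x. ennreal c * g x)"
proof (cases "c = 0")
  case False
  then have c: "0 < c" using c by simp
  have 1: "ennreal (1 / c) * (ennreal c * y) = y" for y
    using c by (simp add: mult.assoc[symmetric] flip: ennreal_mult)
  have "Lnorm q M g = Lnorm q M (\<lambda>x. ennreal (1 / c) * (ennreal c * g x))" by (simp only: 1)
  also have "\<dots> \<le> ennreal (1 / c) * Lnorm q M (\<lambda>x. ennreal c * g x)"
    by (rule Lnorm_cmult_le[OF q]) measurable
  finally have "ennreal c * Lnorm q M g \<le> ennreal c * (ennreal (1 / c) * Lnorm q M (\<lambda>x. ennreal c * g x))"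
    by (intro mult_left_mono) auto
  also have "\<dots> = Lnorm q M (\<lambda>x. ennreal c * g x)"
    using c by (simp add: mult.assoc[symmetric] flip: ennreal_mult)
  finally show ?thesis .
qed simp

lemma Lnorm_Lnorm_add_le:
  assumes M: "sigma_finite_measure M1" "sigma_finite_measure M2" and q: "1 \<le> q1" "1 \<le> q2"
    and [measurable]: "case_prod F \<in> borel_measurable (M1 \<Otimes>\<^sub>M M2)" "case_prod G \<in> borel_measurable (M1 \<Otimes>\<^sub>M M2)"
  shows "Lnorm q1 M1 (\<lambda>x. Lnorm q2 M2 (\<lambda>y. F x y + G x y))
    \<le> Lnorm q1 M1 (\<lambda>x. Lnorm q2 M2 (F x)) + Lnorm q1 M1 (\<lambda>x. Lnorm q2 M2 (G x))"
proof -
  have [measurable]: "(\<lambda>x. Lnorm q2 M2 (F x)) \<in> borel_measurable M1" "(\<lambda>x. Lnorm q2 M2 (G x)) \<in> borel_measurable M1"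
    by (rule measurable_Lnorm[OF M(2)], fact)+
  have "Lnorm q1 M1 (\<lambda>x. Lnorm q2 M2 (\<lambda>y. F x y + G x y)) \<le> Lnorm q1 M1 (\<lambda>x. Lnorm q2 M2 (F x) + Lnorm q2 M2 (G x))"
  proof (rule Lnorm_mono)
    show "(\<lambda>x. Lnorm q2 M2 (\<lambda>y. F x y + G x y)) \<in> borel_measurable M1"
      by (rule measurable_Lnorm[OF M(2)]) measurable
    show "Lnorm q2 M2 (\<lambda>y. F x y + G x y) \<le> Lnorm q2 M2 (F x) + Lnorm q2 M2 (G x)" if [measurable]: "x \<in> space M1" for x
      by (intro Lnorm_add_le M q) measurable
  qed
  also have "\<dots> \<le> Lnorm q1 M1 (\<lambda>x. Lnorm q2 M2 (F x)) + Lnorm q1 M1 (\<lambda>x. Lnorm q2 M2 (G x))"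
    by (intro Lnorm_add_le M q) measurable
  finally show ?thesis .
qed

subsection \<open>Increments are controlled by the blocks\<close>

abbreviation scales :: "int measure" where
  "scales \<equiv> count_space {-1..}"

lemma measurable_pair_count_space2:
  fixes F :: "'a \<Rightarrow> 'b :: countable \<Rightarrow> ennreal"
  assumes "\<And>k. k \<in> A \<Longrightarrow> (\<lambda>x. F x k) \<in> borel_measurable M"
  shows "case_prod F \<in> borel_measurable (M \<Otimes>\<^sub>M count_space A)"
proof -
  have "(\<lambda>(k, x). F x k) \<in> borel_measurable (count_space A \<Otimes>\<^sub>M M)"
    by (rule measurable_pair_measure_countable1) (use assms in auto)
  then show ?thesis by (subst measurable_pair_swap_iff) (simp add: case_prod_beta')
qed

lemma measurable_count_space_pair:
  "g \<in> borel_measurable (count_space A \<Otimes>\<^sub>M count_space B)" for g :: "'a :: countable \<times> 'b :: countable \<Rightarrow> ennreal"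
  by (rule measurable_pair_measure_countable1) auto

lemma measurable_mixed_norm_gen_incr:
  assumes [measurable]: "f \<in> borel_measurable borel" "S \<in> borel_measurable M" "T \<in> borel_measurable M"
  shows "(\<lambda>x. mixed_norm p (gen_incr e1 e2 (S x, T x) f)) \<in> borel_measurable M"
  unfolding mixed_norm_eq gen_incr_def fst_conv snd_conv by measurable

lemma measurable_mixed_norm_gen_incr_pair:
  assumes [measurable]: "f \<in> borel_measurable borel"
  shows "(\<lambda>h. mixed_norm p (gen_incr e1 e2 h f)) \<in> borel_measurable (borel \<Otimes>\<^sub>M borel)"
  using measurable_mixed_norm_gen_incr[of f fst "borel \<Otimes>\<^sub>M borel" snd] by simp

lemma mixed_norm_diff_le:
  assumes "1 \<le> fst p" "1 \<le> snd p" and [measurable]: "a \<in> borel_measurable borel" "b \<in> borel_measurable borel"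
  shows "mixed_norm p (\<lambda>z. a z - b z) \<le> mixed_norm p a + mixed_norm p b"
proof -
  have "mixed_norm p (\<lambda>z. a z - b z) \<le> mnorm p (\<lambda>z. ennreal (cmod (a z)) + ennreal (cmod (b z)))"
    unfolding mixed_norm_eq
    by (intro mnorm_mono) (auto simp: norm_triangle_ineq4 simp flip: ennreal_plus)
  also have "\<dots> \<le> mixed_norm p a + mixed_norm p b"
    unfolding mixed_norm_eq by (intro mnorm_add_le assms) measurable
  finally show ?thesis .
qed

text \<open>The bound for increments of the low-pass kernel that reproduces the block of index
  \<open>j\<close>. That kernel has index \<open>j + 2\<close>, hence the offset.\<close>

definition modulus_weight :: "real \<Rightarrow> bool \<Rightarrow> real \<Rightarrow> int \<Rightarrow> real" where
  "modulus_weight C e h j = C * (if e then min 1 (2 powi (j + 2) * \<bar>h\<bar>) else 1)"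

definition incr_weight :: "bool \<Rightarrow> real \<Rightarrow> real \<Rightarrow> ennreal" where
  "incr_weight e a h = (if e then ennreal (\<bar>h\<bar> powr (- a)) else 1)"

text \<open>The block coefficients carry the factor \<open>2 powr (a * of_int j)\<close> of the
  Besov norm, so the kernel carries its inverse. With the flag unset it is the sequence
  \<open>C * 2 powr (- a * of_int j)\<close>.\<close>

definition incr_kernel :: "real \<Rightarrow> bool \<Rightarrow> real \<Rightarrow> real \<Rightarrow> int \<Rightarrow> ennreal" where
  "incr_kernel C e a h j = incr_weight e a h * ennreal (modulus_weight C e h j * 2 powr (- a * of_int j))"

lemma modulus_weight_mono: "0 < C \<Longrightarrow> \<bar>r\<bar> \<le> \<bar>h\<bar> \<Longrightarrow> modulus_weight C e r j \<le> modulus_weight C e h j"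
  unfolding modulus_weight_def by (auto intro!: mult_left_mono min.coboundedI2)

lemma modulus_weight_nonneg: "0 < C \<Longrightarrow> 0 \<le> modulus_weight C e h j"
  unfolding modulus_weight_def by auto

lemma weighted_incr_le:
  fixes b :: "int \<Rightarrow> int \<Rightarrow> ennreal"
  assumes C: "0 < C"
    and S: "S \<le> (\<integral>\<^sup>+j. ennreal (modulus_weight C e1 h1 j) * (\<integral>\<^sup>+k. ennreal (modulus_weight C e2 h2 k) * b j k \<partial>scales) \<partial>scales)"
  shows "incr_weight e1 a1 h1 * (incr_weight e2 a2 h2 * S) \<le> (\<integral>\<^sup>+j. incr_kernel C e1 a1 h1 j * (\<integral>\<^sup>+k. incr_kernel C e2 a2 h2 k
      * (ennreal (2 powr (a1 * of_int j)) * (ennreal (2 powr (a2 * of_int k)) * b j k)) \<partial>scales) \<partial>scales)"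
proof -
  \<comment> \<open>The Besov weight and its inverse are inserted, the inverse going to the
    kernel.\<close>
  have 1: "ennreal (modulus_weight C e h j) = ennreal (modulus_weight C e h j * 2 powr (- a * of_int j)) * ennreal (2 powr (a * of_int j))" for e h j a
    using C by (simp add: modulus_weight_nonneg mult.assoc flip: ennreal_mult powr_add)
  have "incr_weight e1 a1 h1 * (incr_weight e2 a2 h2 * S)
    \<le> incr_weight e1 a1 h1 * (incr_weight e2 a2 h2 * (\<integral>\<^sup>+j. ennreal (modulus_weight C e1 h1 j) * (\<integral>\<^sup>+k. ennreal (modulus_weight C e2 h2 k) * b j k \<partial>scales) \<partial>scales))"
    by (intro mult_left_mono S) auto
  also have "\<dots> = (\<integral>\<^sup>+j. incr_kernel C e1 a1 h1 j * (\<integral>\<^sup>+k. incr_kernel C e2 a2 h2 k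
      * (ennreal (2 powr (a1 * of_int j)) * (ennreal (2 powr (a2 * of_int k)) * b j k)) \<partial>scales) \<partial>scales)"
    unfolding 1[of e1 h1 _ a1] 1[of e2 h2 _ a2] incr_kernel_def
    by (simp add: nn_integral_cmult[symmetric] mult_ac)
  finally show ?thesis .
qed

lemma schur_incr_kernel_False:
  assumes C: "0 < C" and a: "0 < a"
  obtains A where "schur (count_space (UNIV :: unit set)) scales (\<lambda>_. incr_kernel C False a 0) A"
proof -
  obtain A where "schur scales (count_space (UNIV :: unit set)) (\<lambda>j _. incr_kernel C False a 0 j) A"
    using schur_unit[of a C "incr_kernel C False a 0"] C a
    by (auto simp: incr_kernel_def incr_weight_def modulus_weight_def)
  from schur_swap[OF this] that show thesis by simp
qed

lemma powi_eq_powr: "(2 :: real) powi j = 2 powr of_int j"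
  by (simp add: powr_real_of_int')

text \<open>With \<open>u = 2 powi j * |h|\<close> the kernel is
  \<open>C * min 1 (4 * u) * u powr (- a)\<close>, where 4 is the offset of two scales. It behaves
  like the power 1 - a at 0 and -a at infinity, which is where 0 < a < 1 enters.\<close>

lemma schur_incr_kernel_True:
  assumes C: "0 < C" and a: "0 < a" "a < 1" and D: "D \<in> sets borel"
  obtains A where "schur (scale_measure_on D) scales (incr_kernel C True a) A"
proof -
  have "incr_kernel C True a h j \<le> ennreal (4 * C * phi (1 - a) a (2 powi j * h))" for j h
  proof (cases "h = 0")
    case False
    define u where "u = 2 powi j * \<bar>h\<bar>"
    have u: "0 < u" using False by (simp add: u_def)
    have 4: "(2 :: real) powi (j + 2) * \<bar>h\<bar> = 4 * u" by (simp add: u_def power_int_add)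
    have up: "\<bar>h\<bar> powr (- a) * 2 powr (- a * of_int j) = u powr (- a)"
      using False by (simp add: u_def powi_eq_powr powr_mult powr_powr mult_ac)
    have "min 1 (4 * u) * u powr (- a) \<le> 4 * phi (1 - a) a u"
    proof -
      have "min 1 (4 * u) * u powr (- a) \<le> 4 * u powr (- a)" by (intro mult_right_mono) auto
      moreover have "min 1 (4 * u) * u powr (- a) \<le> (4 * u) * u powr (- a)" by (intro mult_right_mono) auto
      moreover have "(4 * u) * u powr (- a) = 4 * u powr (1 - a)" using u by (simp add: powr_diff powr_minus field_simps)
      ultimately show ?thesis using u by (simp add: phi_def min_def)
    qed
    then have "C * (min 1 (4 * u) * u powr (- a)) \<le> C * (4 * phi (1 - a) a u)"
      using C by (intro mult_left_mono) auto
    moreover have "phi (1 - a) a u = phi (1 - a) a (2 powi j * h)" by (simp add: phi_def u_def abs_mult)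
    moreover have "incr_kernel C True a h j = ennreal (C * (min 1 (4 * u) * (\<bar>h\<bar> powr (- a) * 2 powr (- a * of_int j))))"
    proof -
      have "modulus_weight C True h j = C * min 1 (4 * u)" by (simp only: modulus_weight_def 4 if_True)
      then show ?thesis using C u by (simp add: incr_kernel_def incr_weight_def mult_ac flip: ennreal_mult)
    qed
    ultimately show ?thesis unfolding up by (simp add: ennreal_leI mult_ac)
  qed (simp add: incr_kernel_def incr_weight_def)
  then have le: "incr_kernel C True a h j \<le> ennreal (4 * C * phi (1 - a) a (2 powi j * h))" for j h .
  have [measurable]: "(\<lambda>h. incr_kernel C True a h j) \<in> borel_measurable borel" for j
    unfolding incr_kernel_def incr_weight_def modulus_weight_def by measurable
  obtain A where "schur scales (scale_measure_on D) (\<lambda>j h. incr_kernel C True a h j) A"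
    using schur_scale[of "1 - a" a D "4 * C" "\<lambda>j h. incr_kernel C True a h j"] a C D le by auto
  from schur_swap[OF this] that show thesis by simp
qed

section \<open>Summation of the increments of blocks\<close>

context dyadic
begin

text \<open>Minkowski's inequality distributes the mixed norm over the double series of blocks. Each
  block is written as its convolution with the wider kernel, and the increment is taken on that
  kernel.\<close>

lemma gen_incr_le_sum:
  assumes p: "1 \<le> fst p" "1 \<le> snd p"
  obtains C where "0 < C" "\<And>f e1 e2 h. f \<in> mixed_Lp p \<Longrightarrow> mixed_norm p (gen_incr e1 e2 h f)
    \<le> (\<integral>\<^sup>+j. ennreal (modulus_weight C e1 (fst h) j) * (\<integral>\<^sup>+k. ennreal (modulus_weight C e2 (snd h) k)
        * mixed_norm p (conv2 (kcut j) (kcut k) f) \<partial>scales) \<partial>scales)"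
proof -
  obtain C where C: "0 < C" "\<And>j e h. (\<integral>\<^sup>+s. ennreal (cmod (klow j (s - h) - of_bool e * klow j s)) \<partial>lborel)
    \<le> ennreal (C * (if e then min 1 (2 powi j * \<bar>h\<bar>) else 1))"
    using klow_modulus by blast
  have "mixed_norm p (gen_incr e1 e2 h f)
    \<le> (\<integral>\<^sup>+j. ennreal (modulus_weight C e1 (fst h) j) * (\<integral>\<^sup>+k. ennreal (modulus_weight C e2 (snd h) k)
        * mixed_norm p (conv2 (kcut j) (kcut k) f) \<partial>scales) \<partial>scales)"
    if f: "f \<in> mixed_Lp p" for f e1 e2 h
  proof -
    have w: "weighted_L1 f" by (rule mixed_Lp_weighted_L1[OF p f])
    have [measurable]: "f \<in> borel_measurable borel" using w by measurable
    define g where "g = (\<lambda>j k. conv2 (kcut j) (kcut k) f)"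
    have gm: "g j k \<in> mixed_Lp p" for j k
      unfolding g_def by (intro conv2_mixed_Lp p decaying_kcut f)
    have gw: "weighted_L1 (g j k)" for j k by (rule mixed_Lp_weighted_L1[OF p gm])
    have [measurable]: "g j k \<in> borel_measurable borel" for j k using gw by measurable
    have mi: "gen_incr e1 e2 h (g j k) \<in> borel_measurable borel" for j k
      unfolding gen_incr_def by measurable
    have mf: "gen_incr e1 e2 h f \<in> borel_measurable borel"
      unfolding gen_incr_def by measurable
    note [measurable] = mi mf
    have "mixed_norm p (gen_incr e1 e2 h f)
      \<le> mnorm p (\<lambda>z. \<integral>\<^sup>+j. \<integral>\<^sup>+k. ennreal (cmod (gen_incr e1 e2 h (g j k) z)) \<partial>scales \<partial>scales)"
      unfolding mixed_norm_eq
    proof (rule mnorm_mono_AE)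
      show "AE z in lborel. ennreal (cmod (gen_incr e1 e2 h f z))
        \<le> (\<integral>\<^sup>+j. \<integral>\<^sup>+k. ennreal (cmod (gen_incr e1 e2 h (g j k) z)) \<partial>scales \<partial>scales)"
        unfolding g_def by (rule gen_incr_le_blocks[OF w])
    qed measurable
    also have "\<dots> \<le> (\<integral>\<^sup>+j. mnorm p (\<lambda>z. \<integral>\<^sup>+k. ennreal (cmod (gen_incr e1 e2 h (g j k) z)) \<partial>scales) \<partial>scales)"
      by (intro mnorm_Minkowski sigma_finite_count_space p measurable_pair_count_space2) measurable
    also have "\<dots> \<le> (\<integral>\<^sup>+j. \<integral>\<^sup>+k. mixed_norm p (gen_incr e1 e2 h (g j k)) \<partial>scales \<partial>scales)"
      unfolding mixed_norm_eq
      by (intro nn_integral_mono mnorm_Minkowski sigma_finite_count_space p measurable_pair_count_space2) measurable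
    also have "\<dots> \<le> (\<integral>\<^sup>+j. \<integral>\<^sup>+k. ennreal (modulus_weight C e1 (fst h) j) * (ennreal (modulus_weight C e2 (snd h) k) * mixed_norm p (g j k)) \<partial>scales \<partial>scales)"
    proof (intro nn_integral_mono)
      fix j k assume jk: "j \<in> space scales" "k \<in> space scales"
      let ?a = "\<lambda>s. klow (j + 2) (s - fst h) - of_bool e1 * klow (j + 2) s"
      let ?b = "\<lambda>s. klow (k + 2) (s - snd h) - of_bool e2 * klow (k + 2) s"
      have ab: "decaying ?a" "decaying ?b"
        by (intro decaying_diff decaying_shift decaying_klow)+
      have "conv2 (klow (j + 2)) (klow (k + 2)) (g j k) = g j k"
        unfolding g_def by (rule conv2_klow_kcut[OF w]) (use gw jk in \<open>auto simp: g_def\<close>)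
      then have "gen_incr e1 e2 h (g j k) = conv2 ?a ?b (g j k)"
        using gen_incr_conv2[OF decaying_klow decaying_klow gw, of e1 e2 h "j + 2" "k + 2" j k] by simp
      then have "mixed_norm p (gen_incr e1 e2 h (g j k))
        \<le> (\<integral>\<^sup>+s. ennreal (cmod (?a s)) \<partial>lborel) * (\<integral>\<^sup>+s. ennreal (cmod (?b s)) \<partial>lborel) * mixed_norm p (g j k)"
        using mixed_norm_conv2_le[OF p ab gm] by simp
      also have "\<dots> \<le> ennreal (modulus_weight C e1 (fst h) j) * ennreal (modulus_weight C e2 (snd h) k) * mixed_norm p (g j k)"
        unfolding modulus_weight_def by (intro mult_right_mono mult_mono C) auto
      finally show "mixed_norm p (gen_incr e1 e2 h (g j k))
        \<le> ennreal (modulus_weight C e1 (fst h) j) * (ennreal (modulus_weight C e2 (snd h) k) * mixed_norm p (g j k))"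
        by (simp add: mult.assoc)
    qed
    also have "\<dots> = (\<integral>\<^sup>+j. ennreal (modulus_weight C e1 (fst h) j) * (\<integral>\<^sup>+k. ennreal (modulus_weight C e2 (snd h) k) * mixed_norm p (g j k) \<partial>scales) \<partial>scales)"
      by (intro nn_integral_cong nn_integral_cmult) simp
    finally show ?thesis by (simp add: g_def)
  qed
  with C(1) that show thesis by blast
qed

lemma besov_norm_eq:
  assumes "1 \<le> fst p" "1 \<le> snd p" "f \<in> mixed_Lp p"
  shows "besov_norm chi rho \<alpha> p q (distr_of f) = Lnorm (fst q) scales (\<lambda>j. ennreal (2 powr (fst \<alpha> * of_int j))
    * Lnorm (snd q) scales (\<lambda>k. ennreal (2 powr (snd \<alpha> * of_int k)) * mixed_norm p (conv2 (kcut j) (kcut k) f)))"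
  unfolding besov_norm_def lp_block_eq[OF mixed_Lp_weighted_L1[OF assms]] ..

text \<open>One statement for the four terms of the difference norm: \<open>M1\<close> and
  \<open>M2\<close> are scale measures or one-point measures, and \<open>F\<close> may already
  contain a weight and a supremum.\<close>

lemma increment_term_le_besov:
  assumes p: "1 \<le> fst p" "1 \<le> snd p" and q: "1 \<le> fst q" "1 \<le> snd q" and f: "f \<in> mixed_Lp p"
    and s: "schur M1 scales k1 A1" "schur M2 scales k2 A2"
    and m: "(\<lambda>x. Lnorm (snd q) M2 (F x)) \<in> borel_measurable M1" "\<And>x. F x \<in> borel_measurable M2"
    and F: "\<And>x y. F x y \<le> (\<integral>\<^sup>+j. k1 x j * (\<integral>\<^sup>+k. k2 y k * (ennreal (2 powr (fst \<alpha> * of_int j))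
      * (ennreal (2 powr (snd \<alpha> * of_int k)) * mixed_norm p (conv2 (kcut j) (kcut k) f))) \<partial>scales) \<partial>scales)"
  shows "Lnorm (fst q) M1 (\<lambda>x. Lnorm (snd q) M2 (F x)) \<le> ennreal (A1 * A2) * besov_norm chi rho \<alpha> p q (distr_of f)"
proof -
  let ?a = "\<lambda>j k. ennreal (2 powr (fst \<alpha> * of_int j))
      * (ennreal (2 powr (snd \<alpha> * of_int k)) * mixed_norm p (conv2 (kcut j) (kcut k) f))"
  have "Lnorm (fst q) M1 (\<lambda>x. Lnorm (snd q) M2 (F x))
    \<le> Lnorm (fst q) M1 (\<lambda>x. Lnorm (snd q) M2 (\<lambda>y. \<integral>\<^sup>+j. k1 x j * (\<integral>\<^sup>+k. k2 y k * ?a j k \<partial>scales) \<partial>scales))"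
    by (intro Lnorm_mono m F)
  also have "\<dots> \<le> ennreal (A1 * A2) * Lnorm (fst q) scales (\<lambda>j. Lnorm (snd q) scales (?a j))"
    by (rule Lnorm_tensor_schur[OF s _ q]) (rule measurable_count_space_pair)
  also have "\<dots> \<le> ennreal (A1 * A2) * Lnorm (fst q) scales (\<lambda>j. ennreal (2 powr (fst \<alpha> * of_int j))
    * Lnorm (snd q) scales (\<lambda>k. ennreal (2 powr (snd \<alpha> * of_int k)) * mixed_norm p (conv2 (kcut j) (kcut k) f)))"
    by (intro mult_left_mono Lnorm_mono Lnorm_cmult_le q) auto
  finally show ?thesis unfolding besov_norm_eq[OF p f] .
qed

end

text \<open>Trivial weights and one-point norms bring the first three terms into the same iterated
  form as the box term.\<close>

lemma diff_norm1_eq: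
  assumes q: "1 \<le> fst q" "1 \<le> snd q"
  shows "diff_norm1 D1 D2 \<alpha> p q f =
     Lnorm (fst q) (count_space (UNIV :: unit set)) (\<lambda>_. Lnorm (snd q) (count_space (UNIV :: unit set)) (\<lambda>_.
       incr_weight False (fst \<alpha>) 0 * (incr_weight False (snd \<alpha>) 0 * mixed_norm p (gen_incr False False 0 f))))
   + Lnorm (fst q) (scale_measure_on D1) (\<lambda>h1. Lnorm (snd q) (count_space (UNIV :: unit set)) (\<lambda>_.
       incr_weight True (fst \<alpha>) h1 * (incr_weight False (snd \<alpha>) 0 * (SUP r1\<in>{r. \<bar>r\<bar> \<le> \<bar>h1\<bar>}. mixed_norm p (gen_incr True False (r1, 0) f)))))
   + Lnorm (fst q) (count_space (UNIV :: unit set)) (\<lambda>_. Lnorm (snd q) (scale_measure_on D2) (\<lambda>h2.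
       incr_weight False (fst \<alpha>) 0 * (incr_weight True (snd \<alpha>) h2 * (SUP r2\<in>{r. \<bar>r\<bar> \<le> \<bar>h2\<bar>}. mixed_norm p (gen_incr False True (0, r2) f)))))
   + Lnorm (fst q) (scale_measure_on D1) (\<lambda>h1. incr_weight True (fst \<alpha>) h1 * Lnorm (snd q) (scale_measure_on D2) (\<lambda>h2.
       incr_weight True (snd \<alpha>) h2 * (SUP (r1, r2)\<in>{r. \<bar>r\<bar> \<le> \<bar>h1\<bar>} \<times> {r. \<bar>r\<bar> \<le> \<bar>h2\<bar>}. mixed_norm p (gen_incr True True (r1, r2) f))))"
  unfolding diff_norm1_def incr_weight_def gen_incr_eqs by (simp add: q)

lemma diff_norm2_eq:
  "diff_norm2 D1 D2 \<alpha> p q f =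
     mixed_norm p f
   + Lnorm (fst q) (scale_measure_on D1) (\<lambda>h1. incr_weight True (fst \<alpha>) h1 * mixed_norm p (gen_incr True False (h1, 0) f))
   + Lnorm (snd q) (scale_measure_on D2) (\<lambda>h2. incr_weight True (snd \<alpha>) h2 * mixed_norm p (gen_incr False True (0, h2) f))
   + Lnorm (fst q) (scale_measure_on D1) (\<lambda>h1. incr_weight True (fst \<alpha>) h1 * Lnorm (snd q) (scale_measure_on D2) (\<lambda>h2.
       incr_weight True (snd \<alpha>) h2 * mixed_norm p (gen_incr True True (h1, h2) f)))"
  unfolding diff_norm2_def incr_weight_def gen_incr_eqs by simp

lemma incr_weight_measurable [measurable]: "incr_weight e a \<in> borel_measurable borel"
  unfolding incr_weight_def by measurable

context dyadic
begin

lemma diff_norm1_le_besov: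
  assumes p: "1 \<le> fst p" "1 \<le> snd p" and q: "1 \<le> fst q" "1 \<le> snd q"
    and \<alpha>: "0 < fst \<alpha>" "fst \<alpha> < 1" "0 < snd \<alpha>" "snd \<alpha> < 1"
    and D: "D1 \<in> sets borel" "D2 \<in> sets borel"
  obtains C where "0 < C"
    "\<And>f. f \<in> mixed_Lp p \<Longrightarrow> diff_norm1 D1 D2 \<alpha> p q f \<le> ennreal C * besov_norm chi rho \<alpha> p q (distr_of f)"
proof -
  obtain C where C: "0 < C" "\<And>f e1 e2 h. f \<in> mixed_Lp p \<Longrightarrow> mixed_norm p (gen_incr e1 e2 h f)
    \<le> (\<integral>\<^sup>+j. ennreal (modulus_weight C e1 (fst h) j) * (\<integral>\<^sup>+k. ennreal (modulus_weight C e2 (snd h) k)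
        * mixed_norm p (conv2 (kcut j) (kcut k) f) \<partial>scales) \<partial>scales)"
    using gen_incr_le_sum[OF p] by blast
  let ?u = "count_space (UNIV :: unit set)"
  obtain a1 where a1: "schur ?u scales (\<lambda>_. incr_kernel C False (fst \<alpha>) 0) a1"
    using schur_incr_kernel_False[OF C(1) \<alpha>(1)] by blast
  obtain a2 where a2: "schur ?u scales (\<lambda>_. incr_kernel C False (snd \<alpha>) 0) a2"
    using schur_incr_kernel_False[OF C(1) \<alpha>(3)] by blast
  obtain A1 where A1: "schur (scale_measure_on D1) scales (incr_kernel C True (fst \<alpha>)) A1"
    using schur_incr_kernel_True[OF C(1) \<alpha>(1,2) D(1)] by blast
  obtain A2 where A2: "schur (scale_measure_on D2) scales (incr_kernel C True (snd \<alpha>)) A2"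
    using schur_incr_kernel_True[OF C(1) \<alpha>(3,4) D(2)] by blast
  have pos: "0 < a1" "0 < a2" "0 < A1" "0 < A2" using a1 a2 A1 A2 by (auto simp: schur_def)
  have "diff_norm1 D1 D2 \<alpha> p q f \<le> ennreal (a1 * a2 + A1 * a2 + a1 * A2 + A1 * A2) * besov_norm chi rho \<alpha> p q (distr_of f)"
    if f: "f \<in> mixed_Lp p" for f
  proof -
    have [measurable]: "f \<in> borel_measurable borel" using f by (simp add: mixed_Lp_def)
    let ?N = "\<lambda>e1 e2 h. mixed_norm p (gen_incr e1 e2 h f)"
    let ?R = "\<lambda>e1 e2 h1 h2. \<integral>\<^sup>+j. ennreal (modulus_weight C e1 h1 j) * (\<integral>\<^sup>+k. ennreal (modulus_weight C e2 h2 k)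
        * mixed_norm p (conv2 (kcut j) (kcut k) f) \<partial>scales) \<partial>scales"
    have N: "?N e1 e2 (r1, r2) \<le> ?R e1 e2 h1 h2" if "\<bar>r1\<bar> \<le> \<bar>h1\<bar>" "\<bar>r2\<bar> \<le> \<bar>h2\<bar>" for e1 e2 r1 r2 h1 h2
    proof -
      have "?N e1 e2 (r1, r2) \<le> ?R e1 e2 r1 r2" using C(2)[OF f, of e1 e2 "(r1, r2)"] by simp
      also have "\<dots> \<le> ?R e1 e2 h1 h2"
        by (intro nn_integral_mono mult_mono ennreal_leI modulus_weight_mono C that) auto
      finally show ?thesis .
    qed
    note W = weighted_incr_le[OF C(1)]
    let ?S1 = "\<lambda>h1. SUP r1\<in>{r. \<bar>r\<bar> \<le> \<bar>h1\<bar>}. ?N True False (r1, 0)"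
    let ?S2 = "\<lambda>h2. SUP r2\<in>{r. \<bar>r\<bar> \<le> \<bar>h2\<bar>}. ?N False True (0, r2)"
    let ?S = "\<lambda>h1 h2. SUP (r1, r2)\<in>{r. \<bar>r\<bar> \<le> \<bar>h1\<bar>} \<times> {r. \<bar>r\<bar> \<le> \<bar>h2\<bar>}. ?N True True (r1, r2)"
    have S1: "?S1 \<in> borel_measurable borel"
      by (rule borel_measurable_abs_mono) (auto intro!: SUP_subset_mono)
    have S2: "?S2 \<in> borel_measurable borel"
      by (rule borel_measurable_abs_mono) (auto intro!: SUP_subset_mono)
    have S_mono: "?S h1 h2 \<le> ?S h1' h2'" if "\<bar>h1\<bar> \<le> \<bar>h1'\<bar>" "\<bar>h2\<bar> \<le> \<bar>h2'\<bar>" for h1 h2 h1' h2'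
      using that by (intro SUP_subset_mono) auto
    have S: "?S h1 \<in> borel_measurable borel" for h1
      by (rule borel_measurable_abs_mono) (rule S_mono, auto)
    let ?L = "\<lambda>h1. Lnorm (snd q) (scale_measure_on D2) (\<lambda>h2. incr_weight True (snd \<alpha>) h2 * ?S h1 h2)"
    have wS: "(\<lambda>h2. incr_weight True (snd \<alpha>) h2 * ?S h1 h2) \<in> borel_measurable (scale_measure_on D2)" for h1
      using S[of h1] by (intro measurable_scaleI borel_measurable_times_ennreal) auto
    \<comment> \<open>The inner norm is again monotone in |h1|, so it is measurable without joint
      measurability of the supremum.\<close>
    have L: "?L \<in> borel_measurable borel"
      by (rule borel_measurable_abs_mono, intro Lnorm_mono wS mult_left_mono S_mono) auto
    have T1: "Lnorm (fst q) ?u (\<lambda>_. Lnorm (snd q) ?u (\<lambda>_.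
        incr_weight False (fst \<alpha>) 0 * (incr_weight False (snd \<alpha>) 0 * ?N False False 0)))
      \<le> ennreal (a1 * a2) * besov_norm chi rho \<alpha> p q (distr_of f)"
      using N[of 0 0 0 0 False False] by (intro increment_term_le_besov[OF p q f a1 a2])
        (auto intro!: W simp: zero_prod_def)
    have T2: "Lnorm (fst q) (scale_measure_on D1) (\<lambda>h1. Lnorm (snd q) ?u (\<lambda>_.
        incr_weight True (fst \<alpha>) h1 * (incr_weight False (snd \<alpha>) 0 * ?S1 h1)))
      \<le> ennreal (A1 * a2) * besov_norm chi rho \<alpha> p q (distr_of f)"
      using S1 by (intro increment_term_le_besov[OF p q f A1 a2])
        (auto intro!: W SUP_least N measurable_scaleI borel_measurable_times_ennreal simp: q)
    have T3: "Lnorm (fst q) ?u (\<lambda>_. Lnorm (snd q) (scale_measure_on D2) (\<lambda>h2.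
        incr_weight False (fst \<alpha>) 0 * (incr_weight True (snd \<alpha>) h2 * ?S2 h2)))
      \<le> ennreal (a1 * A2) * besov_norm chi rho \<alpha> p q (distr_of f)"
      using S2 by (intro increment_term_le_besov[OF p q f a1 A2])
        (auto intro!: W SUP_least N measurable_scaleI borel_measurable_times_ennreal)
    have T4: "Lnorm (fst q) (scale_measure_on D1) (\<lambda>h1. incr_weight True (fst \<alpha>) h1 * ?L h1)
      \<le> ennreal (A1 * A2) * besov_norm chi rho \<alpha> p q (distr_of f)"
    proof -
      \<comment> \<open>The weight in h1 is real and constant in h2, so it passes through the inner
        norm in both directions.\<close>
      have eq: "Lnorm (snd q) (scale_measure_on D2) (\<lambda>h2. incr_weight True (fst \<alpha>) h1 * (incr_weight True (snd \<alpha>) h2 * ?S h1 h2))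
         = incr_weight True (fst \<alpha>) h1 * ?L h1" for h1
        unfolding incr_weight_def using Lnorm_cmult_le[OF q(2) wS, unfolded incr_weight_def] Lnorm_cmult_ge[OF q(2) _ wS, unfolded incr_weight_def]
        by (auto intro: antisym)
      have "Lnorm (fst q) (scale_measure_on D1) (\<lambda>h1. Lnorm (snd q) (scale_measure_on D2) (\<lambda>h2.
          incr_weight True (fst \<alpha>) h1 * (incr_weight True (snd \<alpha>) h2 * ?S h1 h2)))
        \<le> ennreal (A1 * A2) * besov_norm chi rho \<alpha> p q (distr_of f)"
      proof (rule increment_term_le_besov[OF p q f A1 A2])
        show "(\<lambda>h1. Lnorm (snd q) (scale_measure_on D2) (\<lambda>h2. incr_weight True (fst \<alpha>) h1 * (incr_weight True (snd \<alpha>) h2 * ?S h1 h2)))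
          \<in> borel_measurable (scale_measure_on D1)"
          unfolding eq using L by (intro measurable_scaleI borel_measurable_times_ennreal) auto
        show "(\<lambda>h2. incr_weight True (fst \<alpha>) h1 * (incr_weight True (snd \<alpha>) h2 * ?S h1 h2)) \<in> borel_measurable (scale_measure_on D2)" for h1
          by (intro borel_measurable_times_ennreal wS) auto
        show "incr_weight True (fst \<alpha>) h1 * (incr_weight True (snd \<alpha>) h2 * ?S h1 h2) \<le>
          (\<integral>\<^sup>+j. incr_kernel C True (fst \<alpha>) h1 j * (\<integral>\<^sup>+k. incr_kernel C True (snd \<alpha>) h2 k * (ennreal (2 powr (fst \<alpha> * of_int j))
          * (ennreal (2 powr (snd \<alpha> * of_int k)) * mixed_norm p (conv2 (kcut j) (kcut k) f))) \<partial>scales) \<partial>scales)" for h1 h2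
          by (rule W, rule SUP_least) (auto intro!: N)
      qed
      then show ?thesis unfolding eq .
    qed
    have "diff_norm1 D1 D2 \<alpha> p q f \<le> ennreal (a1 * a2) * besov_norm chi rho \<alpha> p q (distr_of f)
      + ennreal (A1 * a2) * besov_norm chi rho \<alpha> p q (distr_of f)
      + ennreal (a1 * A2) * besov_norm chi rho \<alpha> p q (distr_of f)
      + ennreal (A1 * A2) * besov_norm chi rho \<alpha> p q (distr_of f)"
      unfolding diff_norm1_eq[OF q] by (intro add_mono T1 T2 T3 T4)
    also have "\<dots> = ennreal (a1 * a2 + A1 * a2 + a1 * A2 + A1 * A2) * besov_norm chi rho \<alpha> p q (distr_of f)"
      using pos by (simp add: ennreal_plus[symmetric] del: ennreal_plus flip: distrib_right)
    finally show ?thesis .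
  qed
  moreover have "0 < a1 * a2 + A1 * a2 + a1 * A2 + A1 * A2" using pos by (simp add: add_pos_pos)
  ultimately show thesis using that by blast
qed

end

text \<open>Every step is admissible in its own supremum. The work lies in the measurability of the
  smaller integrands, which monotonicity of \<open>Lnorm\<close> asks for.\<close>

lemma diff_norm2_le_diff_norm1:
  assumes f: "f \<in> mixed_Lp p" and D: "D1 \<in> sets borel" "D2 \<in> sets borel"
  shows "diff_norm2 D1 D2 \<alpha> p q f \<le> diff_norm1 D1 D2 \<alpha> p q f"
proof -
  have [measurable]: "f \<in> borel_measurable borel" using f by (simp add: mixed_Lp_def)
  have m: "(\<lambda>h. mixed_norm p (gen_incr e1 e2 (S h, T h) f)) \<in> borel_measurable borel"
    if "S \<in> borel_measurable borel" "T \<in> borel_measurable borel" for e1 e2 and S T :: "real \<Rightarrow> real"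
    by (rule measurable_mixed_norm_gen_incr) (use that in auto)
  have m2: "case_prod (\<lambda>h1 h2. ennreal (\<bar>h2\<bar> powr (- snd \<alpha>)) * mixed_norm p (box_increment h1 h2 f))
     \<in> borel_measurable (scale_measure_on D1 \<Otimes>\<^sub>M scale_measure_on D2)"
    unfolding gen_incr_eqs
    by (rule measurable_pair_mono[OF measurable_scale_id measurable_scale_id])
      (auto simp: case_prod_beta' intro!: borel_measurable_times_ennreal measurable_mixed_norm_gen_incr_pair)
  show ?thesis
    unfolding diff_norm2_def diff_norm1_def
  proof (intro add_mono Lnorm_mono mult_left_mono)
    show "(\<lambda>h1. ennreal (\<bar>h1\<bar> powr (- fst \<alpha>)) * mixed_norm p (increment1 h1 f)) \<in> borel_measurable (scale_measure_on D1)"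
      unfolding gen_incr_eqs by (intro measurable_scaleI borel_measurable_times_ennreal m) auto
    show "(\<lambda>h2. ennreal (\<bar>h2\<bar> powr (- snd \<alpha>)) * mixed_norm p (increment2 h2 f)) \<in> borel_measurable (scale_measure_on D2)"
      unfolding gen_incr_eqs by (intro measurable_scaleI borel_measurable_times_ennreal m) auto
    show "(\<lambda>h1. ennreal (\<bar>h1\<bar> powr (- fst \<alpha>)) * Lnorm (snd q) (scale_measure_on D2)
      (\<lambda>h2. ennreal (\<bar>h2\<bar> powr (- snd \<alpha>)) * mixed_norm p (box_increment h1 h2 f))) \<in> borel_measurable (scale_measure_on D1)"
      by (intro borel_measurable_times_ennreal measurable_Lnorm[OF sigma_finite_scale[OF D(2)] m2] measurable_scaleI) auto
    show "(\<lambda>h2. ennreal (\<bar>h2\<bar> powr (- snd \<alpha>)) * mixed_norm p (box_increment h1 h2 f)) \<in> borel_measurable (scale_measure_on D2)" for h1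
      unfolding gen_incr_eqs by (intro measurable_scaleI borel_measurable_times_ennreal m) auto
  qed (auto intro!: SUP_upper SUP_upper2[of "(_, _)"])
qed

text \<open>Transfers the bound for the blocks by increments over [-1, 1] to larger domains.\<close>

lemma diff_norm2_mono:
  assumes f: "f \<in> mixed_Lp p" and q: "1 \<le> fst q" "1 \<le> snd q"
    and D: "D1 \<in> sets borel" "D2 \<in> sets borel" "E1 \<in> sets borel" "E2 \<in> sets borel" "D1 \<subseteq> E1" "D2 \<subseteq> E2"
  shows "diff_norm2 D1 D2 \<alpha> p q f \<le> diff_norm2 E1 E2 \<alpha> p q f"
proof -
  have [measurable]: "f \<in> borel_measurable borel" using f by (simp add: mixed_Lp_def)
  have m: "(\<lambda>h. mixed_norm p (gen_incr e1 e2 (S h, T h) f)) \<in> borel_measurable borel"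
    if "S \<in> borel_measurable borel" "T \<in> borel_measurable borel" for e1 e2 and S T :: "real \<Rightarrow> real"
    by (rule measurable_mixed_norm_gen_incr) (use that in auto)
  have m2: "case_prod (\<lambda>h1 h2. ennreal (\<bar>h2\<bar> powr (- snd \<alpha>)) * mixed_norm p (box_increment h1 h2 f))
     \<in> borel_measurable (borel \<Otimes>\<^sub>M scale_measure_on E)" for E
    unfolding gen_incr_eqs
    by (rule measurable_pair_mono[OF measurable_ident[unfolded id_def] measurable_scale_id])
      (auto simp: case_prod_beta' intro!: borel_measurable_times_ennreal measurable_mixed_norm_gen_incr_pair)
  have L: "(\<lambda>h1. ennreal (\<bar>h1\<bar> powr (- fst \<alpha>)) * Lnorm (snd q) (scale_measure_on E)
      (\<lambda>h2. ennreal (\<bar>h2\<bar> powr (- snd \<alpha>)) * mixed_norm p (box_increment h1 h2 f))) \<in> borel_measurable borel"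
    if "E \<in> sets borel" for E
    by (intro borel_measurable_times_ennreal measurable_Lnorm[OF sigma_finite_scale[OF that] m2]) auto
  have "Lnorm (fst q) (scale_measure_on D1) (\<lambda>h1. ennreal (\<bar>h1\<bar> powr (- fst \<alpha>)) * Lnorm (snd q) (scale_measure_on D2)
      (\<lambda>h2. ennreal (\<bar>h2\<bar> powr (- snd \<alpha>)) * mixed_norm p (box_increment h1 h2 f)))
    \<le> Lnorm (fst q) (scale_measure_on D1) (\<lambda>h1. ennreal (\<bar>h1\<bar> powr (- fst \<alpha>)) * Lnorm (snd q) (scale_measure_on E2)
      (\<lambda>h2. ennreal (\<bar>h2\<bar> powr (- snd \<alpha>)) * mixed_norm p (box_increment h1 h2 f)))"
    unfolding gen_incr_eqs
    by (intro Lnorm_mono mult_left_mono Lnorm_scale_mono D measurable_scaleI L[unfolded gen_incr_eqs]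
        borel_measurable_times_ennreal m) auto
  also have "\<dots> \<le> Lnorm (fst q) (scale_measure_on E1) (\<lambda>h1. ennreal (\<bar>h1\<bar> powr (- fst \<alpha>)) * Lnorm (snd q) (scale_measure_on E2)
      (\<lambda>h2. ennreal (\<bar>h2\<bar> powr (- snd \<alpha>)) * mixed_norm p (box_increment h1 h2 f)))"
    by (intro Lnorm_scale_mono D L)
  finally have T4: "Lnorm (fst q) (scale_measure_on D1) (\<lambda>h1. ennreal (\<bar>h1\<bar> powr (- fst \<alpha>)) * Lnorm (snd q) (scale_measure_on D2)
      (\<lambda>h2. ennreal (\<bar>h2\<bar> powr (- snd \<alpha>)) * mixed_norm p (box_increment h1 h2 f)))
    \<le> Lnorm (fst q) (scale_measure_on E1) (\<lambda>h1. ennreal (\<bar>h1\<bar> powr (- fst \<alpha>)) * Lnorm (snd q) (scale_measure_on E2)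
      (\<lambda>h2. ennreal (\<bar>h2\<bar> powr (- snd \<alpha>)) * mixed_norm p (box_increment h1 h2 f)))" .
  show ?thesis
    unfolding diff_norm2_def
    by (intro add_mono order_refl T4; unfold gen_incr_eqs)
      (intro Lnorm_scale_mono D borel_measurable_times_ennreal m; simp)+
qed

subsection \<open>Blocks are controlled by the increments\<close>

text \<open>The one-variable ingredient of \<open>gen_incr\<close>: a difference if the flag is set,
  otherwise a mere translation. The general increment is a composition of two such operators, and
  these commute.\<close>

definition opt_diff :: "bool \<Rightarrow> real \<times> real \<Rightarrow> (real \<times> real \<Rightarrow> complex) \<Rightarrow> real \<times> real \<Rightarrow> complex" where
  "opt_diff e v g z = g (z + v) - of_bool e * g z"

text \<open>Together with \<open>far_factor\<close> this splits a step at length 1: short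
  differences are kept, long ones are bounded by twice the norm, and with the flag unset the
  translation contributes the norm once.\<close>

definition near_factor :: "bool \<Rightarrow> real \<Rightarrow> ennreal" where
  "near_factor e s = (if e \<and> \<bar>s\<bar> \<le> 1 then 1 else 0)"

definition far_factor :: "bool \<Rightarrow> real \<Rightarrow> ennreal" where
  "far_factor e s = (if e then if \<bar>s\<bar> \<le> 1 then 0 else 2 else 1)"

lemma factor_measurable [measurable]: "near_factor e \<in> borel_measurable borel" "far_factor e \<in> borel_measurable borel"
  unfolding near_factor_def far_factor_def by measurable

lemma gen_incr_opt_diff: "gen_incr e1 e2 w f = opt_diff e1 (fst w, 0) (opt_diff e2 (0, snd w) f)"
proof
  fix z
  have "z + (fst w, 0) + (0, snd w) = z + w" by (simp add: prod_eq_iff)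
  then show "gen_incr e1 e2 w f z = opt_diff e1 (fst w, 0) (opt_diff e2 (0, snd w) f) z"
    by (simp add: gen_incr_def opt_diff_def algebra_simps)
qed

lemma opt_diff_commute: "opt_diff e v (opt_diff e' v' f) = opt_diff e' v' (opt_diff e v f)"
  by (auto simp: opt_diff_def fun_eq_iff algebra_simps)

lemma mixed_Lp_shift:
  assumes "g \<in> mixed_Lp p"
  shows "(\<lambda>z. g (z + v)) \<in> mixed_Lp p"
proof -
  have [measurable]: "g \<in> borel_measurable borel" and per: "\<And>x y. g (x, y + 2 * pi) = g (x, y)"
    using assms by (auto simp: mixed_Lp_def)
  have "g ((x, y + 2 * pi) + v) = g ((x, y) + v)" for x y
  proof -
    have "(x, y + 2 * pi) + v = (x + fst v, (y + snd v) + 2 * pi)" "(x, y) + v = (x + fst v, y + snd v)"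
      by (simp_all add: prod_eq_iff)
    then show ?thesis using per by (simp only:)
  qed
  moreover have "(\<lambda>z. g (z + v)) \<in> borel_measurable borel" by measurable
  ultimately show ?thesis
    using mixed_norm_shift[OF assms, of v] assms by (simp add: mixed_Lp_def)
qed

lemma mixed_norm_opt_diff_le:
  assumes p: "1 \<le> fst p" "1 \<le> snd p" and g: "g \<in> mixed_Lp p"
  shows "mixed_norm p (opt_diff e v g) \<le> near_factor e s * mixed_norm p (opt_diff True v g) + far_factor e s * mixed_norm p g"
proof -
  have [measurable]: "g \<in> borel_measurable borel" using g by (simp add: mixed_Lp_def)
  have 2: "mixed_norm p (opt_diff True v g) \<le> 2 * mixed_norm p g"
  proof -
    have "mixed_norm p (opt_diff True v g) \<le> mixed_norm p (\<lambda>z. g (z + v)) + mixed_norm p g"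
      unfolding opt_diff_def by (simp, intro mixed_norm_diff_le p) measurable
    then show ?thesis by (simp add: mixed_norm_shift[OF g] mult_2)
  qed
  show ?thesis
  proof (cases e)
    case True
    then show ?thesis using 2 by (auto simp: near_factor_def far_factor_def)
  next
    case False
    then have "opt_diff e v g = (\<lambda>z. g (z + v))" by (auto simp: opt_diff_def)
    then show ?thesis using False by (simp add: near_factor_def far_factor_def mixed_norm_shift[OF g])
  qed
qed

lemma opt_diff_mixed_Lp:
  assumes p: "1 \<le> fst p" "1 \<le> snd p" and g: "g \<in> mixed_Lp p"
  shows "opt_diff e v g \<in> mixed_Lp p"
proof -
  have gs: "(\<lambda>z. g (z + v)) \<in> mixed_Lp p" by (rule mixed_Lp_shift[OF g])
  have [measurable]: "g \<in> borel_measurable borel" using g by (simp add: mixed_Lp_def)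
  have "mixed_norm p (opt_diff e v g) \<le> mixed_norm p (\<lambda>z. g (z + v)) + mixed_norm p g"
  proof (cases e)
    case True
    then show ?thesis unfolding opt_diff_def by (simp, intro mixed_norm_diff_le p) measurable
  qed (simp add: opt_diff_def[abs_def])
  also have "\<dots> < \<infinity>" using g gs by (simp add: mixed_Lp_def)
  finally have "mixed_norm p (opt_diff e v g) < \<infinity>" .
  moreover have "opt_diff e v g \<in> borel_measurable borel" unfolding opt_diff_def by measurable
  moreover have "opt_diff e v g (x, y + 2 * pi) = opt_diff e v g (x, y)" for x y
  proof -
    have "g ((x, y + 2 * pi) + v) = g ((x, y) + v)" "g (x, y + 2 * pi) = g (x, y)"
      using g gs by (simp_all only: mixed_Lp_def mem_Collect_eq)
    then show ?thesis by (simp only: opt_diff_def)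
  qed
  ultimately show ?thesis by (simp add: mixed_Lp_def)
qed

text \<open>The one-variable splitting is applied in the first variable and, after commuting the two
  operators, to both resulting functions in the second.\<close>

lemma mixed_norm_gen_incr_split:
  assumes p: "1 \<le> fst p" "1 \<le> snd p" and f: "f \<in> mixed_Lp p"
  shows "mixed_norm p (gen_incr e1 e2 (s, t) f)
    \<le> near_factor e1 s * (near_factor e2 t * mixed_norm p (gen_incr True True (s, t) f) + far_factor e2 t * mixed_norm p (gen_incr True False (s, 0) f))
      + far_factor e1 s * (near_factor e2 t * mixed_norm p (gen_incr False True (0, t) f) + far_factor e2 t * mixed_norm p f)"
proof -
  let ?f1 = "opt_diff True (s, 0) f"
  have 0: "opt_diff False (0, 0) g = g" for g by (auto simp: opt_diff_def zero_prod_def[symmetric])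
  have eqs: "gen_incr True True (s, t) f = opt_diff True (0, t) ?f1" "gen_incr True False (s, 0) f = ?f1"
    "gen_incr False True (0, t) f = opt_diff True (0, t) f"
    by (simp_all add: gen_incr_opt_diff 0 opt_diff_commute[of True "(s, 0)"])
  have "mixed_norm p (gen_incr e1 e2 (s, t) f)
    \<le> near_factor e1 s * mixed_norm p (opt_diff True (s, 0) (opt_diff e2 (0, t) f)) + far_factor e1 s * mixed_norm p (opt_diff e2 (0, t) f)"
    unfolding gen_incr_opt_diff fst_conv snd_conv by (intro mixed_norm_opt_diff_le p opt_diff_mixed_Lp f)
  also have "\<dots> \<le> near_factor e1 s * (near_factor e2 t * mixed_norm p (opt_diff True (0, t) ?f1) + far_factor e2 t * mixed_norm p ?f1)
      + far_factor e1 s * (near_factor e2 t * mixed_norm p (opt_diff True (0, t) f) + far_factor e2 t * mixed_norm p f)"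
    unfolding opt_diff_commute[of True "(s, 0)"]
    by (intro add_mono mult_left_mono mixed_norm_opt_diff_le p opt_diff_mixed_Lp f) auto
  finally show ?thesis unfolding eqs .
qed

section \<open>Schur kernels for the near and far parts of a block\<close>

context dyadic
begin

text \<open>The power \<open>1 + a\<close> cancels the density \<open>1 / |s|\<close> of the scale
  measure and the weight \<open>|s| powr (- a)\<close> of the difference norm. Index -1 has no near
  part, because no increment is inserted there.\<close>

definition block_kernel :: "real \<Rightarrow> int \<Rightarrow> real \<Rightarrow> ennreal" where
  "block_kernel a j s = (if 0 \<le> j then ennreal (2 powr (a * of_int j) * cmod (kcut j s) * \<bar>s\<bar> powr (1 + a)) else 0)"

text \<open>The weighted coefficient of the function without increment: twice the mass of the kernel
  outside [-1, 1], or its full mass at index -1.\<close>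

definition block_const :: "real \<Rightarrow> int \<Rightarrow> ennreal" where
  "block_const a j = ennreal (2 powr (a * of_int j)) * (\<integral>\<^sup>+s. ennreal (cmod (kcut j s)) * far_factor (0 \<le> j) s \<partial>lborel)"

lemma block_kernel_measurable [measurable]: "block_kernel a j \<in> borel_measurable borel"
  unfolding block_kernel_def by measurable

lemma kcut_decay:
  obtains K where "0 < K" "\<And>j s. 0 \<le> j \<Longrightarrow> cmod (kcut j s) \<le> 2 powi j * (K * cw (2 powi j * s))"
proof -
  obtain K where K: "0 < K" "\<And>s. cmod (kcut 0 s) \<le> K * cw s"
    using decaying_kcut by (rule decaying_bound) blast
  have "cmod (kcut j s) \<le> 2 powi j * (K * cw (2 powi j * s))" if "0 \<le> j" for j s
    unfolding kcut_scale[OF that] norm_mult norm_of_real using K(2)[of "2 powi j * s"] by simp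
  with K that show thesis by blast
qed

text \<open>With \<open>u = 2 powi j * |s|\<close> the kernel is at most
  \<open>K * u powr (1 + a) * cw u\<close>. This has the power 1 + a at 0 and -(1 - a) at infinity,
  a decay because a < 1.\<close>

lemma schur_block_kernel:
  assumes a: "0 < a" "a < 1" and D: "D \<in> sets borel"
  obtains A where "schur scales (scale_measure_on D) (block_kernel a) A"
proof -
  obtain K where K: "0 < K" "\<And>j s. 0 \<le> j \<Longrightarrow> cmod (kcut j s) \<le> 2 powi j * (K * cw (2 powi j * s))"
    by (rule kcut_decay) blast
  have le: "block_kernel a j s \<le> ennreal (K * phi (1 + a) (1 - a) (2 powi j * s))" for j s
  proof (cases "0 \<le> j \<and> s \<noteq> 0")
    case True
    define u where "u = 2 powi j * \<bar>s\<bar>"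
    have u: "0 < u" using True by (simp add: u_def)
    have "2 powr (a * of_int j) * cmod (kcut j s) * \<bar>s\<bar> powr (1 + a)
      \<le> 2 powr (a * of_int j) * (2 powi j * (K * cw (2 powi j * s))) * \<bar>s\<bar> powr (1 + a)"
      using K True by (intro mult_right_mono mult_left_mono) auto
    also have "\<dots> = K * (u powr (1 + a) * cw u)"
    proof -
      have "2 powr (a * of_int j) * 2 powi j = (2 powi j) powr (1 + a)"
        by (simp add: powi_eq_powr powr_powr algebra_simps flip: powr_add)
      then have "2 powr (a * of_int j) * 2 powi j * \<bar>s\<bar> powr (1 + a) = u powr (1 + a)"
        by (simp add: u_def powr_mult)
      moreover have "cw (2 powi j * s) = cw u" by (simp add: u_def cw_def power_mult_distrib)
      ultimately show ?thesis by (metis mult.assoc mult.commute)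
    qed
    also have "\<dots> \<le> K * phi (1 + a) (1 - a) u"
    proof (rule mult_left_mono)
      have "u powr (1 + a) * cw u \<le> u powr (1 + a)" using cw_le_1[of u] by (intro mult_left_le) auto
      moreover have "u powr (1 + a) * cw u \<le> u powr (- (1 - a))"
      proof -
        have "cw u \<le> 1 / u\<^sup>2" using u unfolding cw_def by (intro divide_left_mono mult_pos_pos) (auto simp: add_pos_pos)
        then have "u powr (1 + a) * cw u \<le> u powr (1 + a) * (1 / u\<^sup>2)" by (intro mult_left_mono) auto
        also have "1 / u\<^sup>2 = u powr (-2)" using u by (simp add: powr_minus divide_inverse powr_numeral)
        also have "u powr (1 + a) * u powr (-2) = u powr (- (1 - a))" by (simp flip: powr_add)
        finally show ?thesis .
      qed
      ultimately show "u powr (1 + a) * cw u \<le> phi (1 + a) (1 - a) u" using u by (simp add: phi_def)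
    qed (use K in simp)
    also have "phi (1 + a) (1 - a) u = phi (1 + a) (1 - a) (2 powi j * s)" by (simp add: phi_def u_def abs_mult)
    finally show ?thesis using True by (simp add: block_kernel_def ennreal_leI)
  qed (auto simp: block_kernel_def)
  show thesis
    using schur_scale[of "1 + a" "1 - a" D K "block_kernel a"] a D K(1) le that by auto
qed

text \<open>Quadratic decay leaves a mass of order \<open>2 powr (- of_int j)\<close> outside
  [-1, 1], so the constants are of order \<open>2 powr (- (1 - a) * of_int j)\<close> and summable
  for a < 1.\<close>

lemma schur_block_const:
  assumes a: "0 < a" "a < 1"
  obtains A where "schur scales (count_space (UNIV :: unit set)) (\<lambda>j _. block_const a j) A"
proof -
  obtain K where K: "0 < K" "\<And>j s. 0 \<le> j \<Longrightarrow> cmod (kcut j s) \<le> 2 powi j * (K * cw (2 powi j * s))"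
    by (rule kcut_decay) blast
  define P where "P = (LINT s|lborel. cmod (kcut (-1) s))"
  have P: "(\<integral>\<^sup>+s. ennreal (cmod (kcut (-1) s)) \<partial>lborel) = ennreal P" "0 \<le> P"
    unfolding P_def using decaying_integrable[OF decaying_kcut, of "-1"]
    by (auto intro!: nn_integral_eq_integral)
  \<comment> \<open>\<open>4 * K * pi\<close> serves j \<ge> 0: a factor 2 from 1 / s^2 \<le> 2
    cw(s) for |s| > 1, a factor 2 from \<open>far_factor\<close>, and \<open>pi\<close> from the
    integral of \<open>cw\<close>. \<open>P\<close> is the mass of the kernel of index -1.\<close>
  define E where "E = 4 * K * pi + P"
  have E: "0 < E" using K(1) P(2) by (simp add: E_def add_pos_nonneg)
  have "block_const a j \<le> ennreal (E * 2 powr (- (1 - a) * of_int j))" if j: "-1 \<le> j" for j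
  proof (cases "0 \<le> j")
    case True
    have "(\<integral>\<^sup>+s. ennreal (cmod (kcut j s)) * far_factor (0 \<le> j) s \<partial>lborel)
      \<le> (\<integral>\<^sup>+s. ennreal (4 * K * inverse (2 powi j)) * ennreal (cw s) \<partial>lborel)"
    proof (rule nn_integral_mono)
      fix s
      show "ennreal (cmod (kcut j s)) * far_factor (0 \<le> j) s \<le> ennreal (4 * K * inverse (2 powi j)) * ennreal (cw s)"
      proof (cases "\<bar>s\<bar> \<le> 1")
        case False
        define t where "t = (2 :: real) powi j"
        have t: "0 < t" by (simp add: t_def)
        have s2: "1 < s\<^sup>2" using False by (metis abs_square_less_1 abs_le_square_iff abs_1 linorder_not_le one_power2 power2_abs)
        have "cw (t * s) \<le> 1 / (t\<^sup>2 * s\<^sup>2)"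
        proof -
          have "0 < t\<^sup>2 * s\<^sup>2" using t s2 by (intro mult_pos_pos) auto
          then show ?thesis unfolding cw_def power_mult_distrib by (intro divide_left_mono mult_pos_pos) auto
        qed
        also have "\<dots> \<le> 1 / t\<^sup>2 * (2 * cw s)"
        proof -
          have "2 / (2 * s\<^sup>2) \<le> 2 / (1 + s\<^sup>2)" using s2 by (intro divide_left_mono mult_pos_pos) auto
          then have "1 / s\<^sup>2 \<le> 2 * cw s" by (simp add: cw_def)
          then have "1 / t\<^sup>2 * (1 / s\<^sup>2) \<le> 1 / t\<^sup>2 * (2 * cw s)" by (intro mult_left_mono) auto
          then show ?thesis by simp
        qed
        finally have "t * (K * cw (t * s)) \<le> t * (K * (1 / t\<^sup>2 * (2 * cw s)))"
          using t K(1) by (intro mult_left_mono) auto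
        also have "\<dots> = 2 * K * inverse t * cw s" using t by (simp add: field_simps power2_eq_square)
        finally have "cmod (kcut j s) \<le> 2 * K * inverse t * cw s"
          using K(2)[OF True, of s] by (simp add: t_def)
        then have "cmod (kcut j s) * 2 \<le> 4 * K * inverse t * cw s" by linarith
        then have "ennreal (cmod (kcut j s) * 2) \<le> ennreal (4 * K * inverse t * cw s)" by (rule ennreal_leI)
        then show ?thesis using False True t K(1) by (simp add: far_factor_def t_def[symmetric] ennreal_mult)
      qed (simp add: far_factor_def True)
    qed
    also have "\<dots> = ennreal (4 * K * inverse (2 powi j)) * ennreal pi"
      by (subst nn_integral_cmult) (auto simp: nn_integral_cw)
    also have "\<dots> = ennreal (4 * K * pi * 2 powr (- of_int j))"
      using K(1) by (simp add: powi_eq_powr powr_minus mult_ac flip: ennreal_mult)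
    finally have "block_const a j \<le> ennreal (2 powr (a * of_int j)) * ennreal (4 * K * pi * 2 powr (- of_int j))"
      unfolding block_const_def by (intro mult_left_mono) auto
    also have "\<dots> = ennreal (4 * K * pi * 2 powr (- (1 - a) * of_int j))"
    proof -
      have "2 powr (a * of_int j) * (4 * K * pi * 2 powr (- of_int j)) = 4 * K * pi * 2 powr (- (1 - a) * of_int j)"
        by (simp add: algebra_simps flip: powr_add)
      then show ?thesis using K(1) by (simp flip: ennreal_mult)
    qed
    also have "\<dots> \<le> ennreal (E * 2 powr (- (1 - a) * of_int j))"
      using P by (intro ennreal_leI mult_right_mono) (auto simp: E_def)
    finally show ?thesis .
  next
    case False
    then have j: "j = -1" using j by simp
    have "block_const a j = ennreal (2 powr (- a)) * ennreal P"
      using P by (simp add: block_const_def j far_factor_def)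
    also have "\<dots> \<le> ennreal 1 * ennreal E"
      using a K(1) powr_mono[of "- a" 0 2] by (intro mult_mono ennreal_leI) (auto simp: E_def)
    also have "\<dots> \<le> ennreal (E * 2 powr (1 - a))"
    proof -
      have "1 \<le> 2 powr (1 - a)" using a by (intro ge_one_powr_ge_zero) auto
      then show ?thesis using E by (simp add: ennreal_leI)
    qed
    finally show ?thesis by (simp add: j)
  qed
  then show thesis using schur_unit[of "1 - a" E "block_const a"] a E that by auto
qed

text \<open>The near part becomes an integral for the scale measure on [-1, 1], the far part a
  multiple of \<open>G0\<close>. Keeping \<open>G1\<close> and \<open>G0\<close> abstract allows the
  identity to be used in each of the two variables.\<close>

lemma block_kernel_integral:
  assumes [measurable]: "G1 \<in> borel_measurable borel"
  shows "ennreal (2 powr (a * of_int j)) * (\<integral>\<^sup>+s. ennreal (cmod (kcut j s)) * (near_factor (0 \<le> j) s * G1 s + far_factor (0 \<le> j) s * G0) \<partial>lborel)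
    = (\<integral>\<^sup>+s. block_kernel a j s * (incr_weight True a s * G1 s) \<partial>scale_measure_on {-1..1}) + block_const a j * G0"
proof -
  let ?k = "\<lambda>s. ennreal (cmod (kcut j s))" and ?c = "ennreal (2 powr (a * of_int j))"
  have "?c * (\<integral>\<^sup>+s. ?k s * (near_factor (0 \<le> j) s * G1 s + far_factor (0 \<le> j) s * G0) \<partial>lborel)
    = ?c * ((\<integral>\<^sup>+s. ?k s * (near_factor (0 \<le> j) s * G1 s) \<partial>lborel) + (\<integral>\<^sup>+s. ?k s * far_factor (0 \<le> j) s * G0 \<partial>lborel))"
    by (subst nn_integral_add[symmetric]) (auto simp: distrib_left mult.assoc)
  also have "\<dots> = ?c * (\<integral>\<^sup>+s. ?k s * (near_factor (0 \<le> j) s * G1 s) \<partial>lborel) + ?c * (\<integral>\<^sup>+s. ?k s * far_factor (0 \<le> j) s * G0 \<partial>lborel)"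
    by (rule distrib_left)
  also have "?c * (\<integral>\<^sup>+s. ?k s * far_factor (0 \<le> j) s * G0 \<partial>lborel) = block_const a j * G0"
    by (subst nn_integral_multc) (auto simp: block_const_def mult.assoc)
  also have "?c * (\<integral>\<^sup>+s. ?k s * (near_factor (0 \<le> j) s * G1 s) \<partial>lborel)
    = (\<integral>\<^sup>+s. ?c * (?k s * (near_factor (0 \<le> j) s * G1 s)) \<partial>lborel)"
    by (rule nn_integral_cmult[symmetric]) measurable
  also have "\<dots> = (\<integral>\<^sup>+s. ennreal (1 / \<bar>s\<bar>) * (block_kernel a j s * (incr_weight True a s * G1 s)) * indicator {-1..1} s \<partial>lborel)"
  proof (rule nn_integral_cong_AE)
    show "AE s in lborel. ?c * (?k s * (near_factor (0 \<le> j) s * G1 s))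
      = ennreal (1 / \<bar>s\<bar>) * (block_kernel a j s * (incr_weight True a s * G1 s)) * indicator {-1..1} s"
      \<comment> \<open>At s = 0 the powers vanish and the identity may fail, so this point is
        discarded.\<close>
      using AE_lborel_singleton[of 0]
    proof eventually_elim
      case (elim s)
      show ?case
      proof (cases "0 \<le> j \<and> \<bar>s\<bar> \<le> 1")
        case True
        have "1 / \<bar>s\<bar> * (\<bar>s\<bar> powr (1 + a) * \<bar>s\<bar> powr (- a)) = 1"
          using elim by (simp flip: powr_add)
        then have "2 powr (a * of_int j) * cmod (kcut j s)
          = 1 / \<bar>s\<bar> * (2 powr (a * of_int j) * cmod (kcut j s) * \<bar>s\<bar> powr (1 + a) * \<bar>s\<bar> powr (- a))"
        proof -
          assume 1: "1 / \<bar>s\<bar> * (\<bar>s\<bar> powr (1 + a) * \<bar>s\<bar> powr (- a)) = 1"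
          have "1 / \<bar>s\<bar> * (2 powr (a * of_int j) * cmod (kcut j s) * \<bar>s\<bar> powr (1 + a) * \<bar>s\<bar> powr (- a))
            = 2 powr (a * of_int j) * cmod (kcut j s) * (1 / \<bar>s\<bar> * (\<bar>s\<bar> powr (1 + a) * \<bar>s\<bar> powr (- a)))"
            by (simp only: mult_ac)
          then show ?thesis unfolding 1 by simp
        qed
        then have "ennreal (2 powr (a * of_int j) * cmod (kcut j s))
          = ennreal (1 / \<bar>s\<bar> * (2 powr (a * of_int j) * cmod (kcut j s) * \<bar>s\<bar> powr (1 + a) * \<bar>s\<bar> powr (- a)))"
          by simp
        then have "?c * ?k s = ennreal (1 / \<bar>s\<bar>) * (block_kernel a j s * incr_weight True a s)"
          using True by (simp only: block_kernel_def incr_weight_def if_True ennreal_mult zero_le_mult_iff powr_ge_zero norm_ge_zero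
              abs_ge_zero zero_le_divide_1_iff simp_thms mult_nonneg_nonneg)
        moreover have "near_factor (0 \<le> j) s = 1" "indicator {-1..1} s = (1 :: ennreal)"
          using True by (auto simp: near_factor_def abs_le_iff)
        ultimately show ?thesis by (simp add: mult.assoc[symmetric])
      next
        case False
        then have "block_kernel a j s = 0 \<or> indicator {-1..1} s = (0 :: ennreal)" "near_factor (0 \<le> j) s = 0"
          by (auto simp: block_kernel_def near_factor_def abs_le_iff indicator_def)
        then show ?thesis by auto
      qed
    qed
  qed
  also have "\<dots> = (\<integral>\<^sup>+s. block_kernel a j s * (incr_weight True a s * G1 s) \<partial>scale_measure_on {-1..1})"
    by (rule nn_integral_scale[symmetric]) measurable
  finally show ?thesis .
qed

text \<open>Near and far parts in two variables give four groups: the box increment, the two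
  increments in one variable, and \<open>f\<close> itself.\<close>

lemma block_le_increments:
  assumes p: "1 \<le> fst p" "1 \<le> snd p" and f: "f \<in> mixed_Lp p"
  defines "\<mu> \<equiv> scale_measure_on {-1..1}"
  shows "ennreal (2 powr (a1 * of_int j)) * (ennreal (2 powr (a2 * of_int k)) * mixed_norm p (conv2 (kcut j) (kcut k) f))
    \<le> ((\<integral>\<^sup>+s. block_kernel a1 j s * (\<integral>\<^sup>+t. block_kernel a2 k t * (incr_weight True a1 s * (incr_weight True a2 t * mixed_norm p (gen_incr True True (s, t) f))) \<partial>\<mu>) \<partial>\<mu>)
      + (\<integral>\<^sup>+s. block_kernel a1 j s * (block_const a2 k * (incr_weight True a1 s * mixed_norm p (gen_incr True False (s, 0) f))) \<partial>\<mu>))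
      + (block_const a1 j * (\<integral>\<^sup>+t. block_kernel a2 k t * (incr_weight True a2 t * mixed_norm p (gen_incr False True (0, t) f)) \<partial>\<mu>)
      + block_const a1 j * (block_const a2 k * mixed_norm p f))"
proof -
  have w: "weighted_L1 f" by (rule mixed_Lp_weighted_L1[OF p f])
  have [measurable]: "f \<in> borel_measurable borel" using w by measurable
  let ?N = "\<lambda>e1 e2 s t. mixed_norm p (gen_incr e1 e2 (s, t) f)"
  have Np [measurable]: "(\<lambda>h. mixed_norm p (gen_incr e1 e2 h f)) \<in> borel_measurable (borel \<Otimes>\<^sub>M borel)" for e1 e2
    by (rule measurable_mixed_norm_gen_incr_pair) measurable
  have N1 [measurable]: "(\<lambda>s. ?N e1 e2 s t) \<in> borel_measurable borel" for e1 e2 t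
    by (rule measurable_mixed_norm_gen_incr) measurable
  have N2 [measurable]: "(\<lambda>t. ?N e1 e2 s t) \<in> borel_measurable borel" for e1 e2 s
    by (rule measurable_mixed_norm_gen_incr) measurable
  have mu: "sigma_finite_measure \<mu>" unfolding \<mu>_def by (rule sigma_finite_scale) simp
  interpret mu: sigma_finite_measure \<mu> by (rule mu)
  let ?K = "\<lambda>j s. ennreal (cmod (kcut j s))"
  let ?c1 = "ennreal (2 powr (a1 * of_int j))" and ?c2 = "ennreal (2 powr (a2 * of_int k))"
  \<comment> \<open>Increments are inserted where the kernel has mean zero, that is for every index
    except -1.\<close>
  define e1 where "e1 \<longleftrightarrow> 0 \<le> j"
  define e2 where "e2 \<longleftrightarrow> 0 \<le> k"
  \<comment> \<open>\<open>H1\<close> and \<open>H0\<close> are the integrals over t attached to the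
    near and the far part in s. The one-variable identity is applied in s with these as data, and
    afterwards to each of them in t.\<close>
  define H1 where "H1 = (\<lambda>s. \<integral>\<^sup>+t. ?K k t * (near_factor e2 t * ?N True True s t + far_factor e2 t * ?N True False s 0) \<partial>lborel)"
  define H0 where "H0 = (\<integral>\<^sup>+t. ?K k t * (near_factor e2 t * ?N False True 0 t + far_factor e2 t * mixed_norm p f) \<partial>lborel)"
  have NN: "(\<lambda>x. ?N True True (fst x) (snd x)) \<in> borel_measurable (borel \<Otimes>\<^sub>M lborel)"
    using Np[of True True] by simp
  note [measurable] = NN
  have [measurable]: "H1 \<in> borel_measurable borel"
    unfolding H1_def by (rule lborel.borel_measurable_nn_integral) (unfold case_prod_beta', measurable)
  have "mixed_norm p (conv2 (kcut j) (kcut k) f)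
    \<le> (\<integral>\<^sup>+w. ennreal (cmod (kcut j (fst w) * kcut k (snd w))) * mixed_norm p (\<lambda>z. gen_incr e1 e2 w f z) \<partial>lborel)"
  proof (rule mixed_norm_integral_le[OF p])
    show "AE z in lborel. conv2 (kcut j) (kcut k) f z = (LINT w|lborel. kcut j (fst w) * kcut k (snd w) * gen_incr e1 e2 w f z)"
      by (rule conv2_eq_incr[OF decaying_kcut decaying_kcut w]) (auto simp: e1_def e2_def integral_kcut)
    show "conv2 (kcut j) (kcut k) f \<in> borel_measurable borel" by (intro conv2_measurable decaying_kcut w)
    show "(\<lambda>(z, w). gen_incr e1 e2 w f z) \<in> borel_measurable (borel \<Otimes>\<^sub>M borel)"
      unfolding gen_incr_def by measurable
  qed measurable
  also have "\<dots> \<le> (\<integral>\<^sup>+w. ?K j (fst w) * (?K k (snd w) *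
      (near_factor e1 (fst w) * (near_factor e2 (snd w) * ?N True True (fst w) (snd w) + far_factor e2 (snd w) * ?N True False (fst w) 0)
      + far_factor e1 (fst w) * (near_factor e2 (snd w) * ?N False True 0 (snd w) + far_factor e2 (snd w) * mixed_norm p f))) \<partial>lborel)"
  proof (rule nn_integral_mono)
    fix w :: "real \<times> real"
    show "ennreal (cmod (kcut j (fst w) * kcut k (snd w))) * mixed_norm p (\<lambda>z. gen_incr e1 e2 w f z)
      \<le> ?K j (fst w) * (?K k (snd w) *
      (near_factor e1 (fst w) * (near_factor e2 (snd w) * ?N True True (fst w) (snd w) + far_factor e2 (snd w) * ?N True False (fst w) 0)
      + far_factor e1 (fst w) * (near_factor e2 (snd w) * ?N False True 0 (snd w) + far_factor e2 (snd w) * mixed_norm p f)))"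
      using mixed_norm_gen_incr_split[OF p f, of e1 e2 "fst w" "snd w"]
      by (simp add: norm_mult ennreal_mult mult.assoc mult_left_mono)
  qed
  also have "\<dots> = (\<integral>\<^sup>+s. \<integral>\<^sup>+t. ?K j s * (?K k t *
      (near_factor e1 s * (near_factor e2 t * ?N True True s t + far_factor e2 t * ?N True False s 0)
      + far_factor e1 s * (near_factor e2 t * ?N False True 0 t + far_factor e2 t * mixed_norm p f))) \<partial>lborel \<partial>lborel)"
  proof (subst nn_integral_lborel_prod)
    have "(\<lambda>h. ?N True True (fst h) (snd h)) \<in> borel_measurable borel"
      by (intro measurable_mixed_norm_gen_incr measurable_fst_borel measurable_snd_borel) fact
    then have [simp]: "(\<lambda>h. mixed_norm p (gen_incr True True h f)) \<in> borel_measurable borel"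
      by (simp only: prod.collapse)
    show "(\<lambda>w. ?K j (fst w) * (?K k (snd w) *
      (near_factor e1 (fst w) * (near_factor e2 (snd w) * ?N True True (fst w) (snd w) + far_factor e2 (snd w) * ?N True False (fst w) 0)
      + far_factor e1 (fst w) * (near_factor e2 (snd w) * ?N False True 0 (snd w) + far_factor e2 (snd w) * mixed_norm p f)))) \<in> borel_measurable borel"
      using measurable_compose[OF measurable_fst_borel N1] measurable_compose[OF measurable_snd_borel N2]
      by (intro borel_measurable_times_ennreal borel_measurable_add) auto
  qed simp
  also have "\<dots> = (\<integral>\<^sup>+s. ?K j s * (near_factor e1 s * H1 s + far_factor e1 s * H0) \<partial>lborel)"
  proof (rule nn_integral_cong)
    fix s
    have "(\<integral>\<^sup>+t. ?K j s * (?K k t * (near_factor e1 s * (near_factor e2 t * ?N True True s t + far_factor e2 t * ?N True False s 0)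
      + far_factor e1 s * (near_factor e2 t * ?N False True 0 t + far_factor e2 t * mixed_norm p f))) \<partial>lborel)
      = (\<integral>\<^sup>+t. ?K j s * (near_factor e1 s * (?K k t * (near_factor e2 t * ?N True True s t + far_factor e2 t * ?N True False s 0))
      + far_factor e1 s * (?K k t * (near_factor e2 t * ?N False True 0 t + far_factor e2 t * mixed_norm p f))) \<partial>lborel)"
      by (simp add: distrib_left mult_ac)
    also have "\<dots> = ?K j s * (\<integral>\<^sup>+t. near_factor e1 s * (?K k t * (near_factor e2 t * ?N True True s t + far_factor e2 t * ?N True False s 0))
      + far_factor e1 s * (?K k t * (near_factor e2 t * ?N False True 0 t + far_factor e2 t * mixed_norm p f)) \<partial>lborel)"
      by (rule nn_integral_cmult) measurable
    also have "\<dots> = ?K j s * ((\<integral>\<^sup>+t. near_factor e1 s * (?K k t * (near_factor e2 t * ?N True True s t + far_factor e2 t * ?N True False s 0)) \<partial>lborel)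
      + (\<integral>\<^sup>+t. far_factor e1 s * (?K k t * (near_factor e2 t * ?N False True 0 t + far_factor e2 t * mixed_norm p f)) \<partial>lborel))"
      by (subst nn_integral_add) measurable
    also have "\<dots> = ?K j s * (near_factor e1 s * H1 s + far_factor e1 s * H0)"
      unfolding H1_def H0_def by (subst (1 2) nn_integral_cmult) measurable
    finally show "(\<integral>\<^sup>+t. ?K j s * (?K k t * (near_factor e1 s * (near_factor e2 t * ?N True True s t + far_factor e2 t * ?N True False s 0)
      + far_factor e1 s * (near_factor e2 t * ?N False True 0 t + far_factor e2 t * mixed_norm p f))) \<partial>lborel)
      = ?K j s * (near_factor e1 s * H1 s + far_factor e1 s * H0)" .
  qed
  finally have "?c1 * (?c2 * mixed_norm p (conv2 (kcut j) (kcut k) f))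
    \<le> ?c1 * (?c2 * (\<integral>\<^sup>+s. ?K j s * (near_factor e1 s * H1 s + far_factor e1 s * H0) \<partial>lborel))"
    by (intro mult_left_mono) auto
  also have "?c2 * (\<integral>\<^sup>+s. ?K j s * (near_factor e1 s * H1 s + far_factor e1 s * H0) \<partial>lborel)
     = (\<integral>\<^sup>+s. ?K j s * (near_factor e1 s * (?c2 * H1 s) + far_factor e1 s * (?c2 * H0)) \<partial>lborel)"
    by (subst nn_integral_cmult[symmetric]) (auto simp: distrib_left mult_ac)
  also have "?c1 * \<dots> = (\<integral>\<^sup>+s. block_kernel a1 j s * (incr_weight True a1 s * (?c2 * H1 s)) \<partial>\<mu>) + block_const a1 j * (?c2 * H0)"
    unfolding e1_def \<mu>_def by (rule block_kernel_integral) measurable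
  also have "?c2 * H0 = (\<integral>\<^sup>+t. block_kernel a2 k t * (incr_weight True a2 t * ?N False True 0 t) \<partial>\<mu>) + block_const a2 k * mixed_norm p f"
    unfolding H0_def e2_def \<mu>_def by (rule block_kernel_integral) measurable
  also have "(\<integral>\<^sup>+s. block_kernel a1 j s * (incr_weight True a1 s * (?c2 * H1 s)) \<partial>\<mu>)
    = (\<integral>\<^sup>+s. block_kernel a1 j s * (\<integral>\<^sup>+t. block_kernel a2 k t * (incr_weight True a1 s * (incr_weight True a2 t * ?N True True s t)) \<partial>\<mu>)
      + block_kernel a1 j s * (block_const a2 k * (incr_weight True a1 s * ?N True False s 0)) \<partial>\<mu>)"
  proof (rule nn_integral_cong)
    fix s
    have "?c2 * H1 s = (\<integral>\<^sup>+t. block_kernel a2 k t * (incr_weight True a2 t * ?N True True s t) \<partial>\<mu>) + block_const a2 k * ?N True False s 0"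
      unfolding H1_def e2_def \<mu>_def by (rule block_kernel_integral) measurable
    moreover have "incr_weight True a1 s * (\<integral>\<^sup>+t. block_kernel a2 k t * (incr_weight True a2 t * ?N True True s t) \<partial>\<mu>)
      = (\<integral>\<^sup>+t. block_kernel a2 k t * (incr_weight True a1 s * (incr_weight True a2 t * ?N True True s t)) \<partial>\<mu>)"
    proof -
      have "(\<lambda>t. block_kernel a2 k t * (incr_weight True a2 t * ?N True True s t)) \<in> borel_measurable \<mu>"
        unfolding \<mu>_def by (rule measurable_scaleI) measurable
      then show ?thesis by (subst nn_integral_cmult[symmetric]) (auto simp: mult_ac)
    qed
    ultimately show "block_kernel a1 j s * (incr_weight True a1 s * (?c2 * H1 s))
      = block_kernel a1 j s * (\<integral>\<^sup>+t. block_kernel a2 k t * (incr_weight True a1 s * (incr_weight True a2 t * ?N True True s t)) \<partial>\<mu>)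
      + block_kernel a1 j s * (block_const a2 k * (incr_weight True a1 s * ?N True False s 0))"
      by (simp add: distrib_left mult_ac)
  qed
  also have "\<dots> = (\<integral>\<^sup>+s. block_kernel a1 j s * (\<integral>\<^sup>+t. block_kernel a2 k t * (incr_weight True a1 s * (incr_weight True a2 t * ?N True True s t)) \<partial>\<mu>) \<partial>\<mu>)
      + (\<integral>\<^sup>+s. block_kernel a1 j s * (block_const a2 k * (incr_weight True a1 s * ?N True False s 0)) \<partial>\<mu>)"
  proof (rule nn_integral_add)
    have "(\<lambda>x. block_kernel a2 k (snd x) * (incr_weight True a1 (fst x) * (incr_weight True a2 (snd x) * ?N True True (fst x) (snd x)))) \<in> borel_measurable (borel \<Otimes>\<^sub>M borel)"
      using Np[of True True] by (intro borel_measurable_times_ennreal) auto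
    then have "(\<lambda>x. block_kernel a2 k (snd x) * (incr_weight True a1 (fst x) * (incr_weight True a2 (snd x) * ?N True True (fst x) (snd x)))) \<in> borel_measurable (borel \<Otimes>\<^sub>M \<mu>)"
      unfolding \<mu>_def by (rule measurable_pair_mono[OF measurable_ident[unfolded id_def] measurable_scale_id])
    then have "(\<lambda>s. \<integral>\<^sup>+t. block_kernel a2 k t * (incr_weight True a1 s * (incr_weight True a2 t * ?N True True s t)) \<partial>\<mu>) \<in> borel_measurable borel"
      by (intro mu.borel_measurable_nn_integral) (simp add: case_prod_beta')
    then show "(\<lambda>s. block_kernel a1 j s * (\<integral>\<^sup>+t. block_kernel a2 k t * (incr_weight True a1 s * (incr_weight True a2 t * ?N True True s t)) \<partial>\<mu>)) \<in> borel_measurable \<mu>"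
      unfolding \<mu>_def by (intro measurable_scaleI borel_measurable_times_ennreal) auto
    show "(\<lambda>s. block_kernel a1 j s * (block_const a2 k * (incr_weight True a1 s * ?N True False s 0))) \<in> borel_measurable \<mu>"
      unfolding \<mu>_def by (intro measurable_scaleI) measurable
  qed
  finally show ?thesis by (simp only: distrib_left)
qed

text \<open>Each of the four groups is a tensor Schur operator applied to the integrand of one term
  of the difference norm: a scale measure where a near part is integrated, a one-point measure where
  a far constant stands.\<close>

lemma besov_le_diff_norm2:
  assumes p: "1 \<le> fst p" "1 \<le> snd p" and q: "1 \<le> fst q" "1 \<le> snd q"
    and \<alpha>: "0 < fst \<alpha>" "fst \<alpha> < 1" "0 < snd \<alpha>" "snd \<alpha> < 1"
  obtains C where "0 < C"
    "\<And>f. f \<in> mixed_Lp p \<Longrightarrow> besov_norm chi rho \<alpha> p q (distr_of f) \<le> ennreal C * diff_norm2 {-1..1} {-1..1} \<alpha> p q f"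
proof -
  define \<mu> where "\<mu> = scale_measure_on {-1..1}"
  let ?u = "count_space (UNIV :: unit set)"
  obtain A1 where A1: "schur scales \<mu> (block_kernel (fst \<alpha>)) A1"
    unfolding \<mu>_def using schur_block_kernel[OF \<alpha>(1,2), of "{-1..1}"] by auto
  obtain A2 where A2: "schur scales \<mu> (block_kernel (snd \<alpha>)) A2"
    unfolding \<mu>_def using schur_block_kernel[OF \<alpha>(3,4), of "{-1..1}"] by auto
  obtain a1 where a1: "schur scales ?u (\<lambda>j _. block_const (fst \<alpha>) j) a1" using schur_block_const[OF \<alpha>(1,2)] by blast
  obtain a2 where a2: "schur scales ?u (\<lambda>j _. block_const (snd \<alpha>) j) a2" using schur_block_const[OF \<alpha>(3,4)] by blast
  have pos: "0 < a1" "0 < a2" "0 < A1" "0 < A2" using a1 a2 A1 A2 by (auto simp: schur_def)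
  define C where "C = A1 * A2 + A1 * a2 + (a1 * A2 + a1 * a2)"
  have C: "A1 * A2 \<le> C" "A1 * a2 \<le> C" "a1 * A2 \<le> C" "a1 * a2 \<le> C" "0 < C"
    using pos by (auto simp: C_def add_increasing add_increasing2 add_pos_pos)
  have "besov_norm chi rho \<alpha> p q (distr_of f) \<le> ennreal C * diff_norm2 {-1..1} {-1..1} \<alpha> p q f"
    if f: "f \<in> mixed_Lp p" for f
  proof -
    have [measurable]: "f \<in> borel_measurable borel" using f by (simp add: mixed_Lp_def)
    let ?N = "\<lambda>e1 e2 s t. mixed_norm p (gen_incr e1 e2 (s, t) f)"
    let ?w1 = "incr_weight True (fst \<alpha>)" and ?w2 = "incr_weight True (snd \<alpha>)"
    have Np [measurable]: "(\<lambda>h. mixed_norm p (gen_incr e1 e2 h f)) \<in> borel_measurable (borel \<Otimes>\<^sub>M borel)" for e1 e2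
      by (rule measurable_mixed_norm_gen_incr_pair) measurable
    have N1 [measurable]: "(\<lambda>s. ?N e1 e2 s t) \<in> borel_measurable borel" for e1 e2 t
      by (rule measurable_mixed_norm_gen_incr) measurable
    have N2 [measurable]: "(\<lambda>t. ?N e1 e2 s t) \<in> borel_measurable borel" for e1 e2 s
      by (rule measurable_mixed_norm_gen_incr) measurable
    define F11 where "F11 = (\<lambda>j k. \<integral>\<^sup>+s. block_kernel (fst \<alpha>) j s * (\<integral>\<^sup>+t. block_kernel (snd \<alpha>) k t * (?w1 s * (?w2 t * ?N True True s t)) \<partial>\<mu>) \<partial>\<mu>)"
    define F10 where "F10 = (\<lambda>j k. \<integral>\<^sup>+s. block_kernel (fst \<alpha>) j s * (block_const (snd \<alpha>) k * (?w1 s * ?N True False s 0)) \<partial>\<mu>)"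
    define F01 where "F01 = (\<lambda>j k. block_const (fst \<alpha>) j * (\<integral>\<^sup>+t. block_kernel (snd \<alpha>) k t * (?w2 t * ?N False True 0 t) \<partial>\<mu>))"
    define F00 where "F00 = (\<lambda>j k. block_const (fst \<alpha>) j * (block_const (snd \<alpha>) k * mixed_norm p f))"
    let ?LL = "\<lambda>F. Lnorm (fst q) scales (\<lambda>j. Lnorm (snd q) scales (F j))"
    have mI: "case_prod F \<in> borel_measurable (scales \<Otimes>\<^sub>M scales)" for F :: "int \<Rightarrow> int \<Rightarrow> ennreal"
      by (rule measurable_count_space_pair)
    have add: "?LL (\<lambda>j k. F j k + G j k) \<le> ?LL F + ?LL G" for F G
      by (intro Lnorm_Lnorm_add_le sigma_finite_count_space q mI)
    have "besov_norm chi rho \<alpha> p q (distr_of f)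
      \<le> ?LL (\<lambda>j k. ennreal (2 powr (fst \<alpha> * of_int j)) * (ennreal (2 powr (snd \<alpha> * of_int k)) * mixed_norm p (conv2 (kcut j) (kcut k) f)))"
      unfolding besov_norm_eq[OF p f] by (intro Lnorm_mono Lnorm_cmult_ge q) auto
    also have "\<dots> \<le> ?LL (\<lambda>j k. (F11 j k + F10 j k) + (F01 j k + F00 j k))"
      unfolding F11_def F10_def F01_def F00_def \<mu>_def
      by (intro Lnorm_mono block_le_increments p f) auto
    also have "\<dots> \<le> (?LL F11 + ?LL F10) + (?LL F01 + ?LL F00)"
      by (rule order_trans[OF add]) (intro add_mono add)
    also have "?LL F11 \<le> ennreal C * Lnorm (fst q) \<mu> (\<lambda>s. ?w1 s * Lnorm (snd q) \<mu> (\<lambda>t. ?w2 t * ?N True True s t))"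
    proof -
      have W: "case_prod (\<lambda>s t. ?w1 s * (?w2 t * ?N True True s t)) \<in> borel_measurable (\<mu> \<Otimes>\<^sub>M \<mu>)"
        unfolding \<mu>_def using Np[of True True]
        by (intro measurable_pair_mono[OF measurable_scale_id measurable_scale_id])
          (auto simp: case_prod_beta' intro!: borel_measurable_times_ennreal)
      have "?LL F11 \<le> ennreal (A1 * A2) * Lnorm (fst q) \<mu> (\<lambda>s. Lnorm (snd q) \<mu> (\<lambda>t. ?w1 s * (?w2 t * ?N True True s t)))"
        unfolding F11_def by (rule Lnorm_tensor_schur[OF A1 A2 W q])
      also have "\<dots> \<le> ennreal C * Lnorm (fst q) \<mu> (\<lambda>s. ?w1 s * Lnorm (snd q) \<mu> (\<lambda>t. ?w2 t * ?N True True s t))"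
      proof (intro mult_mono ennreal_leI C Lnorm_mono)
        show "(\<lambda>s. Lnorm (snd q) \<mu> (\<lambda>t. ?w1 s * (?w2 t * ?N True True s t))) \<in> borel_measurable \<mu>"
          using measurable_Lnorm[OF _ W] A1 by (auto simp: schur_def)
        show "Lnorm (snd q) \<mu> (\<lambda>t. ?w1 s * (?w2 t * ?N True True s t)) \<le> ?w1 s * Lnorm (snd q) \<mu> (\<lambda>t. ?w2 t * ?N True True s t)" for s
          unfolding \<mu>_def by (intro Lnorm_cmult_le q measurable_scaleI) measurable
      qed auto
      finally show ?thesis .
    qed
    also have "?LL F10 \<le> ennreal C * Lnorm (fst q) \<mu> (\<lambda>s. ?w1 s * ?N True False s 0)"
    proof -
      have W: "case_prod (\<lambda>s (_ :: unit). ?w1 s * ?N True False s 0) \<in> borel_measurable (\<mu> \<Otimes>\<^sub>M ?u)"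
        unfolding \<mu>_def by (intro measurable_pair_count_space2 measurable_scaleI) measurable
      have "?LL F10 \<le> ennreal (A1 * a2) * Lnorm (fst q) \<mu> (\<lambda>s. Lnorm (snd q) ?u (\<lambda>_. ?w1 s * ?N True False s 0))"
        using Lnorm_tensor_schur[OF A1 a2 W q]
        by (simp add: F10_def nn_integral_count_space_finite UNIV_unit)
      also have "\<dots> \<le> ennreal C * Lnorm (fst q) \<mu> (\<lambda>s. ?w1 s * ?N True False s 0)"
        using q by (auto intro!: mult_right_mono ennreal_leI C)
      finally show ?thesis .
    qed
    also have "?LL F01 \<le> ennreal C * Lnorm (snd q) \<mu> (\<lambda>t. ?w2 t * ?N False True 0 t)"
    proof -
      have W: "case_prod (\<lambda>(_ :: unit) t. ?w2 t * ?N False True 0 t) \<in> borel_measurable (?u \<Otimes>\<^sub>M \<mu>)"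
        unfolding \<mu>_def by (rule measurable_pair_measure_countable1) (auto intro!: measurable_scaleI borel_measurable_times_ennreal)
      have "?LL F01 \<le> ennreal (a1 * A2) * Lnorm (fst q) ?u (\<lambda>_. Lnorm (snd q) \<mu> (\<lambda>t. ?w2 t * ?N False True 0 t))"
        using Lnorm_tensor_schur[OF a1 A2 W q]
        by (simp add: F01_def nn_integral_count_space_finite UNIV_unit)
      also have "\<dots> \<le> ennreal C * Lnorm (snd q) \<mu> (\<lambda>t. ?w2 t * ?N False True 0 t)"
        using q by (auto intro!: mult_right_mono ennreal_leI C)
      finally show ?thesis .
    qed
    also have "?LL F00 \<le> ennreal C * mixed_norm p f"
    proof -
      have W: "case_prod (\<lambda>(_ :: unit) (_ :: unit). mixed_norm p f) \<in> borel_measurable (?u \<Otimes>\<^sub>M ?u)"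
        by (rule measurable_count_space_pair)
      have "?LL F00 \<le> ennreal (a1 * a2) * Lnorm (fst q) ?u (\<lambda>_. Lnorm (snd q) ?u (\<lambda>_. mixed_norm p f))"
        using Lnorm_tensor_schur[OF a1 a2 W q]
        by (simp add: F00_def nn_integral_count_space_finite UNIV_unit)
      also have "\<dots> \<le> ennreal C * mixed_norm p f"
        using q by (auto intro!: mult_right_mono ennreal_leI C)
      finally show ?thesis .
    qed
    finally have "besov_norm chi rho \<alpha> p q (distr_of f) \<le>
      (ennreal C * Lnorm (fst q) \<mu> (\<lambda>s. ?w1 s * Lnorm (snd q) \<mu> (\<lambda>t. ?w2 t * ?N True True s t))
       + ennreal C * Lnorm (fst q) \<mu> (\<lambda>s. ?w1 s * ?N True False s 0))
      + (ennreal C * Lnorm (snd q) \<mu> (\<lambda>t. ?w2 t * ?N False True 0 t) + ennreal C * mixed_norm p f)"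
      by (simp add: add_mono)
    also have "\<dots> = ennreal C * diff_norm2 {-1..1} {-1..1} \<alpha> p q f"
      unfolding diff_norm2_eq \<mu>_def by (simp add: distrib_left add_ac)
    finally show ?thesis .
  qed
  with C(5) that show thesis by blast
qed

text \<open>The chain passes through [-1, 1]: the blocks are bounded by the second norm on this
  domain, and enlarging the domain only increases that norm.\<close>

lemma norms_equivalent:
  assumes p: "1 \<le> fst p" "1 \<le> snd p" and q: "1 \<le> fst q" "1 \<le> snd q"
    and \<alpha>: "0 < fst \<alpha>" "fst \<alpha> < 1" "0 < snd \<alpha>" "snd \<alpha> < 1"
    and D: "D1 \<in> sets borel" "D2 \<in> sets borel" "{-1..1} \<subseteq> D1" "{-1..1} \<subseteq> D2"
  shows "\<exists>C>0. \<forall>f. distr_of f \<in> tempered_periodic \<and> f \<in> mixed_Lp p \<longrightarrow>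
        besov_norm chi rho \<alpha> p q (distr_of f) \<le> ennreal C * diff_norm2 D1 D2 \<alpha> p q f \<and>
        diff_norm2 D1 D2 \<alpha> p q f \<le> ennreal C * diff_norm1 D1 D2 \<alpha> p q f \<and>
        diff_norm1 D1 D2 \<alpha> p q f \<le> ennreal C * besov_norm chi rho \<alpha> p q (distr_of f)"
proof -
  obtain A where A: "0 < A"
    "\<And>f. f \<in> mixed_Lp p \<Longrightarrow> besov_norm chi rho \<alpha> p q (distr_of f) \<le> ennreal A * diff_norm2 {-1..1} {-1..1} \<alpha> p q f"
    using besov_le_diff_norm2[OF p q \<alpha>] by blast
  obtain B where B: "0 < B"
    "\<And>f. f \<in> mixed_Lp p \<Longrightarrow> diff_norm1 D1 D2 \<alpha> p q f \<le> ennreal B * besov_norm chi rho \<alpha> p q (distr_of f)"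
    using diff_norm1_le_besov[OF p q \<alpha> D(1,2)] by blast
  show ?thesis
  \<comment> \<open>\<open>A\<close> and \<open>B\<close> serve the two outer inequalities, 1 the
    one between the difference norms.\<close>
  proof (intro exI[of _ "A + B + 1"] conjI allI impI)
    show "0 < A + B + 1" using A B by simp
    fix f assume "distr_of f \<in> tempered_periodic \<and> f \<in> mixed_Lp p"
    then have f: "f \<in> mixed_Lp p" by simp
    have "besov_norm chi rho \<alpha> p q (distr_of f) \<le> ennreal A * diff_norm2 {-1..1} {-1..1} \<alpha> p q f"
      by (rule A(2)[OF f])
    also have "\<dots> \<le> ennreal (A + B + 1) * diff_norm2 D1 D2 \<alpha> p q f"
      using A(1) B(1) D by (intro mult_mono ennreal_leI diff_norm2_mono f q) auto
    finally show "besov_norm chi rho \<alpha> p q (distr_of f) \<le> ennreal (A + B + 1) * diff_norm2 D1 D2 \<alpha> p q f" .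
    have "diff_norm2 D1 D2 \<alpha> p q f \<le> ennreal 1 * diff_norm1 D1 D2 \<alpha> p q f"
      using diff_norm2_le_diff_norm1[OF f D(1,2)] by simp
    also have "\<dots> \<le> ennreal (A + B + 1) * diff_norm1 D1 D2 \<alpha> p q f"
      using A(1) B(1) by (intro mult_right_mono ennreal_leI) auto
    finally show "diff_norm2 D1 D2 \<alpha> p q f \<le> ennreal (A + B + 1) * diff_norm1 D1 D2 \<alpha> p q f" .
    have "diff_norm1 D1 D2 \<alpha> p q f \<le> ennreal B * besov_norm chi rho \<alpha> p q (distr_of f)"
      by (rule B(2)[OF f])
    also have "\<dots> \<le> ennreal (A + B + 1) * besov_norm chi rho \<alpha> p q (distr_of f)"
      using A(1) B(1) by (intro mult_right_mono ennreal_leI) auto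
    finally show "diff_norm1 D1 D2 \<alpha> p q f \<le> ennreal (A + B + 1) * besov_norm chi rho \<alpha> p q (distr_of f)" .
  qed
qed

end

theorem theorem3p2:
  fixes chi rho :: "real \<Rightarrow> real"
    and \<alpha> :: "real \<times> real"
    and p q :: "ennreal \<times> ennreal"
  assumes "dyadic_partition chi rho"
    and "0 < fst \<alpha>" "fst \<alpha> < 1" "0 < snd \<alpha>" "snd \<alpha> < 1"
    and "1 \<le> fst p" "1 \<le> snd p"
    and "1 \<le> fst q" "1 \<le> snd q"
  shows
    "(\<exists>C>0. \<forall>f. distr_of f \<in> tempered_periodic \<and> f \<in> mixed_Lp p \<longrightarrow>
        besov_norm chi rho \<alpha> p q (distr_of f) \<le> ennreal C * diff_norm2 UNIV {-pi..pi} \<alpha> p q f \<and>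
        diff_norm2 UNIV {-pi..pi} \<alpha> p q f \<le> ennreal C * diff_norm1 UNIV {-pi..pi} \<alpha> p q f \<and>
        diff_norm1 UNIV {-pi..pi} \<alpha> p q f \<le> ennreal C * besov_norm chi rho \<alpha> p q (distr_of f)) \<and>
     (\<exists>C>0. \<forall>f. distr_of f \<in> tempered_periodic \<and> f \<in> mixed_Lp p \<longrightarrow>
        besov_norm chi rho \<alpha> p q (distr_of f) \<le> ennreal C * diff_norm2 {-1..1} {-1..1} \<alpha> p q f \<and>
        diff_norm2 {-1..1} {-1..1} \<alpha> p q f \<le> ennreal C * diff_norm1 {-1..1} {-1..1} \<alpha> p q f \<and>
        diff_norm1 {-1..1} {-1..1} \<alpha> p q f \<le> ennreal C * besov_norm chi rho \<alpha> p q (distr_of f))"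
proof -
  interpret dyadic chi rho by standard (rule assms(1))
  have "{-1..1} \<subseteq> {-pi..pi}" using pi_gt3 by auto
  then show ?thesis
    by (intro conjI norms_equivalent assms) auto
qed

end
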